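(* Let $n\in\mathbb{N}_{>0}$, and let $M$ be an oriented closed connected elliptic $n$-manifold. Then \[ \operatorname{ifsv}(M)=\|M\|_{\mathbb Z}^\infty=\frac1{|\pi_1(M)|}\cdot\begin{cases}1&\text{if }n\text{ is odd}\\2&\text{if }n\text{ is even.}\end{cases} \] In contrast, $\|M\|=0$.
   Context: An (oriented closed connected) elliptic $n$-manifold is a quotient of the sphere $S^n$ by a finite subgroup of $\mathrm{SO}(n+1)$ acting freely by rotations. For an oriented closed connected $n$-manifold $M$: $\|M\|:=\inf\{\sum_\sigma|a_\sigma|\}$ over all real singular cycles $\sum_\sigma a_\sigma\sigma\in C_n(M;\mathbb{R})$ representing the real fundamental class; $\|M\|_{\mathbb Z}:=\min\{\sum_\sigma|a_\sigma|\}$ over all integral singular cycles representing the fundamental class $[M]_{\mathbb Z}$; $\|M\|_{\mathbb Z}^\infty:=\inf\{\frac1d\|\overline M\|_{\mathbb Z}\mid d\in\mathbb{N}_{>0},\ \overline M\to M \text{ a connected } d\text{-sheeted covering}\}$. Integral foliated simplicial volume. Let $M$ be an oriented closed connected $n$-manifold with fundamental group $\Gamma$ and universal covering $\pi:\widetilde M\to M$; $\Gamma$ acts from the left on $\widetilde M$ by deck transformations and hence on the singular chain complex $C_*(\widetilde M;\mathbb{Z})$. A standard Borel space is a measurable space isomorphic to a Polish space with its Borel $\sigma$-algebra. A standard $\Gamma$-space is a standard Borel space $X$ with a probability measure $\mu$ and a measurable $\mu$-preserving left $\Gamma$-action. Then $L^\infty(X,\mathbb{Z})$ (essentially bounded measurable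 functions $X\to\mathbb{Z}$ modulo equality $\mu$-a.e.) carries the right $\Gamma$-action $(f\cdot g)(x)=f(g\cdot x)$. The $X$-parametrised fundamental class of $M$ is the image of $[M]_{\mathbb Z}$ under the map $H_n(M;\mathbb{Z})\to H_n\bigl(L^\infty(X,\mathbb{Z})\otimes_{\mathbb{Z}\Gamma}C_*(\widetilde M;\mathbb{Z})\bigr)$ induced by $C_*(M;\mathbb{Z})\cong\mathbb{Z}\otimes_{\mathbb{Z}\Gamma}C_*(\widetilde M;\mathbb{Z})$ and the inclusion $\mathbb{Z}\hookrightarrow L^\infty(X,\mathbb{Z})$ as constant functions; cycles representing it are $X$-parametrised fundamental cycles. A chain $\sum_{j=1}^k f_j\otimes\sigma_j$ is in reduced form if $\pi\circ\sigma_j\ne\pi\circ\sigma_\ell$ for $j\neq\ell$, and then its norm is $\sum_{j=1}^k\int_X|f_j|\,d\mu$. $\operatorname{ifsv}^X(M)$ is the infimum of the norms of all $X$-parametrised fundamental cycles of $M$, and $\operatorname{ifsv}(M)$ is the infimum of $\operatorname{ifsv}^X(M)$ over all (isomorphism classes of) standard $\Gamma$-spaces $X$. *)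

theory Defs
  imports
    "HOL-Homology.Homology"
    "HOL-Probability.Probability_Measure"
    "Jordan_Normal_Form.Determinant"
begin

section \<open>Elliptic manifolds\<close>

definition SO_group :: "nat \<Rightarrow> real mat monoid" where
  "SO_group m = \<lparr>carrier = {A \<in> carrier_mat m m. transpose_mat A * A = 1\<^sub>m m \<and> Determinant.det A = 1},
                 monoid.mult = (*), one = 1\<^sub>m m\<rparr>"

text \<open>Points of the spaces \<^const>\<open>Euclidean_space\<close> and \<^const>\<open>nsphere\<close> are sequences
  \<open>nat \<Rightarrow> real\<close> that vanish beyond the dimension; this is the matrix-vector product for them.\<close>

definition mat_act :: "real mat \<Rightarrow> (nat \<Rightarrow> real) \<Rightarrow> nat \<Rightarrow> real" where
  "mat_act A x = (\<lambda>i. if i < dim_row A then \<Sum>j<dim_col A. A $$ (i, j) * x j else 0)"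

text \<open>\<open>M\<close> carries the quotient topology of \<open>S\<^sup>n\<close>, and the fibres of \<open>q\<close> are the orbits of \<open>G\<close>.
  The points of \<open>M\<close> may be of any type, so \<open>M\<close> need not literally consist of orbits.\<close>

definition elliptic_manifold :: "nat \<Rightarrow> 'a topology \<Rightarrow> bool" where
  "elliptic_manifold n M \<longleftrightarrow>
     (\<exists>G q. subgroup G (SO_group (Suc n)) \<and> finite G
        \<and> (\<forall>A\<in>G. \<forall>x\<in>topspace (nsphere n). mat_act A x = x \<longrightarrow> A = 1\<^sub>m (Suc n))
        \<and> quotient_map (nsphere n) M q
        \<and> (\<forall>x\<in>topspace (nsphere n). \<forall>y\<in>topspace (nsphere n).
              q x = q y \<longleftrightarrow> (\<exists>A\<in>G. mat_act A x = y)))"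


section \<open>Fundamental groups, coverings and deck transformations\<close>

definition loops_at :: "'a topology \<Rightarrow> 'a \<Rightarrow> (real \<Rightarrow> 'a) set" where
  "loops_at X x = {f. pathin X f \<and> f 0 = x \<and> f 1 = x}"

definition loop_homotopic :: "'a topology \<Rightarrow> 'a \<Rightarrow> (real \<Rightarrow> 'a) \<Rightarrow> (real \<Rightarrow> 'a) \<Rightarrow> bool" where
  "loop_homotopic X x =
     homotopic_with (\<lambda>h. h 0 = x \<and> h 1 = x) (subtopology euclideanreal {0..1}) X"

text \<open>The library's \<^const>\<open>joinpaths\<close>, which is confined to the sort \<^class>\<open>topological_space\<close>.\<close>

definition path_join :: "(real \<Rightarrow> 'a) \<Rightarrow> (real \<Rightarrow> 'a) \<Rightarrow> real \<Rightarrow> 'a" where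
  "path_join f g = (\<lambda>t. if t \<le> 1/2 then f (2 * t) else g (2 * t - 1))"

text \<open>Homotopy classes of loops. Values of loops outside \<open>{0..1}\<close> are irrelevant: loops that
  agree on \<open>{0..1}\<close> lie in the same class.\<close>

definition fundamental_group :: "'a topology \<Rightarrow> 'a \<Rightarrow> (real \<Rightarrow> 'a) set monoid" where
  "fundamental_group X x =
     \<lparr>carrier = {Collect (loop_homotopic X x f) | f. f \<in> loops_at X x},
      monoid.mult = (\<lambda>a b. {h. \<exists>f\<in>a. \<exists>g\<in>b. loop_homotopic X x (path_join f g) h}),
      one = Collect (loop_homotopic X x (\<lambda>t. x))\<rparr>"

definition simply_connected_space :: "'a topology \<Rightarrow> bool" where
  "simply_connected_space X \<longleftrightarrow>
     path_connected_space X \<and> (\<forall>x\<in>topspace X. trivial_group (fundamental_group X x))"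

text \<open>The analogue of \<^const>\<open>covering_space\<close> for abstract topologies.\<close>

definition covering_map :: "'b topology \<Rightarrow> 'a topology \<Rightarrow> ('b \<Rightarrow> 'a) \<Rightarrow> bool" where
  "covering_map N M p \<longleftrightarrow>
     continuous_map N M p \<and> p ` topspace N = topspace M \<and>
     (\<forall>x\<in>topspace M. \<exists>U. x \<in> U \<and> openin M U \<and>
        (\<exists>\<V>. \<Union>\<V> = topspace N \<inter> p -` U \<and> (\<forall>V\<in>\<V>. openin N V) \<and> pairwise disjnt \<V> \<and>
             (\<forall>V\<in>\<V>. homeomorphic_map (subtopology N V) (subtopology M U) p)))"

definition sheeted :: "nat \<Rightarrow> 'b topology \<Rightarrow> 'a topology \<Rightarrow> ('b \<Rightarrow> 'a) \<Rightarrow> bool" where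
  "sheeted d N M p \<longleftrightarrow>
     (\<forall>x\<in>topspace M. finite {y \<in> topspace N. p y = x} \<and> card {y \<in> topspace N. p y = x} = d)"

definition universal_covering :: "'e topology \<Rightarrow> 'a topology \<Rightarrow> ('e \<Rightarrow> 'a) \<Rightarrow> bool" where
  "universal_covering E M p \<longleftrightarrow> covering_map E M p \<and> simply_connected_space E"

definition deck_transformation :: "'e topology \<Rightarrow> ('e \<Rightarrow> 'a) \<Rightarrow> ('e \<Rightarrow> 'e) \<Rightarrow> bool" where
  "deck_transformation E p g \<longleftrightarrow>
     g \<in> extensional (topspace E) \<and> homeomorphic_map E E g \<and> (\<forall>e\<in>topspace E. p (g e) = p e)"

text \<open>The action of \<open>\<pi>\<^sub>1(M, p e0)\<close> on the universal covering: \<open>\<gamma>\<close> acts as the deck transformation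
  that sends \<open>e0\<close> to the end point of the lift at \<open>e0\<close> of a loop in \<open>\<gamma>\<close>. As \<open>\<gamma>\<delta>\<close> means first \<open>\<gamma>\<close>,
  then \<open>\<delta>\<close>, this is a left action.\<close>

definition deck_action :: "'e topology \<Rightarrow> ('e \<Rightarrow> 'a) \<Rightarrow> 'e \<Rightarrow> (real \<Rightarrow> 'a) set \<Rightarrow> 'e \<Rightarrow> 'e" where
  "deck_action E p e0 \<gamma> =
     (THE g. deck_transformation E p g \<and>
             (\<exists>l. pathin E l \<and> l 0 = e0 \<and> l 1 = g e0 \<and> p \<circ> l \<in> \<gamma>))"


section \<open>Fundamental classes\<close>

text \<open>An oriented closed connected \<open>n\<close>-manifold is represented by the manifold together with its
  integral fundamental class: a class in \<open>H\<^sub>n(M;\<int>)\<close> that restricts to a generator of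
  \<open>H\<^sub>n(M, M - {x};\<int>)\<close> at every point \<open>x\<close>. Elements of \<^const>\<open>homology_group\<close> are sets of cycles, so
  \<open>z \<in> c\<close> says that the cycle \<open>z\<close> represents \<open>c\<close>.\<close>

definition fundamental_class :: "nat \<Rightarrow> 'a topology \<Rightarrow> 'a chain set \<Rightarrow> bool" where
  "fundamental_class n M c \<longleftrightarrow>
     c \<in> carrier (homology_group (int n) M) \<and>
     (\<forall>x\<in>topspace M.
        let H = relative_homology_group (int n) M (topspace M - {x})
        in carrier H = generate H {hom_induced (int n) M {} M (topspace M - {x}) id c})"


section \<open>Simplicial volume\<close>

type_synonym 'a real_chain = "((nat \<Rightarrow> real) \<Rightarrow> 'a) \<Rightarrow>\<^sub>0 real"

definition real_singular_chain :: "nat \<Rightarrow> 'a topology \<Rightarrow> 'a real_chain \<Rightarrow> bool" where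
  "real_singular_chain k X a \<longleftrightarrow> Poly_Mapping.keys a \<subseteq> singular_simplex_set k X"

definition real_chain_boundary :: "nat \<Rightarrow> 'a real_chain \<Rightarrow> 'a real_chain" where
  "real_chain_boundary k a =
     (if k = 0 then 0
      else \<Sum>\<sigma>\<in>Poly_Mapping.keys a. \<Sum>i\<le>k.
             Poly_Mapping.single (singular_face k i \<sigma>) ((-1) ^ i * Poly_Mapping.lookup a \<sigma>))"

text \<open>The real fundamental class is the image of the integral one under the change of coefficients.\<close>

definition real_fundamental_cycle :: "nat \<Rightarrow> 'a topology \<Rightarrow> 'a chain set \<Rightarrow> 'a real_chain \<Rightarrow> bool" where
  "real_fundamental_cycle n M c a \<longleftrightarrow>
     real_singular_chain n M a \<and>
     (\<exists>z b. z \<in> c \<and> real_singular_chain (Suc n) M b \<and>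
            a - Poly_Mapping.map real_of_int z = real_chain_boundary (Suc n) b)"

definition simplicial_volume :: "nat \<Rightarrow> 'a topology \<Rightarrow> 'a chain set \<Rightarrow> real" where
  "simplicial_volume n M c =
     Inf {\<Sum>\<sigma>\<in>Poly_Mapping.keys a. \<bar>Poly_Mapping.lookup a \<sigma>\<bar> | a. real_fundamental_cycle n M c a}"

definition integral_simplicial_volume :: "'a chain set \<Rightarrow> nat" where
  "integral_simplicial_volume c =
     (LEAST k. \<exists>z\<in>c. int k = (\<Sum>\<sigma>\<in>Poly_Mapping.keys z. \<bar>Poly_Mapping.lookup z \<sigma>\<bar>))"

text \<open>Every \<open>d\<close>-sheeted covering of \<open>M\<close> is isomorphic to one whose points are those of
  \<open>M \<times> {..<d}\<close>, so coverings with points of type \<open>'a \<times> nat\<close> suffice. The two fundamental classes of a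
  connected covering manifold \<open>N\<close> differ by a sign and have the same integral simplicial volume, so
  it does not matter which of them is taken.\<close>

definition stable_integral_simplicial_volume :: "nat \<Rightarrow> 'a topology \<Rightarrow> real" where
  "stable_integral_simplicial_volume n M =
     Inf {1 / real d * real (integral_simplicial_volume c) | d (N :: ('a \<times> nat) topology) p c.
            d > 0 \<and> connected_space N \<and> covering_map N M p \<and> sheeted d N M p \<and>
            fundamental_class n N c}"


section \<open>Standard \<open>\<Gamma>\<close>-spaces\<close>

text \<open>A Polish topology can be transported along a measurable isomorphism, so it may be taken to live
  on the measurable space itself.\<close>

definition standard_borel :: "'x measure \<Rightarrow> bool" where
  "standard_borel X \<longleftrightarrow>
     (\<exists>T. completely_metrizable_space T \<and> second_countable T \<and> topspace T = space X \<and>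
          sets X = sigma_sets (topspace T) {U. openin T U})"

definition standard_space ::
  "('g, 'm) monoid_scheme \<Rightarrow> 'x measure \<Rightarrow> ('g \<Rightarrow> 'x \<Rightarrow> 'x) \<Rightarrow> bool" where
  "standard_space \<Gamma> X \<alpha> \<longleftrightarrow>
     standard_borel X \<and> prob_space X \<and>
     (\<forall>\<gamma>\<in>carrier \<Gamma>. \<alpha> \<gamma> \<in> measurable X X \<and>
        (\<forall>A\<in>sets X. emeasure X (\<alpha> \<gamma> -` A \<inter> space X) = emeasure X A)) \<and>
     (\<forall>x\<in>space X. \<alpha> \<one>\<^bsub>\<Gamma>\<^esub> x = x) \<and>
     (\<forall>\<gamma>\<in>carrier \<Gamma>. \<forall>\<delta>\<in>carrier \<Gamma>. \<forall>x\<in>space X. \<alpha> (\<gamma> \<otimes>\<^bsub>\<Gamma>\<^esub> \<delta>) x = \<alpha> \<gamma> (\<alpha> \<delta> x))"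

text \<open>Representatives of the elements of \<open>L\<^sup>\<infinity>(X, \<int>)\<close>; equality almost everywhere is built into the
  tensor product below.\<close>

definition Linf :: "'x measure \<Rightarrow> ('x \<Rightarrow> int) set" where
  "Linf X = {f \<in> measurable X (count_space UNIV). \<exists>B. AE x in X. \<bar>f x\<bar> \<le> B}"


section \<open>The chain complex \<open>L\<^sup>\<infinity>(X, \<int>) \<otimes>\<^bsub>\<int>\<Gamma>\<^esub> C\<^sub>*(E; \<int>)\<close>\<close>

text \<open>The tensor product is presented as usual: the free abelian group on pairs \<open>(f, c)\<close>, modulo the
  subgroup generated by biadditivity and by \<open>f\<cdot>\<gamma> \<otimes> c = f \<otimes> \<gamma>\<cdot>c\<close>, where \<open>(f\<cdot>\<gamma>)(x) = f(\<gamma>\<cdot>x)\<close>.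
  Its elements are handled through representing formal sums. Here \<open>\<alpha>\<close> is the action of \<open>\<Gamma>\<close> on \<open>X\<close>
  and \<open>\<rho>\<close> the one on \<open>E\<close>.\<close>

type_synonym ('x, 'e) formal_tensor = "(('x \<Rightarrow> int) \<times> 'e chain) \<Rightarrow>\<^sub>0 int"

definition formal_tensors :: "'x measure \<Rightarrow> 'e topology \<Rightarrow> nat \<Rightarrow> ('x, 'e) formal_tensor monoid" where
  "formal_tensors X E k = free_Abelian_group (Linf X \<times> singular_chain_set k E)"

definition tensor_relators ::
  "('g, 'm) monoid_scheme \<Rightarrow> 'x measure \<Rightarrow> ('g \<Rightarrow> 'x \<Rightarrow> 'x) \<Rightarrow> 'e topology \<Rightarrow> ('g \<Rightarrow> 'e \<Rightarrow> 'e) \<Rightarrow> nat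
     \<Rightarrow> ('x, 'e) formal_tensor set" where
  "tensor_relators \<Gamma> X \<alpha> E \<rho> k =
     {frag_of (f, c) - frag_of (g, c) | f g c.
        f \<in> Linf X \<and> g \<in> Linf X \<and> (AE x in X. f x = g x) \<and> singular_chain k E c} \<union>
     {frag_of (\<lambda>x. f x + g x, c) - frag_of (f, c) - frag_of (g, c) | f g c.
        f \<in> Linf X \<and> g \<in> Linf X \<and> singular_chain k E c} \<union>
     {frag_of (f, c + d) - frag_of (f, c) - frag_of (f, d) | f c d.
        f \<in> Linf X \<and> singular_chain k E c \<and> singular_chain k E d} \<union>
     {frag_of (\<lambda>x. f (\<alpha> \<gamma> x), c) - frag_of (f, chain_map k (\<rho> \<gamma>) c) | f \<gamma> c.
        f \<in> Linf X \<and> \<gamma> \<in> carrier \<Gamma> \<and> singular_chain k E c}"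

definition tensor_eq ::
  "('g, 'm) monoid_scheme \<Rightarrow> 'x measure \<Rightarrow> ('g \<Rightarrow> 'x \<Rightarrow> 'x) \<Rightarrow> 'e topology \<Rightarrow> ('g \<Rightarrow> 'e \<Rightarrow> 'e) \<Rightarrow> nat
     \<Rightarrow> ('x, 'e) formal_tensor \<Rightarrow> ('x, 'e) formal_tensor \<Rightarrow> bool" where
  "tensor_eq \<Gamma> X \<alpha> E \<rho> k v w \<longleftrightarrow>
     v \<in> carrier (formal_tensors X E k) \<and> w \<in> carrier (formal_tensors X E k) \<and>
     v - w \<in> generate (formal_tensors X E k) (tensor_relators \<Gamma> X \<alpha> E \<rho> k)"

definition tensor_boundary :: "nat \<Rightarrow> ('x, 'e) formal_tensor \<Rightarrow> ('x, 'e) formal_tensor" where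
  "tensor_boundary k = frag_extend (\<lambda>(f, c). frag_of (f, chain_boundary k c))"


section \<open>Integral foliated simplicial volume\<close>

text \<open>The map \<open>C\<^sub>*(M; \<int>) \<cong> \<int> \<otimes>\<^bsub>\<int>\<Gamma>\<^esub> C\<^sub>*(E; \<int>) \<rightarrow> L\<^sup>\<infinity>(X, \<int>) \<otimes>\<^bsub>\<int>\<Gamma>\<^esub> C\<^sub>*(E; \<int>)\<close> sends the image in \<open>M\<close> of a
  chain \<open>z\<close> of \<open>E\<close> to \<open>1 \<otimes> z\<close>.\<close>

definition parametrised_fundamental_cycle ::
  "nat \<Rightarrow> 'a topology \<Rightarrow> 'a chain set \<Rightarrow> 'e topology \<Rightarrow> ('e \<Rightarrow> 'a) \<Rightarrow> 'e \<Rightarrow>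
   'x measure \<Rightarrow> ((real \<Rightarrow> 'a) set \<Rightarrow> 'x \<Rightarrow> 'x) \<Rightarrow> ('x, 'e) formal_tensor \<Rightarrow> bool" where
  "parametrised_fundamental_cycle n M c E p e0 X \<alpha> w \<longleftrightarrow>
     (\<exists>z v. singular_chain n E z \<and> chain_map n p z \<in> c \<and>
            v \<in> carrier (formal_tensors X E (Suc n)) \<and>
            tensor_eq (fundamental_group M (p e0)) X \<alpha> E (deck_action E p e0) n
              w (frag_of (\<lambda>_. 1, z) + tensor_boundary (Suc n) v))"

text \<open>\<open>S\<close> is the finite set of simplices \<open>\<sigma>\<^sub>1, \<dots>, \<sigma>\<^sub>k\<close> of a chain in reduced form and \<open>f\<close> its
  coefficient family.\<close>

definition ifsv_param ::
  "nat \<Rightarrow> 'a topology \<Rightarrow> 'a chain set \<Rightarrow> 'e topology \<Rightarrow> ('e \<Rightarrow> 'a) \<Rightarrow> 'e \<Rightarrow>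
   'x measure \<Rightarrow> ((real \<Rightarrow> 'a) set \<Rightarrow> 'x \<Rightarrow> 'x) \<Rightarrow> real" where
  "ifsv_param n M c E p e0 X \<alpha> =
     Inf {\<Sum>\<sigma>\<in>S. \<integral>x. \<bar>real_of_int (f \<sigma> x)\<bar> \<partial>X | S f.
            finite S \<and> S \<subseteq> singular_simplex_set n E \<and> inj_on (simplex_map n p) S \<and>
            (\<forall>\<sigma>\<in>S. f \<sigma> \<in> Linf X) \<and>
            parametrised_fundamental_cycle n M c E p e0 X \<alpha> (\<Sum>\<sigma>\<in>S. frag_of (f \<sigma>, frag_of \<sigma>))}"

text \<open>Every standard Borel space is isomorphic to a Borel subset of the real line, so spaces \<open>X\<close> whose
  points are reals represent all isomorphism classes of standard \<open>\<Gamma>\<close>-spaces.\<close>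

definition ifsv ::
  "nat \<Rightarrow> 'a topology \<Rightarrow> 'a chain set \<Rightarrow> 'e topology \<Rightarrow> ('e \<Rightarrow> 'a) \<Rightarrow> 'e \<Rightarrow> real" where
  "ifsv n M c E p e0 =
     Inf {ifsv_param n M c E p e0 X \<alpha> | (X :: real measure) \<alpha>.
            standard_space (fundamental_group M (p e0)) X \<alpha>}"

text \<open>The fundamental group of an elliptic manifold is infinite in the case of the circle; then
  \<open>1 / |G|\<close> is read as \<open>0\<close>.\<close>

definition inverse_order :: "('g, 'm) monoid_scheme \<Rightarrow> real" where
  "inverse_order G = (if finite (carrier G) then 1 / real (card (carrier G)) else 0)"

end

theory Submission
  imports Defs
begin

text \<open>Let \<open>q\<close> be a \<open>d\<close>-sheeted covering of \<open>M\<close> by the sphere. If \<open>n \<ge> 2\<close> then the sphere is simply connected and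
  \<open>d\<close> is the order of \<open>\<pi>\<^sub>1(M)\<close>; if \<open>n = 1\<close> then \<open>d\<close> can be made arbitrarily large by composing \<open>q\<close> with the
  squaring map of the circle. The sphere has a fundamental cycle of norm \<open>1\<close> or \<open>2\<close>, according to the parity of
  \<open>n\<close>: a singular simplex that maps the boundary to a point, corrected by a constant simplex if \<open>n\<close> is even.
  No cycle that is not a boundary has smaller norm, because the coefficients of a cycle of even dimension sum up
  to \<open>0\<close>.

  This bounds the fundamental cycles of every covering of \<open>M\<close> from below, and the number of sheets is at most the
  order of \<open>\<pi>\<^sub>1(M)\<close>. A parametrised fundamental cycle, read as an equivariant map from \<open>X\<close> to the chains of the
  universal covering, has at almost every point a cycle as its value that is homologous to the transfer of a
  fundamental cycle of \<open>M\<close>, hence is not a boundary; integration over \<open>X\<close> gives the lower bound. Conversely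
  the fundamental cycle of the sphere, distributed over the finite \<open>\<pi>\<^sub>1(M)\<close>-space of the lifts of the universal
  covering to the sphere, is a parametrised fundamental cycle of \<open>1 / d\<close> times its norm.

  The class of a simplex with constant boundary can be doubled without any increase of its norm by a map that
  folds the simplex along its first edge. Iteration makes the simplicial volume of \<open>M\<close> vanish.\<close>

section \<open>Coverings and lifts\<close>

text \<open>\<open>M\<close>, its coverings and its universal covering are arbitrary spaces whose
  homology is never computed. What is used is H_n(S^n) = Z with an explicit generator. A cycle
  elsewhere is recognised as a non-boundary by moving it to the sphere through the transfer along
  \<open>q\<close>, or by comparing local homology at a point, where excision makes all these spaces
  look alike. Simple connectedness of the sphere enters in the same indirect way, as the existence
  of lifts to coverings.

  The two upper bounds rest on one mechanism: every \<open>d\<close>-sheeted covering by the sphere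
  yields the value \<open>sphere_norm n / d\<close>, whatever the fundamental group is. The order of
  the group enters the lower bounds and the comparison with \<open>d\<close>; for an infinite group
  the lower bound is 0. The circle thus becomes a limit of finite coverings, although its universal
  covering is not a sphere.\<close>

text \<open>The other sheets survive only as their union, the open complement of \<open>V\<close> in
  the preimage of \<open>U\<close>. So \<open>V\<close> is clopen in that preimage, which is what
  the connectedness arguments use; \<open>s\<close> is the section over \<open>U\<close> with values
  in \<open>V\<close>.\<close>

lemma covering_map_sheet:
  assumes "covering_map E M p" "x \<in> topspace M"
  obtains U where "x \<in> U" "openin M U"
    "\<And>e. e \<in> topspace E \<Longrightarrow> p e \<in> U \<Longrightarrow>
       \<exists>V s. openin E V \<and> e \<in> V \<and> openin E ({z \<in> topspace E. p z \<in> U} - V) \<and>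
             homeomorphic_maps (subtopology E V) (subtopology M U) p s"
proof -
  obtain U \<V> where U: "x \<in> U" "openin M U" and V: "\<Union>\<V> = topspace E \<inter> p -` U" "\<And>V. V \<in> \<V> \<Longrightarrow> openin E V"
    "pairwise disjnt \<V>" "\<And>V. V \<in> \<V> \<Longrightarrow> homeomorphic_map (subtopology E V) (subtopology M U) p"
    using assms unfolding covering_map_def by metis
  show thesis
  proof (rule that[OF U])
    fix e assume e: "e \<in> topspace E" "p e \<in> U"
    then obtain V where V1: "V \<in> \<V>" "e \<in> V" using V(1) by blast
    then obtain s where s: "homeomorphic_maps (subtopology E V) (subtopology M U) p s"
      using V(4) homeomorphic_map_maps by blast
    have "{z \<in> topspace E. p z \<in> U} - V = \<Union>(\<V> - {V})"
    proof -
      have "{z \<in> topspace E. p z \<in> U} = \<Union>\<V>" using V(1) by auto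
      moreover have "\<And>V'. V' \<in> \<V> - {V} \<Longrightarrow> V' \<inter> V = {}"
        using V(3) V1(1) by (auto simp: pairwise_def disjnt_def)
      ultimately show ?thesis by blast
    qed
    moreover have "openin E (\<Union>(\<V> - {V}))" using V(2) by blast
    ultimately show "\<exists>V s. openin E V \<and> e \<in> V \<and> openin E ({z \<in> topspace E. p z \<in> U} - V) \<and>
             homeomorphic_maps (subtopology E V) (subtopology M U) p s"
      using s V1 V(2) by metis
  qed
qed

lemma covering_map_continuous: "covering_map E M p \<Longrightarrow> continuous_map E M p"
  by (simp add: covering_map_def)

lemma covering_map_surj: "covering_map E M p \<Longrightarrow> p ` topspace E = topspace M"
  by (simp add: covering_map_def)

lemma sheet_simps:
  assumes "homeomorphic_maps (subtopology E V) (subtopology M U) p s" "openin E V" "openin M U"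
  shows "v \<in> V \<Longrightarrow> p v \<in> U" "v \<in> V \<Longrightarrow> s (p v) = v" "u \<in> U \<Longrightarrow> s u \<in> V" "u \<in> U \<Longrightarrow> p (s u) = u"
    "continuous_map (subtopology M U) E s" "v \<in> V \<Longrightarrow> v \<in> topspace E" "u \<in> U \<Longrightarrow> u \<in> topspace M"
proof -
  have VE: "V \<subseteq> topspace E" "U \<subseteq> topspace M" using assms openin_subset by blast+
  have *: "continuous_map (subtopology E V) (subtopology M U) p"
    "continuous_map (subtopology M U) (subtopology E V) s"
    using assms(1) by (auto simp: homeomorphic_maps_def)
  show "v \<in> V \<Longrightarrow> p v \<in> U" "u \<in> U \<Longrightarrow> s u \<in> V" using * VE
    by (auto simp: continuous_map_in_subtopology Pi_iff)
  show "v \<in> V \<Longrightarrow> s (p v) = v" "u \<in> U \<Longrightarrow> p (s u) = u"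
    using assms(1) VE unfolding homeomorphic_maps_def by auto
  show "continuous_map (subtopology M U) E s" using *(2) continuous_map_in_subtopology by blast
  show "v \<in> V \<Longrightarrow> v \<in> topspace E" "u \<in> U \<Longrightarrow> u \<in> topspace M" using VE by auto
qed

text \<open>The set of agreement is clopen: near a point of agreement both maps stay in one sheet,
  on which \<open>p\<close> is injective; near a point of disagreement \<open>f\<close> stays in a
  sheet and \<open>g\<close> in the open union of the other ones.\<close>

lemma covering_lift_unique:
  assumes cov: "covering_map E M p" and Y: "connected_space Y"
    and f: "continuous_map Y E f" and g: "continuous_map Y E g"
    and eq: "\<And>y. y \<in> topspace Y \<Longrightarrow> p (f y) = p (g y)"
    and y0: "y0 \<in> topspace Y" "f y0 = g y0" and y: "y \<in> topspace Y"
  shows "f y = g y"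
proof -
  let ?A = "{y \<in> topspace Y. f y = g y}"
  have fE: "\<And>y. y \<in> topspace Y \<Longrightarrow> f y \<in> topspace E" and gE: "\<And>y. y \<in> topspace Y \<Longrightarrow> g y \<in> topspace E"
    using f g by (auto simp: continuous_map_def)
  have pM: "\<And>e. e \<in> topspace E \<Longrightarrow> p e \<in> topspace M"
    using cov by (auto simp: covering_map_def continuous_map_def)
  have loc: "\<exists>W. openin Y W \<and> z \<in> W \<and> (if f z = g z then \<forall>w\<in>W. f w = g w else \<forall>w\<in>W. f w \<noteq> g w)" if z: "z \<in> topspace Y" for z
  proof -
    obtain U where U: "p (f z) \<in> U" "openin M U" and
      sh: "\<And>e. e \<in> topspace E \<Longrightarrow> p e \<in> U \<Longrightarrow>
       \<exists>V s. openin E V \<and> e \<in> V \<and> openin E ({z \<in> topspace E. p z \<in> U} - V) \<and>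
             homeomorphic_maps (subtopology E V) (subtopology M U) p s"
      using covering_map_sheet[OF cov pM[OF fE[OF z]]] by blast
    obtain V s where V: "openin E V" "f z \<in> V" "openin E ({z \<in> topspace E. p z \<in> U} - V)"
        and s: "homeomorphic_maps (subtopology E V) (subtopology M U) p s"
      using sh[OF fE[OF z] U(1)] by blast
    note ss = sheet_simps[OF s V(1) U(2)]
    have O1: "openin Y {w \<in> topspace Y. f w \<in> V}" "openin Y {w \<in> topspace Y. g w \<in> V}"
      "openin Y {w \<in> topspace Y. g w \<in> {z \<in> topspace E. p z \<in> U} - V}"
      using f g V openin_continuous_map_preimage by blast+
    show ?thesis
    proof (cases "f z = g z")
      case True
      have "openin Y ({w \<in> topspace Y. f w \<in> V} \<inter> {w \<in> topspace Y. g w \<in> V})" using O1 by blast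
      moreover have "f w = g w" if "w \<in> {w \<in> topspace Y. f w \<in> V} \<inter> {w \<in> topspace Y. g w \<in> V}" for w
        using that ss(2) eq by (metis (mono_tags, lifting) IntD1 IntD2 mem_Collect_eq)
      ultimately show ?thesis using True V(2) z by (metis (mono_tags, lifting) IntI mem_Collect_eq)
    next
      case False
      have gV: "g z \<notin> V" using False ss(2) V(2) eq[OF z] by metis
      have gz: "g z \<in> {z \<in> topspace E. p z \<in> U} - V" using gV gE[OF z] U(1) eq[OF z] by auto
      have "openin Y ({w \<in> topspace Y. f w \<in> V} \<inter> {w \<in> topspace Y. g w \<in> {z \<in> topspace E. p z \<in> U} - V})"
        using O1 by blast
      moreover have "f w \<noteq> g w" if "w \<in> {w \<in> topspace Y. f w \<in> V} \<inter> {w \<in> topspace Y. g w \<in> {z \<in> topspace E. p z \<in> U} - V}" for w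
        using that by auto
      ultimately show ?thesis using False V(2) gz z by (metis (mono_tags, lifting) IntI mem_Collect_eq)
    qed
  qed
  have 1: "openin Y ?A"
  proof (subst openin_subopen, intro ballI)
    fix z assume z: "z \<in> ?A"
    then obtain W where W: "openin Y W" "z \<in> W" "\<forall>w\<in>W. f w = g w" using loc[of z] by auto
    then have "W \<subseteq> ?A" using openin_subset[OF W(1)] by auto
    then show "\<exists>T. openin Y T \<and> z \<in> T \<and> T \<subseteq> ?A" using W by blast
  qed
  have 2: "openin Y (topspace Y - ?A)"
  proof (subst openin_subopen, intro ballI)
    fix z assume z: "z \<in> topspace Y - ?A"
    then obtain W where W: "openin Y W" "z \<in> W" "\<forall>w\<in>W. f w \<noteq> g w" using loc[of z] by auto
    then have "W \<subseteq> topspace Y - ?A" using openin_subset[OF W(1)] by auto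
    then show "\<exists>T. openin Y T \<and> z \<in> T \<and> T \<subseteq> topspace Y - ?A" using W by blast
  qed
  have "?A = topspace Y"
    using Y 1 2 y0 unfolding connected_space_clopen_in closedin_def by blast
  then show ?thesis using y by auto
qed

section \<open>Lifting of homotopies and of paths\<close>

abbreviation unit_top :: "real topology" where "unit_top \<equiv> top_of_set {0..1}"

lemma connected_space_unit_top: "connected_space unit_top"
  by (metis connected_Icc connectedin_absolute connectedin_def connectedin_iff_connected)

text \<open>Lifts are built over strips \<open>{0..b} \<times> W\<close> around one point of
  \<open>Y\<close> at a time, so \<open>Y\<close> can be any space. Strips around different points
  match because on each vertical interval a lift is determined by its start.\<close>

lemma covering_homotopy_lift:
  assumes cov: "covering_map E M p"
    and h: "continuous_map (prod_topology unit_top Y) M h"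
    and f: "continuous_map Y E f" and pf: "\<And>y. y \<in> topspace Y \<Longrightarrow> p (f y) = h (0, y)"
  obtains k where "continuous_map (prod_topology unit_top Y) E k"
    "\<And>y. y \<in> topspace Y \<Longrightarrow> k (0, y) = f y"
    "\<And>t y. y \<in> topspace Y \<Longrightarrow> t \<in> {0..1} \<Longrightarrow> p (k (t, y)) = h (t, y)"
proof -
  let ?P = "prod_topology euclideanreal Y"
  have eqP: "prod_topology (top_of_set {0..b}) (subtopology Y W) = subtopology ?P ({0..b} \<times> W)" for b W
    by (simp add: subtopology_Times)
  have eqP': "prod_topology unit_top Y = subtopology ?P ({0..1} \<times> topspace Y)"
    using eqP[of 1 "topspace Y"] by simp
  have h': "continuous_map (subtopology ?P ({0..1} \<times> topspace Y)) M h" using h eqP' by simp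
  define Q where "Q = (\<lambda>y0 b. \<exists>W k. openin Y W \<and> y0 \<in> W \<and> continuous_map (subtopology ?P ({0..b} \<times> W)) E k \<and>
     (\<forall>y\<in>W. k (0, y) = f y) \<and> (\<forall>y\<in>W. \<forall>t\<in>{0..b}. p (k (t, y)) = h (t, y)))"
  have Q1: "Q y0 1" if y0: "y0 \<in> topspace Y" for y0
  proof -
    have Q0: "Q y0 0"
    proof -
      have "continuous_map (subtopology ?P ({0..0} \<times> topspace Y)) E (f \<circ> snd)"
        by (rule continuous_map_compose[OF _ f]) (simp add: continuous_map_from_subtopology continuous_map_snd)
      then show ?thesis unfolding Q_def
        by (intro exI[of _ "topspace Y"] exI[of _ "f \<circ> snd"]) (use y0 pf in auto)
    qed
    \<comment> \<open>\<open>Bolzano\<close> replaces the choice of a Lebesgue number: it suffices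
      to extend lifts across each \<open>x\<close> by a short interval, and the strip may become
      thinner every time.\<close>
    have "0 \<le> (0::real) \<longrightarrow> (1::real) \<le> 1 \<longrightarrow> Q y0 0 \<longrightarrow> Q y0 1"
    proof (rule Bolzano[where P = "\<lambda>a b. 0 \<le> a \<longrightarrow> b \<le> 1 \<longrightarrow> Q y0 a \<longrightarrow> Q y0 b"])
      fix x :: real assume x: "0 \<le> x" "x \<le> 1"
      have hx: "h (x, y0) \<in> topspace M" using h x y0 by (auto simp: continuous_map_def)
      obtain U where U: "h (x, y0) \<in> U" "openin M U" and
        sh: "\<And>e. e \<in> topspace E \<Longrightarrow> p e \<in> U \<Longrightarrow>
         \<exists>V s. openin E V \<and> e \<in> V \<and> openin E ({z \<in> topspace E. p z \<in> U} - V) \<and>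
               homeomorphic_maps (subtopology E V) (subtopology M U) p s"
        using covering_map_sheet[OF cov hx] by blast
      have o1: "openin (prod_topology unit_top Y) {z \<in> topspace (prod_topology unit_top Y). h z \<in> U}"
        using openin_continuous_map_preimage h U(2) by blast
      have o2: "(x, y0) \<in> {z \<in> topspace (prod_topology unit_top Y). h z \<in> U}" using x y0 U by auto
      from o1[unfolded openin_prod_topology_alt, rule_format, OF o2] obtain J W0 where JW: "openin unit_top J" "openin Y W0" "x \<in> J" "y0 \<in> W0"
          "J \<times> W0 \<subseteq> {z \<in> topspace (prod_topology unit_top Y). h z \<in> U}"
        by blast
      obtain d where d: "d > 0" "\<And>t. t \<in> {0..1} \<Longrightarrow> dist t x < d \<Longrightarrow> t \<in> J"
        using JW(1,3) unfolding openin_euclidean_subtopology_iff by blast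
      show "\<exists>d>0. \<forall>a b. a \<le> x \<and> x \<le> b \<and> b - a < d \<longrightarrow> 0 \<le> a \<longrightarrow> b \<le> 1 \<longrightarrow> Q y0 a \<longrightarrow> Q y0 b"
      proof (intro exI[of _ d] conjI allI impI d(1))
        fix a b assume ab: "a \<le> x \<and> x \<le> b \<and> b - a < d" "0 \<le> a" "b \<le> 1" and "Q y0 a"
        then obtain W k where W: "openin Y W" "y0 \<in> W" "continuous_map (subtopology ?P ({0..a} \<times> W)) E k"
          "\<And>y. y\<in>W \<Longrightarrow> k (0, y) = f y" "\<And>y t. y\<in>W \<Longrightarrow> t\<in>{0..a} \<Longrightarrow> p (k (t, y)) = h (t, y)" unfolding Q_def by blast
        have tJ: "t \<in> J" if "t \<in> {a..b}" for t
          by (rule d(2)) (use that ab in \<open>auto simp: dist_real_def\<close>)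
        have WE: "W \<subseteq> topspace Y" using W(1) openin_subset by blast
        have kE: "k (a, y) \<in> topspace E" if "y \<in> W" for y
        proof -
          have "(a,y) \<in> topspace (subtopology ?P ({0..a} \<times> W))" using that ab WE by auto
          then show ?thesis using W(3) by (meson continuous_map_image_subset_topspace image_subset_iff)
        qed
        have "p (k (a, y0)) \<in> U" using W(2,5) ab JW(4,5) tJ[of a] by force
        then obtain V s where V: "openin E V" "k (a, y0) \<in> V"
          and s: "homeomorphic_maps (subtopology E V) (subtopology M U) p s"
          using sh kE[OF W(2)] by blast
        note ss = sheet_simps[OF s V(1) U(2)]
        have ca: "continuous_map (subtopology Y W) E (\<lambda>y. k (a, y))"
        proof -
          have "continuous_map (subtopology Y W) (subtopology ?P ({0..a} \<times> W)) (\<lambda>y. (a, y))"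
            using WE ab by (intro continuous_map_into_subtopology continuous_map_pairedI) (auto intro: continuous_map_from_subtopology)
          from continuous_map_compose[OF this W(3)] show ?thesis by (simp add: o_def)
        qed
        \<comment> \<open>Over \<open>W'\<close> the lift at time \<open>a\<close> lies in the
          single sheet \<open>V\<close>, so from \<open>a\<close> on the section \<open>s\<close>
          continues it.\<close>
        define W' where "W' = {y \<in> W. k (a, y) \<in> V} \<inter> W0"
        have "openin (subtopology Y W) {y \<in> topspace (subtopology Y W). k (a, y) \<in> V}"
          using openin_continuous_map_preimage[OF ca V(1)] .
        moreover have "{y \<in> topspace (subtopology Y W). k (a, y) \<in> V} = {y \<in> W. k (a, y) \<in> V}" using WE by auto
        ultimately have "openin Y {y \<in> W. k (a, y) \<in> V}" using W(1) openin_trans_full by metis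
        then have W'o: "openin Y W'" unfolding W'_def using JW(2) by blast
        have W'W: "W' \<subseteq> W" "W' \<subseteq> W0" by (auto simp: W'_def)
        have hU: "h (t, y) \<in> U" if "t \<in> {a..b}" "y \<in> W'" for t y
          using tJ[OF that(1)] that(2) W'W JW(5) by blast
        define k' where "k' = (\<lambda>z. if fst z \<le> a then k z else s (h z))"
        have "continuous_map (subtopology ?P ({0..b} \<times> W')) E k'"
          unfolding k'_def
        proof (rule continuous_map_cases_le)
          show "continuous_map (subtopology ?P ({0..b} \<times> W')) euclideanreal fst"
            by (simp add: continuous_map_from_subtopology continuous_map_fst)
          show "continuous_map (subtopology (subtopology ?P ({0..b} \<times> W')) {x \<in> topspace (subtopology ?P ({0..b} \<times> W')). fst x \<le> a}) E k"
            unfolding subtopology_subtopology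
            by (rule continuous_map_from_subtopology_mono[OF W(3)]) (use W'W in auto)
          have "continuous_map (subtopology ?P ({a..b} \<times> W')) (subtopology M U) h"
            by (rule continuous_map_into_subtopology[OF continuous_map_from_subtopology_mono[OF h']])
              (use ab WE W'W hU in auto)
          from continuous_map_compose[OF this ss(5)]
          have "continuous_map (subtopology ?P ({a..b} \<times> W')) E (\<lambda>z. s (h z))" by (simp add: o_def)
          then show "continuous_map (subtopology (subtopology ?P ({0..b} \<times> W')) {x \<in> topspace (subtopology ?P ({0..b} \<times> W')). a \<le> fst x}) E (\<lambda>z. s (h z))"
            unfolding subtopology_subtopology
            by (rule continuous_map_from_subtopology_mono) auto
          fix z assume z: "z \<in> topspace (subtopology ?P ({0..b} \<times> W'))" "fst z = a"
          then have "snd z \<in> W" "k (a, snd z) \<in> V" using W'W by (auto simp: W'_def)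
          then have "s (p (k (a, snd z))) = k (a, snd z)" using ss(2) by blast
          moreover have "p (k (a, snd z)) = h (a, snd z)" using W(5) \<open>snd z \<in> W\<close> ab by auto
          ultimately show "k z = s (h z)" using z(2) by (metis prod.collapse)
        qed simp
        moreover have "\<forall>y\<in>W'. k' (0, y) = f y" using W(4) W'W ab by (auto simp: k'_def)
        moreover have "\<forall>y\<in>W'. \<forall>t\<in>{0..b}. p (k' (t, y)) = h (t, y)"
          using W(5) W'W hU ss(4) by (auto simp: k'_def)
        moreover have "y0 \<in> W'" using W(2) V(2) JW(4) by (auto simp: W'_def)
        ultimately show "Q y0 b" unfolding Q_def using W'o by blast
      qed
    qed auto
    then show ?thesis using Q0 by auto
  qed
  then obtain W k where Wk: "\<And>y0. y0 \<in> topspace Y \<Longrightarrow> openin Y (W y0) \<and> y0 \<in> W y0 \<and> continuous_map (subtopology ?P ({0..1} \<times> W y0)) E (k y0) \<and>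
     (\<forall>y\<in>W y0. k y0 (0, y) = f y) \<and> (\<forall>y\<in>W y0. \<forall>t\<in>{0..1}. p (k y0 (t, y)) = h (t, y))"
    unfolding Q_def by metis
  have agree: "k y1 (t, y) = k y2 (t, y)"
    if y: "y1 \<in> topspace Y" "y2 \<in> topspace Y" "y \<in> W y1" "y \<in> W y2" "t \<in> {0..1}" for y1 y2 y t
  proof (rule covering_lift_unique[OF cov connected_space_unit_top])
    have yY: "y \<in> topspace Y" using y Wk openin_subset by blast
    have c: "continuous_map unit_top E (\<lambda>t. k y' (t, y))" if "y' \<in> topspace Y" "y \<in> W y'" for y'
    proof -
      have "continuous_map unit_top (subtopology ?P ({0..1} \<times> W y')) (\<lambda>t. (t, y))"
        using that yY by (intro continuous_map_into_subtopology continuous_map_pairedI) (auto)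
      from continuous_map_compose[OF this, of E "k y'"] show ?thesis using Wk[OF that(1)] by (simp add: o_def)
    qed
    show "continuous_map unit_top E (\<lambda>t. k y1 (t, y))" "continuous_map unit_top E (\<lambda>t. k y2 (t, y))"
      using c y by auto
    show "p (k y1 (t, y)) = p (k y2 (t, y))" if "t \<in> topspace unit_top" for t
      using Wk y that by simp
    show "(0::real) \<in> topspace unit_top" "k y1 (0, y) = k y2 (0, y)" "t \<in> topspace unit_top" using y Wk by auto
  qed
  obtain K where K: "continuous_map (prod_topology unit_top Y) E K"
    "\<And>x i. \<lbrakk>i \<in> topspace Y; x \<in> topspace (prod_topology unit_top Y) \<inter> ({0..1} \<times> W i)\<rbrakk> \<Longrightarrow> K x = k i x"
  proof (rule pasting_lemma_exists[of "prod_topology unit_top Y" "\<lambda>y. {0..1} \<times> W y" "topspace Y" E k])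
    show "topspace (prod_topology unit_top Y) \<subseteq> (\<Union>i\<in>topspace Y. {0..1} \<times> W i)" using Wk by auto
    show "openin (prod_topology unit_top Y) ({0..1} \<times> W i)" if "i \<in> topspace Y" for i
      using Wk[OF that] by (simp add: openin_prod_Times_iff)
    show "continuous_map (subtopology (prod_topology unit_top Y) ({0..1} \<times> W i)) E (k i)" if "i \<in> topspace Y" for i
      unfolding eqP' subtopology_subtopology
      by (rule continuous_map_from_subtopology_mono[of _ "{0..1} \<times> W i"]) (use Wk[OF that] in auto)
    show "k i x = k j x" if "i \<in> topspace Y" "j \<in> topspace Y" "x \<in> topspace (prod_topology unit_top Y) \<inter> ({0..1} \<times> W i) \<inter> ({0..1} \<times> W j)" for i j x
      using that agree[of i j "snd x" "fst x"] by auto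
  qed blast
  have K': "K (t, y) = k y (t, y)" if "y \<in> topspace Y" "t \<in> {0..1}" for y t
    using K(2)[OF that(1), of "(t,y)"] Wk[OF that(1)] that by auto
  show thesis
    by (rule that[OF K(1)]) (use K' Wk in auto)
qed

text \<open>Homotopy lifting with a one-point space in place of \<open>Y\<close>.\<close>

lemma covering_path_lift:
  assumes cov: "covering_map E M p" and g: "pathin M g" and e: "e \<in> topspace E" "p e = g 0"
  obtains l where "pathin E l" "l 0 = e" "\<And>t. t \<in> {0..1} \<Longrightarrow> p (l t) = g t"
proof -
  let ?Y = "discrete_topology {()}"
  have 1: "continuous_map (prod_topology unit_top ?Y) M (g \<circ> fst)"
    using g unfolding pathin_def by (rule continuous_map_compose[OF continuous_map_fst])
  have 2: "continuous_map ?Y E (\<lambda>_. e)" using e by simp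
  have 3: "p e = (g \<circ> fst) (0, y)" if "y \<in> topspace ?Y" for y using e by simp
  obtain k where k: "continuous_map (prod_topology unit_top ?Y) E k"
    "\<And>y. y \<in> topspace ?Y \<Longrightarrow> k (0, y) = e"
    "\<And>t y. y \<in> topspace ?Y \<Longrightarrow> t \<in> {0..1} \<Longrightarrow> p (k (t, y)) = (g \<circ> fst) (t, y)"
    using covering_homotopy_lift[OF cov 1 2 3] by blast
  have "continuous_map unit_top (prod_topology unit_top ?Y) (\<lambda>t. (t, ()))"
    by (intro continuous_map_pairedI) auto
  from continuous_map_compose[OF this k(1)] have "pathin E (\<lambda>t. k (t, ()))" by (simp add: pathin_def o_def)
  then show thesis by (rule that) (use k in auto)
qed

lemma covering_path_unique:
  assumes "covering_map E M p" "pathin E l" "pathin E l'" "\<And>t. t \<in> {0..1} \<Longrightarrow> p (l t) = p (l' t)"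
    "l 0 = l' 0" "t \<in> {0..1}"
  shows "l t = l' t"
  by (rule covering_lift_unique[OF assms(1) connected_space_unit_top, of l l' 0 t])
    (use assms in \<open>auto simp: pathin_def\<close>)

lemma pathin_slices:
  assumes "continuous_map (prod_topology unit_top unit_top) Z k" "u \<in> {0..1}"
  shows "pathin Z (\<lambda>t. k (t, u))" "pathin Z (\<lambda>t. k (u, t))"
proof -
  have "continuous_map unit_top (prod_topology unit_top unit_top) (\<lambda>t. (t, u))"
    "continuous_map unit_top (prod_topology unit_top unit_top) (\<lambda>t. (u, t))"
    using assms(2) by (intro continuous_map_pairedI; simp add: continuous_map_in_subtopology)+
  from this[THEN continuous_map_compose, OF assms(1)]
  show "pathin Z (\<lambda>t. k (t, u))" "pathin Z (\<lambda>t. k (u, t))" by (auto simp: pathin_def o_def)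
qed

section \<open>Paths and homotopies of loops\<close>

lemma continuous_map_unit_compose:
  assumes "pathin X f" "continuous_map Y euclideanreal h" "\<And>y. y \<in> topspace Y \<Longrightarrow> h y \<in> {0..1}"
  shows "continuous_map Y X (\<lambda>y. f (h y))"
proof -
  have "continuous_map Y unit_top h" using assms by (auto intro: continuous_map_into_subtopology)
  from continuous_map_compose[OF this assms(1)[unfolded pathin_def]] show ?thesis by (simp add: o_def)
qed

lemma pathin_compose_real:
  assumes "pathin X f" "continuous_on {0..1} h" "\<And>y. y \<in> {0..1} \<Longrightarrow> h y \<in> {0..1}"
  shows "pathin X (\<lambda>y. f (h y))"
  unfolding pathin_def by (rule continuous_map_unit_compose) (use assms in auto)

lemma pathin_cong: "pathin X f \<Longrightarrow> (\<And>t. t \<in> {0..1} \<Longrightarrow> f t = g t) \<Longrightarrow> pathin X g"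
  unfolding pathin_def by (erule continuous_map_eq) auto

lemma pathin_path_join:
  assumes "pathin X f" "pathin X g" "f 1 = g 0"
  shows "pathin X (path_join f g)"
  unfolding pathin_def path_join_def
proof (rule continuous_map_cases_le)
  show "continuous_map (subtopology unit_top {x \<in> topspace unit_top. x \<le> 1 / 2}) X (\<lambda>t. f (2 * t))"
    by (rule continuous_map_unit_compose[OF assms(1)])
      (auto intro!: continuous_intros continuous_map_from_subtopology simp: continuous_on_id)
  show "continuous_map (subtopology unit_top {x \<in> topspace unit_top. 1 / 2 \<le> x}) X (\<lambda>t. g (2 * t - 1))"
    by (rule continuous_map_unit_compose[OF assms(2)])
      (auto intro!: continuous_intros continuous_map_from_subtopology simp: continuous_on_id)
qed (use assms in \<open>auto simp: field_simps\<close>)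

lemma pathin_reverse: "pathin X f \<Longrightarrow> pathin X (\<lambda>t. f (1 - t))"
  by (rule pathin_compose_real) (auto intro!: continuous_intros)

lemma loop_homotopic_iff:
  "loop_homotopic X x f g \<longleftrightarrow>
     (\<exists>h. continuous_map (prod_topology unit_top unit_top) X h \<and>
        (\<forall>u\<in>{0..1}. h (0, u) = f u) \<and> (\<forall>u\<in>{0..1}. h (1, u) = g u) \<and>
        (\<forall>t\<in>{0..1}. h (t, 0) = x \<and> h (t, 1) = x))"
  unfolding loop_homotopic_def by (subst homotopic_with) auto

lemma loop_homotopic_refl: "f \<in> loops_at X x \<Longrightarrow> loop_homotopic X x f f"
  by (auto simp: loop_homotopic_def loops_at_def pathin_def)

lemma loop_homotopic_sym: "loop_homotopic X x f g \<Longrightarrow> loop_homotopic X x g f"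
  unfolding loop_homotopic_def by (rule homotopic_with_symD)

lemma loop_homotopic_trans:
  "loop_homotopic X x f g \<Longrightarrow> loop_homotopic X x g h \<Longrightarrow> loop_homotopic X x f h"
  unfolding loop_homotopic_def by (rule homotopic_with_trans)

lemma loop_homotopic_loops:
  assumes "loop_homotopic X x f g"
  shows "f \<in> loops_at X x" "g \<in> loops_at X x"
proof -
  obtain h where h: "continuous_map (prod_topology unit_top unit_top) X h"
    "\<forall>u\<in>{0..1}. h (0, u) = f u" "\<forall>u\<in>{0..1}. h (1, u) = g u" "\<forall>t\<in>{0..1}. h (t, 0) = x \<and> h (t, 1) = x"
    using assms unfolding loop_homotopic_iff by blast
  have "pathin X f" by (rule pathin_cong[OF pathin_slices(2)[OF h(1), of 0]]) (use h(2) in auto)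
  moreover have "pathin X g" by (rule pathin_cong[OF pathin_slices(2)[OF h(1), of 1]]) (use h(3) in auto)
  moreover have "f 0 = x" "f 1 = x" "g 0 = x" "g 1 = x" using h(2-4) by (metis atLeastAtMost_iff order_refl zero_le_one)+
  ultimately show "f \<in> loops_at X x" "g \<in> loops_at X x" by (auto simp: loops_at_def)
qed

lemma pathin_const': "x \<in> topspace X \<Longrightarrow> pathin X (\<lambda>_. x)"
  by (simp add: pathin_def)

lemma covering_lift_const:
  assumes cov: "covering_map E M p" and l: "pathin E l" and "\<And>t. t \<in> {0..1} \<Longrightarrow> p (l t) = x" "t \<in> {0..1}"
  shows "l t = l 0"
proof (rule covering_path_unique[OF cov l, of "\<lambda>_. l 0"])
  have "l 0 \<in> topspace E" using l by (auto simp: pathin_def continuous_map_def)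
  then show "pathin E (\<lambda>_. l 0)" by (rule pathin_const')
qed (use assms in auto)

text \<open>Lift the homotopy starting from \<open>l\<close>. Its two sides lie over the single
  point \<open>x\<close>, hence are constant; its far edge is then a lift of \<open>f'\<close> with
  the same start as \<open>l'\<close>.\<close>

lemma covering_homotopic_loops_endpoint:
  assumes cov: "covering_map E M p" and hom: "loop_homotopic M x f f'"
    and l: "pathin E l" "pathin E l'" "l 0 = l' 0"
    and pl: "\<And>t. t \<in> {0..1} \<Longrightarrow> p (l t) = f t" "\<And>t. t \<in> {0..1} \<Longrightarrow> p (l' t) = f' t"
  shows "l 1 = l' 1"
proof -
  obtain h where h: "continuous_map (prod_topology unit_top unit_top) M h"
    "\<forall>u\<in>{0..1}. h (0, u) = f u" "\<forall>u\<in>{0..1}. h (1, u) = f' u" "\<forall>t\<in>{0..1}. h (t, 0) = x \<and> h (t, 1) = x"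
    using hom unfolding loop_homotopic_iff by blast
  have 2: "continuous_map unit_top E l" using l by (simp add: pathin_def)
  have 3: "p (l y) = h (0, y)" if "y \<in> topspace unit_top" for y using that pl h by auto
  obtain k where k: "continuous_map (prod_topology unit_top unit_top) E k"
    "\<And>y. y \<in> topspace unit_top \<Longrightarrow> k (0, y) = l y"
    "\<And>t y. y \<in> topspace unit_top \<Longrightarrow> t \<in> {0..1} \<Longrightarrow> p (k (t, y)) = h (t, y)"
    using covering_homotopy_lift[OF cov h(1) 2 3] by blast
  have a: "k (1, 0) = k (0, 0)"
    by (rule covering_lift_const[OF cov pathin_slices(1)[OF k(1)], where x = x]) (use k h in auto)
  have b: "k (1, 1) = k (0, 1)"
    by (rule covering_lift_const[OF cov pathin_slices(1)[OF k(1)], where x = x]) (use k h in auto)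
  have "k (1, 1) = l' 1"
    by (rule covering_path_unique[OF cov pathin_slices(2)[OF k(1)] l(2)]) (use a k h pl l in auto)
  then show ?thesis using b k by simp
qed

text \<open>The classical lifting criterion. The value at \<open>t\<close> is the end point of the
  lift of a path from \<open>t0\<close> to \<open>t\<close>; \<open>null\<close> makes it
  independent of the path, and local path connectedness makes it continuous.\<close>

lemma covering_map_lift:
  assumes cov: "covering_map E M p" and T: "path_connected_space T" "locally_path_connected_space T"
    and t0: "t0 \<in> topspace T" and null: "\<And>f. f \<in> loops_at T t0 \<Longrightarrow> loop_homotopic T t0 f (\<lambda>_. t0)"
    and g: "continuous_map T M g" and e: "e \<in> topspace E" "p e = g t0"
  obtains l where "continuous_map T E l" "l t0 = e" "\<And>t. t \<in> topspace T \<Longrightarrow> p (l t) = g t"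
proof -
  define ep where "ep = (\<lambda>t y. \<exists>\<gamma> l. pathin T \<gamma> \<and> \<gamma> 0 = t0 \<and> \<gamma> 1 = t \<and> pathin E l \<and> l 0 = e \<and>
      (\<forall>s\<in>{0..1}. p (l s) = g (\<gamma> s)) \<and> l 1 = y)"
  have gp: "pathin M (\<lambda>s. g (\<gamma> s))" if "pathin T \<gamma>" for \<gamma>
    using continuous_map_compose[OF that[unfolded pathin_def] g] by (simp add: pathin_def o_def)
  have ex: "\<exists>y. ep t y" if t: "t \<in> topspace T" for t
  proof -
    obtain \<gamma> where \<gamma>: "pathin T \<gamma>" "\<gamma> 0 = t0" "\<gamma> 1 = t"
      using T(1) t0 t unfolding path_connected_space_def by metis
    obtain l where "pathin E l" "l 0 = e" "\<And>t. t \<in> {0..1} \<Longrightarrow> p (l t) = g (\<gamma> t)"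
      by (rule covering_path_lift[OF cov gp[OF \<gamma>(1)] e(1)]) (use e \<gamma> in auto)
    then show ?thesis unfolding ep_def using \<gamma> by blast
  qed
  have un: "y = y'" if y: "ep t y" "ep t y'" for t y y'
  proof -
    obtain \<gamma> l where 1: "pathin T \<gamma>" "\<gamma> 0 = t0" "\<gamma> 1 = t" "pathin E l" "l 0 = e"
      "\<And>s. s\<in>{0..1} \<Longrightarrow> p (l s) = g (\<gamma> s)" "l 1 = y" using y(1) unfolding ep_def by blast
    obtain \<gamma>' l' where 2: "pathin T \<gamma>'" "\<gamma>' 0 = t0" "\<gamma>' 1 = t" "pathin E l'" "l' 0 = e"
      "\<And>s. s\<in>{0..1} \<Longrightarrow> p (l' s) = g (\<gamma>' s)" "l' 1 = y'" using y(2) unfolding ep_def by blast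
    \<comment> \<open>Out along \<open>\<gamma>\<close> and back along \<open>\<gamma>'\<close>:
      this loop is null-homotopic, so its lift closes up, and the midpoint of the lift is the end
      point of both \<open>l\<close> and \<open>l'\<close>.\<close>
    define \<delta> where "\<delta> = path_join \<gamma> (\<lambda>t. \<gamma>' (1 - t))"
    have \<delta>: "pathin T \<delta>" unfolding \<delta>_def by (rule pathin_path_join) (use 1 2 pathin_reverse in auto)
    have "\<delta> \<in> loops_at T t0" using \<delta> 1 2 by (simp add: loops_at_def \<delta>_def path_join_def)
    then have "loop_homotopic T t0 \<delta> (\<lambda>_. t0)" by (rule null)
    then have hom: "loop_homotopic M (g t0) (g \<circ> \<delta>) (g \<circ> (\<lambda>_. t0))"
      unfolding loop_homotopic_def by (rule homotopic_with_compose_continuous_map_left[OF _ g]) auto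
    obtain L where L: "pathin E L" "L 0 = e" "\<And>t. t \<in> {0..1} \<Longrightarrow> p (L t) = g (\<delta> t)"
      by (rule covering_path_lift[OF cov gp[OF \<delta>] e(1)]) (use e 1 in \<open>auto simp: \<delta>_def path_join_def\<close>)
    have "L 1 = e"
      by (rule covering_homotopic_loops_endpoint[OF cov hom L(1), of "\<lambda>_. e"]) (use L e in \<open>auto intro: pathin_const'\<close>)
    have a: "L (1 / 2) = l 1"
    proof -
      have "pathin E (\<lambda>u. L (u / 2))" by (rule pathin_compose_real[OF L(1)]) (auto intro!: continuous_intros)
      from covering_path_unique[OF cov this 1(4), of 1] show ?thesis
        using L 1 by (auto simp: \<delta>_def path_join_def)
    qed
    have b: "L (1 / 2) = l' 1"
    proof -
      have P: "pathin E (\<lambda>u. L (1 - u / 2))" by (rule pathin_compose_real[OF L(1)]) (auto intro!: continuous_intros)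
      have eq: "p (L (1 - u / 2)) = p (l' u)" if u: "u \<in> {0..1}" for u
      proof -
        have "\<delta> (1 - u / 2) = \<gamma>' u"
          using u 1(3) 2(3) by (auto simp: \<delta>_def path_join_def)
        then show ?thesis using L(3)[of "1 - u/2"] 2(6)[OF u] u by auto
      qed
      have "(\<lambda>u. L (1 - u / 2)) 0 = l' 0" using 2(5) \<open>L 1 = e\<close> by simp
      from covering_path_unique[OF cov P 2(4) eq this, of 1] show ?thesis by simp
    qed
    show ?thesis using a b 1 2 by simp
  qed
  define lf where "lf = (\<lambda>t. THE y. ep t y)"
  have lf: "ep t (lf t)" if "t \<in> topspace T" for t
    unfolding lf_def using ex[OF that] un by (metis theI)
  have lfI: "ep t y \<Longrightarrow> lf t = y" for t y using un unfolding lf_def by blast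
  have lfE: "lf t \<in> topspace E" "p (lf t) = g t" if t: "t \<in> topspace T" for t
  proof -
    obtain \<gamma> l where 1: "\<gamma> 1 = t" "pathin E l" "\<And>s. s\<in>{0..1} \<Longrightarrow> p (l s) = g (\<gamma> s)" "l 1 = lf t"
      using lf[OF t] unfolding ep_def by blast
    have "l 1 \<in> topspace E" using 1(2) by (auto simp: pathin_def continuous_map_def)
    then show "lf t \<in> topspace E" "p (lf t) = g t" using 1(1,4) 1(3)[of 1] by simp_all
  qed
  have loc: "\<exists>W. openin T W \<and> t \<in> W \<and> continuous_map (subtopology T W) E lf" if t: "t \<in> topspace T" for t
  proof -
    have gt: "g t \<in> topspace M" using g t by (auto simp: continuous_map_def)
    obtain U where U: "g t \<in> U" "openin M U" and
        sh: "\<And>e. e \<in> topspace E \<Longrightarrow> p e \<in> U \<Longrightarrow>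
         \<exists>V s. openin E V \<and> e \<in> V \<and> openin E ({z \<in> topspace E. p z \<in> U} - V) \<and>
               homeomorphic_maps (subtopology E V) (subtopology M U) p s"
      using covering_map_sheet[OF cov gt] by blast
    obtain V s where V: "openin E V" "lf t \<in> V"
          and s: "homeomorphic_maps (subtopology E V) (subtopology M U) p s"
      using sh[of "lf t"] lfE[OF t] U by auto
    note ss = sheet_simps[OF s V(1) U(2)]
    have "openin T {z \<in> topspace T. g z \<in> U}" using openin_continuous_map_preimage g U(2) by blast
    then obtain W where W: "openin T W" "path_connectedin T W" "t \<in> W" "W \<subseteq> {z \<in> topspace T. g z \<in> U}"
      using T(2) t U(1) unfolding locally_path_connected_space by (metis (mono_tags, lifting) mem_Collect_eq)
    have cs: "continuous_map (subtopology T W) E (\<lambda>z. s (g z))"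
    proof -
      have "continuous_map (subtopology T W) (subtopology M U) g"
        using W(4) g by (intro continuous_map_into_subtopology continuous_map_from_subtopology) auto
      from continuous_map_compose[OF this ss(5)] show ?thesis by (simp add: o_def)
    qed
    \<comment> \<open>A path to \<open>t\<close> is prolonged inside the path connected
      \<open>W\<close>; the lift of the new piece is its image under the section \<open>s\<close>,
      so near \<open>t\<close> the lift is given by \<open>s\<close> after \<open>g\<close>.\<close>
    have "s (g z) = lf z" if z: "z \<in> W" for z
    proof -
      obtain \<beta> where \<beta>: "pathin (subtopology T W) \<beta>" "\<beta> 0 = t" "\<beta> 1 = z"
        using W(2,3) z unfolding path_connectedin_def path_connected_space_def
        by (metis inf.absorb_iff2 topspace_subtopology)
      have \<beta>T: "pathin T \<beta>" and \<beta>W: "\<And>u. u \<in> {0..1} \<Longrightarrow> \<beta> u \<in> W"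
        using \<beta>(1) by (auto simp: pathin_def continuous_map_in_subtopology Pi_iff)
      obtain \<gamma> l where 1: "pathin T \<gamma>" "\<gamma> 0 = t0" "\<gamma> 1 = t" "pathin E l" "l 0 = e"
        "\<And>s. s\<in>{0..1} \<Longrightarrow> p (l s) = g (\<gamma> s)" "l 1 = lf t" using lf[OF t] unfolding ep_def by blast
      have sb: "pathin E (\<lambda>u. s (g (\<beta> u)))"
        using continuous_map_compose[OF \<beta>(1)[unfolded pathin_def] cs] by (simp add: pathin_def o_def)
      have j: "s (g t) = lf t" using ss(2)[OF V(2)] lfE[OF t] by simp
      have "ep z (s (g z))"
        unfolding ep_def
      proof (intro exI conjI ballI)
        show "pathin T (path_join \<gamma> \<beta>)" by (rule pathin_path_join) (use 1 \<beta> \<beta>T in auto)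
        show "pathin E (path_join l (\<lambda>u. s (g (\<beta> u))))" by (rule pathin_path_join) (use 1 \<beta> j sb in auto)
        show "p (path_join l (\<lambda>u. s (g (\<beta> u))) v) = g (path_join \<gamma> \<beta> v)" if v: "v \<in> {0..1}" for v
        proof (cases "v \<le> 1/2")
          case True
          then show ?thesis using 1(6)[of "2 * v"] v by (simp add: path_join_def)
        next
          case False
          then have "\<beta> (2 * v-1) \<in> W" using v \<beta>W by auto
          then have "g (\<beta> (2 * v-1)) \<in> U" using W(4) by auto
          then show ?thesis using False ss(4) by (simp add: path_join_def)
        qed
      qed (use 1 \<beta> in \<open>auto simp: path_join_def\<close>)
      then show ?thesis using lfI by simp
    qed
    then have "continuous_map (subtopology T W) E lf" by (intro continuous_map_eq[OF cs]) auto
    then show ?thesis using W by blast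
  qed
  then obtain W where W: "\<And>t. t \<in> topspace T \<Longrightarrow> openin T (W t) \<and> t \<in> W t \<and> continuous_map (subtopology T (W t)) E lf"
    by metis
  have "continuous_map T E lf"
    by (rule pasting_lemma[of "topspace T" T W E "\<lambda>_. lf"]) (use W in auto)
  moreover have "lf t0 = e"
  proof (rule lfI)
    show "ep t0 e" unfolding ep_def
      by (rule exI[of _ "\<lambda>_. t0"], rule exI[of _ "\<lambda>_. e"]) (use t0 e in \<open>auto intro: pathin_const'\<close>)
  qed
  ultimately show thesis using that lfE by blast
qed

text \<open>Sheets are homeomorphic to open subsets of \<open>M\<close>, and the section
  \<open>s\<close> moves small path connected sets of \<open>M\<close> up into them.\<close>

lemma covering_map_locally_path_connected:
  assumes cov: "covering_map E M p" and M: "locally_path_connected_space M"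
  shows "locally_path_connected_space E"
  unfolding locally_path_connected_space
proof (intro allI impI, elim conjE)
  fix V x assume V: "openin E V" "x \<in> V"
  have xE: "x \<in> topspace E" using V openin_subset by blast
  then have "p x \<in> topspace M" using cov by (auto simp: covering_map_def)
  then obtain U where U: "p x \<in> U" "openin M U" and
        sh: "\<And>e. e \<in> topspace E \<Longrightarrow> p e \<in> U \<Longrightarrow>
         \<exists>V s. openin E V \<and> e \<in> V \<and> openin E ({z \<in> topspace E. p z \<in> U} - V) \<and>
               homeomorphic_maps (subtopology E V) (subtopology M U) p s"
    using covering_map_sheet[OF cov] by blast
  obtain V0 s where V0: "openin E V0" "x \<in> V0"
          and s: "homeomorphic_maps (subtopology E V0) (subtopology M U) p s"
    using sh[of x] xE U by auto
  note ss = sheet_simps[OF s V0(1) U(2)]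
  have "openin (subtopology M U) {u \<in> topspace (subtopology M U). s u \<in> V \<inter> V0}"
    using openin_continuous_map_preimage[OF ss(5)] V V0 by blast
  moreover have "{u \<in> topspace (subtopology M U). s u \<in> V \<inter> V0} = {u \<in> U. s u \<in> V}" using ss(3,7) by auto
  ultimately have "openin M {u \<in> U. s u \<in> V}" using U(2) openin_trans_full by metis
  moreover have "p x \<in> {u \<in> U. s u \<in> V}" using U(1) ss(2)[OF V0(2)] V by auto
  ultimately obtain W where W: "openin M W" "path_connectedin M W" "p x \<in> W" "W \<subseteq> {u \<in> U. s u \<in> V}"
    using M unfolding locally_path_connected_space by meson
  have sW: "s ` W = V0 \<inter> {v \<in> topspace E. p v \<in> W}"
  proof
    show "s ` W \<subseteq> V0 \<inter> {v \<in> topspace E. p v \<in> W}" using W(4) ss(3,4,6) by auto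
    show "V0 \<inter> {v \<in> topspace E. p v \<in> W} \<subseteq> s ` W" using ss(2) by (metis (no_types, lifting) IntE image_eqI mem_Collect_eq subsetI)
  qed
  have "openin E (s ` W)" unfolding sW
    using V0(1) openin_continuous_map_preimage[OF covering_map_continuous[OF cov] W(1)] by blast
  moreover have "path_connectedin E (s ` W)"
  proof (rule path_connectedin_continuous_map_image[OF ss(5)])
    show "path_connectedin (subtopology M U) W" using W(2,4) by (auto simp: path_connectedin_subtopology)
  qed
  moreover have "x \<in> s ` W" unfolding sW using xE V0 W by auto
  moreover have "s ` W \<subseteq> V" using W(4) by auto
  ultimately show "\<exists>U. openin E U \<and> path_connectedin E U \<and> x \<in> U \<and> U \<subseteq> V" by blast
qed

text \<open>Join a point of the image to \<open>b\<close>, project this path to \<open>M\<close> and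
  lift it to \<open>A\<close>. By uniqueness of lifts \<open>L\<close> carries the lift to the
  original path, hence its end point to \<open>b\<close>.\<close>

lemma covering_morphism_surj:
  assumes A: "covering_map A M r" and B: "covering_map B M r'" and L: "continuous_map A B L"
    and eq: "\<And>a. a \<in> topspace A \<Longrightarrow> r' (L a) = r a" and pc: "path_connected_space B" and a0: "a0 \<in> topspace A"
    and b: "b \<in> topspace B"
  obtains a where "a \<in> topspace A" "L a = b"
proof -
  have "L a0 \<in> topspace B" using L a0 by (auto simp: continuous_map_def)
  then obtain \<gamma> where \<gamma>: "pathin B \<gamma>" "\<gamma> 0 = L a0" "\<gamma> 1 = b"
    using pc b unfolding path_connected_space_def by metis
  have "pathin M (\<lambda>t. r' (\<gamma> t))"
    using continuous_map_compose[OF \<gamma>(1)[unfolded pathin_def] covering_map_continuous[OF B]]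
    by (simp add: pathin_def o_def)
  then obtain l where l: "pathin A l" "l 0 = a0" "\<And>t. t \<in> {0..1} \<Longrightarrow> r (l t) = r' (\<gamma> t)"
    by (rule covering_path_lift[OF A _ a0]) (use \<gamma> eq a0 in auto)
  have lA: "l t \<in> topspace A" if "t \<in> {0..1}" for t using l(1) that by (auto simp: pathin_def continuous_map_def)
  have "pathin B (\<lambda>t. L (l t))"
    using continuous_map_compose[OF l(1)[unfolded pathin_def] L] by (simp add: pathin_def o_def)
  from covering_path_unique[OF B this \<gamma>(1), of 1] have "L (l 1) = b"
    using l \<gamma> eq lA by auto
  then show thesis using that lA[of 1] by auto
qed

section \<open>The universal covering\<close>

lemma loop_class_eq:
  assumes "loop_homotopic X x f g"
  shows "Collect (loop_homotopic X x f) = Collect (loop_homotopic X x g)"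
proof (rule Collect_cong)
  fix h
  show "loop_homotopic X x f h \<longleftrightarrow> loop_homotopic X x g h"
    using assms loop_homotopic_trans[of X x g f h] loop_homotopic_trans[of X x f g h] loop_homotopic_sym[of X x f g]
    by iprover
qed

lemma simply_connected_space_null:
  assumes "simply_connected_space X" "f \<in> loops_at X x"
  shows "loop_homotopic X x f (\<lambda>_. x)"
proof -
  have x: "x \<in> topspace X" using assms(2) by (auto simp: loops_at_def pathin_def continuous_map_def)
  have tg: "trivial_group (fundamental_group X x)" using assms(1) x by (simp add: simply_connected_space_def)
  have "Collect (loop_homotopic X x f) \<in> carrier (fundamental_group X x)"
    unfolding fundamental_group_def partial_object.select_convs
    by (intro CollectI exI[of _ f] conjI refl assms(2))
  moreover have "carrier (fundamental_group X x) = {\<one>\<^bsub>fundamental_group X x\<^esub>}"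
    using tg unfolding trivial_group_def by (rule conjunct2)
  ultimately have "Collect (loop_homotopic X x f) \<in> {\<one>\<^bsub>fundamental_group X x\<^esub>}" by (rule subst[rotated])
  then have "Collect (loop_homotopic X x f) = \<one>\<^bsub>fundamental_group X x\<^esub>" by (rule singletonD)
  then have "Collect (loop_homotopic X x f) = Collect (loop_homotopic X x (\<lambda>t. x))"
    unfolding fundamental_group_def monoid.select_convs .
  moreover have "loop_homotopic X x (\<lambda>t. x) (\<lambda>t. x)"
    by (rule loop_homotopic_refl) (use x in \<open>auto simp: loops_at_def intro: pathin_const'\<close>)
  ultimately show ?thesis by blast
qed

lemma null_loops_paths_homotopic:
  assumes l: "pathin X l" "pathin X l'" "l 0 = x" "l' 0 = x" "l 1 = l' 1"
    and null: "\<And>f. f \<in> loops_at X x \<Longrightarrow> loop_homotopic X x f (\<lambda>_. x)"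
  obtains G where "continuous_map (prod_topology unit_top unit_top) X G"
    "\<And>u. u \<in> {0..1} \<Longrightarrow> G (0, u) = l u" "\<And>u. u \<in> {0..1} \<Longrightarrow> G (1, u) = l' u"
    "\<And>s. s \<in> {0..1} \<Longrightarrow> G (s, 0) = x" "\<And>s. s \<in> {0..1} \<Longrightarrow> G (s, 1) = l 1"
proof -
  define L where "L = path_join l (\<lambda>t. l' (1 - t))"
  have "pathin X L" unfolding L_def by (rule pathin_path_join) (use l pathin_reverse in auto)
  then have "L \<in> loops_at X x" using l by (simp add: loops_at_def L_def path_join_def)
  then obtain H where H: "continuous_map (prod_topology unit_top unit_top) X H"
     "\<And>u. u\<in>{0..1} \<Longrightarrow> H (0, u) = L u" "\<And>u. u\<in>{0..1} \<Longrightarrow> H (1, u) = x"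
     "\<And>t. t\<in>{0..1} \<Longrightarrow> H (t, 0) = x" "\<And>t. t\<in>{0..1} \<Longrightarrow> H (t, 1) = x"
    using null[of L] unfolding loop_homotopic_iff by blast
  \<comment> \<open>\<open>c\<close> runs from \<open>(0, 0)\<close> to \<open>(0, 1)\<close> along the three sides of the square on which \<open>H\<close> is constant;
    joining \<open>c s\<close> to \<open>(0, 1/2)\<close> by a segment sweeps out the required homotopy.\<close>
  define c1 where "c1 = (\<lambda>s::real. max 0 (min 1 (min (3 * s) (3 - 3 * s))))"
  define c2 where "c2 = (\<lambda>s::real. max 0 (min 1 (3 * s - 1)))"
  define F1 where "F1 = (\<lambda>z::real\<times>real. (1 - snd z) * c1 (fst z))"
  define F2 where "F2 = (\<lambda>z::real\<times>real. (1 - snd z) * c2 (fst z) + snd z * (1/2))"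
  have cb: "0 \<le> c1 s" "c1 s \<le> 1" "0 \<le> c2 s" "c2 s \<le> 1" for s by (auto simp: c1_def c2_def)
  have F: "F1 z \<in> {0..1}" "F2 z \<in> {0..1}" if "fst z \<in> {0..1}" "snd z \<in> {0..1}" for z
  proof -
    show "F1 z \<in> {0..1}" using that cb[of "fst z"] by (auto simp: F1_def mult_le_one)
    have "(1 - snd z) * c2 (fst z) \<le> (1 - snd z) * 1" "0 \<le> (1 - snd z) * c2 (fst z)"
      using that cb(3,4)[of "fst z"] by (intro mult_left_mono mult_nonneg_nonneg; simp)+
    then show "F2 z \<in> {0..1}" using that by (auto simp: F2_def)
  qed
  have cF: "continuous_on UNIV F1" "continuous_on UNIV F2"
    unfolding F1_def F2_def c1_def c2_def by (intro continuous_intros)+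
  have eu: "prod_topology unit_top unit_top = top_of_set ({0..1} \<times> {0..1} :: (real\<times>real) set)"
    by (metis euclidean_product_topology prod_topology_subtopology_eu)
  have cF': "continuous_map (prod_topology unit_top unit_top) unit_top F1"
    "continuous_map (prod_topology unit_top unit_top) unit_top F2"
    unfolding eu continuous_map_in_subtopology
    using F cF by (auto intro: continuous_on_subset)
  have cG: "continuous_map (prod_topology unit_top unit_top) X (\<lambda>z. H (F1 z, F2 z))"
    using continuous_map_compose[OF continuous_map_pairedI[OF cF'] H(1)] by (simp add: o_def)
  show thesis
  proof (rule that[OF cG])
    fix u :: real assume u: "u \<in> {0..1}"
    have Fu: "F1 (0,u) = 0" "F2 (0,u) = u / 2" "F1 (1,u) = 0" "F2 (1,u) = 1 - u / 2"
      using u by (auto simp: F1_def F2_def c1_def c2_def)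
    show "H (F1 (0, u), F2 (0, u)) = l u" "H (F1 (1, u), F2 (1, u)) = l' u"
      unfolding Fu using H(2)[of "u/2"] H(2)[of "1 - u/2"] u l(5) by (auto simp: L_def path_join_def)
    have Fu1: "F1 (u, 1) = 0" "F2 (u, 1) = 1/2" by (auto simp: F1_def F2_def)
    show "H (F1 (u, 1), F2 (u, 1)) = l 1" unfolding Fu1 using H(2)[of "1/2"] by (auto simp: L_def path_join_def)
    have F0: "F1 (u, 0) = c1 u" "F2 (u, 0) = c2 u" by (auto simp: F1_def F2_def)
    consider "u \<le> 1/3" | "1/3 \<le> u" "u \<le> 2/3" | "2/3 \<le> u" by linarith
    then show "H (F1 (u, 0), F2 (u, 0)) = x"
    proof cases
      case 1 then have "c2 u = 0" by (auto simp: c2_def)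
      then show ?thesis unfolding F0 using H(4) cb by simp
    next
      case 2 then have "c1 u = 1" by (auto simp: c1_def)
      then show ?thesis unfolding F0 using H(3) cb by simp
    next
      case 3 then have "c2 u = 1" by (auto simp: c2_def)
      then show ?thesis unfolding F0 using H(5) cb by simp
    qed
  qed
qed

section \<open>The action of the fundamental group by deck transformations\<close>

text \<open>Local path connectedness is the property of manifolds that the lifting criterion asks
  for; elliptic manifolds inherit it from the sphere. The point \<open>e0\<close> is what turns
  classes of loops into deck transformations.\<close>

locale pointed_universal_covering =
  fixes E :: "'e topology" and M :: "'a topology" and p :: "'e \<Rightarrow> 'a" and e0 :: 'e
  assumes uc: "universal_covering E M p" and lpcM: "locally_path_connected_space M"
    and e0: "e0 \<in> topspace E"
begin

abbreviation "\<Gamma> \<equiv> fundamental_group M (p e0)"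
abbreviation "\<rho> \<equiv> deck_action E p e0"

lemma cov: "covering_map E M p" and sc: "simply_connected_space E"
  using uc by (auto simp: universal_covering_def)

lemma pcE: "path_connected_space E"
  using sc by (simp add: simply_connected_space_def)

lemma conE: "connected_space E"
  by (simp add: path_connected_imp_connected_space pcE)

lemma lpcE: "locally_path_connected_space E"
  by (rule covering_map_locally_path_connected[OF cov lpcM])

lemma lift_ex:
  assumes "covering_map N M r" "x \<in> topspace E" "y \<in> topspace N" "r y = p x"
  obtains l where "continuous_map E N l" "l x = y" "\<And>e. e \<in> topspace E \<Longrightarrow> r (l e) = p e"
  using covering_map_lift[OF assms(1) pcE lpcE assms(2) simply_connected_space_null[OF sc]
    covering_map_continuous[OF cov] assms(3,4)] by blast

lemma lift_unique:
  assumes "covering_map N M r" "continuous_map E N l" "continuous_map E N l'"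
    "\<And>e. e \<in> topspace E \<Longrightarrow> r (l e) = p e" "\<And>e. e \<in> topspace E \<Longrightarrow> r (l' e) = p e"
    "x \<in> topspace E" "l x = l' x" "e \<in> topspace E"
  shows "l e = l' e"
  by (rule covering_lift_unique[OF assms(1) conE assms(2,3) _ assms(6,7,8)]) (use assms in auto)

lemma deckD:
  assumes "deck_transformation E p g"
  shows "continuous_map E E g" "\<And>e. e \<in> topspace E \<Longrightarrow> g e \<in> topspace E" "\<And>e. e \<in> topspace E \<Longrightarrow> p (g e) = p e"
proof -
  show c: "continuous_map E E g" using assms
    by (simp add: deck_transformation_def homeomorphic_imp_continuous_map)
  show "\<And>e. e \<in> topspace E \<Longrightarrow> g e \<in> topspace E" using c by (auto simp: continuous_map_def)
  show "\<And>e. e \<in> topspace E \<Longrightarrow> p (g e) = p e" using assms by (simp add: deck_transformation_def)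
qed

lemma deck_unique:
  assumes "deck_transformation E p g" "deck_transformation E p g'" "e \<in> topspace E" "g e = g' e"
  shows "g = g'"
proof
  fix x show "g x = g' x"
  proof (cases "x \<in> topspace E")
    case True
    show ?thesis by (rule lift_unique[OF cov deckD(1) deckD(1) deckD(3) deckD(3)]) (use assms True in auto)
  next
    case False
    then show ?thesis using assms unfolding deck_transformation_def extensional_def by auto
  qed
qed

text \<open>Lift \<open>p\<close> through itself, once with \<open>x\<close> sent to
  \<open>y\<close> and once the other way round. By uniqueness of lifts the two maps are inverse to
  each other.\<close>

lemma deck_ex:
  assumes "x \<in> topspace E" "y \<in> topspace E" "p y = p x"
  obtains g where "deck_transformation E p g" "g x = y"
proof -
  obtain g where g: "continuous_map E E g" "g x = y" "\<And>e. e \<in> topspace E \<Longrightarrow> p (g e) = p e"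
    using lift_ex[OF cov assms] by blast
  obtain h where h: "continuous_map E E h" "h y = x" "\<And>e. e \<in> topspace E \<Longrightarrow> p (h e) = p e"
    using lift_ex[OF cov assms(2,1) assms(3)[symmetric]] by blast
  have gE: "g e \<in> topspace E" "h e \<in> topspace E" if "e \<in> topspace E" for e
    using g h that by (auto simp: continuous_map_def)
  have hg: "h (g e) = e" if "e \<in> topspace E" for e
    by (rule lift_unique[OF cov, of "\<lambda>e. h (g e)" "\<lambda>e. e" x])
      (use continuous_map_compose[OF g(1) h(1)] g h gE assms that in \<open>auto simp: o_def\<close>)
  have gh: "g (h e) = e" if "e \<in> topspace E" for e
    by (rule lift_unique[OF cov, of "\<lambda>e. g (h e)" "\<lambda>e. e" y])
      (use continuous_map_compose[OF h(1) g(1)] g h gE assms that in \<open>auto simp: o_def\<close>)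
  \<comment> \<open>Extensionality is part of \<open>deck_transformation\<close>, so that deck
    transformations which agree on \<open>E\<close> are equal.\<close>
  let ?g = "restrict g (topspace E)"
  have "homeomorphic_maps E E ?g h"
    unfolding homeomorphic_maps_def
    using continuous_map_eq[OF g(1), of ?g] h(1) hg gh gE by auto
  then have "homeomorphic_map E E ?g" unfolding homeomorphic_map_maps by blast
  then have "deck_transformation E p ?g"
    unfolding deck_transformation_def using g(3) by auto
  moreover have "?g x = y" using g(2) assms by simp
  ultimately show thesis by (rule that)
qed

lemma pathin_project: "pathin E l \<Longrightarrow> pathin M (p \<circ> l)"
  unfolding pathin_def by (rule continuous_map_compose[OF _ covering_map_continuous[OF cov]])

text \<open>Paths with common end points are homotopic in the simply connected \<open>E\<close>, and
  \<open>p\<close> carries the homotopy down.\<close>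

lemma loops_homotopic_of_lifts:
  assumes l: "pathin E l" "pathin E l'" "l 0 = e0" "l' 0 = e0" "l 1 = l' 1" "p (l 1) = p e0"
    and f: "\<And>t. t \<in> {0..1} \<Longrightarrow> f t = p (l t)" "\<And>t. t \<in> {0..1} \<Longrightarrow> f' t = p (l' t)"
  shows "loop_homotopic M (p e0) f f'"
proof -
  obtain G where G: "continuous_map (prod_topology unit_top unit_top) E G"
    "\<And>u. u \<in> {0..1} \<Longrightarrow> G (0, u) = l u" "\<And>u. u \<in> {0..1} \<Longrightarrow> G (1, u) = l' u"
    "\<And>s. s \<in> {0..1} \<Longrightarrow> G (s, 0) = e0" "\<And>s. s \<in> {0..1} \<Longrightarrow> G (s, 1) = l 1"
    using null_loops_paths_homotopic[OF l(1-5) simply_connected_space_null[OF sc]] by blast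
  show ?thesis unfolding loop_homotopic_iff
    by (rule exI[of _ "p \<circ> G"])
      (use continuous_map_compose[OF G(1) covering_map_continuous[OF cov]] G l(6) f in auto)
qed

lemma loop_lift:
  assumes "f \<in> loops_at M (p e0)"
  obtains l where "pathin E l" "l 0 = e0" "\<And>t. t \<in> {0..1} \<Longrightarrow> p (l t) = f t" "p (l 1) = p e0" "l 1 \<in> topspace E"
proof -
  obtain l where l: "pathin E l" "l 0 = e0" "\<And>t. t \<in> {0..1} \<Longrightarrow> p (l t) = f t"
    using covering_path_lift[OF cov, of f e0] e0 assms by (auto simp: loops_at_def)
  moreover have "p (l 1) = p e0" using l(3)[of 1] assms by (auto simp: loops_at_def)
  moreover have "l 1 \<in> topspace E" using l(1) by (auto simp: pathin_def continuous_map_def)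
  ultimately show thesis using that by blast
qed

lemma carrier_pi1D:
  assumes "\<gamma> \<in> carrier \<Gamma>" "f \<in> \<gamma>"
  shows "\<gamma> = Collect (loop_homotopic M (p e0) f)" "f \<in> loops_at M (p e0)"
proof -
  obtain f' where f': "f' \<in> loops_at M (p e0)" "\<gamma> = Collect (loop_homotopic M (p e0) f')"
    using assms(1) by (auto simp: fundamental_group_def)
  then have h: "loop_homotopic M (p e0) f' f" using assms(2) by auto
  then show "\<gamma> = Collect (loop_homotopic M (p e0) f)"
    unfolding f'(2) by (rule loop_class_eq)
  show "f \<in> loops_at M (p e0)" using loop_homotopic_loops[OF h] by blast
qed

lemma carrier_pi1_nonempty:
  assumes "\<gamma> \<in> carrier \<Gamma>"
  obtains f where "f \<in> \<gamma>"
proof -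
  obtain f where f: "f \<in> loops_at M (p e0)" "\<gamma> = Collect (loop_homotopic M (p e0) f)"
    using assms by (auto simp: fundamental_group_def)
  then have "f \<in> \<gamma>" using loop_homotopic_refl[OF f(1)] by simp
  then show thesis by (rule that)
qed

text \<open>Resolves the definite description: all lifts at \<open>e0\<close> of loops in
  \<open>\<gamma>\<close> have the same end point, and a deck transformation is determined by its
  value at \<open>e0\<close>.\<close>

lemma deck_action_eqI:
  assumes "\<gamma> \<in> carrier \<Gamma>" "deck_transformation E p g" "pathin E l" "l 0 = e0" "l 1 = g e0" "p \<circ> l \<in> \<gamma>"
  shows "\<rho> \<gamma> = g"
  unfolding deck_action_def
proof (rule the_equality)
  show "deck_transformation E p g \<and> (\<exists>l. pathin E l \<and> l 0 = e0 \<and> l 1 = g e0 \<and> p \<circ> l \<in> \<gamma>)" using assms by blast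
  fix g' assume g': "deck_transformation E p g' \<and> (\<exists>l. pathin E l \<and> l 0 = e0 \<and> l 1 = g' e0 \<and> p \<circ> l \<in> \<gamma>)"
  then obtain l' where l': "pathin E l'" "l' 0 = e0" "l' 1 = g' e0" "p \<circ> l' \<in> \<gamma>" by blast
  have "loop_homotopic M (p e0) (p \<circ> l) (p \<circ> l')" using carrier_pi1D(1)[OF assms(1,6)] l'(4) by blast
  then have "l 1 = l' 1"
    by (rule covering_homotopic_loops_endpoint[OF cov]) (use assms l' in auto)
  then have "g' e0 = g e0" using assms(5) l'(3) by simp
  then show "g' = g" using deck_unique[OF conjunct1[OF g'] assms(2) e0] by iprover
qed

lemma deck_action_path:
  assumes \<gamma>: "\<gamma> \<in> carrier \<Gamma>" and f: "f \<in> \<gamma>" and l: "pathin E l" "l 0 = e0" "\<And>t. t \<in> {0..1} \<Longrightarrow> p (l t) = f t"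
  shows "deck_transformation E p (\<rho> \<gamma>)" "\<rho> \<gamma> e0 = l 1" "p \<circ> l \<in> \<gamma>"
proof -
  have fl: "f \<in> loops_at M (p e0)" using carrier_pi1D[OF \<gamma> f] by blast
  have l1: "p (l 1) = p e0" "l 1 \<in> topspace E"
    using l(3)[of 1] fl l(1) by (auto simp: loops_at_def pathin_def continuous_map_def)
  obtain g where g: "deck_transformation E p g" "g e0 = l 1"
    using deck_ex[OF e0 l1(2,1)] by blast
  \<comment> \<open>The loops \<open>f\<close> and \<open>p \<circ> l\<close> agree on the unit
    interval only, so they need not be equal as functions.\<close>
  have "loop_homotopic M (p e0) f (p \<circ> l)"
    by (rule loops_homotopic_of_lifts[OF l(1,1,2,2)]) (use l l1 in auto)
  then show pl: "p \<circ> l \<in> \<gamma>" using carrier_pi1D[OF \<gamma> f] by blast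
  have "\<rho> \<gamma> = g" by (rule deck_action_eqI[OF \<gamma> g(1) l(1,2)]) (use g pl in auto)
  then show "deck_transformation E p (\<rho> \<gamma>)" "\<rho> \<gamma> e0 = l 1" using g by auto
qed

lemma deck_action_deck:
  assumes "\<gamma> \<in> carrier \<Gamma>"
  shows "deck_transformation E p (\<rho> \<gamma>)"
proof -
  obtain f where f: "f \<in> \<gamma>" using carrier_pi1_nonempty[OF assms] .
  obtain l where "pathin E l" "l 0 = e0" "\<And>t. t \<in> {0..1} \<Longrightarrow> p (l t) = f t"
    using loop_lift[OF carrier_pi1D(2)[OF assms f]] by blast
  from deck_action_path(1)[OF assms f this] show ?thesis .
qed

lemmas deck_actionD = deckD[OF deck_action_deck]

lemma deck_action_inj:
  assumes "\<gamma> \<in> carrier \<Gamma>" "\<delta> \<in> carrier \<Gamma>" "\<rho> \<gamma> e0 = \<rho> \<delta> e0"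
  shows "\<gamma> = \<delta>"
proof -
  obtain f f' where f: "f \<in> \<gamma>" "f' \<in> \<delta>" using carrier_pi1_nonempty assms by metis
  obtain l where l: "pathin E l" "l 0 = e0" "\<And>t. t \<in> {0..1} \<Longrightarrow> p (l t) = f t" "p (l 1) = p e0"
    using loop_lift[OF carrier_pi1D(2)[OF assms(1) f(1)]] by blast
  obtain l' where l': "pathin E l'" "l' 0 = e0" "\<And>t. t \<in> {0..1} \<Longrightarrow> p (l' t) = f' t"
    using loop_lift[OF carrier_pi1D(2)[OF assms(2) f(2)]] by blast
  have "l 1 = l' 1"
    using deck_action_path(2)[OF assms(1) f(1) l(1-3)] deck_action_path(2)[OF assms(2) f(2) l'] assms(3) by simp
  then have "loop_homotopic M (p e0) f f'"
    by (intro loops_homotopic_of_lifts[OF l(1) l'(1)]) (use l l' in auto)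
  then have "Collect (loop_homotopic M (p e0) f) = Collect (loop_homotopic M (p e0) f')" by (rule loop_class_eq)
  then show ?thesis
    unfolding carrier_pi1D(1)[OF assms(1) f(1), symmetric] carrier_pi1D(1)[OF assms(2) f(2), symmetric] .
qed

lemma deck_action_surj:
  assumes "y \<in> topspace E" "p y = p e0"
  obtains \<gamma> where "\<gamma> \<in> carrier \<Gamma>" "\<rho> \<gamma> e0 = y"
proof -
  obtain l where l: "pathin E l" "l 0 = e0" "l 1 = y"
    using pcE e0 assms unfolding path_connected_space_def by metis
  have pl: "p \<circ> l \<in> loops_at M (p e0)" using pathin_project[OF l(1)] l assms by (auto simp: loops_at_def)
  let ?\<gamma> = "Collect (loop_homotopic M (p e0) (p \<circ> l))"
  have "?\<gamma> \<in> carrier \<Gamma>" using pl by (auto simp: fundamental_group_def)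
  moreover have "p \<circ> l \<in> ?\<gamma>" using loop_homotopic_refl[OF pl] by simp
  ultimately show thesis
    using that deck_action_path(2)[OF \<open>?\<gamma> \<in> carrier \<Gamma>\<close> _ l(1,2)] l(3) by auto
qed

text \<open>Translates the order of the fundamental group into the number of sheets of the universal
  covering.\<close>

lemma deck_action_bij: "bij_betw (\<lambda>\<gamma>. \<rho> \<gamma> e0) (carrier \<Gamma>) {y \<in> topspace E. p y = p e0}"
proof (rule bij_betwI')
  show "(\<rho> \<gamma> e0 = \<rho> \<delta> e0) = (\<gamma> = \<delta>)" if "\<gamma> \<in> carrier \<Gamma>" "\<delta> \<in> carrier \<Gamma>" for \<gamma> \<delta>
    using deck_action_inj that by blast
  show "\<rho> \<gamma> e0 \<in> {y \<in> topspace E. p y = p e0}" if "\<gamma> \<in> carrier \<Gamma>" for \<gamma>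
    using deck_actionD[OF that] e0 by auto
  show "\<exists>\<gamma>\<in>carrier \<Gamma>. y = \<rho> \<gamma> e0" if "y \<in> {y \<in> topspace E. p y = p e0}" for y
    using deck_action_surj[of y] that by (metis (mono_tags, lifting) mem_Collect_eq)
qed

text \<open>The lift of a product is the lift of the first loop followed by the translate under
  \<open>\<rho> \<gamma>\<close> of the lift of the second one.\<close>

lemma deck_action_mult:
  assumes \<gamma>: "\<gamma> \<in> carrier \<Gamma>" and \<delta>: "\<delta> \<in> carrier \<Gamma>"
  shows "\<gamma> \<otimes>\<^bsub>\<Gamma>\<^esub> \<delta> \<in> carrier \<Gamma>" "\<And>e. e \<in> topspace E \<Longrightarrow> \<rho> (\<gamma> \<otimes>\<^bsub>\<Gamma>\<^esub> \<delta>) e = \<rho> \<gamma> (\<rho> \<delta> e)"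
proof -
  have join: "\<exists>L. pathin E L \<and> L 0 = e0 \<and> L 1 = \<rho> \<gamma> (\<rho> \<delta> e0) \<and> (\<forall>t\<in>{0..1}. p (L t) = path_join f g t)"
    if "f \<in> \<gamma>" "g \<in> \<delta>" for f g
  proof -
    obtain l where l: "pathin E l" "l 0 = e0" "\<And>t. t \<in> {0..1} \<Longrightarrow> p (l t) = f t"
      using loop_lift[OF carrier_pi1D(2)[OF \<gamma> \<open>f \<in> \<gamma>\<close>]] by blast
    obtain l' where l': "pathin E l'" "l' 0 = e0" "\<And>t. t \<in> {0..1} \<Longrightarrow> p (l' t) = g t"
      using loop_lift[OF carrier_pi1D(2)[OF \<delta> \<open>g \<in> \<delta>\<close>]] by blast
    have e: "l 1 = \<rho> \<gamma> e0" "l' 1 = \<rho> \<delta> e0"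
      using deck_action_path(2)[OF \<gamma> \<open>f \<in> \<gamma>\<close> l] deck_action_path(2)[OF \<delta> \<open>g \<in> \<delta>\<close> l'] by simp_all
    have "pathin E (\<rho> \<gamma> \<circ> l')" using l'(1) deck_actionD(1)[OF \<gamma>]
      unfolding pathin_def by (rule continuous_map_compose)
    then have "pathin E (path_join l (\<rho> \<gamma> \<circ> l'))"
      by (intro pathin_path_join[OF l(1)]) (use e l' in auto)
    moreover have "p (path_join l (\<rho> \<gamma> \<circ> l') t) = path_join f g t" if t: "t \<in> {0..1}" for t
    proof (cases "t \<le> 1/2")
      case True then show ?thesis using l(3)[of "2 * t"] t by (simp add: path_join_def)
    next
      case False
      then have I: "2 * t - 1 \<in> {0..1}" using t by auto
      then have "l' (2 * t - 1) \<in> topspace E" using l'(1) by (auto simp: pathin_def continuous_map_def)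
      then show ?thesis using False l'(3)[OF I] deck_actionD(3)[OF \<gamma>] by (simp add: path_join_def)
    qed
    ultimately show ?thesis
      by (intro exI[of _ "path_join l (\<rho> \<gamma> \<circ> l')"]) (use l e in \<open>auto simp: path_join_def\<close>)
  qed
  obtain f g where fg: "f \<in> \<gamma>" "g \<in> \<delta>" using carrier_pi1_nonempty \<gamma> \<delta> by metis
  obtain L where L: "pathin E L" "L 0 = e0" "L 1 = \<rho> \<gamma> (\<rho> \<delta> e0)" "\<And>t. t\<in>{0..1} \<Longrightarrow> p (L t) = path_join f g t"
    using join[OF fg] by blast
  have pL: "p (\<rho> \<gamma> (\<rho> \<delta> e0)) = p e0" using deck_actionD[OF \<gamma>] deck_actionD[OF \<delta>] e0 by simp
  \<comment> \<open>The product in \<open>fundamental_group\<close> is a union over all pairs of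
    representatives. Their joins all lift to paths from \<open>e0\<close> to one common end point,
    so the union is a single class.\<close>
  have eq: "\<gamma> \<otimes>\<^bsub>\<Gamma>\<^esub> \<delta> = Collect (loop_homotopic M (p e0) (path_join f g))"
  proof
    show "\<gamma> \<otimes>\<^bsub>\<Gamma>\<^esub> \<delta> \<subseteq> Collect (loop_homotopic M (p e0) (path_join f g))"
    proof
      fix h assume "h \<in> \<gamma> \<otimes>\<^bsub>\<Gamma>\<^esub> \<delta>"
      then obtain f' g' where fg': "f' \<in> \<gamma>" "g' \<in> \<delta>" and h: "loop_homotopic M (p e0) (path_join f' g') h"
        by (auto simp: fundamental_group_def)
      obtain L' where L': "pathin E L'" "L' 0 = e0" "L' 1 = \<rho> \<gamma> (\<rho> \<delta> e0)" "\<And>t. t\<in>{0..1} \<Longrightarrow> p (L' t) = path_join f' g' t"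
        using join[OF fg'] by blast
      have "loop_homotopic M (p e0) (path_join f g) (path_join f' g')"
        by (rule loops_homotopic_of_lifts[OF L(1) L'(1)]) (use L L' pL in auto)
      then show "h \<in> Collect (loop_homotopic M (p e0) (path_join f g))" using h loop_homotopic_trans by (metis mem_Collect_eq)
    qed
    show "Collect (loop_homotopic M (p e0) (path_join f g)) \<subseteq> \<gamma> \<otimes>\<^bsub>\<Gamma>\<^esub> \<delta>"
      using fg by (auto simp: fundamental_group_def)
  qed
  have hom: "loop_homotopic M (p e0) (path_join f g) (path_join f g)"
    by (rule loops_homotopic_of_lifts[OF L(1) L(1)]) (use L pL in auto)
  show c: "\<gamma> \<otimes>\<^bsub>\<Gamma>\<^esub> \<delta> \<in> carrier \<Gamma>"
    using loop_homotopic_loops(1)[OF hom] unfolding eq by (auto simp: fundamental_group_def)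
  have pj: "path_join f g \<in> \<gamma> \<otimes>\<^bsub>\<Gamma>\<^esub> \<delta>" using hom eq by blast
  have e1: "\<rho> (\<gamma> \<otimes>\<^bsub>\<Gamma>\<^esub> \<delta>) e0 = \<rho> \<gamma> (\<rho> \<delta> e0)"
    using deck_action_path(2)[OF c pj L(1,2,4)] L(3) by simp
  show "\<rho> (\<gamma> \<otimes>\<^bsub>\<Gamma>\<^esub> \<delta>) e = \<rho> \<gamma> (\<rho> \<delta> e)" if "e \<in> topspace E" for e
    by (rule lift_unique[OF cov deck_actionD(1)[OF c], of "\<lambda>e. \<rho> \<gamma> (\<rho> \<delta> e)" e0])
      (use continuous_map_compose[OF deck_actionD(1)[OF \<delta>] deck_actionD(1)[OF \<gamma>]]
        deck_actionD[OF c] deck_actionD[OF \<gamma>] deck_actionD[OF \<delta>] e0 e1 that in \<open>auto simp: o_def\<close>)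
qed

lemma deck_action_one:
  shows "\<one>\<^bsub>\<Gamma>\<^esub> \<in> carrier \<Gamma>" "\<And>e. e \<in> topspace E \<Longrightarrow> \<rho> \<one>\<^bsub>\<Gamma>\<^esub> e = e"
proof -
  have "p e0 \<in> topspace M" using cov e0 by (auto simp: covering_map_def)
  then have c: "(\<lambda>_. p e0) \<in> loops_at M (p e0)" by (auto simp: loops_at_def intro: pathin_const')
  then show one: "\<one>\<^bsub>\<Gamma>\<^esub> \<in> carrier \<Gamma>" by (auto simp: fundamental_group_def)
  have "(\<lambda>_. p e0) \<in> \<one>\<^bsub>\<Gamma>\<^esub>" using loop_homotopic_refl[OF c] by (simp add: fundamental_group_def)
  from deck_action_path(2)[OF one this pathin_const'[OF e0]] have e1: "\<rho> \<one>\<^bsub>\<Gamma>\<^esub> e0 = e0" by simp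
  show "\<rho> \<one>\<^bsub>\<Gamma>\<^esub> e = e" if "e \<in> topspace E" for e
    by (rule lift_unique[OF cov deck_actionD(1)[OF one] continuous_map_id[unfolded id_def] deck_actionD(3)[OF one] _ e0])
      (use that e1 in simp_all)
qed

text \<open>Left cancellation, read off from the action on \<open>E\<close> instead of from group
  axioms.\<close>

lemma deck_action_mult_inj:
  assumes "\<gamma> \<in> carrier \<Gamma>" "\<delta> \<in> carrier \<Gamma>" "\<delta>' \<in> carrier \<Gamma>" "\<gamma> \<otimes>\<^bsub>\<Gamma>\<^esub> \<delta> = \<gamma> \<otimes>\<^bsub>\<Gamma>\<^esub> \<delta>'"
  shows "\<delta> = \<delta>'"
proof -
  have "\<rho> \<gamma> (\<rho> \<delta> e0) = \<rho> \<gamma> (\<rho> \<delta>' e0)"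
    using deck_action_mult(2)[OF assms(1,2) e0] deck_action_mult(2)[OF assms(1,3) e0] assms(4) by simp
  moreover have "inj_on (\<rho> \<gamma>) (topspace E)"
    using deck_action_deck[OF assms(1)] by (simp add: deck_transformation_def homeomorphic_map_def)
  ultimately have "\<rho> \<delta> e0 = \<rho> \<delta>' e0"
    using deck_actionD(2)[OF assms(2)] deck_actionD(2)[OF assms(3)] e0 by (meson inj_onD)
  then show ?thesis using deck_action_inj assms by blast
qed

section \<open>The number of sheets and the order of the fundamental group\<close>

text \<open>The universal covering maps onto every connected covering \<open>N\<close> over
  \<open>M\<close>, so a fibre of \<open>E\<close> surjects onto a fibre of
  \<open>N\<close>.\<close>

lemma sheets_le_card_pi1:
  assumes N: "covering_map N M r" "sheeted d N M r" "connected_space N" and fin: "finite (carrier \<Gamma>)"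
  shows "d \<le> card (carrier \<Gamma>)"
proof (cases "d = 0")
  case False
  have pe: "p e0 \<in> topspace M" using cov e0 by (auto simp: covering_map_def)
  let ?F = "{y \<in> topspace N. r y = p e0}"
  have F: "finite ?F" "card ?F = d" using N(2) pe by (auto simp: sheeted_def)
  then obtain y0 where y0: "y0 \<in> ?F" using False by (metis card.empty equals0I)
  obtain L where L: "continuous_map E N L" "L e0 = y0" "\<And>e. e \<in> topspace E \<Longrightarrow> r (L e) = p e"
    using lift_ex[OF N(1) e0, of y0] y0 by auto
  have pcN: "path_connected_space N"
    using N(3) covering_map_locally_path_connected[OF N(1) lpcM] path_connected_eq_connected_space by blast
  have "?F \<subseteq> L ` {y \<in> topspace E. p y = p e0}"
  proof
    fix y assume y: "y \<in> ?F"
    obtain a where a: "a \<in> topspace E" "L a = y"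
      using covering_morphism_surj[OF cov N(1) L(1) L(3) pcN e0, of y] y by blast
    then have "a \<in> {y \<in> topspace E. p y = p e0}" using L(3)[OF a(1)] y by simp
    then show "y \<in> L ` {y \<in> topspace E. p y = p e0}" using a(2) by blast
  qed
  moreover have fin': "finite {y \<in> topspace E. p y = p e0}"
    using bij_betw_finite[OF deck_action_bij] fin by blast
  ultimately have "card ?F \<le> card {y \<in> topspace E. p y = p e0}"
    by (rule surj_card_le[rotated])
  then show ?thesis using F(2) bij_betw_same_card[OF deck_action_bij] by simp
qed simp

text \<open>The converse estimate: a map from \<open>N\<close> to \<open>E\<close> over
  \<open>M\<close> is onto, because \<open>E\<close> is path connected. It is applied to spheres of
  dimension at least 2 and proves the finiteness of the fundamental group on the way.\<close>

lemma card_pi1_le_sheets: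
  assumes N: "covering_map N M r" "sheeted d N M r"
    and L: "continuous_map N E L" "\<And>y. y \<in> topspace N \<Longrightarrow> p (L y) = r y"
  shows "finite (carrier \<Gamma>)" "card (carrier \<Gamma>) \<le> d"
proof -
  have pe: "p e0 \<in> topspace M" using cov e0 by (auto simp: covering_map_def)
  let ?F = "{y \<in> topspace N. r y = p e0}"
  have F: "finite ?F" "card ?F = d" using N(2) pe by (auto simp: sheeted_def)
  obtain y0 where y0: "y0 \<in> topspace N" using pe covering_map_surj[OF N(1)] by blast
  have "{y \<in> topspace E. p y = p e0} \<subseteq> L ` ?F"
  proof
    fix y assume y: "y \<in> {y \<in> topspace E. p y = p e0}"
    obtain a where a: "a \<in> topspace N" "L a = y"
      using covering_morphism_surj[OF N(1) cov L(1) L(2) pcE y0, of y] y by blast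
    then have "a \<in> ?F" using L(2)[OF a(1)] y by simp
    then show "y \<in> L ` ?F" using a(2) by blast
  qed
  then have "finite {y \<in> topspace E. p y = p e0}" "card {y \<in> topspace E. p y = p e0} \<le> d"
    using F finite_surj surj_card_le[OF F(1)] by auto
  then show "finite (carrier \<Gamma>)" "card (carrier \<Gamma>) \<le> d"
    using bij_betw_finite[OF deck_action_bij] bij_betw_same_card[OF deck_action_bij] by simp_all
qed

end

section \<open>Finite coverings by spheres\<close>

text \<open>Openness, local injectivity and equally large finite fibres are easy to check for
  quotients by group actions and easy to compose. Evenly covered neighbourhoods follow from them in
  \<open>finite_cover_covering\<close>.\<close>

definition finite_cover :: "nat \<Rightarrow> 'b topology \<Rightarrow> 'a topology \<Rightarrow> ('b \<Rightarrow> 'a) \<Rightarrow> bool" where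
  "finite_cover d N M q \<longleftrightarrow> d > 0 \<and> Hausdorff_space N \<and> continuous_map N M q \<and> open_map N M q \<and>
     q ` topspace N = topspace M \<and> sheeted d N M q \<and>
     (\<forall>y\<in>topspace N. \<exists>V. openin N V \<and> y \<in> V \<and> inj_on q V)"

lemma Hausdorff_finite_separation:
  assumes H: "Hausdorff_space N" and F: "finite F" "F \<subseteq> topspace N"
  obtains W where "\<And>y. y \<in> F \<Longrightarrow> openin N (W y) \<and> y \<in> W y"
    "\<And>y z. y \<in> F \<Longrightarrow> z \<in> F \<Longrightarrow> y \<noteq> z \<Longrightarrow> W y \<inter> W z = {}"
proof -
  have "\<forall>y z. \<exists>U V. y \<in> F \<longrightarrow> z \<in> F \<longrightarrow> y \<noteq> z \<longrightarrow> openin N U \<and> openin N V \<and> y \<in> U \<and> z \<in> V \<and> disjnt U V"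
    using H F(2) unfolding Hausdorff_space_def by (meson subsetD)
  then obtain U V where UV: "\<And>y z. y \<in> F \<Longrightarrow> z \<in> F \<Longrightarrow> y \<noteq> z \<Longrightarrow>
      openin N (U y z) \<and> openin N (V y z) \<and> y \<in> U y z \<and> z \<in> V y z \<and> disjnt (U y z) (V y z)"
    by metis
  define W where "W = (\<lambda>y. topspace N \<inter> \<Inter>((\<lambda>z. U y z \<inter> V z y) ` (F - {y})))"
  show thesis
  proof (rule that[of W])
    show "openin N (W y) \<and> y \<in> W y" if y: "y \<in> F" for y
    proof
      show "openin N (W y)" unfolding W_def
        by (intro openin_Int_Inter) (use F(1) UV y in auto)
      show "y \<in> W y" unfolding W_def using UV y F(2) by auto
    qed
    show "W y \<inter> W z = {}" if yz: "y \<in> F" "z \<in> F" "y \<noteq> z" for y z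
    proof -
      have "W y \<subseteq> U y z" "W z \<subseteq> V y z" unfolding W_def using yz by auto
      then show ?thesis using UV[OF yz] by (auto simp: disjnt_def)
    qed
  qed
qed

text \<open>Separate the \<open>d\<close> points of a fibre by disjoint open sets \<open>W y\<close>
  on which \<open>q\<close> is injective. Over the intersection \<open>U\<close> of their images
  every fibre meets each of the \<open>d\<close> sets, and since it has only \<open>d\<close>
  points, it lies in their union.\<close>

lemma finite_cover_covering:
  assumes fc: "finite_cover d N M q"
  shows "covering_map N M q"
  unfolding covering_map_def
proof (intro conjI ballI)
  show "continuous_map N M q" "q ` topspace N = topspace M" using fc by (auto simp: finite_cover_def)
  fix x assume x: "x \<in> topspace M"
  let ?F = "{y \<in> topspace N. q y = x}"
  have F: "finite ?F" "card ?F = d" using fc x by (auto simp: finite_cover_def sheeted_def)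
  then have "?F \<noteq> {}" using fc by (metis card.empty finite_cover_def less_irrefl)
  have om: "\<And>U. openin N U \<Longrightarrow> openin M (q ` U)" using fc by (auto simp: finite_cover_def open_map_def)
  obtain W0 where W0: "\<And>y. y \<in> ?F \<Longrightarrow> openin N (W0 y) \<and> y \<in> W0 y"
    "\<And>y z. y \<in> ?F \<Longrightarrow> z \<in> ?F \<Longrightarrow> y \<noteq> z \<Longrightarrow> W0 y \<inter> W0 z = {}"
    using Hausdorff_finite_separation[of N ?F] fc F(1) by (auto simp: finite_cover_def)
  have "\<forall>y. \<exists>V. y \<in> topspace N \<longrightarrow> openin N V \<and> y \<in> V \<and> inj_on q V" using fc by (auto simp: finite_cover_def)
  then obtain V0 where V0: "\<And>y. y \<in> topspace N \<Longrightarrow> openin N (V0 y) \<and> y \<in> V0 y \<and> inj_on q (V0 y)" by metis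
  define W where "W = (\<lambda>y. W0 y \<inter> V0 y)"
  have W: "openin N (W y)" "y \<in> W y" "inj_on q (W y)" if "y \<in> ?F" for y
    using W0(1)[OF that] V0[of y] that by (auto simp: W_def intro: inj_on_subset)
  have Wd: "W y \<inter> W z = {}" if "y \<in> ?F" "z \<in> ?F" "y \<noteq> z" for y z
    using W0(2)[OF that] by (auto simp: W_def)
  define U where "U = \<Inter>((\<lambda>y. q ` W y) ` ?F)"
  have oU: "openin M U" unfolding U_def
    by (rule openin_Inter) (use F W om \<open>?F \<noteq> {}\<close> in auto)
  have xU: "x \<in> U" unfolding U_def using W(2) by force
  define W' where "W' = (\<lambda>y. {z \<in> W y. q z \<in> U})"
  have WN: "W y \<subseteq> topspace N" if "y \<in> ?F" for y using W(1)[OF that] openin_subset by blast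
  have oW': "openin N (W' y)" if y: "y \<in> ?F" for y
  proof -
    have "openin N {z \<in> topspace N. q z \<in> U}" using fc oU openin_continuous_map_preimage by (auto simp: finite_cover_def)
    moreover have "W' y = W y \<inter> {z \<in> topspace N. q z \<in> U}" using WN[OF y] by (auto simp: W'_def)
    ultimately show ?thesis using W(1)[OF y] by auto
  qed
  have imW': "q ` W' y = U" if y: "y \<in> ?F" for y
  proof -
    have "U \<subseteq> q ` W y" using y by (auto simp: U_def)
    then show ?thesis by (auto simp: W'_def)
  qed
  have un: "\<Union>(W' ` ?F) = topspace N \<inter> q -` U"
  proof
    show "\<Union>(W' ` ?F) \<subseteq> topspace N \<inter> q -` U" using WN by (auto simp: W'_def)
    show "topspace N \<inter> q -` U \<subseteq> \<Union>(W' ` ?F)"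
    proof
      fix z assume z: "z \<in> topspace N \<inter> q -` U"
      let ?Fz = "{y \<in> topspace N. q y = q z}"
      have "q z \<in> topspace M" using z oU openin_subset by blast
      then have Fz: "finite ?Fz" "card ?Fz = d" using fc by (auto simp: finite_cover_def sheeted_def)
      have "\<forall>y. \<exists>w. y \<in> ?F \<longrightarrow> w \<in> W y \<and> q w = q z" using z unfolding U_def by fastforce
      then obtain w where w: "\<And>y. y \<in> ?F \<Longrightarrow> w y \<in> W y \<and> q (w y) = q z" by metis
      have "inj_on w ?F"
      proof (rule inj_onI)
        fix y y' assume y: "y \<in> ?F" "y' \<in> ?F" "w y = w y'"
        then have "w y \<in> W y \<inter> W y'" using w[OF y(1)] w[OF y(2)] by simp
        then show "y = y'" using Wd[OF y(1,2)] by (metis empty_iff)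
      qed
      then have "card (w ` ?F) = d" using F card_image by metis
      moreover have "w ` ?F \<subseteq> ?Fz" using w WN by blast
      ultimately have "w ` ?F = ?Fz" using Fz by (simp add: card_subset_eq)
      moreover have "z \<in> ?Fz" using z by simp
      ultimately have "z \<in> w ` ?F" by simp
      then obtain y where y: "z = w y" "y \<in> ?F" by (rule imageE)
      then have "z \<in> W' y" using w[OF y(2)] z by (simp add: W'_def)
      then show "z \<in> \<Union>(W' ` ?F)" using y(2) by blast
    qed
  qed
  have hom: "homeomorphic_map (subtopology N (W' y)) (subtopology M U) q" if y: "y \<in> ?F" for y
  proof (rule bijective_open_imp_homeomorphic_map)
    have sub: "W' y \<subseteq> topspace N" "U \<subseteq> topspace M" using oW'[OF y] oU openin_subset by blast+
    show "continuous_map (subtopology N (W' y)) (subtopology M U) q"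
      using fc imW'[OF y] by (intro continuous_map_into_subtopology continuous_map_from_subtopology) (auto simp: finite_cover_def)
    show "open_map (subtopology N (W' y)) (subtopology M U) q"
      unfolding open_map_def
      using oW'[OF y] oU om imW'[OF y] by (auto simp: openin_open_subtopology)
    show "q ` topspace (subtopology N (W' y)) = topspace (subtopology M U)"
      using imW'[OF y] sub by (simp add: inf.absorb2)
    show "inj_on q (topspace (subtopology N (W' y)))"
      by (rule inj_on_subset[OF W(3)[OF y]]) (auto simp: W'_def)
  qed
  show "\<exists>U. x \<in> U \<and> openin M U \<and> (\<exists>\<V>. \<Union>\<V> = topspace N \<inter> q -` U \<and> (\<forall>V\<in>\<V>. openin N V) \<and> pairwise disjnt \<V> \<and>
       (\<forall>V\<in>\<V>. homeomorphic_map (subtopology N V) (subtopology M U) q))"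
  proof (intro exI[of _ U] conjI xU oU exI[of _ "W' ` ?F"] un ballI)
    show "pairwise disjnt (W' ` ?F)"
    proof (rule pairwiseI)
      fix A B assume AB: "A \<in> W' ` ?F" "B \<in> W' ` ?F" "A \<noteq> B"
      obtain y where y: "y \<in> ?F" "A = W' y" using AB(1) by (rule imageE)
      obtain z where z: "z \<in> ?F" "B = W' z" using AB(2) by (rule imageE)
      have "W y \<inter> W z = {}" by (rule Wd[OF y(1) z(1)]) (metis AB(3) y(2) z(2))
      then show "disjnt A B" unfolding y(2) z(2) disjnt_def W'_def by blast
    qed
  qed (use oW' hom in auto)
qed

lemma finite_cover_compose:
  assumes f: "finite_cover d A B f" and g: "finite_cover d' B C g"
  shows "finite_cover (d * d') A C (g \<circ> f)"
  unfolding finite_cover_def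
proof (intro conjI ballI)
  show "0 < d * d'" "Hausdorff_space A" using f g by (auto simp: finite_cover_def)
  show "continuous_map A C (g \<circ> f)" "open_map A C (g \<circ> f)"
    using f g by (auto simp: finite_cover_def intro: continuous_map_compose open_map_compose)
  show "(g \<circ> f) ` topspace A = topspace C" using f g unfolding finite_cover_def image_comp[symmetric] by simp
  have fB: "f a \<in> topspace B" if "a \<in> topspace A" for a using f that by (auto simp: finite_cover_def)
  show "sheeted (d * d') A C (g \<circ> f)"
    unfolding sheeted_def
  proof (intro ballI)
    fix x assume x: "x \<in> topspace C"
    let ?G = "{y \<in> topspace B. g y = x}" and ?F = "\<lambda>y. {z \<in> topspace A. f z = y}"
    have G: "finite ?G" "card ?G = d'" using g x by (auto simp: finite_cover_def sheeted_def)
    have F: "finite (?F y)" "card (?F y) = d" if "y \<in> ?G" for y using f that by (auto simp: finite_cover_def sheeted_def)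
    have eq: "{z \<in> topspace A. (g \<circ> f) z = x} = (\<Union>y\<in>?G. ?F y)" using fB by auto
    have "card (\<Union>y\<in>?G. ?F y) = (\<Sum>y\<in>?G. card (?F y))"
      by (rule card_UN_disjoint) (use G F in auto)
    also have "\<dots> = d * d'" using F G by simp
    finally show "finite {z \<in> topspace A. (g \<circ> f) z = x} \<and> card {z \<in> topspace A. (g \<circ> f) z = x} = d * d'"
      unfolding eq using G F by blast
  qed
  fix y assume y: "y \<in> topspace A"
  obtain V where V: "openin A V" "y \<in> V" "inj_on f V" using f y by (auto simp: finite_cover_def)
  obtain W where W: "openin B W" "f y \<in> W" "inj_on g W" using g fB[OF y] by (auto simp: finite_cover_def)
  have "openin A {z \<in> topspace A. f z \<in> W}" using f W(1) openin_continuous_map_preimage by (auto simp: finite_cover_def)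
  then have "openin A (V \<inter> {z \<in> topspace A. f z \<in> W})" using V(1) by blast
  moreover have "inj_on (g \<circ> f) (V \<inter> {z \<in> topspace A. f z \<in> W})"
    using V(3) W(3) by (auto simp: inj_on_def)
  ultimately show "\<exists>V. openin A V \<and> y \<in> V \<and> inj_on (g \<circ> f) V" using V(2) W(2) y by blast
qed

section \<open>Topology of spheres\<close>

lemma topspace_nsphere: "topspace (nsphere n) = {x. (\<Sum>i\<le>n. (x i)\<^sup>2) = 1 \<and> (\<forall>i>n. x i = 0)}"
  by (simp add: nsphere)

lemma nsphereD: "x \<in> topspace (nsphere n) \<Longrightarrow> (\<Sum>i\<le>n. (x i)\<^sup>2) = 1"
  "x \<in> topspace (nsphere n) \<Longrightarrow> i > n \<Longrightarrow> x i = 0"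
  by (auto simp: topspace_nsphere)

lemma Hausdorff_nsphere: "Hausdorff_space (nsphere n)"
  by (simp add: nsphere euclidean_product_topology Hausdorff_space_subtopology)

lemma compact_nsphere: "compact_space (nsphere n)"
proof -
  have S: "topspace (nsphere n) \<subseteq> PiE UNIV (\<lambda>_. {-1..1})"
  proof
    fix x assume x: "x \<in> topspace (nsphere n)"
    have "\<bar>x i\<bar> \<le> 1" for i
    proof (cases "i \<le> n")
      case True
      then have "(x i)\<^sup>2 \<le> (\<Sum>i\<le>n. (x i)\<^sup>2)" by (intro member_le_sum) auto
      then show ?thesis using nsphereD(1)[OF x] by (simp add: abs_square_le_1)
    qed (use nsphereD(2)[OF x] in auto)
    then have "x i \<in> {-1..1}" for i by (simp add: abs_le_iff minus_le_iff)
    then show "x \<in> PiE UNIV (\<lambda>_. {-1..1})" by (simp add: PiE_def Pi_iff)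
  qed
  have "compactin (powertop_real UNIV) (PiE UNIV (\<lambda>_. {-1..1}))"
    by (simp add: compactin_PiE)
  moreover have "closedin (powertop_real UNIV) (topspace (nsphere n))"
  proof -
    have "closed {x::nat\<Rightarrow>real. (\<Sum>i\<le>n. (x i)\<^sup>2) = 1 \<and> (\<forall>i>n. x i = 0)}"
      by (intro closed_Collect_conj closed_Collect_eq closed_Collect_all closed_Collect_imp continuous_intros continuous_on_product_coordinates) auto
    then show ?thesis unfolding topspace_nsphere euclidean_product_topology by simp
  qed
  ultimately have "compactin (powertop_real UNIV) (topspace (nsphere n))"
    using S closed_compactin by blast
  then show ?thesis
    unfolding nsphere compact_space_subtopology by (simp add: compact_space_subtopology topspace_nsphere[symmetric])
qed

lemma continuous_map_nsphere_iff:
  "continuous_map X (nsphere n) f \<longleftrightarrow>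
     (\<forall>i. continuous_map X euclideanreal (\<lambda>x. f x i)) \<and> f \<in> topspace X \<rightarrow> topspace (nsphere n)"
  unfolding nsphere continuous_map_in_subtopology continuous_map_componentwise_UNIV by simp

lemma nsphere_unit: "k \<le> n \<Longrightarrow> (\<lambda>i. if i = k then 1 else 0) \<in> topspace (nsphere n)"
  by (auto simp: topspace_nsphere if_distrib[of "\<lambda>x. x\<^sup>2"] cong: if_cong)

lemma nsphere_uminus: "x \<in> topspace (nsphere n) \<Longrightarrow> (\<lambda>i. - x i) \<in> topspace (nsphere n)"
  by (auto simp: topspace_nsphere)

definition sphere_proj :: "nat \<Rightarrow> (nat \<Rightarrow> real) \<Rightarrow> nat \<Rightarrow> real" where
  "sphere_proj n x = (\<lambda>i. x i / sqrt (\<Sum>j\<le>n. (x j)\<^sup>2))"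

lemma sum_squares_pos:
  fixes x :: "nat \<Rightarrow> real"
  assumes "\<forall>i>n. x i = 0" "x \<noteq> (\<lambda>_. 0)"
  shows "(\<Sum>j\<le>n. (x j)\<^sup>2) > 0"
proof -
  obtain i where i: "x i \<noteq> 0" using assms(2) by auto
  then have "i \<le> n" using assms(1) by (meson not_le)
  then have "0 < (x i)\<^sup>2" "(x i)\<^sup>2 \<le> (\<Sum>j\<le>n. (x j)\<^sup>2)" using i by (auto intro!: member_le_sum)
  then show ?thesis by linarith
qed

lemma sphere_proj_in:
  assumes "\<forall>i>n. x i = 0" "x \<noteq> (\<lambda>_. 0)"
  shows "sphere_proj n x \<in> topspace (nsphere n)"
proof -
  have "(\<Sum>j\<le>n. (x j)\<^sup>2) > 0" by (rule sum_squares_pos[OF assms])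
  then show ?thesis using assms
    by (simp add: topspace_nsphere sphere_proj_def power_divide flip: sum_divide_distrib)
qed

lemma sphere_proj_id: "x \<in> topspace (nsphere n) \<Longrightarrow> sphere_proj n x = x"
  by (auto simp: sphere_proj_def topspace_nsphere)

lemma continuous_map_sphere_proj:
  assumes "\<And>i. continuous_map X euclideanreal (\<lambda>x. f x i)"
    "\<And>x i. x \<in> topspace X \<Longrightarrow> i > n \<Longrightarrow> f x i = 0" "\<And>x. x \<in> topspace X \<Longrightarrow> f x \<noteq> (\<lambda>_. 0)"
  shows "continuous_map X (nsphere n) (\<lambda>x. sphere_proj n (f x))"
  unfolding continuous_map_nsphere_iff
proof (intro conjI allI)
  have "(\<Sum>j\<le>n. (f x j)\<^sup>2) > 0" if "x \<in> topspace X" for x using sum_squares_pos[of n "f x"] assms that by auto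
  then show "continuous_map X euclideanreal (\<lambda>x. sphere_proj n (f x) i)" for i
    unfolding sphere_proj_def by (intro continuous_intros assms) (auto dest: less_imp_neq[THEN not_sym])
  show "(\<lambda>x. sphere_proj n (f x)) \<in> topspace X \<rightarrow> topspace (nsphere n)"
    using sphere_proj_in assms by blast
qed

text \<open>The sphere is a retract, by radial projection, of Euclidean space without the
  origin.\<close>

lemma locally_path_connected_nsphere: "locally_path_connected_space (nsphere n)"
proof -
  let ?X = "subtopology (Euclidean_space (Suc n)) (- {\<lambda>_. 0})"
  have t1: "t1_space (Euclidean_space (Suc n))"
    unfolding Euclidean_space_def by (intro t1_space_subtopology) (simp add: Hausdorff_imp_t1_space euclidean_product_topology)
  have "openin (Euclidean_space (Suc n)) (topspace (Euclidean_space (Suc n)) - {\<lambda>_. 0})"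
    using t1 unfolding t1_space_openin_delete_alt by (auto simp: t1_space_openin_delete_alt)
  moreover have "?X = subtopology (Euclidean_space (Suc n)) (topspace (Euclidean_space (Suc n)) - {\<lambda>_. 0})"
    by (metis Diff_eq subtopology_restrict)
  ultimately have X: "locally_path_connected_space ?X"
    using locally_path_connected_space_open_subset[OF locally_path_connected_Euclidean_space] by metis
  have co: "continuous_map (powertop_real UNIV) euclideanreal (\<lambda>x. x i)" for i :: nat
    by (metis UNIV_I continuous_map_product_projection)
  have 1: "continuous_map ?X (nsphere n) (\<lambda>x. sphere_proj n x)"
    by (rule continuous_map_sphere_proj)
      (auto simp: Euclidean_space_def subtopology_subtopology intro: continuous_map_from_subtopology co)
  have 2: "continuous_map (nsphere n) ?X (\<lambda>x. x)"
    unfolding nsphere Euclidean_space_def subtopology_subtopology continuous_map_in_subtopology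
    by (auto simp: continuous_map_componentwise_UNIV intro!: continuous_map_from_subtopology co)
  have "retraction_maps ?X (nsphere n) (\<lambda>x. sphere_proj n x) (\<lambda>x. x)"
    unfolding retraction_maps_def using 1 2 sphere_proj_id by auto
  then show ?thesis using X locally_path_connected_space_retraction_map_image unfolding retraction_map_def by blast
qed

text \<open>The two closed hemispheres are contractible and share a point of the equator, which is
  nonempty for positive \<open>n\<close>.\<close>

lemma connected_nsphere:
  assumes "n > 0"
  shows "connected_space (nsphere n)"
proof -
  let ?U = "topspace (nsphere n) \<inter> {x. x n \<ge> 0}" and ?L = "topspace (nsphere n) \<inter> {x. x n \<le> 0}"
  have "connectedin (nsphere n) ?U" "connectedin (nsphere n) ?L"
    using contractible_imp_connected_space[OF contractible_space_upper_hemisphere[of n n]]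
      contractible_imp_connected_space[OF contractible_space_lower_hemisphere[of n n]]
    by (auto simp: connectedin_def subtopology_restrict)
  moreover have "(\<lambda>i. if i = 0 then 1 else 0) \<in> ?U \<inter> ?L" using assms nsphere_unit[of 0 n] by auto
  ultimately have "connectedin (nsphere n) (?U \<union> ?L)" by (intro connectedin_Un) auto
  moreover have "?U \<union> ?L = topspace (nsphere n)" by auto
  ultimately show ?thesis by (simp add: connectedin_topspace)
qed

section \<open>Lifting maps defined on spheres\<close>

text \<open>Normalise the segment from the antipode of \<open>a\<close> to \<open>y\<close>. If it
  met the origin, or if its normalisation met \<open>a\<close>, then \<open>y\<close> would be a
  nonnegative multiple of \<open>a\<close>, and comparing norms would give
  \<open>y = a\<close>.\<close>

lemma punctured_sphere_contraction:
  assumes a: "a \<in> topspace (nsphere n)"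
  defines "Y \<equiv> subtopology (nsphere n) (- {a})"
  obtains h where "continuous_map (prod_topology unit_top Y) Y h"
    "\<And>y. y \<in> topspace Y \<Longrightarrow> h (0, y) = (\<lambda>i. - a i)" "\<And>y. y \<in> topspace Y \<Longrightarrow> h (1, y) = y"
    "\<And>t. t \<in> {0..1} \<Longrightarrow> h (t, \<lambda>i. - a i) = (\<lambda>i. - a i)"
proof -
  define f where "f = (\<lambda>(t::real, x::nat\<Rightarrow>real) i. t * x i - (1 - t) * a i)"
  define h where "h = (\<lambda>z. sphere_proj n (f z))"
  let ?X = "prod_topology unit_top Y"
  have Y: "topspace Y = topspace (nsphere n) - {a}" by (auto simp: Y_def)
  have nz: "f (t, x) \<noteq> (\<lambda>_. 0)" if t: "t \<in> {0..1}" and x: "x \<in> topspace (nsphere n)" "x \<noteq> a" for t x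
  proof
    assume "f (t, x) = (\<lambda>_. 0)"
    then have e: "t * x i = (1 - t) * a i" for i by (auto simp: f_def fun_eq_iff)
    have "t\<^sup>2 = (\<Sum>i\<le>n. (t * x i)\<^sup>2)" using nsphereD(1)[OF x(1)] by (simp add: power_mult_distrib flip: sum_distrib_left)
    also have "\<dots> = (1 - t)\<^sup>2" unfolding e using nsphereD(1)[OF a] by (simp add: power_mult_distrib flip: sum_distrib_left)
    finally have "t = 1 - t" using t by (simp add: power2_eq_iff_nonneg)
    then have "t = 1/2" by simp
    then have "x i = a i" for i using e[of i] \<open>t = 1 - t\<close> by simp
    then have "x = a" by blast
    then show False using x by simp
  qed
  have na: "sphere_proj n (f (t, x)) \<noteq> a" if t: "t \<in> {0..1}" and x: "x \<in> topspace (nsphere n)" "x \<noteq> a" for t x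
  proof
    assume h: "sphere_proj n (f (t, x)) = a"
    define r where "r = sqrt (\<Sum>j\<le>n. (f (t, x) j)\<^sup>2)"
    have "\<forall>i>n. f (t, x) i = 0" by (simp add: f_def nsphereD(2)[OF x(1)] nsphereD(2)[OF a])
    then have r: "r > 0" unfolding r_def using sum_squares_pos nz[OF t x] by auto
    have e: "t * x i = (r + 1 - t) * a i" for i
    proof -
      have "f (t, x) i = r * a i" using fun_cong[OF h, of i] r unfolding sphere_proj_def r_def[symmetric]
        by (simp add: field_simps)
      then show ?thesis by (simp add: f_def algebra_simps)
    qed
    have "t\<^sup>2 = (\<Sum>i\<le>n. (t * x i)\<^sup>2)" using nsphereD(1)[OF x(1)] by (simp add: power_mult_distrib flip: sum_distrib_left)
    also have "\<dots> = (r + 1 - t)\<^sup>2" unfolding e using nsphereD(1)[OF a] by (simp add: power_mult_distrib flip: sum_distrib_left)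
    finally have tr: "t = r + 1 - t" using t r by (subst (asm) power2_eq_iff_nonneg) auto
    then have "t > 0" using t r by auto
    then have "x = a" using e unfolding tr[symmetric] by (auto simp: fun_eq_iff)
    then show False using x by simp
  qed
  have f0: "f (t, x) i = 0" if "x \<in> topspace (nsphere n)" "i > n" for t x i
    by (simp add: f_def nsphereD(2)[OF that] nsphereD(2)[OF a that(2)])
  have cY: "continuous_map ?X euclideanreal (\<lambda>z. snd z i)" for i
  proof -
    have "continuous_map ?X (nsphere n) snd" unfolding Y_def
      by (rule continuous_map_into_fulltopology[OF continuous_map_snd])
    then show ?thesis unfolding continuous_map_nsphere_iff by blast
  qed
  have cT: "continuous_map ?X euclideanreal fst"
    by (rule continuous_map_into_fulltopology[OF continuous_map_fst])
  have ch: "continuous_map ?X (nsphere n) h"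
    unfolding h_def
  proof (rule continuous_map_sphere_proj)
    show "continuous_map ?X euclideanreal (\<lambda>z. f z i)" for i
      unfolding f_def case_prod_beta by (intro continuous_intros cY cT)
  qed (use f0 nz Y in auto)
  have "h z \<in> - {a}" if "z \<in> topspace ?X" for z
    using na[of "fst z" "snd z"] that Y by (simp add: h_def mem_Times_iff)
  then have "h \<in> topspace ?X \<rightarrow> - {a}" by blast
  from continuous_map_into_subtopology[OF ch this] have "continuous_map ?X Y h" unfolding Y_def .
  moreover have ma: "sphere_proj n (\<lambda>i. - a i) = (\<lambda>i. - a i)"
    by (rule sphere_proj_id[OF nsphere_uminus[OF a]])
  moreover have "h (t, \<lambda>i. - a i) = (\<lambda>i. - a i)" for t
  proof -
    have "f (t, \<lambda>i. - a i) = (\<lambda>i. - a i)" by (auto simp: f_def algebra_simps)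
    then show ?thesis using ma by (simp add: h_def)
  qed
  moreover have "h (0, y) = (\<lambda>i. - a i)" for y using ma by (simp add: h_def f_def)
  moreover have "h (1, y) = y" if "y \<in> topspace Y" for y using that Y sphere_proj_id by (simp add: h_def f_def)
  ultimately show thesis using that by blast
qed

text \<open>Lift the contraction, starting from the constant map to \<open>e\<close>. The track of
  \<open>y0\<close> is constant, and so is its lift; this is where the contraction has to keep
  \<open>y0\<close> fixed.\<close>

lemma contraction_lift_base:
  assumes cov: "covering_map E M p" and g: "continuous_map Y M g"
    and h: "continuous_map (prod_topology unit_top Y) Y h" "\<And>y. y \<in> topspace Y \<Longrightarrow> h (0, y) = y0"
      "\<And>y. y \<in> topspace Y \<Longrightarrow> h (1, y) = y" "\<And>t. t \<in> {0..1} \<Longrightarrow> h (t, y0) = y0"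
    and y0: "y0 \<in> topspace Y" and e: "e \<in> topspace E" "p e = g y0"
  obtains l where "continuous_map Y E l" "l y0 = e" "\<And>y. y \<in> topspace Y \<Longrightarrow> p (l y) = g y"
proof -
  have 1: "continuous_map (prod_topology unit_top Y) M (g \<circ> h)" by (rule continuous_map_compose[OF h(1) g])
  have 2: "continuous_map Y E (\<lambda>_. e)" using e by simp
  have 3: "p e = (g \<circ> h) (0, y)" if "y \<in> topspace Y" for y using e h that by simp
  obtain k where k: "continuous_map (prod_topology unit_top Y) E k"
    "\<And>y. y \<in> topspace Y \<Longrightarrow> k (0, y) = e"
    "\<And>t y. y \<in> topspace Y \<Longrightarrow> t \<in> {0..1} \<Longrightarrow> p (k (t, y)) = (g \<circ> h) (t, y)"
    using covering_homotopy_lift[OF cov 1 2 3] by blast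
  have "continuous_map Y (prod_topology unit_top Y) (\<lambda>y. (1, y))" by (intro continuous_map_pairedI) auto
  from continuous_map_compose[OF this k(1)] have c: "continuous_map Y E (\<lambda>y. k (1, y))" by (simp add: o_def)
  have "continuous_map unit_top (prod_topology unit_top Y) (\<lambda>t. (t, y0))"
    using y0 by (intro continuous_map_pairedI) auto
  from continuous_map_compose[OF this k(1)] have "pathin E (\<lambda>t. k (t, y0))" by (simp add: o_def pathin_def)
  then have "k (1, y0) = k (0, y0)"
    by (rule covering_lift_const[OF cov, of _ "g y0"]) (use k h y0 in auto)
  then show thesis using that[OF c] k h y0 by auto
qed

text \<open>Moves the prescribed value from the centre \<open>y0\<close> of the contraction to an
  arbitrary point \<open>w\<close>, by lifting the track of \<open>w\<close> backwards.\<close>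

lemma contraction_lift:
  assumes cov: "covering_map E M p" and g: "continuous_map Y M g"
    and h: "continuous_map (prod_topology unit_top Y) Y h" "\<And>y. y \<in> topspace Y \<Longrightarrow> h (0, y) = y0"
      "\<And>y. y \<in> topspace Y \<Longrightarrow> h (1, y) = y" "\<And>t. t \<in> {0..1} \<Longrightarrow> h (t, y0) = y0"
    and y0: "y0 \<in> topspace Y" and w: "w \<in> topspace Y" and e: "e \<in> topspace E" "p e = g w"
  obtains l where "continuous_map Y E l" "l w = e" "\<And>y. y \<in> topspace Y \<Longrightarrow> p (l y) = g y"
proof -
  have "continuous_map unit_top (prod_topology unit_top Y) (\<lambda>t. (t, w))"
    using w by (intro continuous_map_pairedI) auto
  from continuous_map_compose[OF this h(1)] have hw: "pathin Y (\<lambda>t. h (t, w))" by (simp add: o_def pathin_def)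
  have "pathin M (\<lambda>t. g (h (1 - t, w)))"
    using continuous_map_compose[OF pathin_reverse[OF hw, unfolded pathin_def] g] by (simp add: o_def pathin_def)
  then obtain c where c: "pathin E c" "c 0 = e" "\<And>t. t \<in> {0..1} \<Longrightarrow> p (c t) = g (h (1 - t, w))"
    using covering_path_lift[OF cov _ e(1), of "\<lambda>t. g (h (1 - t, w))"] e(2) h(3)[OF w] by auto
  have c1: "c 1 \<in> topspace E" "p (c 1) = g y0"
    using c(1) c(3)[of 1] h(2)[OF w] by (auto simp: pathin_def continuous_map_def)
  obtain l where l: "continuous_map Y E l" "l y0 = c 1" "\<And>y. y \<in> topspace Y \<Longrightarrow> p (l y) = g y"
    using contraction_lift_base[OF cov g h y0 c1] by blast
  have lp: "pathin E (\<lambda>t. l (h (t, w)))" using continuous_map_compose[OF hw[unfolded pathin_def] l(1)]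
    by (simp add: o_def pathin_def)
  have eq: "p (l (h (t, w))) = p (c (1 - t))" if "t \<in> {0..1}" for t
  proof -
    have "h (t, w) \<in> topspace Y" using hw that by (auto simp: pathin_def continuous_map_def)
    then show ?thesis using l(3) c(3)[of "1 - t"] that by auto
  qed
  have "l (h (0, w)) = c (1 - 0)" using l(2) h(2)[OF w] by simp
  from covering_path_unique[OF cov lp pathin_reverse[OF c(1)] eq this, of 1]
  have "l w = e" using h(3)[OF w] c(2) by simp
  then show thesis using that l by blast
qed

text \<open>Cylindrical coordinates present the set as the image of \<open>nsphere m\<close> times
  an open interval; for \<open>m > 0\<close> the first factor is connected.\<close>

lemma connected_sphere_minus_poles:
  assumes "m > 0"
  shows "connectedin (nsphere (Suc m)) (topspace (nsphere (Suc m)) - {\<lambda>i. if i = Suc m then 1 else 0, \<lambda>i. if i = Suc m then -1 else 0})"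
proof -
  let ?e = "\<lambda>i. if i = Suc m then 1 else 0 :: real" and ?e' = "\<lambda>i. if i = Suc m then -1 else 0 :: real"
  let ?X = "prod_topology (nsphere m) (top_of_set {-1<..<1::real})"
  define f where "f = (\<lambda>z::(nat\<Rightarrow>real)\<times>real. \<lambda>i. if i = Suc m then snd z else sqrt (1 - (snd z)\<^sup>2) * fst z i)"
  have "connected_space (top_of_set {-1<..<1::real})"
    by (metis connected_Ioo connectedin_absolute connectedin_def connectedin_iff_connected)
  then have X: "connected_space ?X" using connected_nsphere[OF assms] by (simp add: connected_space_prod_topology)
  have sq: "(snd z)\<^sup>2 < 1" if "z \<in> topspace ?X" for z
  proof -
    have "\<bar>snd z\<bar> < 1" using that by auto
    then show ?thesis by (simp add: abs_square_less_1)
  qed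
  have c: "continuous_map ?X (nsphere (Suc m)) f"
    unfolding continuous_map_nsphere_iff
  proof (intro conjI allI)
    have c1: "continuous_map ?X euclideanreal snd" by (rule continuous_map_into_fulltopology[OF continuous_map_snd])
    have c2: "continuous_map ?X euclideanreal (\<lambda>z. fst z i)" for i
      using continuous_map_fst[of "nsphere m"] unfolding continuous_map_nsphere_iff by blast
    show "continuous_map ?X euclideanreal (\<lambda>z. f z i)" for i
    proof (cases "i = Suc m")
      case True then show ?thesis using c1 by (simp add: f_def)
    next
      case False then show ?thesis using c1 c2 by (simp add: f_def) (intro continuous_intros c1 c2)
    qed
    show "f \<in> topspace ?X \<rightarrow> topspace (nsphere (Suc m))"
    proof
      fix z assume z: "z \<in> topspace ?X"
      then have s: "(\<Sum>i\<le>m. (fst z i)\<^sup>2) = 1" "\<forall>i>m. fst z i = 0" by (auto simp: topspace_nsphere)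
      have "(\<Sum>i\<le>Suc m. (f z i)\<^sup>2) = (\<Sum>i\<le>m. (f z i)\<^sup>2) + (snd z)\<^sup>2" by (simp add: f_def)
      also have "(\<Sum>i\<le>m. (f z i)\<^sup>2) = (\<Sum>i\<le>m. (1 - (snd z)\<^sup>2) * (fst z i)\<^sup>2)"
        using sq[OF z] by (intro sum.cong) (auto simp: f_def power_mult_distrib)
      also have "\<dots> = 1 - (snd z)\<^sup>2" using s by (simp flip: sum_distrib_left)
      finally show "f z \<in> topspace (nsphere (Suc m))" using s by (simp add: topspace_nsphere f_def)
    qed
  qed
  have im: "f ` topspace ?X = topspace (nsphere (Suc m)) - {?e, ?e'}"
  proof
    show "f ` topspace ?X \<subseteq> topspace (nsphere (Suc m)) - {?e, ?e'}"
    proof clarify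
      fix y h assume z: "(y, h) \<in> topspace ?X"
      have "f (y, h) (Suc m) = h" by (simp add: f_def)
      then have "f (y, h) \<noteq> ?e" "f (y, h) \<noteq> ?e'" using z by (auto dest: fun_cong[of _ _ "Suc m"])
      then show "f (y, h) \<in> topspace (nsphere (Suc m)) - {?e, ?e'}" using c z by (auto simp: continuous_map_def)
    qed
    show "topspace (nsphere (Suc m)) - {?e, ?e'} \<subseteq> f ` topspace ?X"
    proof
      fix x assume x: "x \<in> topspace (nsphere (Suc m)) - {?e, ?e'}"
      define h where "h = x (Suc m)"
      have s: "(\<Sum>i\<le>m. (x i)\<^sup>2) + h\<^sup>2 = 1" "\<forall>i>Suc m. x i = 0" using x by (auto simp: topspace_nsphere h_def)
      have h1: "h\<^sup>2 < 1"
      proof (rule ccontr)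
        assume "\<not> h\<^sup>2 < 1"
        then have h0: "(\<Sum>i\<le>m. (x i)\<^sup>2) = 0" using s sum_nonneg[of "{..m}" "\<lambda>i. (x i)\<^sup>2"] by auto
        then have "x i = 0" if "i \<noteq> Suc m" for i
          using s(2) that by (cases "i \<le> m") (auto simp: sum_nonneg_eq_0_iff)
        moreover have "h = 1 \<or> h = -1" using h0 s(1) by (simp add: power2_eq_1_iff)
        ultimately have "x = ?e \<or> x = ?e'" unfolding h_def by (auto simp: fun_eq_iff)
        then show False using x by auto
      qed
      define y where "y = (\<lambda>i. if i = Suc m then 0 else x i / sqrt (1 - h\<^sup>2))"
      have "(\<Sum>i\<le>m. (y i)\<^sup>2) = (\<Sum>i\<le>m. (x i)\<^sup>2 / (1 - h\<^sup>2))"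
        using h1 by (intro sum.cong) (auto simp: y_def power_divide)
      also have "\<dots> = 1" using s(1) h1 by (simp flip: sum_divide_distrib)
      finally have "y \<in> topspace (nsphere m)" using s(2) by (auto simp: topspace_nsphere y_def)
      moreover have "\<bar>h\<bar> < 1" using h1 by (simp add: abs_square_less_1)
      moreover have "f (y, h) = x" using h1 s(2) by (auto simp: f_def y_def h_def fun_eq_iff)
      ultimately show "x \<in> f ` topspace ?X" by (intro image_eqI[of _ _ "(y, h)"]) auto
    qed
  qed
  show ?thesis using connectedin_continuous_map_image[OF c, of "topspace ?X"] X
    unfolding im connectedin_topspace by blast
qed

text \<open>Stands in for simple connectedness of the sphere. Lifts exist on the complements of the
  two poles, by contraction, and can be chosen to agree at \<open>w\<close>; they agree on the whole
  overlap because it is connected. On the circle the overlap falls into two arcs, and the argument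
  breaks down.\<close>

lemma nsphere_lift:
  assumes n: "n \<ge> 2" and cov: "covering_map E M p" and q: "continuous_map (nsphere n) M q"
  obtains L where "continuous_map (nsphere n) E L" "\<And>y. y \<in> topspace (nsphere n) \<Longrightarrow> p (L y) = q y"
proof -
  obtain m where m: "n = Suc m" "m > 0" using n by (metis Suc_le_D Suc_1 Suc_le_mono less_eq_Suc_le One_nat_def)
  define a where "a = (\<lambda>i. if i = n then 1 else 0 :: real)"
  define b where "b = (\<lambda>i. - a i)"
  have ab: "a \<in> topspace (nsphere n)" "b \<in> topspace (nsphere n)" "(\<lambda>i. - b i) = a"
    unfolding b_def using nsphere_unit[of n n] nsphere_uminus by (auto simp: a_def)
  have be: "b = (\<lambda>i. if i = n then -1 else 0)" by (auto simp: b_def a_def)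
  have "a \<noteq> b" by (metis ab(3) a_def b_def one_neq_neg_one)
  define w where "w = (\<lambda>i::nat. if i = 0 then 1 else 0 :: real)"
  have w: "w \<in> topspace (nsphere n)" "w \<noteq> a" "w \<noteq> b"
    using nsphere_unit[of 0 n] m by (auto simp: w_def a_def be dest: fun_cong[of _ _ 0])
  let ?Y = "\<lambda>a. subtopology (nsphere n) (- {a})"
  obtain e where e: "e \<in> topspace E" "p e = q w"
    using covering_map_surj[OF cov] q w(1) by (metis (no_types, lifting) continuous_map_def PiE imageE)
  have ex: "\<exists>l. continuous_map (?Y a) E l \<and> l w = e \<and> (\<forall>y\<in>topspace (nsphere n) - {a}. p (l y) = q y)"
    if a: "a \<in> topspace (nsphere n)" "w \<noteq> a" "(\<lambda>i. - a i) \<noteq> a" for a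
  proof -
    obtain h where h: "continuous_map (prod_topology unit_top (?Y a)) (?Y a) h"
      "\<And>y. y \<in> topspace (?Y a) \<Longrightarrow> h (0, y) = (\<lambda>i. - a i)" "\<And>y. y \<in> topspace (?Y a) \<Longrightarrow> h (1, y) = y"
      "\<And>t. t \<in> {0..1} \<Longrightarrow> h (t, \<lambda>i. - a i) = (\<lambda>i. - a i)"
      using punctured_sphere_contraction[OF a(1)] by blast
    have y0: "(\<lambda>i. - a i) \<in> topspace (?Y a)" "w \<in> topspace (?Y a)" using nsphere_uminus[OF a(1)] a w by auto
    obtain l where "continuous_map (?Y a) E l" "l w = e" "\<And>y. y \<in> topspace (?Y a) \<Longrightarrow> p (l y) = q y"
      using contraction_lift[where p = p and g = q and w = w and e = e, OF cov continuous_map_from_subtopology[OF q, of "- {a}"] h y0 e] by blast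
    then show ?thesis by auto
  qed
  obtain l1 where l1: "continuous_map (?Y a) E l1" "l1 w = e" "\<forall>y\<in>topspace (nsphere n) - {a}. p (l1 y) = q y"
    using ex[of a] ab w \<open>a \<noteq> b\<close> unfolding b_def by metis
  obtain l2 where l2: "continuous_map (?Y b) E l2" "l2 w = e" "\<forall>y\<in>topspace (nsphere n) - {b}. p (l2 y) = q y"
    using ex[of b] ab w \<open>a \<noteq> b\<close> by metis
  let ?Z = "subtopology (nsphere n) (topspace (nsphere n) - {a, b})"
  have Z: "connected_space ?Z"
    using connected_sphere_minus_poles[OF m(2)] unfolding a_def be m(1) by (simp add: connectedin_def)
  have agree: "l1 y = l2 y" if y: "y \<in> topspace (nsphere n) - {a, b}" for y
  proof (rule covering_lift_unique[OF cov Z, of l1 l2 w y])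
    show "continuous_map ?Z E l1" by (rule continuous_map_from_subtopology_mono[OF l1(1)]) auto
    show "continuous_map ?Z E l2" by (rule continuous_map_from_subtopology_mono[OF l2(1)]) auto
  qed (use l1 l2 w y in auto)
  define L where "L = (\<lambda>y. if y = a then l2 y else l1 y)"
  have op: "openin (nsphere n) (topspace (nsphere n) - {c})" for c
    using Hausdorff_imp_t1_space[OF Hausdorff_nsphere] by (cases "c \<in> topspace (nsphere n)") (auto simp: t1_space_openin_delete)
  have "continuous_map (nsphere n) E L"
  proof (rule pasting_lemma[of UNIV "nsphere n" "\<lambda>i::bool. if i then topspace (nsphere n) - {a} else topspace (nsphere n) - {b}" E "\<lambda>i. if i then l1 else l2"])
    show "openin (nsphere n) (if i then topspace (nsphere n) - {a} else topspace (nsphere n) - {b})" for i using op by simp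
    show "continuous_map (subtopology (nsphere n) (if i then topspace (nsphere n) - {a} else topspace (nsphere n) - {b})) E (if i then l1 else l2)" for i
      by (cases i) (auto intro: continuous_map_from_subtopology_mono[OF l1(1)] continuous_map_from_subtopology_mono[OF l2(1)])
    show "(if i then l1 else l2) x = (if j then l1 else l2) x"
      if "x \<in> topspace (nsphere n) \<inter> (if i then topspace (nsphere n) - {a} else topspace (nsphere n) - {b}) \<inter>
           (if j then topspace (nsphere n) - {a} else topspace (nsphere n) - {b})" for i j x
      using that agree[of x] by (cases i; cases j) auto
    show "\<exists>j. j \<in> UNIV \<and> x \<in> (if j then topspace (nsphere n) - {a} else topspace (nsphere n) - {b}) \<and> L x = (if j then l1 else l2) x"
      if "x \<in> topspace (nsphere n)" for x
      using that \<open>a \<noteq> b\<close> by (intro exI[of _ "x \<noteq> a"]) (auto simp: L_def)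
  qed
  moreover have "p (L y) = q y" if "y \<in> topspace (nsphere n)" for y
    using l1 l2 that \<open>a \<noteq> b\<close> by (auto simp: L_def)
  ultimately show thesis using that by blast
qed

section \<open>Rotations and quotients of spheres by them\<close>

lemma group_SO_group: "group (SO_group m)"
proof (rule groupI)
  fix A assume A: "A \<in> carrier (SO_group m)"
  then have A': "A \<in> carrier_mat m m" "transpose_mat A * A = 1\<^sub>m m" "Determinant.det A = 1" by (auto simp: SO_group_def)
  have T: "transpose_mat A \<in> carrier_mat m m" using A' by simp
  have "A * transpose_mat A = 1\<^sub>m m" using mat_mult_left_right_inverse[OF T A'(1,2)] .
  then have "transpose_mat A \<in> carrier (SO_group m)"
    using A' T Determinant.det_transpose[OF A'(1)] by (auto simp: SO_group_def)
  then show "\<exists>B\<in>carrier (SO_group m). B \<otimes>\<^bsub>SO_group m\<^esub> A = \<one>\<^bsub>SO_group m\<^esub>"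
    by (rule bexI[rotated]) (use A' in \<open>simp add: SO_group_def\<close>)
next
  fix A B assume "A \<in> carrier (SO_group m)" "B \<in> carrier (SO_group m)"
  then have A: "A \<in> carrier_mat m m" "transpose_mat A * A = 1\<^sub>m m" "Determinant.det A = 1"
    and B: "B \<in> carrier_mat m m" "transpose_mat B * B = 1\<^sub>m m" "Determinant.det B = 1"
    by (auto simp: SO_group_def)
  have "transpose_mat (A * B) * (A * B) = transpose_mat B * transpose_mat A * (A * B)"
    using A B by (simp add: transpose_mult[of A m m B m])
  also have "\<dots> = transpose_mat B * (transpose_mat A * (A * B))"
    by (rule assoc_mult_mat[of _ m m _ m _ m]) (use A B in auto)
  also have "transpose_mat A * (A * B) = transpose_mat A * A * B"
    by (rule assoc_mult_mat[of _ m m _ m _ m, symmetric]) (use A B in auto)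
  also have "\<dots> = B" using A B by simp
  finally have "transpose_mat (A * B) * (A * B) = 1\<^sub>m m" using B by simp
  then show "A \<otimes>\<^bsub>SO_group m\<^esub> B \<in> carrier (SO_group m)"
    using A B by (auto simp: SO_group_def Determinant.det_mult[of A m B])
qed (auto simp: SO_group_def assoc_mult_mat[of _ m m _ m _ m])

lemma mat_act_mult:
  assumes "A \<in> carrier_mat m m" "B \<in> carrier_mat m m"
  shows "mat_act (A * B) x = mat_act A (mat_act B x)"
proof
  fix i
  show "mat_act (A * B) x i = mat_act A (mat_act B x) i"
  proof (cases "i < m")
    case True
    have "mat_act (A * B) x i = (\<Sum>j<m. (\<Sum>k<m. A $$ (i, k) * B $$ (k, j)) * x j)"
      using assms True by (auto simp: mat_act_def scalar_prod_def lessThan_atLeast0 intro!: sum.cong)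
    also have "\<dots> = (\<Sum>j<m. \<Sum>k<m. A $$ (i, k) * B $$ (k, j) * x j)" by (simp add: sum_distrib_right)
    also have "\<dots> = (\<Sum>k<m. \<Sum>j<m. A $$ (i, k) * B $$ (k, j) * x j)" by (rule sum.swap)
    also have "\<dots> = (\<Sum>k<m. A $$ (i, k) * (\<Sum>j<m. B $$ (k, j) * x j))" by (simp add: sum_distrib_left mult.assoc)
    also have "\<dots> = mat_act A (mat_act B x) i" using assms True by (auto simp: mat_act_def intro!: sum.cong)
    finally show ?thesis .
  qed (use assms in \<open>auto simp: mat_act_def\<close>)
qed

lemma mat_act_one:
  assumes "x \<in> topspace (nsphere n)"
  shows "mat_act (1\<^sub>m (Suc n)) x = x"
proof
  fix i
  show "mat_act (1\<^sub>m (Suc n)) x i = x i"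
  proof (cases "i < Suc n")
    case True
    have "mat_act (1\<^sub>m (Suc n)) x i = (\<Sum>j<Suc n. 1\<^sub>m (Suc n) $$ (i, j) * x j)"
      using True by (simp add: mat_act_def del: sum.lessThan_Suc)
    also have "\<dots> = (\<Sum>j<Suc n. (if i = j then x j else 0))"
      by (intro sum.cong) (use True in auto)
    also have "\<dots> = x i" using True by (simp del: sum.lessThan_Suc)
    finally show ?thesis .
  qed (use nsphereD(2)[OF assms] in \<open>auto simp: mat_act_def\<close>)
qed

lemma mat_act_nsphere:
  assumes A: "A \<in> carrier (SO_group (Suc n))" and x: "x \<in> topspace (nsphere n)"
  shows "mat_act A x \<in> topspace (nsphere n)"
proof -
  let ?m = "Suc n"
  have A': "A \<in> carrier_mat ?m ?m" "transpose_mat A * A = 1\<^sub>m ?m" using A by (auto simp: SO_group_def)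
  have o: "(\<Sum>i<?m. A $$ (i, j) * A $$ (i, k)) = (if j = k then 1 else 0)" if "j < ?m" "k < ?m" for j k
  proof -
    have "(transpose_mat A * A) $$ (j, k) = (\<Sum>i<?m. A $$ (i, j) * A $$ (i, k))"
      using A'(1) that by (auto simp: scalar_prod_def lessThan_atLeast0 intro!: sum.cong)
    then show ?thesis using that unfolding A'(2) by auto
  qed
  have "(\<Sum>i<?m. (mat_act A x i)\<^sup>2) = (\<Sum>i<?m. \<Sum>j<?m. \<Sum>k<?m. (A $$ (i, j) * A $$ (i, k)) * (x j * x k))"
  proof (intro sum.cong refl)
    fix i assume "i \<in> {..<?m}"
    then have "mat_act A x i = (\<Sum>j<?m. A $$ (i, j) * x j)"
      using A'(1) by (simp add: mat_act_def del: sum.lessThan_Suc)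
    then have "(mat_act A x i)\<^sup>2 = (\<Sum>j<?m. \<Sum>k<?m. (A $$ (i, j) * x j) * (A $$ (i, k) * x k))"
      by (simp add: power2_eq_square sum_product del: sum.lessThan_Suc)
    also have "\<dots> = (\<Sum>j<?m. \<Sum>k<?m. (A $$ (i, j) * A $$ (i, k)) * (x j * x k))"
      by (intro sum.cong refl) (simp add: mult_ac)
    finally show "(mat_act A x i)\<^sup>2 = (\<Sum>j<?m. \<Sum>k<?m. (A $$ (i, j) * A $$ (i, k)) * (x j * x k))" .
  qed
  also have "\<dots> = (\<Sum>j<?m. \<Sum>i<?m. \<Sum>k<?m. (A $$ (i, j) * A $$ (i, k)) * (x j * x k))" by (rule sum.swap)
  also have "\<dots> = (\<Sum>j<?m. \<Sum>k<?m. \<Sum>i<?m. (A $$ (i, j) * A $$ (i, k)) * (x j * x k))"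
    by (intro sum.cong refl sum.swap)
  also have "\<dots> = (\<Sum>j<?m. \<Sum>k<?m. if j = k then x j * x k else 0)"
  proof (intro sum.cong refl)
    fix j k assume jk: "j \<in> {..<?m}" "k \<in> {..<?m}"
    show "(\<Sum>i<?m. (A $$ (i, j) * A $$ (i, k)) * (x j * x k)) = (if j = k then x j * x k else 0)"
      using o[of j k] jk by (simp flip: sum_distrib_right del: sum.lessThan_Suc)
  qed
  also have "\<dots> = (\<Sum>j<?m. (x j)\<^sup>2)" by (intro sum.cong refl) (simp add: power2_eq_square del: sum.lessThan_Suc)
  finally have "(\<Sum>i<?m. (mat_act A x i)\<^sup>2) = 1" using nsphereD(1)[OF x] by (simp add: lessThan_Suc_atMost)
  then show ?thesis using A'(1) by (auto simp: topspace_nsphere lessThan_Suc_atMost mat_act_def)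
qed

lemma continuous_map_mat_act:
  assumes A: "A \<in> carrier (SO_group (Suc n))"
  shows "continuous_map (nsphere n) (nsphere n) (mat_act A)"
  unfolding continuous_map_nsphere_iff
proof (intro conjI allI)
  show "continuous_map (nsphere n) euclideanreal (\<lambda>x. mat_act A x i)" for i
    unfolding mat_act_def
    by (cases "i < dim_row A") (auto intro!: continuous_intros continuous_map_nsphere_projection)
  show "mat_act A \<in> topspace (nsphere n) \<rightarrow> topspace (nsphere n)" using mat_act_nsphere[OF A] by blast
qed

text \<open>Freeness of the action enters twice: every orbit has \<open>card G\<close> points, and
  points close to a given one are not identified with each other.\<close>

lemma elliptic_finite_cover:
  assumes G: "subgroup G (SO_group (Suc n))" "finite G"
    and free: "\<forall>A\<in>G. \<forall>x\<in>topspace (nsphere n). mat_act A x = x \<longrightarrow> A = 1\<^sub>m (Suc n)"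
    and q: "quotient_map (nsphere n) M q"
    and orb: "\<forall>x\<in>topspace (nsphere n). \<forall>y\<in>topspace (nsphere n). q x = q y \<longleftrightarrow> (\<exists>A\<in>G. mat_act A x = y)"
  shows "finite_cover (card G) (nsphere n) M q"
  unfolding finite_cover_def
proof (intro conjI ballI)
  let ?S = "topspace (nsphere n)"
  interpret SO: group "SO_group (Suc n)" by (rule group_SO_group)
  interpret G: subgroup G "SO_group (Suc n)" by (rule G)
  have Gc: "A \<in> carrier (SO_group (Suc n))" if "A \<in> G" for A using that G.subset by blast
  have Gm: "A \<in> carrier_mat (Suc n) (Suc n)" if "A \<in> G" for A using Gc[OF that] by (auto simp: SO_group_def)
  have one: "1\<^sub>m (Suc n) \<in> G" using G.one_closed by (simp add: SO_group_def)
  show "card G > 0" using G(2) one card_gt_0_iff by blast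
  show "Hausdorff_space (nsphere n)" by (rule Hausdorff_nsphere)
  show "continuous_map (nsphere n) M q" using q quotient_imp_continuous_map by blast
  show sur: "q ` ?S = topspace M" using q by (simp add: quotient_map_def)
  have actS: "mat_act A y \<in> ?S" if "A \<in> G" "y \<in> ?S" for A y using mat_act_nsphere Gc that by blast
  have inj: "A = B" if AB: "A \<in> G" "B \<in> G" and y: "y \<in> ?S" "mat_act A y = mat_act B y" for A B y
  proof -
    let ?I = "inv\<^bsub>SO_group (Suc n)\<^esub> A"
    have I: "?I \<in> G" using AB by simp
    have IA: "?I * A = 1\<^sub>m (Suc n)" using SO.l_inv[OF Gc[OF AB(1)]] by (simp add: SO_group_def)
    have AI: "A * ?I = 1\<^sub>m (Suc n)" using SO.r_inv[OF Gc[OF AB(1)]] by (simp add: SO_group_def)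
    have IB: "?I * B \<in> G" using G.m_closed[OF I AB(2)] by (simp add: SO_group_def)
    have "mat_act (?I * B) y = mat_act (?I * A) y"
      using mat_act_mult[OF Gm[OF I] Gm[OF AB(1)]] mat_act_mult[OF Gm[OF I] Gm[OF AB(2)]] y(2) by simp
    then have "mat_act (?I * B) y = y" using IA mat_act_one[OF y(1)] by simp
    then have "?I * B = 1\<^sub>m (Suc n)" using free IB y(1) by blast
    then have "A * (?I * B) = A" using Gm[OF AB(1)] by simp
    moreover have "A * (?I * B) = (A * ?I) * B"
      using assoc_mult_mat[OF Gm[OF AB(1)] Gm[OF I] Gm[OF AB(2)]] by simp
    ultimately show "A = B" using AI Gm[OF AB(2)] by simp
  qed
  show "open_map (nsphere n) M q"
    unfolding open_map_def
  proof (intro allI impI)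
    fix U assume U: "openin (nsphere n) U"
    have US: "U \<subseteq> ?S" using U openin_subset by blast
    \<comment> \<open>The saturation of \<open>U\<close> is a union of preimages of \<open>U\<close>
      under rotations, hence open; so the quotient map is open.\<close>
    have "{y \<in> ?S. q y \<in> q ` U} = (\<Union>A\<in>G. {y \<in> ?S. mat_act A y \<in> U})"
    proof -
      have "q y \<in> q ` U \<longleftrightarrow> (\<exists>A\<in>G. mat_act A y \<in> U)" if y: "y \<in> ?S" for y
      proof -
        have "q y \<in> q ` U \<longleftrightarrow> (\<exists>u\<in>U. q y = q u)" by blast
        also have "\<dots> \<longleftrightarrow> (\<exists>u\<in>U. \<exists>A\<in>G. mat_act A y = u)"
          by (rule bex_cong[OF refl]) (rule orb[rule_format, OF y US[THEN subsetD]])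
        finally show ?thesis by blast
      qed
      then show ?thesis by auto
    qed
    moreover have "openin (nsphere n) (\<Union>A\<in>G. {y \<in> ?S. mat_act A y \<in> U})"
      using openin_continuous_map_preimage[OF continuous_map_mat_act[OF Gc] U] by blast
    ultimately have "openin (nsphere n) {y \<in> ?S. q y \<in> q ` U}" by simp
    moreover have "q ` U \<subseteq> topspace M" using US sur by blast
    ultimately show "openin M (q ` U)" using q unfolding quotient_map_def by blast
  qed
  show "sheeted (card G) (nsphere n) M q"
    unfolding sheeted_def
  proof
    fix x assume "x \<in> topspace M"
    then have "x \<in> q ` ?S" using sur by simp
    then obtain y where "x = q y" and y: "y \<in> ?S" by (rule imageE)
    then have y: "y \<in> ?S" "q y = x" by simp_all
    have "{z \<in> ?S. q z = x} = (\<lambda>A. mat_act A y) ` G"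
    proof
      show "{z \<in> ?S. q z = x} \<subseteq> (\<lambda>A. mat_act A y) ` G"
      proof
        fix z assume "z \<in> {z \<in> ?S. q z = x}"
        then have "z \<in> ?S" "q y = q z" using y by auto
        then have "\<exists>A\<in>G. mat_act A y = z" using orb[rule_format, OF y(1)] by blast
        then show "z \<in> (\<lambda>A. mat_act A y) ` G" by blast
      qed
      show "(\<lambda>A. mat_act A y) ` G \<subseteq> {z \<in> ?S. q z = x}"
      proof clarify
        fix A assume A: "A \<in> G"
        have "q y = q (mat_act A y)" using orb[rule_format, OF y(1) actS[OF A y(1)]] A by blast
        then show "mat_act A y \<in> ?S \<and> q (mat_act A y) = x" using actS A y by auto
      qed
    qed
    moreover have "inj_on (\<lambda>A. mat_act A y) G" using inj y(1) by (auto simp: inj_on_def)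
    ultimately show "finite {z \<in> ?S. q z = x} \<and> card {z \<in> ?S. q z = x} = card G"
      using G(2) by (simp add: card_image)
  qed
  fix y assume y: "y \<in> ?S"
  obtain W where W: "\<And>z. z \<in> (\<lambda>A. mat_act A y) ` G \<Longrightarrow> openin (nsphere n) (W z) \<and> z \<in> W z"
    "\<And>z z'. z \<in> (\<lambda>A. mat_act A y) ` G \<Longrightarrow> z' \<in> (\<lambda>A. mat_act A y) ` G \<Longrightarrow> z \<noteq> z' \<Longrightarrow> W z \<inter> W z' = {}"
    by (rule Hausdorff_finite_separation[OF Hausdorff_nsphere, of "(\<lambda>A. mat_act A y) ` G" n])
      (use G(2) actS y in auto)
  have y1: "mat_act (1\<^sub>m (Suc n)) y = y" by (rule mat_act_one[OF y])
  then have yG: "y \<in> (\<lambda>A. mat_act A y) ` G" using one by (metis imageI)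
  \<comment> \<open>The translates of \<open>y\<close> have disjoint neighbourhoods. If a rotation
    \<open>A\<close> takes one point of \<open>V\<close> to another, the second one lies both near
    \<open>y\<close> and near the translate of \<open>y\<close> by \<open>A\<close>; so
    \<open>A\<close> fixes \<open>y\<close> and is the identity.\<close>
  define V where "V = W y \<inter> (\<Inter>A\<in>G. {z \<in> ?S. mat_act A z \<in> W (mat_act A y)})"
  have "openin (nsphere n) V" unfolding V_def
  proof (rule openin_Int)
    show "openin (nsphere n) (W y)" using W(1)[OF yG] by blast
    show "openin (nsphere n) (\<Inter>A\<in>G. {z \<in> ?S. mat_act A z \<in> W (mat_act A y)})"
    proof (rule openin_Inter)
      show "finite ((\<lambda>A. {z \<in> ?S. mat_act A z \<in> W (mat_act A y)}) ` G)" using G(2) by simp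
      show "(\<lambda>A. {z \<in> ?S. mat_act A z \<in> W (mat_act A y)}) ` G \<noteq> {}" using one by blast
      fix X assume "X \<in> (\<lambda>A. {z \<in> ?S. mat_act A z \<in> W (mat_act A y)}) ` G"
      then obtain A where A: "A \<in> G" "X = {z \<in> ?S. mat_act A z \<in> W (mat_act A y)}" by blast
      have "openin (nsphere n) (W (mat_act A y))" using W(1) A(1) by blast
      then show "openin (nsphere n) X" unfolding A(2)
        by (rule openin_continuous_map_preimage[OF continuous_map_mat_act[OF Gc[OF A(1)]]])
    qed
  qed
  moreover have "y \<in> V" unfolding V_def using W(1) yG y by blast
  moreover have "inj_on q V"
  proof (rule inj_onI)
    fix z z' assume z: "z \<in> V" "z' \<in> V" "q z = q z'"
    have zS: "z \<in> ?S" "z' \<in> ?S" using z one by (auto simp: V_def)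
    then obtain A where A: "A \<in> G" "mat_act A z = z'" using orb z(3) by meson
    have "z' \<in> W (mat_act A y)" "z' \<in> W y" using z A by (auto simp: V_def)
    then have "mat_act A y = y" using W(2)[of "mat_act A y" y] A(1) yG by blast
    then have "A = 1\<^sub>m (Suc n)" using free A(1) y by blast
    then show "z = z'" using A(2) mat_act_one[OF zS(1)] by simp
  qed
  ultimately show "\<exists>V. openin (nsphere n) V \<and> y \<in> V \<and> inj_on q V" by blast
qed

section \<open>Coverings of the circle by itself\<close>

text \<open>The square of \<open>x 0 + i * x 1\<close>, computed in the complex plane.\<close>

definition circle_square :: "(nat \<Rightarrow> real) \<Rightarrow> nat \<Rightarrow> real" where
  "circle_square x = (\<lambda>i. if i = 0 then (x 0)\<^sup>2 - (x 1)\<^sup>2 else if i = 1 then 2 * x 0 * x 1 else 0)"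

lemma topspace_circle: "x \<in> topspace (nsphere 1) \<longleftrightarrow> (x 0)\<^sup>2 + (x 1)\<^sup>2 = 1 \<and> (\<forall>i>1. x i = 0)"
  by (simp add: topspace_nsphere atMost_Suc add.commute)

lemma circle_eqI:
  assumes "x \<in> topspace (nsphere 1)" "y \<in> topspace (nsphere 1)" "x 0 = y 0" "x 1 = y 1"
  shows "x = y"
proof
  fix i :: nat
  consider "i = 0" | "i = 1" | "i > 1" by linarith
  then show "x i = y i"
    using assms(3,4) nsphereD(2)[OF assms(1)] nsphereD(2)[OF assms(2)] by cases simp_all
qed

lemma circle_square_eq_iff:
  assumes x: "x \<in> topspace (nsphere 1)" and y: "y \<in> topspace (nsphere 1)"
  shows "circle_square x = circle_square y \<longleftrightarrow> x = y \<or> x = (\<lambda>i. - y i)"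
proof
  assume "circle_square x = circle_square y"
  then have "circle_square x 0 = circle_square y 0" "circle_square x 1 = circle_square y 1" by auto
  then have e: "(x 0)\<^sup>2 - (x 1)\<^sup>2 = (y 0)\<^sup>2 - (y 1)\<^sup>2" "x 0 * x 1 = y 0 * y 1" by (auto simp: circle_square_def)
  have "Complex (x 0) (x 1) ^ 2 = Complex (y 0) (y 1) ^ 2"
    using e by (simp add: power2_eq_square complex_mult) (auto simp: algebra_simps)
  then have "Complex (x 0) (x 1) = Complex (y 0) (y 1) \<or> Complex (x 0) (x 1) = - Complex (y 0) (y 1)"
    by (simp add: power2_eq_iff)
  then have "(x 0 = y 0 \<and> x 1 = y 1) \<or> (x 0 = - y 0 \<and> x 1 = - y 1)" by (simp add: complex_eq_iff)
  then show "x = y \<or> x = (\<lambda>i. - y i)"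
    using circle_eqI[OF x y] circle_eqI[OF x nsphere_uminus[OF y]] by argo
qed (auto simp: circle_square_def)

lemma circle_square_finite_cover: "finite_cover 2 (nsphere 1) (nsphere 1) circle_square"
  unfolding finite_cover_def
proof (intro conjI ballI)
  let ?S = "topspace (nsphere 1)"
  show "Hausdorff_space (nsphere 1)" by (rule Hausdorff_nsphere)
  have sqS: "circle_square x \<in> ?S" if "x \<in> ?S" for x
  proof -
    have "((x 0)\<^sup>2 - (x 1)\<^sup>2)\<^sup>2 + (2 * x 0 * x 1)\<^sup>2 = ((x 0)\<^sup>2 + (x 1)\<^sup>2)\<^sup>2"
      by (simp add: power2_eq_square algebra_simps)
    then show ?thesis using that unfolding topspace_circle by (simp add: circle_square_def)
  qed
  show c: "continuous_map (nsphere 1) (nsphere 1) circle_square"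
    unfolding continuous_map_nsphere_iff
  proof (intro conjI allI)
    show "continuous_map (nsphere 1) euclideanreal (\<lambda>x. circle_square x i)" for i
    proof -
      consider "i = 0" | "i = 1" | "i > 1" by linarith
      then show ?thesis
        by cases (auto simp: circle_square_def intro!: continuous_intros continuous_map_nsphere_projection)
    qed
  qed (use sqS in auto)
  show sur: "circle_square ` ?S = ?S"
  proof
    show "circle_square ` ?S \<subseteq> ?S" using sqS by blast
    show "?S \<subseteq> circle_square ` ?S"
    proof
      fix y assume y: "y \<in> ?S"
      define c s where "c = y 0" and "s = y 1"
      have cs: "c\<^sup>2 + s\<^sup>2 = 1" using y unfolding topspace_circle c_def s_def by blast
      then have "\<bar>c\<bar> \<le> 1" by (metis abs_square_le_1 le_add_same_cancel1 zero_le_power2)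
      then have c1: "0 \<le> 1 + c" "0 \<le> 1 - c" by auto
      \<comment> \<open>The half-angle formulas for a square root of \<open>(c, s)\<close>; the sign
        of the second coordinate makes twice the product of the coordinates equal to
        \<open>s\<close> and not to its negative.\<close>
      define x where "x = (\<lambda>i::nat. if i = 0 then sqrt ((1 + c) / 2) else if i = 1 then (if s \<ge> 0 then 1 else -1) * sqrt ((1 - c) / 2) else 0)"
      have x2: "(x 0)\<^sup>2 = (1 + c) / 2" "(x 1)\<^sup>2 = (1 - c) / 2" using c1 by (auto simp: x_def power_mult_distrib)
      have xS: "x \<in> ?S" unfolding topspace_circle x2 by (auto simp: x_def field_simps)
      have "sqrt ((1 + c) / 2) * sqrt ((1 - c) / 2) = sqrt (s\<^sup>2 / 4)"
        using cs by (simp add: field_simps power2_eq_square flip: real_sqrt_mult)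
      also have "\<dots> = \<bar>s\<bar> / 2" by (simp add: real_sqrt_divide)
      finally have "2 * x 0 * x 1 = s" by (auto simp: x_def)
      moreover have "(x 0)\<^sup>2 - (x 1)\<^sup>2 = c" unfolding x2 by (simp add: field_simps)
      ultimately have "circle_square x = y"
        by (intro circle_eqI[OF sqS[OF xS] y]) (auto simp: circle_square_def c_def s_def)
      then show "y \<in> circle_square ` ?S" using xS by blast
    qed
  qed
  \<comment> \<open>Compactness of the circle makes the map closed, hence a quotient map; openness
    can then be tested on preimages.\<close>
  have q: "quotient_map (nsphere 1) (nsphere 1) circle_square"
    by (rule continuous_closed_imp_quotient_map[OF c continuous_imp_closed_map[OF c compact_nsphere Hausdorff_nsphere] sur])
  have m: "continuous_map (nsphere 1) (nsphere 1) (\<lambda>x i. - x i)"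
    unfolding continuous_map_nsphere_iff
    using nsphere_uminus[of _ 1] by (auto intro!: continuous_intros continuous_map_nsphere_projection)
  show "open_map (nsphere 1) (nsphere 1) circle_square"
    unfolding open_map_def
  proof (intro allI impI)
    fix U assume U: "openin (nsphere 1) U"
    have US: "U \<subseteq> ?S" using U openin_subset by blast
    have "{y \<in> ?S. circle_square y \<in> circle_square ` U} = U \<union> {y \<in> ?S. (\<lambda>i. - y i) \<in> U}"
    proof -
      have "circle_square y \<in> circle_square ` U \<longleftrightarrow> y \<in> U \<or> (\<lambda>i. - y i) \<in> U" if y: "y \<in> ?S" for y
      proof -
        have "circle_square y \<in> circle_square ` U \<longleftrightarrow> (\<exists>u\<in>U. circle_square u = circle_square y)"
          unfolding image_iff by (rule bex_cong[OF refl]) (rule eq_commute)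
        also have "\<dots> \<longleftrightarrow> (\<exists>u\<in>U. u = y \<or> u = (\<lambda>i. - y i))" using circle_square_eq_iff y US by blast
        finally show ?thesis by blast
      qed
      then show ?thesis using US by auto
    qed
    moreover have "openin (nsphere 1) {y \<in> ?S. (\<lambda>i. - y i) \<in> U}"
      by (rule openin_continuous_map_preimage[OF m U])
    ultimately have "openin (nsphere 1) {y \<in> ?S. circle_square y \<in> circle_square ` U}" using U by auto
    moreover have "circle_square ` U \<subseteq> ?S" using US sqS by blast
    ultimately show "openin (nsphere 1) (circle_square ` U)" using q unfolding quotient_map_def by blast
  qed
  have ne: "x \<noteq> (\<lambda>i. - x i)" if "x \<in> ?S" for x
  proof
    assume "x = (\<lambda>i. - x i)"
    then have "x 0 = - x 0" "x 1 = - x 1" by metis+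
    then have "x 0 = 0" "x 1 = 0" by simp_all
    then show False using that unfolding topspace_circle by simp
  qed
  show "sheeted 2 (nsphere 1) (nsphere 1) circle_square"
    unfolding sheeted_def
  proof
    fix x assume "x \<in> ?S"
    then have "x \<in> circle_square ` ?S" using sur by simp
    then obtain y where "x = circle_square y" and "y \<in> ?S" by (rule imageE)
    then have y: "y \<in> ?S" "circle_square y = x" by simp_all
    have "{z \<in> ?S. circle_square z = x} = {y, \<lambda>i. - y i}"
      using circle_square_eq_iff[OF _ y(1)] y nsphere_uminus[OF y(1)] by auto
    then show "finite {z \<in> ?S. circle_square z = x} \<and> card {z \<in> ?S. circle_square z = x} = 2"
      using ne[OF y(1)] by auto
  qed
  fix y assume y: "y \<in> ?S"
  \<comment> \<open>The open half circle centred at \<open>y\<close> does not contain two antipodal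
    points.\<close>
  define V where "V = {z \<in> ?S. z 0 * y 0 + z 1 * y 1 > 0}"
  have "openin (nsphere 1) {z \<in> ?S. (z 0 * y 0 + z 1 * y 1) \<in> {0<..}}"
    by (rule openin_continuous_map_preimage[of _ euclideanreal])
      (auto intro!: continuous_intros continuous_map_nsphere_projection)
  then have "openin (nsphere 1) V" by (simp add: V_def)
  moreover have "y 0 * y 0 + y 1 * y 1 = 1" using y unfolding topspace_circle power2_eq_square by blast
  then have "y \<in> V" using y by (simp add: V_def)
  moreover have "inj_on circle_square V"
  proof (rule inj_onI)
    fix z z' assume z: "z \<in> V" "z' \<in> V" "circle_square z = circle_square z'"
    then have "z = z' \<or> z = (\<lambda>i. - z' i)" using circle_square_eq_iff by (auto simp: V_def)
    moreover have "z \<noteq> (\<lambda>i. - z' i)" using z(1,2) by (auto simp: V_def)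
    ultimately show "z = z'" by blast
  qed
  ultimately show "\<exists>V. openin (nsphere 1) V \<and> y \<in> V \<and> inj_on circle_square V" by blast
qed simp

lemma circle_finite_covers: "\<exists>f. finite_cover (2 ^ m) (nsphere 1) (nsphere 1) f"
proof (induction m)
  case 0
  have "finite_cover 1 (nsphere 1) (nsphere 1) (\<lambda>x. x)"
    unfolding finite_cover_def
  proof (intro conjI ballI)
    have "{y \<in> topspace (nsphere 1). y = x} = {x}" if "x \<in> topspace (nsphere 1)" for x using that by blast
    then show "sheeted 1 (nsphere 1) (nsphere 1) (\<lambda>x. x)" by (simp add: sheeted_def)
    show "\<exists>V. openin (nsphere 1) V \<and> y \<in> V \<and> inj_on (\<lambda>x. x) V" if "y \<in> topspace (nsphere 1)" for y
      by (rule exI[of _ "topspace (nsphere 1)"]) (use that in simp)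
  qed (use Hausdorff_nsphere in \<open>auto simp: open_map_def\<close>)
  then show ?case by auto
next
  case (Suc m)
  then show ?case using finite_cover_compose[OF _ circle_square_finite_cover] by (metis power_Suc2)
qed

text \<open>The bound \<open>D\<close> serves the circle only: \<open>D\<close> squarings give
  \<open>2 ^ D\<close> sheets. Coverings with more and more sheets show that the fundamental group
  is infinite and at the same time drive the norms to 0.\<close>

lemma elliptic_manifold_covers:
  assumes "elliptic_manifold n M"
  obtains d q where "finite_cover d (nsphere n) M q"
    "n = 1 \<Longrightarrow> \<exists>d' q'. d' > D \<and> finite_cover d' (nsphere n) M q'" "locally_path_connected_space M"
proof -
  obtain G q where G: "subgroup G (SO_group (Suc n))" "finite G"
     "\<forall>A\<in>G. \<forall>x\<in>topspace (nsphere n). mat_act A x = x \<longrightarrow> A = 1\<^sub>m (Suc n)" "quotient_map (nsphere n) M q"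
     "\<forall>x\<in>topspace (nsphere n). \<forall>y\<in>topspace (nsphere n). q x = q y \<longleftrightarrow> (\<exists>A\<in>G. mat_act A x = y)"
    using assms unfolding elliptic_manifold_def by blast
  note fc = elliptic_finite_cover[OF G]
  show thesis
  proof (rule that[OF fc])
    show "locally_path_connected_space M"
      by (rule locally_path_connected_space_quotient_map_image[OF G(4) locally_path_connected_nsphere])
    assume n: "n = 1"
    obtain f where f: "finite_cover (2 ^ D) (nsphere 1) (nsphere 1) f" using circle_finite_covers by blast
    have "finite_cover (2 ^ D * card G) (nsphere n) M (q \<circ> f)"
      using finite_cover_compose[OF f] fc n by blast
    moreover have "2 ^ D * card G > D"
    proof -
      have "card G > 0" using fc by (simp add: finite_cover_def)
      then have "2 ^ D \<le> 2 ^ D * card G" by simp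
      then show ?thesis using less_exp[of D] by linarith
    qed
    ultimately show "\<exists>d' q'. d' > D \<and> finite_cover d' (nsphere n) M q'" by blast
  qed
qed

lemma (in pointed_universal_covering) finite_cover_le_card_pi1:
  assumes "finite_cover d (nsphere n) M q" "n > 0" "finite (carrier \<Gamma>)"
  shows "d \<le> card (carrier \<Gamma>)"
  using sheets_le_card_pi1[OF finite_cover_covering[OF assms(1)] _ connected_nsphere[OF assms(2)] assms(3)] assms(1)
  by (simp add: finite_cover_def)

lemma (in pointed_universal_covering) finite_cover_card_pi1:
  assumes fc: "finite_cover d (nsphere n) M q" and n: "n \<ge> 2"
  shows "finite (carrier \<Gamma>)" "card (carrier \<Gamma>) = d"
proof -
  obtain L where L: "continuous_map (nsphere n) E L" "\<And>y. y \<in> topspace (nsphere n) \<Longrightarrow> p (L y) = q y"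
    using nsphere_lift[OF n cov, of q] fc by (auto simp: finite_cover_def)
  have sh: "sheeted d (nsphere n) M q" using fc by (simp add: finite_cover_def)
  show "finite (carrier \<Gamma>)" by (rule card_pi1_le_sheets(1)[OF finite_cover_covering[OF fc] sh L])
  then show "card (carrier \<Gamma>) = d"
    using card_pi1_le_sheets(2)[OF finite_cover_covering[OF fc] sh L] finite_cover_le_card_pi1[OF fc] n
    by (simp add: le_antisym)
qed

section \<open>The transfer\<close>

abbreviation simplex_top :: "nat \<Rightarrow> (nat \<Rightarrow> real) topology" where
  "simplex_top k \<equiv> subtopology (powertop_real UNIV) (standard_simplex k)"

definition vertex0 :: "nat \<Rightarrow> real" where "vertex0 = (\<lambda>j. if j = 0 then 1 else 0)"

lemma vertex0_in [simp]: "vertex0 \<in> standard_simplex k"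
  by (simp add: vertex0_def)

lemma topspace_simplex_top [simp]: "topspace (simplex_top k) = standard_simplex k"
  by simp

lemma connected_simplex_top: "connected_space (simplex_top k)"
  using connectedin_standard_simplex[of k] by (simp add: connectedin_def)

lemma continuous_map_simplex_iff:
  "continuous_map X (simplex_top k) f \<longleftrightarrow>
     (\<forall>i. continuous_map X euclideanreal (\<lambda>x. f x i)) \<and> f \<in> topspace X \<rightarrow> standard_simplex k"
  unfolding continuous_map_in_subtopology continuous_map_componentwise_UNIV by simp

lemma standard_simplex_convex:
  assumes "x \<in> standard_simplex k" "y \<in> standard_simplex k" "0 \<le> u" "u \<le> 1"
  shows "(\<lambda>i. (1 - u) * x i + u * y i) \<in> standard_simplex k"
  using convex_standard_simplex[OF assms] .

text \<open>A simplex contracts linearly to \<open>vertex0\<close>, so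
  \<open>contraction_lift\<close> applies; the restriction at the end makes the lift extensional, as
  singular simplices are.\<close>

lemma simplex_lift_ex:
  assumes cov: "covering_map N M q" and \<tau>: "singular_simplex k M \<tau>"
    and t: "t \<in> standard_simplex k" and y: "y \<in> topspace N" "q y = \<tau> t"
  obtains \<sigma> where "singular_simplex k N \<sigma>" "simplex_map k q \<sigma> = \<tau>" "\<sigma> t = y"
proof -
  define h where "h = (\<lambda>z::real \<times> (nat \<Rightarrow> real). \<lambda>i. (1 - fst z) * vertex0 i + fst z * snd z i)"
  let ?P = "prod_topology unit_top (simplex_top k)"
  have c1: "continuous_map ?P euclideanreal (\<lambda>z. snd z i)" for i
    using continuous_map_snd[of _ "simplex_top k"] unfolding continuous_map_simplex_iff by blast
  have c2: "continuous_map ?P euclideanreal fst" by (rule continuous_map_into_fulltopology[OF continuous_map_fst])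
  have ch: "continuous_map ?P (simplex_top k) h"
    unfolding continuous_map_simplex_iff
  proof (intro conjI allI)
    show "continuous_map ?P euclideanreal (\<lambda>z. h z i)" for i
      unfolding h_def by (intro continuous_intros c1 c2)
    show "h \<in> topspace ?P \<rightarrow> standard_simplex k"
      unfolding h_def by (rule Pi_I) (rule standard_simplex_convex, auto)
  qed
  have \<tau>c: "continuous_map (simplex_top k) M \<tau>" using \<tau> by (simp add: singular_simplex_def)
  obtain l where l: "continuous_map (simplex_top k) N l" "l t = y" "\<And>x. x \<in> topspace (simplex_top k) \<Longrightarrow> q (l x) = \<tau> x"
  proof (rule contraction_lift[where p = q and g = \<tau> and w = t and e = y and h = h and Y = "simplex_top k" and ?y0.0 = vertex0, OF cov \<tau>c ch])
  qed (use t y in \<open>auto simp: h_def algebra_simps\<close>)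
  let ?\<sigma> = "restrict l (standard_simplex k)"
  have "singular_simplex k N ?\<sigma>"
    unfolding singular_simplex_def using continuous_map_eq[OF l(1), of ?\<sigma>] by simp
  moreover have "simplex_map k q ?\<sigma> = \<tau>"
  proof
    fix x show "simplex_map k q ?\<sigma> x = \<tau> x"
      using \<tau> l(3) by (cases "x \<in> standard_simplex k") (auto simp: simplex_map_def singular_simplex_def extensional_def)
  qed
  ultimately show thesis by (rule that) (use l t in auto)
qed

lemma simplex_lift_unique:
  assumes cov: "covering_map N M q" and s: "singular_simplex k N \<sigma>" "singular_simplex k N \<sigma>'"
    and eq: "simplex_map k q \<sigma> = simplex_map k q \<sigma>'" and t: "t \<in> standard_simplex k" "\<sigma> t = \<sigma>' t"
  shows "\<sigma> = \<sigma>'"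
proof
  fix x show "\<sigma> x = \<sigma>' x"
  proof (cases "x \<in> standard_simplex k")
    case True
    show ?thesis
    proof (rule covering_lift_unique[OF cov connected_simplex_top, of k \<sigma> \<sigma>' t x])
      fix y assume "y \<in> topspace (simplex_top k)"
      then show "q (\<sigma> y) = q (\<sigma>' y)" using fun_cong[OF eq, of y] by (simp add: simplex_map_def)
    qed (use s t True in \<open>auto simp: singular_simplex_def\<close>)
  qed (use s in \<open>auto simp: singular_simplex_def extensional_def\<close>)
qed

section \<open>Lifts of simplices and the transfer of chains\<close>

definition simplex_lifts :: "nat \<Rightarrow> 'b topology \<Rightarrow> ('b \<Rightarrow> 'a) \<Rightarrow> ((nat \<Rightarrow> real) \<Rightarrow> 'a) \<Rightarrow> ((nat \<Rightarrow> real) \<Rightarrow> 'b) set" where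
  "simplex_lifts k N q \<tau> = {\<sigma>. singular_simplex k N \<sigma> \<and> simplex_map k q \<sigma> = \<tau>}"

lemma singular_simplex_value: "singular_simplex k N \<sigma> \<Longrightarrow> t \<in> standard_simplex k \<Longrightarrow> \<sigma> t \<in> topspace N"
  by (auto simp: singular_simplex_def continuous_map_def)

lemma simplex_map_apply: "t \<in> standard_simplex k \<Longrightarrow> simplex_map k q \<sigma> t = q (\<sigma> t)"
  by (simp add: simplex_map_def)

lemma simplex_lifts_bij:
  assumes cov: "covering_map N M q" and \<tau>: "singular_simplex k M \<tau>" and t: "t \<in> standard_simplex k"
  shows "bij_betw (\<lambda>\<sigma>. \<sigma> t) (simplex_lifts k N q \<tau>) {y \<in> topspace N. q y = \<tau> t}"
proof (rule bij_betwI')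
  show "(\<sigma> t = \<sigma>' t) = (\<sigma> = \<sigma>')" if "\<sigma> \<in> simplex_lifts k N q \<tau>" "\<sigma>' \<in> simplex_lifts k N q \<tau>" for \<sigma> \<sigma>'
    using simplex_lift_unique[OF cov _ _ _ t] that by (metis (mono_tags, lifting) mem_Collect_eq simplex_lifts_def)
  show "\<sigma> t \<in> {y \<in> topspace N. q y = \<tau> t}" if "\<sigma> \<in> simplex_lifts k N q \<tau>" for \<sigma>
    using that singular_simplex_value[of k N \<sigma> t] simplex_map_apply[OF t, of q \<sigma>] t by (auto simp: simplex_lifts_def)
  show "\<exists>\<sigma>\<in>simplex_lifts k N q \<tau>. y = \<sigma> t" if "y \<in> {y \<in> topspace N. q y = \<tau> t}" for y
  proof -
    have "y \<in> topspace N" "q y = \<tau> t" using that by auto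
    then obtain \<sigma> where "singular_simplex k N \<sigma>" "simplex_map k q \<sigma> = \<tau>" "\<sigma> t = y"
      using simplex_lift_ex[OF cov \<tau> t] by blast
    then show ?thesis by (auto simp: simplex_lifts_def)
  qed
qed

text \<open>A lift of a face extends to exactly one lift of the whole simplex. This is why the
  transfer commutes with the boundary.\<close>

lemma simplex_lifts_face_bij:
  fixes N :: "'b topology" and M :: "'a topology"
  assumes cov: "covering_map N M q" and \<tau>: "singular_simplex k M \<tau>" and k: "1 \<le> k" "i \<le> k"
  shows "bij_betw (singular_face k i) (simplex_lifts k N q \<tau>) (simplex_lifts (k - 1) N q (singular_face k i \<tau>))"
proof -
  \<comment> \<open>The point of the simplex that is the first vertex of its face \<open>i\<close>;
    there lifts of the simplex and lifts of the face can be compared.\<close>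
  let ?v = "simplical_face i vertex0 :: nat \<Rightarrow> real"
  have v: "?v \<in> standard_simplex k" by (rule simplical_face_in_standard_simplex[OF k]) simp
  have fv: "singular_face k i \<sigma> vertex0 = \<sigma> ?v" for \<sigma> :: "(nat \<Rightarrow> real) \<Rightarrow> 'b" by (simp add: singular_face_def)
  have fm: "simplex_map (k - 1) q (singular_face k i \<sigma>) = singular_face k i (simplex_map k q \<sigma>)" for \<sigma>
    unfolding singular_face_simplex_map[OF k]
    using simplical_face_in_standard_simplex[OF k] by (auto simp: simplex_map_def singular_face_def)
  have ff: "singular_face k i \<sigma> \<in> simplex_lifts (k - 1) N q (singular_face k i \<tau>)" if "\<sigma> \<in> simplex_lifts k N q \<tau>" for \<sigma>
    using that singular_simplex_singular_face[of k N \<sigma> i] k fm by (auto simp: simplex_lifts_def)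
  show ?thesis
  proof (rule bij_betwI')
    show "(singular_face k i \<sigma> = singular_face k i \<sigma>') = (\<sigma> = \<sigma>')"
      if "\<sigma> \<in> simplex_lifts k N q \<tau>" "\<sigma>' \<in> simplex_lifts k N q \<tau>" for \<sigma> \<sigma>'
    proof
      assume "singular_face k i \<sigma> = singular_face k i \<sigma>'"
      then have "\<sigma> ?v = \<sigma>' ?v" using fv by metis
      then show "\<sigma> = \<sigma>'" using simplex_lift_unique[OF cov _ _ _ v] that by (simp add: simplex_lifts_def)
    qed simp
    show "\<exists>\<sigma>\<in>simplex_lifts k N q \<tau>. \<rho> = singular_face k i \<sigma>"
      if \<rho>: "\<rho> \<in> simplex_lifts (k - 1) N q (singular_face k i \<tau>)" for \<rho>
    proof -
      have r: "singular_simplex (k - 1) N \<rho>" "simplex_map (k - 1) q \<rho> = singular_face k i \<tau>"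
        using \<rho> by (auto simp: simplex_lifts_def)
      have "q (\<rho> vertex0) = \<tau> ?v" using simplex_map_apply[of vertex0 "k - 1" q \<rho>] r(2)
        by (simp add: singular_face_def)
      then obtain \<sigma> where \<sigma>: "singular_simplex k N \<sigma>" "simplex_map k q \<sigma> = \<tau>" "\<sigma> ?v = \<rho> vertex0"
        using simplex_lift_ex[OF cov \<tau> v] singular_simplex_value[OF r(1)] by (metis vertex0_in)
      then have L: "\<sigma> \<in> simplex_lifts k N q \<tau>" by (simp add: simplex_lifts_def)
      have f: "singular_simplex (k - 1) N (singular_face k i \<sigma>)"
        "simplex_map (k - 1) q (singular_face k i \<sigma>) = singular_face k i \<tau>"
        using ff[OF L] by (simp_all add: simplex_lifts_def)
      have "\<rho> vertex0 = singular_face k i \<sigma> vertex0" using \<sigma>(3) fv by simp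
      from simplex_lift_unique[OF cov r(1) f(1) _ vertex0_in this] have "\<rho> = singular_face k i \<sigma>"
        using r(2) f(2) by simp
      then show ?thesis using L by blast
    qed
  qed (use ff in auto)
qed

lemma frag_cmul_diff_distrib2: "frag_cmul c (a - b) = frag_cmul c a - frag_cmul c b"
  by (metis add_diff_cancel diff_add_cancel frag_cmul_distrib2)

text \<open>The classical wrong-way map. A sum over an infinite set is 0 by default, so its
  properties as a chain map are stated for finitely many sheets.\<close>

definition transfer :: "nat \<Rightarrow> 'b topology \<Rightarrow> ('b \<Rightarrow> 'a) \<Rightarrow> 'a chain \<Rightarrow> 'b chain" where
  "transfer k N q = frag_extend (\<lambda>\<tau>. \<Sum>\<sigma>\<in>simplex_lifts k N q \<tau>. frag_of \<sigma>)"

lemma transfer_simps [simp]: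
  "transfer k N q 0 = 0" "transfer k N q (a + b) = transfer k N q a + transfer k N q b"
  "transfer k N q (a - b) = transfer k N q a - transfer k N q b"
  "transfer k N q (- a) = - transfer k N q a"
  "transfer k N q (frag_cmul m a) = frag_cmul m (transfer k N q a)"
  "transfer k N q (frag_of \<tau>) = (\<Sum>\<sigma>\<in>simplex_lifts k N q \<tau>. frag_of \<sigma>)"
  by (auto simp: transfer_def frag_extend_add frag_extend_diff frag_extend_cmul frag_extend_minus)

lemma transfer_sum: "finite I \<Longrightarrow> transfer k N q (\<Sum>i\<in>I. g i) = (\<Sum>i\<in>I. transfer k N q (g i))"
  by (simp add: transfer_def frag_extend_sum o_def)

lemma singular_chain_induct [consumes 1, case_names zero one diff]:
  assumes "singular_chain k X c" "P 0" "\<And>\<sigma>. singular_simplex k X \<sigma> \<Longrightarrow> P (frag_of \<sigma>)"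
    "\<And>a b. singular_chain k X a \<Longrightarrow> singular_chain k X b \<Longrightarrow> P a \<Longrightarrow> P b \<Longrightarrow> P (a - b)"
  shows "P c"
proof -
  have "singular_chain k X c \<and> P c"
  proof (rule frag_induction[of c "singular_simplex_set k X"])
    show "Poly_Mapping.keys c \<subseteq> singular_simplex_set k X" using assms(1) by (simp add: singular_chain_def)
  qed (use assms in \<open>auto simp: singular_chain_of intro: singular_chain_diff\<close>)
  then show ?thesis ..
qed

lemma singular_chain_transfer:
  assumes "singular_chain k (subtopology M S) c"
  shows "singular_chain k (subtopology N (q -` S)) (transfer k N q c)"
  using assms
proof (induction rule: singular_chain_induct)
  case (one \<tau>)
  have "singular_chain k (subtopology N (q -` S)) (frag_of \<sigma>)" if "\<sigma> \<in> simplex_lifts k N q \<tau>" for \<sigma>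
  proof -
    have \<sigma>: "singular_simplex k N \<sigma>" "simplex_map k q \<sigma> = \<tau>" using that by (auto simp: simplex_lifts_def)
    have "\<tau> ` standard_simplex k \<subseteq> S" using one by (simp add: singular_simplex_subtopology)
    then have "\<sigma> ` standard_simplex k \<subseteq> q -` S" using \<sigma>(2) simplex_map_apply[of _ k q \<sigma>] by auto
    then show ?thesis using \<sigma>(1) by (simp add: singular_chain_of singular_simplex_subtopology)
  qed
  then show ?case by (simp add: singular_chain_sum)
qed (auto simp: singular_chain_diff)

lemma singular_chain_transfer':
  assumes "singular_chain k M c"
  shows "singular_chain k N (transfer k N q c)"
  using singular_chain_transfer[of k M UNIV c N q] assms by simp

locale finite_sheeted_covering =
  fixes N :: "'b topology" and M :: "'a topology" and q :: "'b \<Rightarrow> 'a" and d :: nat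
  assumes cov: "covering_map N M q" and sheets: "sheeted d N M q"
begin

lemma finite_simplex_lifts:
  assumes "singular_simplex k M \<tau>"
  shows "finite (simplex_lifts k N q \<tau>)" "card (simplex_lifts k N q \<tau>) = d"
proof -
  have "\<tau> vertex0 \<in> topspace M" using singular_simplex_value[OF assms] by simp
  then have "finite {y \<in> topspace N. q y = \<tau> vertex0}" "card {y \<in> topspace N. q y = \<tau> vertex0} = d"
    using sheets by (auto simp: sheeted_def)
  then show "finite (simplex_lifts k N q \<tau>)" "card (simplex_lifts k N q \<tau>) = d"
    using bij_betw_finite[OF simplex_lifts_bij[OF cov assms vertex0_in]]
      bij_betw_same_card[OF simplex_lifts_bij[OF cov assms vertex0_in]] by simp_all
qed

lemma chain_boundary_transfer:
  assumes "singular_chain k M c"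
  shows "chain_boundary k (transfer k N q c) = transfer (k - 1) N q (chain_boundary k c)"
proof (cases "k = 0")
  case True then show ?thesis by (simp add: chain_boundary_def)
next
  case False
  show ?thesis using assms
  proof (induction rule: singular_chain_induct)
    case (one \<tau>)
    note fin = finite_simplex_lifts(1)[OF one]
    have "chain_boundary k (transfer k N q (frag_of \<tau>)) = (\<Sum>\<sigma>\<in>simplex_lifts k N q \<tau>. chain_boundary k (frag_of \<sigma>))"
      by (simp add: chain_boundary_sum o_def)
    also have "\<dots> = (\<Sum>\<sigma>\<in>simplex_lifts k N q \<tau>. \<Sum>i\<le>k. frag_cmul ((-1) ^ i) (frag_of (singular_face k i \<sigma>)))"
      using False by (simp add: chain_boundary_of)
    also have "\<dots> = (\<Sum>i\<le>k. \<Sum>\<sigma>\<in>simplex_lifts k N q \<tau>. frag_cmul ((-1) ^ i) (frag_of (singular_face k i \<sigma>)))"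
      by (rule sum.swap)
    also have "\<dots> = (\<Sum>i\<le>k. frag_cmul ((-1) ^ i) (transfer (k - 1) N q (frag_of (singular_face k i \<tau>))))"
    proof (intro sum.cong refl)
      fix i assume i: "i \<in> {..k}"
      have "(\<Sum>\<sigma>\<in>simplex_lifts k N q \<tau>. frag_of (singular_face k i \<sigma>)) =
          (\<Sum>\<rho>\<in>simplex_lifts (k - 1) N q (singular_face k i \<tau>). frag_of \<rho>)"
        by (rule sum.reindex_bij_betw[OF simplex_lifts_face_bij[OF cov one]]) (use False i in auto)
      then show "(\<Sum>\<sigma>\<in>simplex_lifts k N q \<tau>. frag_cmul ((-1) ^ i) (frag_of (singular_face k i \<sigma>))) =
         frag_cmul ((-1) ^ i) (transfer (k - 1) N q (frag_of (singular_face k i \<tau>)))"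
        using frag_cmul_sum[of "(-1) ^ i" "\<lambda>\<sigma>. frag_of (singular_face k i \<sigma>)" "simplex_lifts k N q \<tau>"] by simp
    qed
    also have "\<dots> = transfer (k - 1) N q (chain_boundary k (frag_of \<tau>))"
      using False by (simp add: chain_boundary_of transfer_sum)
    finally show ?case .
  qed (auto simp: chain_boundary_diff)
qed

lemma chain_map_transfer:
  assumes "singular_chain k M c"
  shows "chain_map k q (transfer k N q c) = frag_cmul (int d) c"
  using assms
proof (induction rule: singular_chain_induct)
  case (one \<tau>)
  note fin = finite_simplex_lifts[OF one]
  have "chain_map k q (transfer k N q (frag_of \<tau>)) = (\<Sum>\<sigma>\<in>simplex_lifts k N q \<tau>. frag_of \<tau>)"
    by (simp add: chain_map_sum o_def fin) (simp add: simplex_lifts_def)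
  also have "\<dots> = frag_cmul (int d) (frag_of \<tau>)"
  proof -
    have "(\<Sum>i\<in>A. frag_of \<tau>) = frag_cmul (int (card A)) (frag_of \<tau>)" if "finite A" for A :: "((nat \<Rightarrow> real) \<Rightarrow> 'b) set"
      using that by (induction A rule: finite_induct) (auto simp: frag_cmul_distrib)
    then show ?thesis using fin by simp
  qed
  finally show ?case .
qed (auto simp: chain_map_diff frag_cmul_diff_distrib2)

lemma singular_relcycle_transfer:
  assumes "singular_relcycle k M S c"
  shows "singular_relcycle k N (q -` S) (transfer k N q c)"
  using assms chain_boundary_transfer singular_chain_transfer[of "k - 1" M S _ N q] singular_chain_transfer'
  unfolding singular_relcycle by metis

lemma singular_relboundary_transfer:
  assumes "singular_relboundary k M S c"
  shows "singular_relboundary k N (q -` S) (transfer k N q c)"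
proof -
  obtain b e where b: "singular_chain (Suc k) M b" "singular_chain k (subtopology M S) e" "chain_boundary (Suc k) b + e = c"
    using assms unfolding singular_relboundary by blast
  have "chain_boundary (Suc k) (transfer (Suc k) N q b) + transfer k N q e = transfer k N q c"
    using chain_boundary_transfer[OF b(1)] b(3) by auto
  then show ?thesis unfolding singular_relboundary
    using singular_chain_transfer'[OF b(1)] singular_chain_transfer[OF b(2)] by blast
qed

lemma homologous_rel_transfer:
  assumes "homologous_rel k M S a b"
  shows "homologous_rel k N (q -` S) (transfer k N q a) (transfer k N q b)"
  using singular_relboundary_transfer[of k S "a - b"] assms by (simp add: homologous_rel_def)

text \<open>By \<open>bij\<close> the maps \<open>l i\<close> run through all lifts of
  \<open>r\<close>, hence their composites with a simplex run through all lifts of its image. It is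
  used with the universal covering as \<open>A\<close>: once for inverse deck transformations, once
  for the lifts to the sphere.\<close>

lemma transfer_chain_map:
  assumes r: "continuous_map A M r" and l: "\<And>i. i \<in> I \<Longrightarrow> continuous_map A N (l i)"
    and ql: "\<And>i a. i \<in> I \<Longrightarrow> a \<in> topspace A \<Longrightarrow> q (l i a) = r a"
    and bij: "\<And>a. a \<in> topspace A \<Longrightarrow> bij_betw (\<lambda>i. l i a) I {y \<in> topspace N. q y = r a}"
    and z: "singular_chain k A z"
  shows "transfer k N q (chain_map k r z) = (\<Sum>i\<in>I. chain_map k (l i) z)"
  using z
proof (induction rule: singular_chain_induct)
  case (one \<sigma>)
  have v: "\<sigma> vertex0 \<in> topspace A" using singular_simplex_value[OF one] by simp
  have "bij_betw (\<lambda>i. simplex_map k (l i) \<sigma>) I (simplex_lifts k N q (simplex_map k r \<sigma>))"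
  proof (rule bij_betwI')
    have si: "simplex_map k (l i) \<sigma> vertex0 = l i (\<sigma> vertex0)" for i by (simp add: simplex_map_apply)
    show "(simplex_map k (l i) \<sigma> = simplex_map k (l j) \<sigma>) = (i = j)" if "i \<in> I" "j \<in> I" for i j
      using si that bij[OF v] by (metis bij_betw_inv_into_left)
    show mem: "simplex_map k (l i) \<sigma> \<in> simplex_lifts k N q (simplex_map k r \<sigma>)" if i: "i \<in> I" for i
    proof -
      have "simplex_map k q (simplex_map k (l i) \<sigma>) = simplex_map k r \<sigma>"
        using singular_simplex_value[OF one] ql[OF i] by (auto simp: simplex_map_def)
      then show ?thesis using singular_simplex_simplex_map[OF one l[OF i]] by (simp add: simplex_lifts_def)
    qed
    show "\<exists>i\<in>I. \<rho> = simplex_map k (l i) \<sigma>" if \<rho>: "\<rho> \<in> simplex_lifts k N q (simplex_map k r \<sigma>)" for \<rho>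
    proof -
      have r: "singular_simplex k N \<rho>" "simplex_map k q \<rho> = simplex_map k r \<sigma>" using \<rho> by (auto simp: simplex_lifts_def)
      have "q (\<rho> vertex0) = r (\<sigma> vertex0)" using r(2) simplex_map_apply[OF vertex0_in] by metis
      then have "\<rho> vertex0 \<in> {y \<in> topspace N. q y = r (\<sigma> vertex0)}" using singular_simplex_value[OF r(1)] by simp
      then have "\<rho> vertex0 \<in> (\<lambda>i. l i (\<sigma> vertex0)) ` I" using bij[OF v] by (simp add: bij_betw_def)
      then obtain i where i: "\<rho> vertex0 = l i (\<sigma> vertex0)" "i \<in> I" by (rule imageE)
      have m: "singular_simplex k N (simplex_map k (l i) \<sigma>)" "simplex_map k q (simplex_map k (l i) \<sigma>) = simplex_map k r \<sigma>"
        using mem[OF i(2)] by (auto simp: simplex_lifts_def)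
      have "\<rho> = simplex_map k (l i) \<sigma>"
        by (rule simplex_lift_unique[OF cov r(1) m(1) _ vertex0_in]) (use m r i si in simp_all)
      then show ?thesis using i by blast
    qed
  qed
  from sum.reindex_bij_betw[OF this, of frag_of] show ?case by simp
qed (auto simp: chain_map_diff sum_subtractf)

end

lemma finite_cover_locale:
  "finite_cover d N M q \<Longrightarrow> finite_sheeted_covering N M q d"
  by (simp add: finite_sheeted_covering_def finite_cover_covering) (simp add: finite_cover_def)

section \<open>Generators of homology groups\<close>

text \<open>Generation of a relative homology group, phrased for representing cycles so that chains
  can be manipulated without passing to cosets.\<close>

definition hgen :: "nat \<Rightarrow> 'a topology \<Rightarrow> 'a set \<Rightarrow> 'a chain \<Rightarrow> bool" where
  "hgen k X S z \<longleftrightarrow> singular_relcycle k X S z \<and>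
     (\<forall>w. singular_relcycle k X S w \<longrightarrow> (\<exists>m. homologous_rel k X S w (frag_cmul m z)))"

lemma homologous_rel_cmul:
  "homologous_rel k X S a b \<Longrightarrow> homologous_rel k X S (frag_cmul m a) (frag_cmul m b)"
  using singular_relboundary_cmul[of k X S "a - b" m]
  by (simp add: homologous_rel_def frag_cmul_diff_distrib2)

lemma homologous_rel_0: "homologous_rel k X S c 0 \<longleftrightarrow> singular_relboundary k X S c"
  by (simp add: homologous_rel_def)

lemma hgen_homologous:
  assumes "hgen k X S z" "homologous_rel k X S z z'"
  shows "hgen k X S z'"
  unfolding hgen_def
proof (intro conjI allI impI)
  show "singular_relcycle k X S z'" using assms(1) homologous_rel_singular_relcycle[OF assms(2)] by (simp add: hgen_def)
  fix w assume "singular_relcycle k X S w"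
  then obtain m where "homologous_rel k X S w (frag_cmul m z)" using assms by (auto simp: hgen_def)
  then show "\<exists>m. homologous_rel k X S w (frag_cmul m z')"
    using homologous_rel_cmul[OF assms(2)] homologous_rel_trans by blast
qed

lemma homologous_rel_id_sub:
  assumes "homologous_rel k X S a b" "S \<subseteq> T"
  shows "homologous_rel k X T a b"
proof -
  obtain d e where d: "singular_chain (Suc k) X d" "singular_chain k (subtopology X S) e" "chain_boundary (Suc k) d + e = a - b"
    using assms(1) unfolding homologous_rel_def singular_relboundary by blast
  have "singular_chain k (subtopology X T) e" using d(2) assms(2) by (auto simp: singular_chain_subtopology)
  then show ?thesis using d unfolding homologous_rel_def singular_relboundary by blast
qed

lemma singular_relcycle_sub:
  assumes "singular_relcycle k X S a" "S \<subseteq> T"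
  shows "singular_relcycle k X T a"
  using assms unfolding singular_relcycle by (auto simp: singular_chain_subtopology)

lemma homologous_rel_sub_zero:
  assumes "singular_chain k (subtopology X S) e"
  shows "homologous_rel k X S (a + e) a"
  using assms unfolding homologous_rel_def by (simp add: singular_chain_imp_relboundary)

lemma homologous_rel_chain_map:
  assumes "homologous_rel k X S a b" "continuous_map X Y g" "g \<in> S \<rightarrow> T"
  shows "homologous_rel k Y T (chain_map k g a) (chain_map k g b)"
  using singular_relboundary_chain_map[of k X S "a - b" Y g T] assms
  by (simp add: homologous_rel_def chain_map_diff)

section \<open>Isomorphisms of homology on the level of cycles\<close>

text \<open>Excision, homeomorphisms and exact sequences provide isomorphisms of groups of cosets;
  \<open>surj\<close>, \<open>inj\<close> and \<open>hgen_iff\<close> extract from them what is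
  needed about cycles.\<close>

locale homology_iso =
  fixes k :: nat and X :: "'a topology" and S and Y :: "'b topology" and T and f
  assumes iso: "hom_induced (int k) X S Y T f \<in> Group.iso (relative_homology_group (int k) X S) (relative_homology_group (int k) Y T)"
    and cf: "continuous_map X Y f" and fST: "f \<in> S \<rightarrow> T"
begin

lemma surj:
  assumes "singular_relcycle k Y T w"
  obtains w' where "singular_relcycle k X S w'" "homologous_rel k Y T w (chain_map k f w')"
proof -
  have "homologous_rel_set k Y T w \<in> carrier (relative_homology_group (int k) Y T)"
    using assms by (simp add: carrier_relative_homology_group)
  then have "homologous_rel_set k Y T w \<in> hom_induced (int k) X S Y T f ` carrier (relative_homology_group (int k) X S)"
    using iso by (simp add: iso_def bij_betw_def)
  then obtain w' where w': "singular_relcycle k X S w'"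
      "homologous_rel_set k Y T w = hom_induced (int k) X S Y T f (homologous_rel_set k X S w')"
    by (auto simp: carrier_relative_homology_group)
  then have "homologous_rel_set k Y T w = homologous_rel_set k Y T (chain_map k f w')"
    using hom_induced_chain_map[OF cf fST w'(1)] by simp
  then show thesis using that w'(1) homologous_rel_set_eq by blast
qed

lemma inj:
  assumes "singular_relcycle k X S a" "singular_relcycle k X S b"
    "homologous_rel k Y T (chain_map k f a) (chain_map k f b)"
  shows "homologous_rel k X S a b"
proof -
  have "hom_induced (int k) X S Y T f (homologous_rel_set k X S a) = hom_induced (int k) X S Y T f (homologous_rel_set k X S b)"
    using hom_induced_chain_map[OF cf fST] assms homologous_rel_set_eq by metis
  moreover have "inj_on (hom_induced (int k) X S Y T f) (carrier (relative_homology_group (int k) X S))"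
    using iso by (simp add: iso_def bij_betw_def)
  ultimately have "homologous_rel_set k X S a = homologous_rel_set k X S b"
    using assms by (auto simp: carrier_relative_homology_group inj_on_def)
  then show ?thesis using homologous_rel_set_eq by blast
qed

lemma hgen_iff:
  assumes "singular_relcycle k X S z"
  shows "hgen k Y T (chain_map k f z) \<longleftrightarrow> hgen k X S z"
proof
  assume h: "hgen k Y T (chain_map k f z)"
  show "hgen k X S z" unfolding hgen_def
  proof (intro conjI allI impI assms)
    fix w assume w: "singular_relcycle k X S w"
    have "singular_relcycle k Y T (chain_map k f w)" using singular_relcycle_chain_map[OF w cf fST] .
    then obtain m where "homologous_rel k Y T (chain_map k f w) (frag_cmul m (chain_map k f z))"
      using h by (auto simp: hgen_def)
    then have "homologous_rel k X S w (frag_cmul m z)"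
      by (intro inj w singular_relcycle_cmul assms) simp
    then show "\<exists>m. homologous_rel k X S w (frag_cmul m z)" by blast
  qed
next
  assume h: "hgen k X S z"
  show "hgen k Y T (chain_map k f z)" unfolding hgen_def
  proof (intro conjI allI impI singular_relcycle_chain_map[OF assms cf fST])
    fix w assume "singular_relcycle k Y T w"
    then obtain w' where w': "singular_relcycle k X S w'" "homologous_rel k Y T w (chain_map k f w')"
      by (rule surj)
    then obtain m where "homologous_rel k X S w' (frag_cmul m z)" using h by (auto simp: hgen_def)
    from homologous_rel_chain_map[OF this cf fST]
    have "homologous_rel k Y T (chain_map k f w') (frag_cmul m (chain_map k f z))" by simp
    then show "\<exists>m. homologous_rel k Y T w (frag_cmul m (chain_map k f z))"
      using w'(2) homologous_rel_trans by blast
  qed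
qed

end

lemma homology_isoI:
  assumes "hom_induced (int k) X S Y T f \<in> Group.iso (relative_homology_group (int k) X S) (relative_homology_group (int k) Y T)"
    "continuous_map X Y f" "f \<in> S \<rightarrow> T"
  shows "homology_iso k X S Y T f"
  using assms by (simp add: homology_iso_def)

lemma chain_map_id_singular: "singular_chain k X c \<Longrightarrow> chain_map k id c = c"
  using chain_map_id_gen[of k X c id] by simp

lemma homology_class_mult:
  assumes "singular_relcycle k X S a" "singular_relcycle k X S b"
  shows "homologous_rel_set k X S a \<otimes>\<^bsub>relative_homology_group (int k) X S\<^esub> homologous_rel_set k X S b
    = homologous_rel_set k X S (a + b)"
proof -
  have "(\<Union>r\<in>homologous_rel_set k X S a. \<Union>s\<in>homologous_rel_set k X S b. {r + s}) = homologous_rel_set k X S (a + b)"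
  proof
    show "(\<Union>r\<in>homologous_rel_set k X S a. \<Union>s\<in>homologous_rel_set k X S b. {r + s}) \<subseteq> homologous_rel_set k X S (a + b)"
      using homologous_rel_add by blast
    show "homologous_rel_set k X S (a + b) \<subseteq> (\<Union>r\<in>homologous_rel_set k X S a. \<Union>s\<in>homologous_rel_set k X S b. {r + s})"
    proof
      fix h assume "h \<in> homologous_rel_set k X S (a + b)"
      then have "homologous_rel k X S b (h - a)" by (simp add: homologous_rel_def algebra_simps)
      moreover have "h = a + (h - a)" by simp
      ultimately show "h \<in> (\<Union>r\<in>homologous_rel_set k X S a. \<Union>s\<in>homologous_rel_set k X S b. {r + s})"
        using homologous_rel_refl by (metis (mono_tags, lifting) UN_iff mem_Collect_eq singletonI)
    qed
  qed
  then show ?thesis by (simp add: mult_relative_homology_group)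
qed

lemma homology_class_inv:
  assumes "singular_relcycle k X S a"
  shows "inv\<^bsub>relative_homology_group (int k) X S\<^esub> homologous_rel_set k X S a = homologous_rel_set k X S (- a)"
proof (rule group.inv_equality[OF group_relative_homology_group])
  show "homologous_rel_set k X S (- a) \<otimes>\<^bsub>relative_homology_group (int k) X S\<^esub> homologous_rel_set k X S a = \<one>\<^bsub>relative_homology_group (int k) X S\<^esub>"
    using homology_class_mult[of k X S "- a" a] assms singular_relcycle_minus[of k X S a]
      homologous_rel_set_eq_relboundary[of k X S 0] by simp
qed (use assms singular_relcycle_minus[of k X S a] in \<open>auto simp: carrier_relative_homology_group\<close>)

lemma generate_homology_class:
  assumes z: "singular_relcycle k X S z"
  shows "generate (relative_homology_group (int k) X S) {homologous_rel_set k X S z}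
    = {homologous_rel_set k X S (frag_cmul m z) | m. True}"
proof -
  let ?H = "relative_homology_group (int k) X S" and ?c = "\<lambda>m. homologous_rel_set k X S (frag_cmul m z)"
  have cm: "singular_relcycle k X S (frag_cmul m z)" for m using z by (rule singular_relcycle_cmul)
  have mul: "?c m \<otimes>\<^bsub>?H\<^esub> ?c m' = ?c (m + m')" for m m'
    using homology_class_mult[OF cm cm] by (simp add: frag_cmul_distrib)
  have one: "\<one>\<^bsub>?H\<^esub> = ?c 0"
    using homologous_rel_set_eq_relboundary[of k X S 0] by simp
  have inv: "inv\<^bsub>?H\<^esub> ?c m = ?c (- m)" for m
    using homology_class_inv[OF cm, of m] by (metis frag_cmul_minus_one frag_cmul_cmul mult_minus1)
  have c1: "?c 1 = homologous_rel_set k X S z" by simp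
  show ?thesis
  proof
    show "generate ?H {homologous_rel_set k X S z} \<subseteq> {?c m | m. True}"
    proof
      fix h assume "h \<in> generate ?H {homologous_rel_set k X S z}"
      then show "h \<in> {?c m | m. True}"
      proof induction
        case one then show ?case using \<open>\<one>\<^bsub>?H\<^esub> = ?c 0\<close> by blast
      next
        case (incl h)
        then have "h = ?c 1" by simp
        then show ?case by blast
      next
        case (inv h)
        then have "h = ?c 1" by simp
        then have "inv\<^bsub>?H\<^esub> h = ?c (-1)" using \<open>\<And>m. inv\<^bsub>?H\<^esub> ?c m = ?c (- m)\<close> by blast
        then show ?case by blast
      next
        case (eng h1 h2)
        then obtain m m' where "h1 = ?c m" "h2 = ?c m'" by blast
        then have "h1 \<otimes>\<^bsub>?H\<^esub> h2 = ?c (m + m')" using mul by blast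
        then show ?case by blast
      qed
    qed
    have pos: "?c (int m) \<in> generate ?H {homologous_rel_set k X S z}" for m
    proof (induction m)
      case 0 then show ?case using generate.one[of ?H] one by simp
    next
      case (Suc m)
      have "homologous_rel_set k X S z \<in> generate ?H {homologous_rel_set k X S z}" by (rule generate.incl) simp
      from generate.eng[OF Suc this] have "?c (int m) \<otimes>\<^bsub>?H\<^esub> ?c 1 \<in> generate ?H {homologous_rel_set k X S z}" by simp
      then show ?case unfolding mul by (simp add: add.commute)
    qed
    have neg: "?c (- int m) \<in> generate ?H {homologous_rel_set k X S z}" for m
    proof (induction m)
      case 0 then show ?case using generate.one[of ?H] one by simp
    next
      case (Suc m)
      have "inv\<^bsub>?H\<^esub> (homologous_rel_set k X S z) \<in> generate ?H {homologous_rel_set k X S z}" by (rule generate.inv) simp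
      then have "?c (-1) \<in> generate ?H {homologous_rel_set k X S z}" using inv[of 1] c1 by simp
      from generate.eng[OF Suc this] have "?c (- int m + -1) \<in> generate ?H {homologous_rel_set k X S z}" unfolding mul .
      moreover have "- int m + -1 = - int (Suc m)" by simp
      ultimately show ?case by (simp only:)
    qed
    show "{?c m | m. True} \<subseteq> generate ?H {homologous_rel_set k X S z}"
    proof clarify
      fix m :: int
      show "?c m \<in> generate ?H {homologous_rel_set k X S z}"
        using pos[of "nat m"] neg[of "nat (- m)"] by (cases "m \<ge> 0") auto
    qed
  qed
qed

lemma generate_iff_hgen:
  assumes z: "singular_relcycle k X S z"
  shows "carrier (relative_homology_group (int k) X S) = generate (relative_homology_group (int k) X S) {homologous_rel_set k X S z}
    \<longleftrightarrow> hgen k X S z"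
  unfolding generate_homology_class[OF z] carrier_relative_homology_group
proof
  assume eq: "homologous_rel_set k X S ` singular_relcycle_set k X S = {homologous_rel_set k X S (frag_cmul m z) | m. True}"
  show "hgen k X S z" unfolding hgen_def
  proof (intro conjI z allI impI)
    fix w assume "singular_relcycle k X S w"
    then have "homologous_rel_set k X S w \<in> {homologous_rel_set k X S (frag_cmul m z) | m. True}"
      unfolding eq[symmetric] by blast
    then obtain m where "homologous_rel_set k X S w = homologous_rel_set k X S (frag_cmul m z)" by blast
    then show "\<exists>m. homologous_rel k X S w (frag_cmul m z)" using homologous_rel_set_eq by blast
  qed
next
  assume h: "hgen k X S z"
  show "homologous_rel_set k X S ` singular_relcycle_set k X S = {homologous_rel_set k X S (frag_cmul m z) | m. True}"
  proof
    show "homologous_rel_set k X S ` singular_relcycle_set k X S \<subseteq> {homologous_rel_set k X S (frag_cmul m z) | m. True}"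
    proof clarify
      fix w assume "singular_relcycle k X S w"
      then obtain m where "homologous_rel k X S w (frag_cmul m z)" using h by (auto simp: hgen_def)
      then have "homologous_rel_set k X S w = homologous_rel_set k X S (frag_cmul m z)" using homologous_rel_set_eq by blast
      then show "\<exists>m. homologous_rel_set k X S w = homologous_rel_set k X S (frag_cmul m z) \<and> True" by blast
    qed
    show "{homologous_rel_set k X S (frag_cmul m z) | m. True} \<subseteq> homologous_rel_set k X S ` singular_relcycle_set k X S"
      using singular_relcycle_cmul[OF z] by blast
  qed
qed

text \<open>The form in which fundamental classes are used from here on: one representative, chosen
  at will, generates the local homology at every point.\<close>

lemma fundamental_class_iff:
  assumes z: "z \<in> c"
  shows "fundamental_class n M c \<longleftrightarrow> singular_relcycle n M {} z \<and> c = homologous_rel_set n M {} z \<and>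
     (\<forall>x\<in>topspace M. hgen n M (topspace M - {x}) z)"
proof -
  have carr: "c \<in> carrier (homology_group (int n) M) \<longleftrightarrow> singular_relcycle n M {} z \<and> c = homologous_rel_set n M {} z"
  proof
    assume "c \<in> carrier (homology_group (int n) M)"
    then obtain w where w: "singular_relcycle n M {} w" "c = homologous_rel_set n M {} w"
      by (auto simp: carrier_relative_homology_group)
    then have "homologous_rel n M {} w z" using z by blast
    then show "singular_relcycle n M {} z \<and> c = homologous_rel_set n M {} z"
      using w homologous_rel_singular_relcycle homologous_rel_set_eq by blast
  qed (auto simp: carrier_relative_homology_group)
  have "(let H = relative_homology_group (int n) M (topspace M - {x})
        in carrier H = generate H {hom_induced (int n) M {} M (topspace M - {x}) id c}) \<longleftrightarrow> hgen n M (topspace M - {x}) z"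
    if "singular_relcycle n M {} z" "c = homologous_rel_set n M {} z" for x
  proof -
    have "chain_map n id z = z" using that(1) chain_map_id_singular by (auto simp: singular_relcycle)
    then have "hom_induced (int n) M {} M (topspace M - {x}) id c = homologous_rel_set n M (topspace M - {x}) z"
      using hom_induced_chain_map[of M M id "{}" "topspace M - {x}" n z] that by simp
    then show ?thesis
      using generate_iff_hgen[OF singular_relcycle_sub[OF that(1)]] by (simp add: Let_def)
  qed
  then show ?thesis unfolding fundamental_class_def using carr by blast
qed

lemma fundamental_class_nonempty:
  assumes "fundamental_class n M c"
  obtains z where "z \<in> c"
proof -
  obtain w where w: "singular_relcycle n M {} w" "c = homologous_rel_set n M {} w"
    using assms by (auto simp: fundamental_class_def carrier_relative_homology_group)
  then show thesis using that[of w] by simp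
qed

section \<open>Infinite cyclic homology groups\<close>

lemma integer_homology_coordinate:
  assumes "relative_homology_group (int k) X S \<cong> integer_group"
  obtains \<phi> where "\<And>a b. singular_relcycle k X S a \<Longrightarrow> singular_relcycle k X S b \<Longrightarrow> \<phi> (a + b) = \<phi> a + (\<phi> b :: int)"
    "\<And>a b. singular_relcycle k X S a \<Longrightarrow> singular_relcycle k X S b \<Longrightarrow> \<phi> a = \<phi> b \<longleftrightarrow> homologous_rel k X S a b"
    "\<And>m. \<exists>a. singular_relcycle k X S a \<and> \<phi> a = m"
    "\<And>a m. singular_relcycle k X S a \<Longrightarrow> \<phi> (frag_cmul m a) = m * \<phi> a"
proof -
  let ?H = "relative_homology_group (int k) X S"
  obtain h where h: "h \<in> Group.iso ?H integer_group" using assms by (auto simp: is_iso_def)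
  define \<phi> where "\<phi> = (\<lambda>a. h (homologous_rel_set k X S a))"
  have hb: "bij_betw h (carrier ?H) UNIV" and hm: "\<And>x y. x \<in> carrier ?H \<Longrightarrow> y \<in> carrier ?H \<Longrightarrow> h (x \<otimes>\<^bsub>?H\<^esub> y) = h x + h y"
    using h by (auto simp: iso_def hom_def integer_group_def)
  have c: "homologous_rel_set k X S a \<in> carrier ?H" if "singular_relcycle k X S a" for a
    using that by (simp add: carrier_relative_homology_group)
  have add: "\<phi> (a + b) = \<phi> a + \<phi> b" if "singular_relcycle k X S a" "singular_relcycle k X S b" for a b
    unfolding \<phi>_def homology_class_mult[OF that, symmetric] by (rule hm[OF c[OF that(1)] c[OF that(2)]])
  have zero: "\<phi> 0 = 0" using add[of 0 0] by simp
  have neg: "\<phi> (- a) = - \<phi> a" if "singular_relcycle k X S a" for a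
    using add[of "- a" a] that zero singular_relcycle_minus[of k X S a] by (simp add: eq_neg_iff_add_eq_0)
  have nat: "\<phi> (frag_cmul (int m) a) = int m * \<phi> a" if a: "singular_relcycle k X S a" for a m
  proof (induction m)
    case (Suc m)
    have "frag_cmul (int (Suc m)) a = a + frag_cmul (int m) a" by (simp add: frag_cmul_distrib)
    then show ?case using add[OF a singular_relcycle_cmul[OF a]] Suc by (simp add: algebra_simps)
  qed (simp add: zero)
  show thesis
  proof (rule that[of \<phi>])
    show "\<phi> a = \<phi> b \<longleftrightarrow> homologous_rel k X S a b" if "singular_relcycle k X S a" "singular_relcycle k X S b" for a b
      using hb c[OF that(1)] c[OF that(2)] homologous_rel_set_eq[of k X S a b]
      by (auto simp: \<phi>_def bij_betw_def inj_on_def)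
    show "\<exists>a. singular_relcycle k X S a \<and> \<phi> a = m" for m
    proof -
      have "m \<in> h ` carrier ?H" using hb by (simp add: bij_betw_def)
      then show ?thesis by (auto simp: carrier_relative_homology_group \<phi>_def)
    qed
    show "\<phi> (frag_cmul m a) = m * \<phi> a" if a: "singular_relcycle k X S a" for a m
    proof (cases "m \<ge> 0")
      case True then show ?thesis using nat[OF a, of "nat m"] by simp
    next
      case False
      have "frag_cmul m a = - frag_cmul (- m) a" by (metis frag_cmul_minus_one frag_cmul_cmul minus_mult_minus mult_1)
      then show ?thesis using neg[OF singular_relcycle_cmul[OF a]] nat[OF a, of "nat (- m)"] False by simp
    qed
  qed (fact add)
qed

text \<open>With \<open>\<phi>\<close> as integer coordinate of a cycle, generators are the cycles
  with coordinate 1 or -1, and no nonzero multiple of them has coordinate 0.\<close>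

lemma integer_homology_hgen:
  assumes iso: "relative_homology_group (int k) X S \<cong> integer_group"
  shows "\<exists>z. hgen k X S z"
    and "hgen k X S z \<Longrightarrow> singular_relboundary k X S (frag_cmul m z) \<Longrightarrow> m = 0"
    and "hgen k X S z \<Longrightarrow> hgen k X S z' \<Longrightarrow> homologous_rel k X S z z' \<or> homologous_rel k X S z (- z')"
proof -
  obtain \<phi> where add: "\<And>a b. singular_relcycle k X S a \<Longrightarrow> singular_relcycle k X S b \<Longrightarrow> \<phi> (a + b) = \<phi> a + (\<phi> b :: int)"
    and inj: "\<And>a b. singular_relcycle k X S a \<Longrightarrow> singular_relcycle k X S b \<Longrightarrow> \<phi> a = \<phi> b \<longleftrightarrow> homologous_rel k X S a b"
    and sur: "\<And>m. \<exists>a. singular_relcycle k X S a \<and> \<phi> a = m"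
    and mul: "\<And>a m. singular_relcycle k X S a \<Longrightarrow> \<phi> (frag_cmul m a) = m * \<phi> a"
    using integer_homology_coordinate[OF iso] by blast
  have unit: "\<bar>\<phi> z\<bar> = 1" if z: "hgen k X S z" for z
  proof -
    have zc: "singular_relcycle k X S z" using z by (simp add: hgen_def)
    obtain a where a: "singular_relcycle k X S a" "\<phi> a = 1" using sur by blast
    obtain m where "homologous_rel k X S a (frag_cmul m z)" using z a by (auto simp: hgen_def)
    then have "m * \<phi> z = 1" using inj[OF a(1) singular_relcycle_cmul[OF zc]] mul[OF zc] a(2) by metis
    then show ?thesis using zmult_eq_1_iff by (metis abs_minus_cancel abs_one)
  qed
  have zero: "\<phi> 0 = 0" using add[of 0 0] by simp
  show "\<exists>z. hgen k X S z"
  proof -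
    obtain a where a: "singular_relcycle k X S a" "\<phi> a = 1" using sur by blast
    have "hgen k X S a" unfolding hgen_def
    proof (intro conjI a(1) allI impI)
      fix w assume w: "singular_relcycle k X S w"
      have "\<phi> w = \<phi> (frag_cmul (\<phi> w) a)" using mul[OF a(1)] a(2) by simp
      then show "\<exists>m. homologous_rel k X S w (frag_cmul m a)" using inj[OF w singular_relcycle_cmul[OF a(1)]] by blast
    qed
    then show ?thesis by blast
  qed
  show "m = 0" if z: "hgen k X S z" and b: "singular_relboundary k X S (frag_cmul m z)"
  proof -
    have zc: "singular_relcycle k X S z" using z by (simp add: hgen_def)
    have "\<phi> (frag_cmul m z) = \<phi> 0"
      using inj[OF singular_relcycle_cmul[OF zc] singular_relcycle_0] b by (simp add: homologous_rel_0)
    then have "m * \<phi> z = 0" using mul[OF zc] zero by simp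
    then show "m = 0" using unit[OF z] by auto
  qed
  show "homologous_rel k X S z z' \<or> homologous_rel k X S z (- z')" if z: "hgen k X S z" "hgen k X S z'"
  proof -
    have zc: "singular_relcycle k X S z" "singular_relcycle k X S z'" using z by (auto simp: hgen_def)
    have "\<phi> (- z') = - \<phi> z'" using mul[OF zc(2), of "-1"] by simp
    moreover have "\<phi> z = \<phi> z' \<or> \<phi> z = - \<phi> z'" using unit[OF z(1)] unit[OF z(2)] by linarith
    ultimately show ?thesis using inj[OF zc] inj[OF zc(1) singular_relcycle_minus[THEN iffD2, OF zc(2)]] by auto
  qed
qed

section \<open>The simplex modulo its boundary\<close>

abbreviation Rtop :: "(nat \<Rightarrow> real) set \<Rightarrow> (nat \<Rightarrow> real) topology" where
  "Rtop C \<equiv> subtopology (powertop_real UNIV) C"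

lemma continuous_map_Rtop_iff:
  "continuous_map X (Rtop C) f \<longleftrightarrow> (\<forall>i. continuous_map X euclideanreal (\<lambda>x. f x i)) \<and> f \<in> topspace X \<rightarrow> C"
  unfolding continuous_map_in_subtopology continuous_map_componentwise_UNIV by simp

lemma continuous_map_Rtop_coord: "continuous_map (Rtop C) euclideanreal (\<lambda>x. x i)"
  by (metis UNIV_I continuous_map_from_subtopology continuous_map_product_projection)

lemma linear_homotopic:
  assumes f: "continuous_map X (Rtop C) f" and g: "continuous_map X (Rtop C) g"
    and C: "\<And>x u. x \<in> topspace X \<Longrightarrow> u \<in> {0..1} \<Longrightarrow> (\<lambda>i. (1 - u) * f x i + u * g x i) \<in> C"
    and P: "\<And>u. u \<in> {0..1} \<Longrightarrow> P (\<lambda>x i. (1 - u) * f x i + u * g x i)"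
  shows "homotopic_with P X (Rtop C) f g"
  unfolding homotopic_with_def
proof (intro exI conjI)
  let ?h = "\<lambda>z::real \<times> 'a. \<lambda>i. (1 - fst z) * f (snd z) i + fst z * g (snd z) i"
  let ?P = "prod_topology unit_top X"
  have c1: "continuous_map ?P euclideanreal fst" by (rule continuous_map_into_fulltopology[OF continuous_map_fst])
  have cf: "continuous_map ?P euclideanreal (\<lambda>z. f (snd z) i)" for i
    using continuous_map_compose[OF continuous_map_snd f, of unit_top] unfolding continuous_map_Rtop_iff o_def by blast
  have cg: "continuous_map ?P euclideanreal (\<lambda>z. g (snd z) i)" for i
    using continuous_map_compose[OF continuous_map_snd g, of unit_top] unfolding continuous_map_Rtop_iff o_def by blast
  show "continuous_map ?P (Rtop C) ?h"
    unfolding continuous_map_Rtop_iff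
  proof (intro conjI allI)
    show "continuous_map ?P euclideanreal (\<lambda>z. ?h z i)" for i
      by (intro continuous_intros c1 cf cg)
  qed (use C in auto)
qed (use P in auto)

lemma starlike_contractible:
  assumes c: "c \<in> C" and st: "\<And>t u. t \<in> C \<Longrightarrow> u \<in> {0..1} \<Longrightarrow> (\<lambda>i. (1 - u) * t i + u * c i) \<in> C"
  shows "contractible_space (Rtop C)"
proof -
  have "homotopic_with (\<lambda>x. True) (Rtop C) (Rtop C) (\<lambda>t. t) (\<lambda>_. c)"
    by (rule linear_homotopic) (use c st in \<open>auto simp: continuous_map_Rtop_iff continuous_map_Rtop_coord\<close>)
  then show ?thesis unfolding contractible_space_def id_def by blast
qed

definition std_simplex :: "nat \<Rightarrow> (nat \<Rightarrow> real) \<Rightarrow> nat \<Rightarrow> real" where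
  "std_simplex k = restrict id (standard_simplex k)"

definition simplex_bdry :: "nat \<Rightarrow> (nat \<Rightarrow> real) set" where
  "simplex_bdry k = {t \<in> standard_simplex k. \<exists>i\<le>k. t i = 0}"

lemma singular_std_simplex: "singular_simplex k (simplex_top k) (std_simplex k)"
  unfolding singular_simplex_def std_simplex_def
  by (auto intro: continuous_map_eq[of _ _ id])

lemma simplex_map_std: "simplex_map k f (std_simplex k) = restrict f (standard_simplex k)"
  by (auto simp: simplex_map_def std_simplex_def)

lemma face_std_coord:
  assumes "1 \<le> k" "i \<le> k" "t \<in> standard_simplex (k - 1)"
  shows "singular_face k i (std_simplex k) t \<in> standard_simplex k" "singular_face k i (std_simplex k) t i = 0"
  using simplical_face_in_standard_simplex[of k i t] assms
  by (auto simp: singular_face_def std_simplex_def simplical_face_def)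

lemma last_face_std:
  assumes "1 \<le> k"
  shows "singular_face k k (std_simplex k) = std_simplex (k - 1)"
proof
  fix t
  show "singular_face k k (std_simplex k) t = std_simplex (k - 1) t"
  proof (cases "t \<in> standard_simplex (k - 1)")
    case True
    then have "t j = 0" if "j \<ge> k" for j using that assms by (auto simp: standard_simplex_def)
    then have "simplical_face k t = t" by (auto simp: simplical_face_def fun_eq_iff)
    then show ?thesis using True simplical_face_in_standard_simplex[of k k t] assms
      by (auto simp: singular_face_def std_simplex_def)
  qed (auto simp: singular_face_def std_simplex_def)
qed

lemma singular_face_std_in:
  assumes "1 \<le> k" "i \<le> k" "\<And>t. t \<in> standard_simplex k \<Longrightarrow> t i = 0 \<Longrightarrow> t \<in> S"
  shows "singular_simplex (k - 1) (subtopology (simplex_top k) S) (singular_face k i (std_simplex k))"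
proof -
  have "singular_simplex (k - 1) (simplex_top k) (singular_face k i (std_simplex k))"
    using singular_simplex_singular_face[OF singular_std_simplex assms(1,2)] by simp
  moreover have "singular_face k i (std_simplex k) ` standard_simplex (k - 1) \<subseteq> S"
    using face_std_coord[OF assms(1,2)] assms(3) by blast
  ultimately show ?thesis by (rule singular_simplex_subtopology[THEN iffD2, OF conjI])
qed

lemma std_simplex_relcycle: "singular_relcycle k (simplex_top k) (simplex_bdry k) (frag_of (std_simplex k))"
  unfolding singular_relcycle
proof
  show "singular_chain k (simplex_top k) (frag_of (std_simplex k))"
    by (simp add: singular_chain_of singular_std_simplex)
  show "singular_chain (k - 1) (subtopology (simplex_top k) (simplex_bdry k)) (chain_boundary k (frag_of (std_simplex k)))"
  proof (cases "k = 0")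
    case False
    have "singular_simplex (k - 1) (subtopology (simplex_top k) (simplex_bdry k)) (singular_face k i (std_simplex k))" if "i \<le> k" for i
      by (rule singular_face_std_in) (use False that in \<open>auto simp: simplex_bdry_def\<close>)
    then show ?thesis using False
      by (simp add: chain_boundary_of) (intro singular_chain_sum singular_chain_cmul, simp add: singular_chain_of)
  qed (simp add: chain_boundary_def)
qed

lemma hgen_cmul_unit:
  assumes "hgen k X S z" "s * s = (1::int)"
  shows "hgen k X S (frag_cmul s z)"
  unfolding hgen_def
proof (intro conjI allI impI)
  show "singular_relcycle k X S (frag_cmul s z)" using assms(1) by (simp add: hgen_def singular_relcycle_cmul)
  fix w assume "singular_relcycle k X S w"
  then obtain m where m: "homologous_rel k X S w (frag_cmul m z)" using assms(1) by (auto simp: hgen_def)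
  have "frag_cmul m z = frag_cmul (m * s) (frag_cmul s z)" using assms(2) by (simp add: mult.assoc)
  then show "\<exists>m. homologous_rel k X S w (frag_cmul m (frag_cmul s z))" using m by metis
qed

lemma homology_iso_id_hgen:
  assumes "homology_iso k X S Y T id" "hgen k X S z"
  shows "hgen k Y T z"
proof -
  have "singular_relcycle k X S z" "chain_map k id z = z"
    using assms(2) chain_map_id_singular by (auto simp: hgen_def singular_relcycle)
  then show ?thesis using homology_iso.hgen_iff[OF assms(1)] assms(2) by metis
qed

lemma contractible_simplex_top: "contractible_space (simplex_top k)"
  by (rule starlike_contractible[OF vertex0_in[of k]]) (use standard_simplex_convex in auto)

lemma simplexD:
  assumes "t \<in> standard_simplex k"
  shows "0 \<le> t i" "t i \<le> 1" "i > k \<Longrightarrow> t i = 0" "(\<Sum>i\<le>k. t i) = 1"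
  using assms by (auto simp: standard_simplex_def)

lemma standard_simplexI:
  assumes "\<And>i. i \<le> k \<Longrightarrow> 0 \<le> t i" "\<And>i. i > k \<Longrightarrow> t i = 0" "(\<Sum>i\<le>k. t i) = 1"
  shows "t \<in> standard_simplex k"
proof -
  have "t i \<le> 1" if "i \<le> k" for i
    using member_le_sum[of i "{..k}" t] that assms by auto
  then show ?thesis using assms by (auto simp: standard_simplex_def) (metis linorder_not_less order_refl zero_le_one)+
qed

text \<open>Induction over the dimension. The connecting map of the triple formed by the simplex,
  its boundary and the horn \<open>T\<close> is an isomorphism; excision of a neighbourhood of the
  last vertex and a deformation onto the last face identify its target with the homology of the
  simplex of one dimension less.\<close>

theorem std_simplex_hgen: "hgen k (simplex_top k) (simplex_bdry k) (frag_of (std_simplex k))"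
proof (induction k)
  case 0
  let ?a = "\<lambda>j::nat. if j = 0 then 1 else 0 :: real"
  have b: "simplex_bdry 0 = {}" by (auto simp: simplex_bdry_def standard_simplex_def)
  have tp: "topspace (simplex_top 0) = {?a}" by (simp add: standard_simplex_0)
  have s: "std_simplex 0 = restrict (\<lambda>x. ?a) (standard_simplex 0)"
    by (auto simp: std_simplex_def standard_simplex_0)
  show ?case unfolding hgen_def
  proof (intro conjI std_simplex_relcycle allI impI)
    fix w assume "singular_relcycle 0 (simplex_top 0) (simplex_bdry 0) w"
    then have "singular_chain 0 (simplex_top 0) w" by (simp add: singular_relcycle)
    then obtain m where "w = frag_cmul m (frag_of (std_simplex 0))"
      using singular_chain_singleton[OF tp] s by metis
    then show "\<exists>m. homologous_rel 0 (simplex_top 0) (simplex_bdry 0) w (frag_cmul m (frag_of (std_simplex 0)))"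
      using homologous_rel_refl by metis
  qed
next
  case (Suc k)
  define n where "n = Suc k"
  define X where "X = simplex_top n"
  define S where "S = simplex_bdry n"
  \<comment> \<open>The horn of all faces except the one opposite to vertex \<open>n\<close>. All
    these faces contain that vertex, hence the horn is star-shaped about it.\<close>
  define T where "T = {t \<in> standard_simplex n. \<exists>i<n. t i = 0}"
  define z where "z = (frag_of (std_simplex n) :: (nat \<Rightarrow> real) chain)"
  have TS: "T \<subseteq> S" unfolding T_def S_def simplex_bdry_def using less_imp_le by blast
  have SX: "S \<subseteq> standard_simplex n" by (auto simp: S_def simplex_bdry_def)
  define en where "en = (\<lambda>j::nat. if j = n then 1 else 0 :: real)"
  have en: "en \<in> T" by (auto simp: T_def en_def n_def)
  have XT: "subtopology X T = Rtop T" unfolding X_def subtopology_subtopology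
    using TS SX by (simp add: inf.absorb2 order_trans)
  have XS: "subtopology X S = Rtop S" unfolding X_def subtopology_subtopology
    using SX by (simp add: inf.absorb2)
  have cT: "contractible_space (subtopology X T)"
    unfolding XT
  proof (rule starlike_contractible[OF en])
    fix t u assume t: "t \<in> T" and u: "u \<in> {0..1::real}"
    have "(\<lambda>i. (1 - u) * t i + u * en i) \<in> standard_simplex n"
      using standard_simplex_convex[of t n en u] t en u by (auto simp: T_def)
    moreover obtain i where "i < n" "t i = 0" using t by (auto simp: T_def)
    moreover from this have "(1 - u) * t i + u * en i = 0" by (simp add: en_def)
    ultimately show "(\<lambda>i. (1 - u) * t i + u * en i) \<in> T" by (auto simp: T_def)
  qed
  have ne: "topspace X \<inter> T \<noteq> {}" using en TS SX by (auto simp: X_def)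
  \<comment> \<open>In the exact sequence of the triple the homology of \<open>X\<close> relative to
    \<open>T\<close> vanishes, since both are contractible.\<close>
  have iso1: "hom_relboundary (int n) X S T \<in> Group.iso (relative_homology_group (int n) X S) (relative_homology_group (int k) (subtopology X S) T)"
    using iso_hom_relboundary_contractible[OF _ cT TS ne, of "int n"] contractible_simplex_top[of n]
    by (simp add: X_def n_def)
  have rb: "hom_relboundary (int n) X S T (homologous_rel_set n X S w) = homologous_rel_set k (subtopology X S) T (chain_boundary n w)"
    and rbc: "singular_relcycle k (subtopology X S) T (chain_boundary n w)"
    if w: "singular_relcycle n X S w" for w
  proof -
    have c0: "singular_chain k (subtopology X S) (chain_boundary n w)"
      using w by (simp add: singular_relcycle n_def)
    have "chain_boundary k (chain_boundary n w) = 0"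
      using chain_boundary_boundary[of n X w] w by (simp add: singular_relcycle n_def)
    then have c: "singular_relcycle k (subtopology X S) {} (chain_boundary n w)"
      using c0 by (simp add: singular_relcycle)
    then show "singular_relcycle k (subtopology X S) T (chain_boundary n w)"
      by (rule singular_relcycle_sub) simp
    have "hom_boundary (int n) X S (homologous_rel_set n X S w) = homologous_rel_set k (subtopology X S) {} (chain_boundary n w)"
      using hom_boundary_chain_boundary[OF w] by (simp add: n_def)
    moreover have "hom_induced (int k) (subtopology X S) {} (subtopology X S) T id (homologous_rel_set k (subtopology X S) {} (chain_boundary n w))
       = homologous_rel_set k (subtopology X S) T (chain_boundary n w)"
      using hom_induced_chain_map[OF _ _ c, of "subtopology X S" id T] chain_map_id_singular[OF c0] by simp
    ultimately show "hom_relboundary (int n) X S T (homologous_rel_set n X S w) = homologous_rel_set k (subtopology X S) T (chain_boundary n w)"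
      by (simp add: hom_relboundary_def n_def)
  qed
  have inj1: "homologous_rel n X S a b" if ab: "singular_relcycle n X S a" "singular_relcycle n X S b"
    and h: "homologous_rel k (subtopology X S) T (chain_boundary n a) (chain_boundary n b)" for a b
  proof -
    have "hom_relboundary (int n) X S T (homologous_rel_set n X S a) = hom_relboundary (int n) X S T (homologous_rel_set n X S b)"
      using rb[OF ab(1)] rb[OF ab(2)] h homologous_rel_set_eq by metis
    moreover have "inj_on (hom_relboundary (int n) X S T) (carrier (relative_homology_group (int n) X S))"
      using iso1 by (simp add: iso_def bij_betw_def)
    ultimately have "homologous_rel_set n X S a = homologous_rel_set n X S b"
      using ab by (auto simp: carrier_relative_homology_group inj_on_def)
    then show ?thesis using homologous_rel_set_eq by blast
  qed
  \<comment> \<open>A neighbourhood of the vertex opposite to the last face. It lies well inside the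
    horn, so it can be excised, and on what remains \<open>1 - t n\<close> is bounded away from
    0.\<close>
  define U where "U = {t \<in> S. t n > 1/2}"
  define Y where "Y = subtopology (subtopology X S) (S - U)"
  have Y: "Y = Rtop (S - U)" unfolding Y_def XS subtopology_subtopology by (simp add: inf.absorb2)
  have co: "continuous_map (Rtop S) euclideanreal (\<lambda>t. t n)" by (rule continuous_map_Rtop_coord)
  have exc: "hom_induced (int k) Y (T - U) (subtopology X S) T id \<in> Group.iso (relative_homology_group (int k) Y (T - U)) (relative_homology_group (int k) (subtopology X S) T)"
  proof -
    have "(Rtop S) closure_of U \<subseteq> {t \<in> topspace (Rtop S). t n \<in> {1/2..}}"
    proof (rule closure_of_minimal)
      show "closedin (Rtop S) {t \<in> topspace (Rtop S). t n \<in> {1/2..}}"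
        by (rule closedin_continuous_map_preimage[OF co]) simp
    qed (auto simp: U_def)
    also have "\<dots> \<subseteq> {t \<in> topspace (Rtop S). t n \<in> {0<..}}" by auto
    also have "\<dots> \<subseteq> (Rtop S) interior_of T"
    proof (rule interior_of_maximal)
      show "{t \<in> topspace (Rtop S). t n \<in> {0<..}} \<subseteq> T"
        by (auto simp: S_def simplex_bdry_def T_def) (metis le_neq_implies_less less_irrefl)
      show "openin (Rtop S) {t \<in> topspace (Rtop S). t n \<in> {0<..}}"
        by (rule openin_continuous_map_preimage[OF co]) simp
    qed
    finally have cl: "(subtopology X S) closure_of U \<subseteq> (subtopology X S) interior_of T" unfolding XS .
    have "subtopology (subtopology X S) S = subtopology X S" by (simp add: subtopology_subtopology)
    then show ?thesis using homology_excision_axiom[OF cl TS, of "int k"] by (simp add: Y_def)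
  qed
  have Bk: "simplex_bdry k \<subseteq> T - U" and Dk: "standard_simplex k \<subseteq> S - U"
  proof -
    have m: "standard_simplex k \<subseteq> standard_simplex n" using standard_simplex_mono[of k n] by (simp add: n_def)
    have z: "t n = 0" if "t \<in> standard_simplex k" for t using simplexD(3)[OF that, of n] by (simp add: n_def)
    show "standard_simplex k \<subseteq> S - U"
    proof
      fix t assume t: "t \<in> standard_simplex k"
      then show "t \<in> S - U" using m z[OF t] by (auto simp: S_def U_def simplex_bdry_def)
    qed
    show "simplex_bdry k \<subseteq> T - U"
    proof
      fix t assume t: "t \<in> simplex_bdry k"
      then have "t \<in> standard_simplex k" by (simp add: simplex_bdry_def)
      with t show "t \<in> T - U" using m z[of t] by (auto simp: T_def U_def simplex_bdry_def n_def less_Suc_eq_le)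
    qed
  qed
  \<comment> \<open>Projection from the vertex \<open>en\<close> onto the last face. It preserves
    the vanishing of coordinates, so the segments from \<open>r t\<close> to \<open>t\<close> stay
    in \<open>S\<close> and, for \<open>t\<close> in \<open>T\<close>, in \<open>T\<close>.\<close>
  define r where "r = (\<lambda>t::nat\<Rightarrow>real. \<lambda>i. if i = n then 0 else t i / (1 - t n))"
  have rt: "r t = t" if "t \<in> standard_simplex k" for t
    using simplexD(3)[OF that, of n] by (auto simp: r_def n_def)
  have YD: "t \<in> standard_simplex n" "t n \<le> 1/2" "\<exists>i\<le>n. t i = 0" if "t \<in> S - U" for t
    using that by (auto simp: S_def U_def simplex_bdry_def)
  have YI: "t \<in> S - U" if "t \<in> standard_simplex n" "t n \<le> 1/2" "i \<le> n" "t i = 0" for t i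
    using that by (auto simp: S_def U_def simplex_bdry_def)
  have rD: "r t \<in> standard_simplex k" if t: "t \<in> standard_simplex n" "t n \<le> 1/2" for t
  proof (rule standard_simplexI)
    have "(\<Sum>i\<le>k. t i) = 1 - t n" using simplexD(4)[OF t(1)] by (simp add: n_def)
    then show "(\<Sum>i\<le>k. r t i) = 1" using t(2) by (simp add: r_def n_def flip: sum_divide_distrib)
    show "0 \<le> r t i" for i using simplexD(1)[OF t(1)] t(2) by (simp add: r_def)
    show "i > k \<Longrightarrow> r t i = 0" for i using simplexD(3)[OF t(1), of i] by (auto simp: r_def n_def)
  qed
  have lin: "(\<lambda>i. (1 - u) * r t i + u * t i) \<in> S - U" "t \<in> T \<Longrightarrow> (\<lambda>i. (1 - u) * r t i + u * t i) \<in> T - U"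
    if t: "t \<in> S - U" and u: "u \<in> {0..1::real}" for t u
  proof -
    note y = YD[OF t]
    have rn: "r t \<in> standard_simplex n" using rD[OF y(1,2)] standard_simplex_mono[of k n] by (auto simp: n_def)
    have D: "(\<lambda>i. (1 - u) * r t i + u * t i) \<in> standard_simplex n"
      using standard_simplex_convex[OF rn y(1)] u by auto
    have "u * t n \<le> 1 * (1/2)" using u y(2) simplexD(1)[OF y(1)] by (intro mult_mono) auto
    then have h: "(1 - u) * r t n + u * t n \<le> 1/2" by (simp add: r_def)
    have zero: "(1 - u) * r t i + u * t i = 0" if "t i = 0" for i using that by (simp add: r_def)
    show 1: "(\<lambda>i. (1 - u) * r t i + u * t i) \<in> S - U" using YI[OF D h] y(3) zero by blast
    show "(\<lambda>i. (1 - u) * r t i + u * t i) \<in> T - U" if tT: "t \<in> T"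
    proof -
      obtain i where "i < n" "t i = 0" using tT unfolding T_def by blast
      then show ?thesis using D zero 1 by (auto simp: T_def)
    qed
  qed
  have cr: "continuous_map Y (simplex_top k) r"
    unfolding continuous_map_simplex_iff Y
  proof (intro conjI allI)
    show "continuous_map (Rtop (S - U)) euclideanreal (\<lambda>x. r x i)" for i
    proof (cases "i = n")
      case False
      have "\<And>t. t \<in> S - U \<Longrightarrow> 1 - t n \<noteq> 0" using YD(2) by fastforce
      then show ?thesis using False unfolding r_def by simp (intro continuous_intros continuous_map_Rtop_coord, auto)
    qed (simp add: r_def)
    show "r \<in> topspace (Rtop (S - U)) \<rightarrow> standard_simplex k" using rD YD by auto
  qed
  have rTB: "r \<in> T - U \<rightarrow> simplex_bdry k"
  proof
    fix t assume t: "t \<in> T - U"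
    then have tS: "t \<in> S - U" using TS by auto
    obtain i where i: "i < n" "t i = 0" using t by (auto simp: T_def)
    then have "i \<le> k" "r t i = 0" by (auto simp: r_def n_def)
    then show "r t \<in> simplex_bdry k"
      using rD[OF YD(1)[OF tS] YD(2)[OF tS]] unfolding simplex_bdry_def by blast
  qed
  have iso2: "hom_induced (int k) (simplex_top k) (simplex_bdry k) Y (T - U) id \<in>
     Group.iso (relative_homology_group (int k) (simplex_top k) (simplex_bdry k)) (relative_homology_group (int k) Y (T - U))"
  proof (rule homotopy_equivalence_relative_homology_group_isomorphism[where g = r])
    show "continuous_map (simplex_top k) Y id"
      unfolding Y continuous_map_Rtop_iff using Dk by (auto simp: continuous_map_Rtop_coord)
    show "id \<in> simplex_bdry k \<rightarrow> T - U" using Bk by auto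
    show "homotopic_with (\<lambda>h. h \<in> simplex_bdry k \<rightarrow> simplex_bdry k) (simplex_top k) (simplex_top k) (r \<circ> id) id"
    proof (rule linear_homotopic)
      show "continuous_map (simplex_top k) (simplex_top k) (r \<circ> id)"
        by (rule continuous_map_eq[OF continuous_map_id]) (use rt in auto)
      have e: "(1 - u) * r x i + u * x i = x i" if "x \<in> standard_simplex k" for u x i
        using rt[OF that] by (simp add: algebra_simps)
      show "(\<lambda>i. (1 - u) * (r \<circ> id) x i + u * id x i) \<in> standard_simplex k" if "x \<in> topspace (simplex_top k)" for x u
        using that e by simp
      show "(\<lambda>x i. (1 - u) * (r \<circ> id) x i + u * id x i) \<in> simplex_bdry k \<rightarrow> simplex_bdry k" for u
        using e by (auto simp: simplex_bdry_def)
    qed simp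
    have "homotopic_with (\<lambda>k. k \<in> T - U \<rightarrow> T - U) Y (Rtop (S - U)) (id \<circ> r) id"
    proof (rule linear_homotopic)
      show "continuous_map Y (Rtop (S - U)) (id \<circ> r)"
        using cr Dk unfolding continuous_map_simplex_iff continuous_map_Rtop_iff by auto
      show "continuous_map Y (Rtop (S - U)) id" unfolding Y by simp
      show "(\<lambda>i. (1 - u) * (id \<circ> r) x i + u * id x i) \<in> S - U" if "x \<in> topspace Y" "u \<in> {0..1}" for x u
        using lin(1)[of x u] that by (simp add: Y)
      show "(\<lambda>x i. (1 - u) * (id \<circ> r) x i + u * id x i) \<in> T - U \<rightarrow> T - U" if "u \<in> {0..1}" for u
      proof
        fix x assume "x \<in> T - U"
        then show "(\<lambda>i. (1 - u) * (id \<circ> r) x i + u * id x i) \<in> T - U"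
          using lin(2)[of x u] that TS by auto
      qed
    qed
    then show "homotopic_with (\<lambda>k. k \<in> T - U \<rightarrow> T - U) Y Y (id \<circ> r) id" unfolding Y .
  qed (use cr rTB in auto)
  have g1: "hgen k Y (T - U) (frag_of (std_simplex k))"
    by (rule homology_iso_id_hgen[OF homology_isoI[OF iso2] Suc])
      (use Dk Bk in \<open>auto simp: Y continuous_map_Rtop_iff continuous_map_Rtop_coord\<close>)
  have g2: "hgen k (subtopology X S) T (frag_of (std_simplex k))"
    by (rule homology_iso_id_hgen[OF homology_isoI[OF exc] g1])
      (auto simp: Y_def continuous_map_from_subtopology)
  \<comment> \<open>All faces but the last one lie in the horn. Modulo \<open>T\<close> the boundary
    of the standard simplex is therefore the standard simplex of dimension \<open>k\<close>, up to
    sign.\<close>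
  have "homologous_rel k (subtopology X S) T (frag_cmul ((-1) ^ n) (frag_of (std_simplex k))) (chain_boundary n z)"
  proof -
    let ?e = "\<Sum>i<n. frag_cmul ((-1) ^ i) (frag_of (singular_face n i (std_simplex n)))"
    have "chain_boundary n z = (\<Sum>i\<le>n. frag_cmul ((-1) ^ i) (frag_of (singular_face n i (std_simplex n))))"
      by (simp add: z_def chain_boundary_of n_def)
    also have "\<dots> = ?e + frag_cmul ((-1) ^ n) (frag_of (std_simplex k))"
      using last_face_std[of n] by (simp add: n_def flip: lessThan_Suc_atMost)
    finally have e: "chain_boundary n z = frag_cmul ((-1) ^ n) (frag_of (std_simplex k)) + ?e" by simp
    have "singular_simplex k (subtopology (subtopology X S) T) (singular_face n i (std_simplex n))" if "i < n" for i
    proof -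
      have "singular_simplex k (subtopology X T) (singular_face n i (std_simplex n))"
        using singular_face_std_in[of n i T] that by (auto simp: n_def X_def T_def)
      then show ?thesis using TS by (simp add: subtopology_subtopology inf.absorb2)
    qed
    then have "singular_chain k (subtopology (subtopology X S) T) ?e"
      by (intro singular_chain_sum singular_chain_cmul) (simp add: singular_chain_of)
    from homologous_rel_sub_zero[OF this] show ?thesis unfolding e using homologous_rel_sym by blast
  qed
  then have g3: "hgen k (subtopology X S) T (chain_boundary n z)"
    by (rule hgen_homologous[OF hgen_cmul_unit[OF g2], rotated]) (simp flip: power_add mult_2 power_mult_distrib add: power_mult)
  have zc: "singular_relcycle n X S z" unfolding X_def S_def z_def by (rule std_simplex_relcycle)
  have "hgen n X S z" unfolding hgen_def
  proof (intro conjI zc allI impI)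
    fix w assume w: "singular_relcycle n X S w"
    obtain m where "homologous_rel k (subtopology X S) T (chain_boundary n w) (frag_cmul m (chain_boundary n z))"
      using g3 rbc[OF w] by (auto simp: hgen_def)
    then have "homologous_rel n X S w (frag_cmul m z)"
      by (intro inj1 w singular_relcycle_cmul zc) (simp add: chain_boundary_cmul)
    then show "\<exists>m. homologous_rel n X S w (frag_cmul m z)" by blast
  qed
  then show ?case by (simp add: n_def X_def S_def z_def)
qed

section \<open>The sphere relative to the complement of a point\<close>

text \<open>The complement of a point of the sphere is contractible, so in positive degree nothing
  changes when homology is taken relative to it.\<close>

lemma trivial_reduced_relative:
  assumes n: "n > 0" and a: "a \<in> topspace (nsphere n)"
  shows "hom_induced (int n) (nsphere n) {} (nsphere n) (topspace (nsphere n) - {a}) id \<in>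
    Group.iso (homology_group (int n) (nsphere n)) (relative_homology_group (int n) (nsphere n) (topspace (nsphere n) - {a}))"
proof -
  let ?Y = "subtopology (nsphere n) (- {a})"
  have Y: "subtopology (nsphere n) (topspace (nsphere n) - {a}) = ?Y"
    by (simp add: Diff_eq subtopology_restrict)
  obtain h where h: "continuous_map (prod_topology unit_top ?Y) ?Y h"
    "\<And>y. y \<in> topspace ?Y \<Longrightarrow> h (0, y) = (\<lambda>i. - a i)" "\<And>y. y \<in> topspace ?Y \<Longrightarrow> h (1, y) = y"
    "\<And>t. t \<in> {0..1} \<Longrightarrow> h (t, \<lambda>i. - a i) = (\<lambda>i. - a i)"
    using punctured_sphere_contraction[OF a] by blast
  have "homotopic_with (\<lambda>x. True) ?Y ?Y (\<lambda>_ i. - a i) id"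
    by (subst homotopic_with, simp, rule exI[of _ h]) (use h in simp)
  then have "contractible_space ?Y" unfolding contractible_space_def using homotopic_with_symD by blast
  moreover have "topspace (nsphere n) \<inter> (topspace (nsphere n) - {a}) \<noteq> {}"
  proof -
    have "(\<lambda>i. - a i) \<noteq> a"
    proof
      assume "(\<lambda>i. - a i) = a"
      then have "- a i = a i" for i by metis
      then have "a i = 0" for i by (metis neg_equal_0_iff_equal neg_equal_zero)
      then show False using nsphereD(1)[OF a] by simp
    qed
    then show ?thesis using nsphere_uminus[OF a] by blast
  qed
  ultimately show ?thesis
    using iso_reduced_homology_by_contractible[of "nsphere n" "topspace (nsphere n) - {a}" "int n"] n
    unfolding Y by (simp add: un_reduced_homology_group)
qed

lemma nsphere_homology_iso:
  assumes "n > 0" "a \<in> topspace (nsphere n)"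
  shows "homology_iso n (nsphere n) {} (nsphere n) (topspace (nsphere n) - {a}) id"
  by (rule homology_isoI[OF trivial_reduced_relative[OF assms]]) auto

lemma homology_nsphere_integer: "n > 0 \<Longrightarrow> homology_group (int n) (nsphere n) \<cong> integer_group"
  using reduced_homology_group_nsphere(1)[of n] by (simp add: un_reduced_homology_group)

text \<open>Lets a single point decide whether a cycle generates the homology of the sphere; later
  arguments pick the point where the computation is easiest.\<close>

lemma nsphere_hgen_local:
  assumes "n > 0" "a \<in> topspace (nsphere n)" "singular_relcycle n (nsphere n) {} z"
  shows "hgen n (nsphere n) (topspace (nsphere n) - {a}) z \<longleftrightarrow> hgen n (nsphere n) {} z"
proof -
  have "chain_map n id z = z" using chain_map_id_singular assms(3) by (auto simp: singular_relcycle)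
  then show ?thesis using homology_iso.hgen_iff[OF nsphere_homology_iso[OF assms(1,2)] assms(3)] by simp
qed

section \<open>The least barycentric coordinate\<close>

text \<open>A radial coordinate on the simplex: 0 exactly on the boundary and maximal, with value
  \<open>1 / real (Suc n)\<close>, exactly at the barycentre.\<close>

definition min_coord :: "nat \<Rightarrow> (nat \<Rightarrow> real) \<Rightarrow> real" where
  "min_coord n t = Min (t ` {..n})"

lemma continuous_map_min_coord:
  assumes "\<And>i. continuous_map X euclideanreal (\<lambda>x. f x i)"
  shows "continuous_map X euclideanreal (\<lambda>x. min_coord n (f x))"
proof (induction n)
  case 0 then show ?case using assms by (simp add: min_coord_def)
next
  case (Suc n)
  have "min_coord (Suc n) t = min (t (Suc n)) (min_coord n t)" for t
    by (simp add: min_coord_def atMost_Suc)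
  then show ?case using continuous_map_real_min[OF assms Suc] by simp
qed

lemma min_coord_le: "i \<le> n \<Longrightarrow> min_coord n t \<le> t i"
  by (simp add: min_coord_def)

lemma min_coord_attained: obtains i where "i \<le> n" "t i = min_coord n t"
proof -
  have "Min (t ` {..n}) \<in> t ` {..n}" by (rule Min_in) auto
  then obtain i where "Min (t ` {..n}) = t i" "i \<in> {..n}" by (rule imageE)
  then show thesis using that[of i] by (simp add: min_coord_def)
qed

lemma min_coord_affine:
  assumes "(c::real) \<ge> 0"
  shows "min_coord n (\<lambda>i. b + c * t i) = b + c * min_coord n t"
proof (rule antisym)
  obtain i where "i \<le> n" "t i = min_coord n t" using min_coord_attained .
  then show "min_coord n (\<lambda>i. b + c * t i) \<le> b + c * min_coord n t" using min_coord_le[of i n "\<lambda>i. b + c * t i"] by simp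
  obtain i where "i \<le> n" "b + c * t i = min_coord n (\<lambda>i. b + c * t i)" using min_coord_attained[of n "\<lambda>i. b + c * t i"] .
  then show "b + c * min_coord n t \<le> min_coord n (\<lambda>i. b + c * t i)"
    using min_coord_le[of i n t] assms by (metis add_left_mono mult_left_mono)
qed

lemma min_coord_cong: "(\<And>i. i \<le> n \<Longrightarrow> s i = t i) \<Longrightarrow> min_coord n s = min_coord n t"
  using image_cong[of "{..n}" "{..n}" s t] by (simp add: min_coord_def)

lemma min_coord_simplex:
  assumes "t \<in> standard_simplex n"
  shows "0 \<le> min_coord n t" "t \<in> simplex_bdry n \<longleftrightarrow> min_coord n t = 0"
    "real (Suc n) * min_coord n t \<le> 1"
    "real (Suc n) * min_coord n t = 1 \<Longrightarrow> i \<le> n \<Longrightarrow> t i = 1 / real (Suc n)"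
proof -
  obtain j where j: "j \<le> n" "t j = min_coord n t" using min_coord_attained .
  show p: "0 \<le> min_coord n t" using simplexD(1)[OF assms, of j] j by simp
  show "t \<in> simplex_bdry n \<longleftrightarrow> min_coord n t = 0"
  proof
    assume "t \<in> simplex_bdry n"
    then obtain i where "i \<le> n" "t i = 0" by (auto simp: simplex_bdry_def)
    then show "min_coord n t = 0" using min_coord_le[of i n t] p by simp
  next
    assume "min_coord n t = 0"
    then show "t \<in> simplex_bdry n" using j assms by (auto simp: simplex_bdry_def)
  qed
  have s: "(\<Sum>i\<le>n. t i - min_coord n t) = 1 - real (Suc n) * min_coord n t"
    using simplexD(4)[OF assms] by (simp add: sum_subtractf)
  have nn: "0 \<le> t i - min_coord n t" if "i \<le> n" for i using min_coord_le[OF that] by simp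
  then show "real (Suc n) * min_coord n t \<le> 1" using s sum_nonneg[of "{..n}" "\<lambda>i. t i - min_coord n t"] by simp
  assume e: "real (Suc n) * min_coord n t = 1" "i \<le> n"
  then have "(\<Sum>i\<le>n. t i - min_coord n t) = 0" using s by simp
  then have "t i - min_coord n t = 0" using sum_nonneg_eq_0_iff[of "{..n}" "\<lambda>i. t i - min_coord n t"] nn e(2) by auto
  then show "t i = 1 / real (Suc n)" using e(1) by (simp add: field_simps)
qed

definition barycentre :: "nat \<Rightarrow> nat \<Rightarrow> real" where
  "barycentre n = (\<lambda>i. if i \<le> n then 1 / real (Suc n) else 0)"

lemma barycentre_in: "barycentre n \<in> standard_simplex n"
  by (rule standard_simplexI) (auto simp: barycentre_def)

lemma min_coord_barycentre: "min_coord n (barycentre n) = 1 / real (Suc n)"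
proof -
  have "barycentre n ` {..n} = {1 / real (Suc n)}" by (auto simp: barycentre_def)
  then show ?thesis by (simp add: min_coord_def)
qed

lemma barycentre_iff:
  assumes "t \<in> standard_simplex n"
  shows "t = barycentre n \<longleftrightarrow> real (Suc n) * min_coord n t = 1"
proof
  assume "real (Suc n) * min_coord n t = 1"
  from min_coord_simplex(4)[OF assms this] show "t = barycentre n"
    using simplexD(3)[OF assms] by (auto simp: barycentre_def fun_eq_iff not_le)
qed (simp add: min_coord_barycentre)

text \<open>The simplex without its barycentre deforms onto the boundary, so the generator relative
  to the boundary is also one relative to the punctured simplex. In this form it is a local class at
  an interior point.\<close>

lemma std_simplex_hgen_barycentre:
  "hgen n (simplex_top n) (standard_simplex n - {barycentre n}) (frag_of (std_simplex n))"
proof (rule homology_iso_id_hgen[OF homology_isoI std_simplex_hgen])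
  let ?X = "simplex_top n" and ?S = "standard_simplex n - {barycentre n}" and ?B = "simplex_bdry n"
  have SX: "subtopology ?X ?S = Rtop ?S" by (simp add: subtopology_subtopology inf.absorb2)
  have BS: "?B \<subseteq> ?S"
  proof
    fix t assume t: "t \<in> ?B"
    then have tD: "t \<in> standard_simplex n" by (simp add: simplex_bdry_def)
    then have "min_coord n t = 0" using min_coord_simplex(2)[OF tD] t by blast
    then show "t \<in> ?S" using barycentre_iff[OF tD] tD by auto
  qed
  have BX: "subtopology (Rtop ?S) ?B = Rtop ?B"
    unfolding subtopology_subtopology using BS by (simp add: inf.absorb2 Int_absorb1 Int_assoc)
  have mS: "real (Suc n) * min_coord n t < 1" if "t \<in> ?S" for t
    using min_coord_simplex(3)[of t n] barycentre_iff[of t n] that by fastforce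
  \<comment> \<open>Radial projection from the barycentre onto the boundary: \<open>t\<close> is the
    convex combination of \<open>r t\<close> and the barycentre in which the latter has weight
    \<open>real (Suc n) * min_coord n t\<close>.\<close>
  define r where "r = (\<lambda>t::nat\<Rightarrow>real. \<lambda>i. if i \<le> n then (t i - min_coord n t) / (1 - real (Suc n) * min_coord n t) else 0)"
  have rD: "r t \<in> standard_simplex n" if t: "t \<in> ?S" for t
  proof (rule standard_simplexI)
    have "(\<Sum>i\<le>n. r t i) = (\<Sum>i\<le>n. t i - min_coord n t) / (1 - real (Suc n) * min_coord n t)"
      by (simp add: r_def sum_divide_distrib)
    also have "\<dots> = 1" using mS[OF t] simplexD(4)[of t n] t by (simp add: sum_subtractf)
    finally show "(\<Sum>i\<le>n. r t i) = 1" .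
    show "0 \<le> r t i" if "i \<le> n" for i using mS[OF t] min_coord_le[OF that, of t] by (simp add: r_def)
  qed (simp add: r_def)
  have r0: "r t i = 0" if "i \<le> n" "t i = min_coord n t" for t i using that by (simp add: r_def)
  have rB: "r t \<in> ?B" if t: "t \<in> ?S" for t
  proof -
    obtain i where "i \<le> n" "t i = min_coord n t" using min_coord_attained .
    then show ?thesis using rD[OF t] r0 by (auto simp: simplex_bdry_def)
  qed
  have cr: "continuous_map (Rtop ?S) (Rtop ?B) r"
    unfolding continuous_map_Rtop_iff
  proof (intro conjI allI)
    have cm: "continuous_map (Rtop ?S) euclideanreal (\<lambda>x. min_coord n x)"
      by (rule continuous_map_min_coord) (rule continuous_map_Rtop_coord)
    have nz: "1 - real (Suc n) * min_coord n x \<noteq> 0" if "x \<in> topspace (Rtop ?S)" for x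
      using mS[of x] that by auto
    show "continuous_map (Rtop ?S) euclideanreal (\<lambda>x. r x i)" for i
    proof (cases "i \<le> n")
      case True
      then show ?thesis unfolding r_def using nz
        by (simp del: of_nat_Suc) (intro continuous_intros continuous_map_Rtop_coord cm, auto)
    qed (simp add: r_def)
  qed (use rB in auto)
  have lin: "(\<lambda>i. (1 - u) * r t i + u * t i) \<in> ?S" "t \<in> ?B \<Longrightarrow> (\<lambda>i. (1 - u) * r t i + u * t i) \<in> ?B"
    if t: "t \<in> ?S" and u: "u \<in> {0..1::real}" for t u
  proof -
    have D: "(\<lambda>i. (1 - u) * r t i + u * t i) \<in> standard_simplex n"
      using standard_simplex_convex[OF rD[OF t], of t u] t u by auto
    obtain i where i: "i \<le> n" "t i = min_coord n t" using min_coord_attained .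
    have tD: "t \<in> standard_simplex n" using t by simp
    \<comment> \<open>The coordinate that is least for \<open>t\<close> vanishes for
      \<open>r t\<close>. Along the segment it stays below \<open>1 / real (Suc n)\<close>, so the
      barycentre is avoided.\<close>
    have "u * min_coord n t \<le> 1 * min_coord n t"
      using u min_coord_simplex(1)[OF tD] by (intro mult_right_mono) auto
    then have "real (Suc n) * (u * min_coord n t) \<le> real (Suc n) * min_coord n t" by (simp add: mult_left_mono)
    then have "real (Suc n) * (u * min_coord n t) < 1" using mS[OF t] by linarith
    then have "u * min_coord n t \<noteq> 1 / real (Suc n)" by (auto simp: field_simps)
    then have "(1 - u) * r t i + u * t i \<noteq> barycentre n i" using i r0 by (simp add: barycentre_def)
    then have "(\<lambda>i. (1 - u) * r t i + u * t i) \<noteq> barycentre n" by metis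
    then show "(\<lambda>i. (1 - u) * r t i + u * t i) \<in> ?S" using D by blast
    assume "t \<in> ?B"
    then have "min_coord n t = 0" using min_coord_simplex(2)[OF tD] by blast
    then show "(\<lambda>i. (1 - u) * r t i + u * t i) \<in> ?B" using D i r0 by (auto simp: simplex_bdry_def)
  qed
  have triv: "trivial_group (relative_homology_group q (subtopology ?X ?S) ?B)" for q
  proof (rule trivial_relative_homology_group_gen)
    show "continuous_map (subtopology ?X ?S) (subtopology (subtopology ?X ?S) ?B) r" unfolding SX BX by (rule cr)
    show "homotopic_with (\<lambda>h. True) (subtopology (subtopology ?X ?S) ?B) (subtopology (subtopology ?X ?S) ?B) r id"
      unfolding SX BX
    proof (rule linear_homotopic)
      show "continuous_map (Rtop ?B) (Rtop ?B) r"
        by (rule continuous_map_from_subtopology_mono[OF cr BS])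
      show "(\<lambda>i. (1 - u) * r x i + u * id x i) \<in> ?B" if "x \<in> topspace (Rtop ?B)" "u \<in> {0..1}" for x u
        using lin(2)[of x u] that BS by auto
    qed auto
    have "homotopic_with (\<lambda>k. True) (Rtop ?S) (Rtop ?S) r id"
    proof (rule linear_homotopic)
      show "continuous_map (Rtop ?S) (Rtop ?S) r" using cr BS unfolding continuous_map_Rtop_iff by blast
      show "(\<lambda>i. (1 - u) * r x i + u * id x i) \<in> ?S" if "x \<in> topspace (Rtop ?S)" "u \<in> {0..1}" for x u
        using lin(1)[of x u] that by simp
    qed auto
    then show "homotopic_with (\<lambda>k. True) (subtopology ?X ?S) (subtopology ?X ?S) r id" unfolding SX .
  qed
  show "hom_induced (int n) ?X ?B ?X ?S id \<in> Group.iso (relative_homology_group (int n) ?X ?B) (relative_homology_group (int n) ?X ?S)"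
  \<comment> \<open>On either side of the map in the sequence of the triple stands the homology of
    the punctured simplex relative to the boundary, which is trivial by \<open>triv\<close>.\<close>
  proof (rule very_short_exact_sequence[OF _ triv[of "int n"] triv[of "int n - 1"]])
    show "exact_seq ([relative_homology_group (int n - 1) (subtopology ?X ?S) ?B, relative_homology_group (int n) ?X ?S,
        relative_homology_group (int n) ?X ?B, relative_homology_group (int n) (subtopology ?X ?S) ?B],
       [hom_relboundary (int n) ?X ?S ?B, hom_induced (int n) ?X ?B ?X ?S id, hom_induced (int n) (subtopology ?X ?S) ?B ?X ?B id])"
      using homology_exactness_triple_1[OF BS, of "int n" ?X] homology_exactness_triple_3[OF BS, of "int n" ?X] by simp
  qed
  show "continuous_map ?X ?X id" by simp
  show "id \<in> ?B \<rightarrow> ?S" using BS by auto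
qed

text \<open>The collapse is inverse stereographic projection from \<open>- pole\<close>, applied to \<open>v / m\<close> where \<open>v\<close> is the
  vector from the barycentre and \<open>m\<close> the least barycentric coordinate; clearing denominators makes it
  continuous up to the boundary \<open>m = 0\<close>. The sphere lies in \<open>\<real>\<^sup>n\<^sup>+\<^sup>1\<close> and \<open>v\<close> is orthogonal to the pole.\<close>

definition pole :: "nat \<Rightarrow> nat \<Rightarrow> real" where
  "pole n = (\<lambda>i. if i \<le> n then 1 / sqrt (real (Suc n)) else 0)"

definition collapse :: "nat \<Rightarrow> (nat \<Rightarrow> real) \<Rightarrow> nat \<Rightarrow> real" where
  "collapse n t = (let m = min_coord n t; v = (\<lambda>i. t i - barycentre n i); s = (\<Sum>i\<le>n. (v i)\<^sup>2)
     in (\<lambda>i. if i \<le> n then (2 * m * v i + (m\<^sup>2 - s) * pole n i) / (m\<^sup>2 + s) else 0))"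

section \<open>The collapse of the simplex onto the sphere\<close>

lemma pole_in: "pole n \<in> topspace (nsphere n)"
  by (auto simp: topspace_nsphere pole_def power_divide)

lemma sum_pole_sq: "(\<Sum>i\<le>n. (pole n i)\<^sup>2) = 1"
  using nsphereD(1)[OF pole_in] .

lemma sum_mult_pole: "(\<Sum>i\<le>n. x i * pole n i) = (\<Sum>i\<le>n. x i) / sqrt (real (Suc n))"
  by (simp add: pole_def sum_divide_distrib)

lemma sum_simplex_barycentre:
  assumes "t \<in> standard_simplex n"
  shows "(\<Sum>i\<le>n. t i - barycentre n i) = 0"
  using simplexD(4)[OF assms] simplexD(4)[OF barycentre_in[of n]] by (simp add: sum_subtractf)

lemma sum_sq_barycentre_eq_0:
  assumes "t \<in> standard_simplex n"
  shows "(\<Sum>i\<le>n. (t i - barycentre n i)\<^sup>2) = 0 \<longleftrightarrow> t = barycentre n"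
proof
  assume "(\<Sum>i\<le>n. (t i - barycentre n i)\<^sup>2) = 0"
  then have "t i = barycentre n i" if "i \<le> n" for i using that by (auto simp: sum_nonneg_eq_0_iff)
  then show "t = barycentre n" using simplexD(3)[OF assms] by (auto simp: barycentre_def fun_eq_iff not_le)
qed simp

lemma collapse_denominator:
  assumes "t \<in> standard_simplex n"
  shows "(min_coord n t)\<^sup>2 + (\<Sum>i\<le>n. (t i - barycentre n i)\<^sup>2) > 0"
proof (cases "t = barycentre n")
  case True
  then show ?thesis by (simp add: min_coord_barycentre)
next
  case False
  then have "(\<Sum>i\<le>n. (t i - barycentre n i)\<^sup>2) \<noteq> 0" using sum_sq_barycentre_eq_0[OF assms] by simp
  then show ?thesis using sum_nonneg[of "{..n}" "\<lambda>i. (t i - barycentre n i)\<^sup>2"]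
    by (smt (verit) zero_le_power2)
qed

text \<open>As \<open>v\<close> is orthogonal to the unit vector \<open>pole n\<close>, the squared
  norm of the numerator is \<open>4 * m^2 * s + (m^2 - s)^2\<close>, that is
  \<open>(m^2 + s)^2\<close>.\<close>

lemma collapse_in:
  assumes t: "t \<in> standard_simplex n"
  shows "collapse n t \<in> topspace (nsphere n)"
proof -
  define m where "m = min_coord n t"
  define v where "v = (\<lambda>i. t i - barycentre n i)"
  define s where "s = (\<Sum>i\<le>n. (v i)\<^sup>2)"
  have D: "m\<^sup>2 + s > 0" using collapse_denominator[OF t] by (simp add: m_def s_def v_def)
  have vN: "(\<Sum>i\<le>n. v i * pole n i) = 0" unfolding sum_mult_pole using sum_simplex_barycentre[OF t] by (simp add: v_def)
  have c: "collapse n t i = (2 * m * v i + (m\<^sup>2 - s) * pole n i) / (m\<^sup>2 + s)" if "i \<le> n" for i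
    using that by (simp add: collapse_def Let_def m_def v_def s_def)
  have "(\<Sum>i\<le>n. (2 * m * v i + (m\<^sup>2 - s) * pole n i)\<^sup>2)
     = (\<Sum>i\<le>n. 4 * m\<^sup>2 * (v i)\<^sup>2 + 4 * m * (m\<^sup>2 - s) * (v i * pole n i) + (m\<^sup>2 - s)\<^sup>2 * (pole n i)\<^sup>2)"
    by (intro sum.cong refl) (simp add: power2_eq_square algebra_simps)
  also have "\<dots> = 4 * m\<^sup>2 * s + 4 * m * (m\<^sup>2 - s) * (\<Sum>i\<le>n. v i * pole n i) + (m\<^sup>2 - s)\<^sup>2 * (\<Sum>i\<le>n. (pole n i)\<^sup>2)"
    by (simp add: sum.distrib s_def flip: sum_distrib_left)
  also have "\<dots> = (m\<^sup>2 + s)\<^sup>2" unfolding vN sum_pole_sq by (simp add: power2_eq_square algebra_simps)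
  finally have "(\<Sum>i\<le>n. (collapse n t i)\<^sup>2) = 1"
    using c D by (simp add: power_divide flip: sum_divide_distrib)
  then show ?thesis by (simp add: topspace_nsphere collapse_def Let_def)
qed

lemma continuous_map_collapse: "continuous_map (simplex_top n) (nsphere n) (collapse n)"
  unfolding continuous_map_nsphere_iff
proof (intro conjI allI)
  have cm: "continuous_map (simplex_top n) euclideanreal (\<lambda>x. min_coord n x)"
    by (rule continuous_map_min_coord) (rule continuous_map_Rtop_coord)
  have nz: "(min_coord n t)\<^sup>2 + (\<Sum>i\<le>n. (t i - barycentre n i)\<^sup>2) \<noteq> 0" if "t \<in> topspace (simplex_top n)" for t
    using collapse_denominator[of t n] that by auto
  show "continuous_map (simplex_top n) euclideanreal (\<lambda>x. collapse n x i)" for i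
  proof (cases "i \<le> n")
    case True
    then show ?thesis unfolding collapse_def Let_def using nz
      by simp (intro continuous_intros continuous_map_Rtop_coord cm, auto)
  qed (simp add: collapse_def Let_def)
  show "collapse n \<in> topspace (simplex_top n) \<rightarrow> topspace (nsphere n)" using collapse_in by auto
qed

lemma collapse_bdry:
  assumes "t \<in> simplex_bdry n"
  shows "collapse n t = (\<lambda>i. - pole n i)"
proof -
  have t: "t \<in> standard_simplex n" using assms by (simp add: simplex_bdry_def)
  have m: "min_coord n t = 0" using min_coord_simplex(2)[OF t] assms by blast
  have "(\<Sum>i\<le>n. (t i - barycentre n i)\<^sup>2) > 0" using collapse_denominator[OF t] m by simp
  then show ?thesis by (auto simp: collapse_def Let_def m fun_eq_iff pole_def)
qed

text \<open>Stereographic projection from the antipole: \<open>c\<close> is the height of the image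
  in the direction of the pole, and the quotient by \<open>1 + c\<close> recovers the vector
  \<open>v / m\<close>.\<close>

lemma collapse_decompose:
  assumes t: "t \<in> standard_simplex n" and tb: "t \<notin> simplex_bdry n"
  defines "c \<equiv> (\<Sum>i\<le>n. collapse n t i * pole n i)"
  shows "1 + c > 0" "\<And>i. i \<le> n \<Longrightarrow> t i = barycentre n i + min_coord n t * ((collapse n t i - c * pole n i) / (1 + c))"
proof -
  define m where "m = min_coord n t"
  define v where "v = (\<lambda>i. t i - barycentre n i)"
  define s where "s = (\<Sum>i\<le>n. (v i)\<^sup>2)"
  have D: "m\<^sup>2 + s > 0" using collapse_denominator[OF t] by (simp add: m_def s_def v_def)
  have m0: "m > 0" using min_coord_simplex(1,2)[OF t] tb by (auto simp: m_def less_le)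
  have vN: "(\<Sum>i\<le>n. v i * pole n i) = 0" unfolding sum_mult_pole using sum_simplex_barycentre[OF t] by (simp add: v_def)
  have k: "collapse n t i = (2 * m * v i + (m\<^sup>2 - s) * pole n i) / (m\<^sup>2 + s)" if "i \<le> n" for i
    using that by (simp add: collapse_def Let_def m_def v_def s_def)
  have "c = (\<Sum>i\<le>n. (2 * m * (v i * pole n i) + (m\<^sup>2 - s) * (pole n i)\<^sup>2) / (m\<^sup>2 + s))"
    unfolding c_def by (intro sum.cong refl) (simp add: k power2_eq_square algebra_simps)
  also have "\<dots> = (2 * m * (\<Sum>i\<le>n. v i * pole n i) + (m\<^sup>2 - s) * (\<Sum>i\<le>n. (pole n i)\<^sup>2)) / (m\<^sup>2 + s)"
    by (simp add: sum.distrib sum_distrib_left flip: sum_divide_distrib)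
  finally have c: "c = (m\<^sup>2 - s) / (m\<^sup>2 + s)" unfolding vN sum_pole_sq by simp
  have c1: "1 + c = 2 * m\<^sup>2 / (m\<^sup>2 + s)" using D unfolding c by (simp add: field_simps)
  then show "1 + c > 0" using D m0 by simp
  show "t i = barycentre n i + min_coord n t * ((collapse n t i - c * pole n i) / (1 + c))" if i: "i \<le> n" for i
  proof -
    have "collapse n t i - c * pole n i = 2 * m * v i / (m\<^sup>2 + s)"
      unfolding k[OF i] c by (simp add: add_divide_distrib)
    then have "(collapse n t i - c * pole n i) / (1 + c) = v i / m"
      using D m0 unfolding c1 by (simp add: field_simps power2_eq_square)
    then show ?thesis using m0 by (simp add: v_def m_def)
  qed
qed

lemma collapse_eq_antipole_iff:
  assumes t: "t \<in> standard_simplex n"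
  shows "collapse n t = (\<lambda>i. - pole n i) \<longleftrightarrow> t \<in> simplex_bdry n"
proof
  assume e: "collapse n t = (\<lambda>i. - pole n i)"
  have "(\<Sum>i\<le>n. collapse n t i * pole n i) = -1"
    using sum_pole_sq[of n] unfolding e by (simp add: power2_eq_square sum_negf)
  then show "t \<in> simplex_bdry n" using collapse_decompose(1)[OF t] by force
qed (rule collapse_bdry)

text \<open>The image determines \<open>w = v / m\<close>. Taking least coordinates in the equation
  of \<open>collapse_decompose\<close> gives
  \<open>m * (1 - min_coord n w) = 1 / real (Suc n)\<close>, which determines \<open>m\<close> and
  with it the point.\<close>

lemma collapse_inj: "inj_on (collapse n) (standard_simplex n - simplex_bdry n)"
proof (rule inj_onI)
  fix t t' assume tt: "t \<in> standard_simplex n - simplex_bdry n" "t' \<in> standard_simplex n - simplex_bdry n"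
    and e: "collapse n t = collapse n t'"
  then have t: "t \<in> standard_simplex n" "t \<notin> simplex_bdry n" and t': "t' \<in> standard_simplex n" "t' \<notin> simplex_bdry n" by auto
  define c where "c = (\<Sum>i\<le>n. collapse n t i * pole n i)"
  define w where "w = (\<lambda>i. (collapse n t i - c * pole n i) / (1 + c))"
  have 1: "t i = barycentre n i + min_coord n t * w i" if "i \<le> n" for i
    using collapse_decompose(2)[OF t that] by (simp add: w_def c_def)
  have 2: "t' i = barycentre n i + min_coord n t' * w i" if "i \<le> n" for i
    using collapse_decompose(2)[OF t' that] by (simp add: w_def c_def e)
  have mm: "min_coord n u * (1 - min_coord n w) = 1 / real (Suc n)"
    if u: "u \<in> standard_simplex n" "\<And>i. i \<le> n \<Longrightarrow> u i = barycentre n i + min_coord n u * w i" for u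
  proof -
    have "min_coord n u = min_coord n (\<lambda>i. 1 / real (Suc n) + min_coord n u * w i)"
      by (rule min_coord_cong) (simp add: u(2) barycentre_def)
    also have "\<dots> = 1 / real (Suc n) + min_coord n u * min_coord n w"
      by (rule min_coord_affine) (rule min_coord_simplex(1)[OF u(1)])
    finally show ?thesis by (simp add: algebra_simps)
  qed
  have e1: "min_coord n t * (1 - min_coord n w) = min_coord n t' * (1 - min_coord n w)"
    using mm[OF t(1) 1] mm[OF t'(1) 2] by simp
  moreover have "1 - min_coord n w \<noteq> 0" using mm[OF t(1) 1] by auto
  ultimately have "min_coord n t = min_coord n t'" by simp
  then have "t i = t' i" if "i \<le> n" for i using 1[OF that] 2[OF that] by simp
  then show "t = t'" using simplexD(3)[OF t(1)] simplexD(3)[OF t'(1)] by (metis ext not_le)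
qed

lemma collapse_surj:
  assumes x: "x \<in> topspace (nsphere n)" and xp: "x \<noteq> (\<lambda>i. - pole n i)"
  shows "\<exists>t\<in>standard_simplex n - simplex_bdry n. collapse n t = x"
proof -
  define c where "c = (\<Sum>i\<le>n. x i * pole n i)"
  have xx: "(\<Sum>i\<le>n. (x i)\<^sup>2) = 1" using nsphereD(1)[OF x] .
  have e: "(\<Sum>i\<le>n. (x i + pole n i)\<^sup>2) = 2 * (1 + c)"
  proof -
    have "(\<Sum>i\<le>n. (x i + pole n i)\<^sup>2) = (\<Sum>i\<le>n. (x i)\<^sup>2 + (pole n i)\<^sup>2 + 2 * (x i * pole n i))"
      by (intro sum.cong refl) (simp add: power2_eq_square algebra_simps)
    also have "\<dots> = (\<Sum>i\<le>n. (x i)\<^sup>2) + (\<Sum>i\<le>n. (pole n i)\<^sup>2) + 2 * c"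
      by (simp add: sum.distrib c_def sum_distrib_left)
    finally show ?thesis using xx sum_pole_sq[of n] by simp
  qed
  have c1: "1 + c > 0"
  proof (rule ccontr)
    assume "\<not> 1 + c > 0"
    then have z: "(\<Sum>i\<le>n. (x i + pole n i)\<^sup>2) = 0"
      using e sum_nonneg[of "{..n}" "\<lambda>i. (x i + pole n i)\<^sup>2"] by auto
    then have "x i = - pole n i" if "i \<le> n" for i using that by (auto simp: sum_nonneg_eq_0_iff add_eq_0_iff)
    then have "x = (\<lambda>i. - pole n i)" using nsphereD(2)[OF x] by (auto simp: fun_eq_iff pole_def not_le)
    then show False using xp by simp
  qed
  define w where "w = (\<lambda>i. (x i - c * pole n i) / (1 + c))"
  have sw: "(\<Sum>i\<le>n. w i) = 0"
  proof -
    have "(\<Sum>i\<le>n. x i - c * pole n i) = (\<Sum>i\<le>n. x i) - c * (\<Sum>i\<le>n. pole n i)" by (simp add: sum_subtractf sum_distrib_left)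
    moreover have "(\<Sum>i\<le>n. pole n i) = sqrt (real (Suc n))"
      by (simp add: pole_def real_div_sqrt del: of_nat_Suc)
    moreover have "c * sqrt (real (Suc n)) = (\<Sum>i\<le>n. x i)" unfolding c_def sum_mult_pole by simp
    ultimately show ?thesis by (simp add: w_def flip: sum_divide_distrib)
  qed
  have "real (Suc n) * min_coord n w \<le> 0"
  proof -
    have "(\<Sum>i\<le>n. min_coord n w) \<le> (\<Sum>i\<le>n. w i)" by (intro sum_mono) (simp add: min_coord_le)
    then show ?thesis using sw by simp
  qed
  then have mw: "min_coord n w \<le> 0" by (simp add: mult_le_0_iff)
  \<comment> \<open>The value forced by the equation that appears in \<open>collapse_inj\<close>. It
    is positive because the coordinates of \<open>w\<close> sum up to 0, so that the least of them
    is at most 0.\<close>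
  define m where "m = 1 / (real (Suc n) * (1 - min_coord n w))"
  have m0: "m > 0" using mw by (simp add: m_def)
  have m1: "1 / real (Suc n) = m * (1 - min_coord n w)" using mw by (simp add: m_def)
  define t where "t = (\<lambda>i. if i \<le> n then barycentre n i + m * w i else 0)"
  have mt: "min_coord n t = m"
  proof -
    have "min_coord n t = min_coord n (\<lambda>i. 1 / real (Suc n) + m * w i)"
      by (rule min_coord_cong) (simp add: t_def barycentre_def)
    also have "\<dots> = 1 / real (Suc n) + m * min_coord n w" by (rule min_coord_affine) (use m0 in simp)
    also have "\<dots> = m" unfolding m1 by (simp add: algebra_simps)
    finally show ?thesis .
  qed
  have tD: "t \<in> standard_simplex n"
  proof (rule standard_simplexI)
    show "0 \<le> t i" if "i \<le> n" for i using min_coord_le[OF that, of t] mt m0 by simp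
    have "(\<Sum>i\<le>n. t i) = (\<Sum>i\<le>n. barycentre n i) + m * (\<Sum>i\<le>n. w i)" by (simp add: t_def sum.distrib sum_distrib_left)
    then show "(\<Sum>i\<le>n. t i) = 1" using sw simplexD(4)[OF barycentre_in[of n]] by simp
  qed (simp add: t_def)
  have tb: "t \<notin> simplex_bdry n" using min_coord_simplex(2)[OF tD] mt m0 by simp
  define s where "s = (\<Sum>i\<le>n. (t i - barycentre n i)\<^sup>2)"
  have s: "s = m\<^sup>2 * ((1 - c) / (1 + c))"
  proof -
    have "(\<Sum>i\<le>n. (x i - c * pole n i)\<^sup>2) = (\<Sum>i\<le>n. (x i)\<^sup>2 - 2 * c * (x i * pole n i) + c\<^sup>2 * (pole n i)\<^sup>2)"
      by (intro sum.cong refl) (simp add: power2_eq_square algebra_simps)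
    also have "\<dots> = (\<Sum>i\<le>n. (x i)\<^sup>2) - 2 * c * c + c\<^sup>2 * (\<Sum>i\<le>n. (pole n i)\<^sup>2)"
      by (simp add: sum.distrib sum_subtractf c_def sum_distrib_left)
    also have "\<dots> = (1 - c) * (1 + c)" unfolding xx sum_pole_sq by (simp add: power2_eq_square algebra_simps)
    finally have "(\<Sum>i\<le>n. (w i)\<^sup>2) = (1 - c) * (1 + c) / (1 + c)\<^sup>2"
      by (simp add: w_def power_divide flip: sum_divide_distrib)
    then have "(\<Sum>i\<le>n. (w i)\<^sup>2) = (1 - c) / (1 + c)" using c1 by (simp add: power2_eq_square)
    moreover have "s = (\<Sum>i\<le>n. m\<^sup>2 * (w i)\<^sup>2)" unfolding s_def by (intro sum.cong refl) (simp add: t_def power_mult_distrib)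
    ultimately show ?thesis by (simp flip: sum_distrib_left)
  qed
  have D: "m\<^sup>2 + s = m\<^sup>2 * (2 / (1 + c))" and D': "m\<^sup>2 - s = m\<^sup>2 * (2 * c / (1 + c))"
    using c1 unfolding s by (simp_all add: field_simps)
  have "collapse n t i = x i" for i
  proof (cases "i \<le> n")
    case True
    have "collapse n t i = (2 * m * (t i - barycentre n i) + (m\<^sup>2 - s) * pole n i) / (m\<^sup>2 + s)"
      using True by (simp add: collapse_def Let_def mt s_def)
    also have "t i - barycentre n i = m * w i" using True by (simp add: t_def)
    also have "2 * m * (m * w i) + (m\<^sup>2 - s) * pole n i = (m\<^sup>2 * (2 / (1 + c))) * ((1 + c) * w i + c * pole n i)"
      unfolding D' using c1 by (simp add: field_simps power2_eq_square)
    also have "\<dots> / (m\<^sup>2 + s) = (1 + c) * w i + c * pole n i" unfolding D using c1 m0 by simp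
    also have "\<dots> = x i" using c1 by (simp add: w_def)
    finally show ?thesis .
  next
    case False
    then show ?thesis using nsphereD(2)[OF x, of i] by (simp add: collapse_def Let_def)
  qed
  then have "collapse n t = x" by blast
  then show ?thesis using tD tb by blast
qed

lemma collapse_barycentre: "collapse n (barycentre n) = pole n"
  by (auto simp: collapse_def Let_def min_coord_barycentre pole_def fun_eq_iff)

section \<open>Fundamental cycles of spheres\<close>

text \<open>Excision of the complement of \<open>U\<close>, which is closed and contained in the
  open complement of \<open>x\<close>.\<close>

lemma local_homology_iso:
  assumes U: "openin X U" "x \<in> U" and x: "closedin X {x}"
  shows "homology_iso n (subtopology X U) (U - {x}) X (topspace X - {x}) id"
proof (rule homology_isoI)
  let ?W = "topspace X - U"
  have US: "U \<subseteq> topspace X" using U openin_subset by blast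
  have o: "openin X (topspace X - {x})" using x by (simp add: closedin_def)
  have "closedin X ?W" using U by blast
  then have "X closure_of ?W = ?W" by (simp add: closure_of_closedin)
  then have cl: "X closure_of ?W \<subseteq> X interior_of (topspace X - {x})"
    using o U by (auto simp: interior_of_openin)
  have e: "topspace X - ?W = U" "topspace X - {x} - ?W = U - {x}" using US by auto
  show "hom_induced (int n) (subtopology X U) (U - {x}) X (topspace X - {x}) id \<in>
     Group.iso (relative_homology_group (int n) (subtopology X U) (U - {x})) (relative_homology_group (int n) X (topspace X - {x}))"
    using homology_excision_axiom[OF cl, of "topspace X" "int n"] e by simp
  show "continuous_map (subtopology X U) X id" by (simp add: continuous_map_from_subtopology)
  show "id \<in> U - {x} \<rightarrow> topspace X - {x}" using US by auto
qed

lemma closedin_nsphere_point: "x \<in> topspace (nsphere n) \<Longrightarrow> closedin (nsphere n) {x}"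
  using Hausdorff_imp_t1_space[OF Hausdorff_nsphere] by (simp add: t1_space_closedin_singleton)

section \<open>Collapsed simplices and their cycles\<close>

definition const_simplex :: "nat \<Rightarrow> 'a \<Rightarrow> (nat \<Rightarrow> real) \<Rightarrow> 'a" where
  "const_simplex k P = restrict (\<lambda>_. P) (standard_simplex k)"

definition collapsed :: "nat \<Rightarrow> 'a topology \<Rightarrow> 'a \<Rightarrow> ((nat \<Rightarrow> real) \<Rightarrow> 'a) \<Rightarrow> bool" where
  "collapsed n X P \<sigma> \<longleftrightarrow> P \<in> topspace X \<and> singular_simplex n X \<sigma> \<and> (\<forall>t\<in>simplex_bdry n. \<sigma> t = P)"

text \<open>The faces of a collapsed simplex are constant and cancel if \<open>n\<close> is odd; if \<open>n\<close> is even one of them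
  is left over, which the boundary of a constant simplex cancels.\<close>

definition collapsed_cycle :: "nat \<Rightarrow> 'a \<Rightarrow> ((nat \<Rightarrow> real) \<Rightarrow> 'a) \<Rightarrow> 'a chain" where
  "collapsed_cycle n P \<sigma> = frag_of \<sigma> - (if even n then frag_of (const_simplex n P) else 0)"

lemma singular_const_simplex: "P \<in> topspace X \<Longrightarrow> singular_simplex k X (const_simplex k P)"
  unfolding singular_simplex_def const_simplex_def
  by (auto intro: continuous_map_eq[of _ _ "\<lambda>_. P"])

lemma collapsed_const: "P \<in> topspace X \<Longrightarrow> collapsed n X P (const_simplex n P)"
  using singular_const_simplex[of P X n] by (auto simp: collapsed_def const_simplex_def simplex_bdry_def)

lemma collapsed_face:
  assumes "collapsed n X P \<sigma>" "1 \<le> n" "i \<le> n"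
  shows "singular_face n i \<sigma> = const_simplex (n - 1) P"
proof
  fix t
  show "singular_face n i \<sigma> t = const_simplex (n - 1) P t"
  proof (cases "t \<in> standard_simplex (n - 1)")
    case True
    then have "simplical_face i t \<in> standard_simplex n"
      using simplical_face_in_standard_simplex[OF assms(2,3)] by simp
    moreover have "simplical_face i t i = 0" by (simp add: simplical_face_def)
    ultimately have "simplical_face i t \<in> simplex_bdry n" using assms(3) unfolding simplex_bdry_def by blast
    then show ?thesis using True assms(1) by (simp add: singular_face_def const_simplex_def collapsed_def)
  qed (simp add: singular_face_def const_simplex_def)
qed

lemma alternating_sum_cmul:
  "(\<Sum>i\<le>n. frag_cmul ((-1) ^ i) c) = (if even n then c else 0)"
  by (induction n) auto

lemma chain_boundary_collapsed:
  assumes "collapsed n X P \<sigma>" "n > 0"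
  shows "chain_boundary n (frag_of \<sigma>) = (if even n then frag_of (const_simplex (n - 1) P) else 0)"
proof -
  have "chain_boundary n (frag_of \<sigma>) = (\<Sum>i\<le>n. frag_cmul ((-1) ^ i) (frag_of (const_simplex (n - 1) P)))"
    using assms collapsed_face[OF assms(1)] by (simp add: chain_boundary_of)
  then show ?thesis by (simp only: alternating_sum_cmul)
qed

lemma collapsed_cycle_relcycle:
  assumes "collapsed n X P \<sigma>" "n > 0"
  shows "singular_relcycle n X {} (collapsed_cycle n P \<sigma>)"
proof -
  have P: "P \<in> topspace X" "singular_simplex n X \<sigma>" using assms by (auto simp: collapsed_def)
  have "singular_chain n X (collapsed_cycle n P \<sigma>)"
    unfolding collapsed_cycle_def
    by (intro singular_chain_diff) (use P singular_const_simplex[OF P(1)] in \<open>auto simp: singular_chain_of\<close>)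
  moreover have "chain_boundary n (collapsed_cycle n P \<sigma>) = 0"
    using chain_boundary_collapsed[OF assms] chain_boundary_collapsed[OF collapsed_const[OF P(1)] assms(2)]
    by (simp add: collapsed_cycle_def chain_boundary_diff)
  ultimately show ?thesis by (simp add: singular_cycle)
qed

lemma collapsed_simplex_map:
  assumes "collapsed n X P \<sigma>" "continuous_map X Y q"
  shows "collapsed n Y (q P) (simplex_map n q \<sigma>)"
proof -
  have "simplex_bdry n \<subseteq> standard_simplex n" by (auto simp: simplex_bdry_def)
  then show ?thesis
    using assms singular_simplex_simplex_map[OF _ assms(2), of n \<sigma>]
    by (auto simp: collapsed_def simplex_map_def continuous_map_def)
qed

lemma simplex_map_const: "simplex_map n q (const_simplex n P) = const_simplex n (q P)"
  by (auto simp: simplex_map_def const_simplex_def)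

lemma chain_map_collapsed_cycle:
  "chain_map n q (collapsed_cycle n P \<sigma>) = collapsed_cycle n (q P) (simplex_map n q \<sigma>)"
  by (simp add: collapsed_cycle_def chain_map_diff simplex_map_const)

definition collapse_simplex :: "nat \<Rightarrow> (nat \<Rightarrow> real) \<Rightarrow> nat \<Rightarrow> real" where
  "collapse_simplex n = restrict (collapse n) (standard_simplex n)"

abbreviation "antipole n \<equiv> (\<lambda>i. - pole n i)"

lemma collapsed_collapse_simplex: "collapsed n (nsphere n) (antipole n) (collapse_simplex n)"
  unfolding collapsed_def
proof (intro conjI ballI)
  show "antipole n \<in> topspace (nsphere n)" using nsphere_uminus[OF pole_in] .
  show "singular_simplex n (nsphere n) (collapse_simplex n)"
    unfolding singular_simplex_def collapse_simplex_def
    using continuous_map_eq[OF continuous_map_collapse] by auto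
  show "collapse_simplex n t = antipole n" if "t \<in> simplex_bdry n" for t
    using collapse_bdry[OF that] that by (simp add: collapse_simplex_def simplex_bdry_def)
qed

lemma antipole_neq_pole: "antipole n \<noteq> pole n"
proof
  assume "antipole n = pole n"
  then have "- pole n 0 = pole n 0" by metis
  then show False by (simp add: pole_def)
qed

lemma collapse_eq_pole_iff:
  assumes t: "t \<in> standard_simplex n"
  shows "collapse n t = pole n \<longleftrightarrow> t = barycentre n"
proof
  assume e: "collapse n t = pole n"
  have tb: "t \<notin> simplex_bdry n" using collapse_bdry[of t n] antipole_neq_pole[of n] e by metis
  have "min_coord n (barycentre n) \<noteq> 0" by (simp add: min_coord_barycentre)
  then have bb: "barycentre n \<notin> simplex_bdry n" using min_coord_simplex(2)[OF barycentre_in] by blast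
  show "t = barycentre n"
    by (rule inj_onD[OF collapse_inj]) (use e t tb bb barycentre_in collapse_barycentre in auto)
qed (simp add: collapse_barycentre)

text \<open>The collapse maps the open simplex homeomorphically onto the sphere without the
  antipole, and the barycentre to the pole. Excision shrinks the simplex to its interior, the
  homeomorphism carries the local generator over, and excision on the sphere enlarges the space
  again.\<close>

lemma collapse_simplex_hgen_local:
  "hgen n (nsphere n) (topspace (nsphere n) - {pole n}) (frag_of (collapse_simplex n))"
proof -
  let ?X = "simplex_top n" and ?S = "topspace (nsphere n)" and ?D = "standard_simplex n" and ?B = "simplex_bdry n" and ?b = "barycentre n"
  let ?z = "frag_of (std_simplex n) :: (nat \<Rightarrow> real) chain"
  have t1: "t1_space ?X"
    by (intro t1_space_subtopology) (simp add: Hausdorff_imp_t1_space euclidean_product_topology)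
  have bD: "?b \<in> ?D" by (rule barycentre_in)
  have cm: "continuous_map ?X euclideanreal (min_coord n)"
    by (rule continuous_map_min_coord) (rule continuous_map_Rtop_coord)
  have Beq: "?B = {t \<in> topspace ?X. min_coord n t \<in> {0}}"
    using min_coord_simplex(2) by (auto simp: simplex_bdry_def)
  have Bc: "closedin ?X ?B" unfolding Beq by (rule closedin_continuous_map_preimage[OF cm]) simp
  have DB: "openin ?X (?D - ?B)" using Bc by (metis closedin_def topspace_simplex_top)
  have bB: "?b \<in> ?D - ?B"
  proof -
    have "min_coord n ?b \<noteq> 0" by (simp add: min_coord_barycentre)
    then show ?thesis using min_coord_simplex(2)[OF bD] bD by blast
  qed
  have "closedin ?X {?b}" using t1 bD by (simp add: t1_space_closedin_singleton)
  from local_homology_iso[OF DB bB this, of n]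
  interpret I1: homology_iso n "subtopology ?X (?D - ?B)" "?D - ?B - {?b}" ?X "?D - {?b}" id by simp
  have "singular_relcycle n ?X (?D - {?b}) ?z" using std_simplex_hgen_barycentre by (auto simp: hgen_def)
  \<comment> \<open>The standard simplex is not a chain of the open simplex; a homologous cycle
    inside takes its place and is exchanged again at the end.\<close>
  then obtain w where w: "singular_relcycle n (subtopology ?X (?D - ?B)) (?D - ?B - {?b}) w"
    "homologous_rel n ?X (?D - {?b}) ?z (chain_map n id w)" by (rule I1.surj)
  have widw: "chain_map n id w = w" using w(1) chain_map_id_singular by (auto simp: singular_relcycle)
  have "hgen n ?X (?D - {?b}) (chain_map n id w)" using hgen_homologous[OF std_simplex_hgen_barycentre w(2)] .
  then have hw: "hgen n (subtopology ?X (?D - ?B)) (?D - ?B - {?b}) w" using I1.hgen_iff[OF w(1)] by blast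
  let ?SP = "?S - {antipole n}"
  have pre: "{t \<in> topspace ?X. collapse n t \<in> ?SP} = ?D - ?B"
    using collapse_eq_antipole_iff[of _ n] collapse_in[of _ n] by auto
  have im: "collapse n ` (?D - ?B) = ?SP"
  proof
    show "collapse n ` (?D - ?B) \<subseteq> ?SP"
    proof (rule image_subsetI)
      fix t assume t: "t \<in> ?D - ?B"
      then have "collapse n t \<noteq> antipole n" using collapse_eq_antipole_iff[of t n] by simp
      then show "collapse n t \<in> ?SP" using collapse_in[of t n] t by simp
    qed
    show "?SP \<subseteq> collapse n ` (?D - ?B)"
    proof
      fix x assume "x \<in> ?SP"
      then obtain t where "t \<in> ?D - ?B" "collapse n t = x" using collapse_surj[of x n] by blast
      then show "x \<in> collapse n ` (?D - ?B)" by blast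
    qed
  qed
  have hom: "homeomorphic_map (subtopology ?X (?D - ?B)) (subtopology (nsphere n) ?SP) (collapse n)"
  proof (rule bijective_closed_imp_homeomorphic_map)
    have ts: "topspace (subtopology ?X (?D - ?B)) = ?D - ?B" "topspace (subtopology (nsphere n) ?SP) = ?SP" by auto
    show "continuous_map (subtopology ?X (?D - ?B)) (subtopology (nsphere n) ?SP) (collapse n)"
    proof (rule continuous_map_into_subtopology[OF continuous_map_from_subtopology[OF continuous_map_collapse]])
      show "collapse n \<in> topspace (subtopology ?X (?D - ?B)) \<rightarrow> ?SP"
        unfolding ts image_subset_iff_funcset[symmetric] im by (rule subset_refl)
    qed
    \<comment> \<open>Compactness makes the collapse a closed map, and it remains closed over the
      sphere without the antipole, whose full preimage is the open simplex. This gives continuity of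
      the inverse.\<close>
    have "compact_space ?X" using compactin_standard_simplex[of n] by (simp add: compactin_subspace)
    then have "closed_map ?X (nsphere n) (collapse n)"
      using continuous_imp_closed_map[OF continuous_map_collapse _ Hausdorff_nsphere] by blast
    then show "closed_map (subtopology ?X (?D - ?B)) (subtopology (nsphere n) ?SP) (collapse n)"
      using pre by (rule closed_map_restriction)
    show "collapse n ` topspace (subtopology ?X (?D - ?B)) = topspace (subtopology (nsphere n) ?SP)" unfolding ts by (rule im)
    show "inj_on (collapse n) (topspace (subtopology ?X (?D - ?B)))" unfolding ts by (rule collapse_inj)
  qed
  have im2: "collapse n ` (?D - ?B - {?b}) = ?SP - {pole n}"
  proof -
    have "collapse n ` (?D - ?B - {?b}) = collapse n ` (?D - ?B) - {pole n}"
      using collapse_eq_pole_iff[of _ n] bB by auto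
    then show ?thesis unfolding im .
  qed
  have "hom_induced (int n) (subtopology ?X (?D - ?B)) (?D - ?B - {?b}) (subtopology (nsphere n) ?SP) (?SP - {pole n}) (collapse n)
     \<in> Group.iso (relative_homology_group (int n) (subtopology ?X (?D - ?B)) (?D - ?B - {?b}))
         (relative_homology_group (int n) (subtopology (nsphere n) ?SP) (?SP - {pole n}))"
    by (rule homeomorphic_map_relative_homology_iso[OF hom _ im2]) auto
  then interpret I2: homology_iso n "subtopology ?X (?D - ?B)" "?D - ?B - {?b}" "subtopology (nsphere n) ?SP" "?SP - {pole n}" "collapse n"
    by (rule homology_isoI) (use hom homeomorphic_imp_continuous_map im2 in blast)+
  have h2: "hgen n (subtopology (nsphere n) ?SP) (?SP - {pole n}) (chain_map n (collapse n) w)"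
    using I2.hgen_iff[OF w(1)] hw by blast
  have oSP: "openin (nsphere n) ?SP"
    using closedin_nsphere_point[OF nsphere_uminus[OF pole_in]] by (simp add: closedin_def)
  have pSP: "pole n \<in> ?SP" using pole_in antipole_neq_pole[of n] by auto
  have h3: "hgen n (nsphere n) (?S - {pole n}) (chain_map n (collapse n) w)"
    by (rule homology_iso_id_hgen[OF local_homology_iso[OF oSP pSP closedin_nsphere_point[OF pole_in]] h2])
  have "collapse n \<in> ?D - {?b} \<rightarrow> ?S - {pole n}" using collapse_eq_pole_iff[of _ n] collapse_in[of _ n] by blast
  from homologous_rel_chain_map[OF w(2) continuous_map_collapse this]
  have "homologous_rel n (nsphere n) (?S - {pole n}) (frag_of (collapse_simplex n)) (chain_map n (collapse n) w)"
    unfolding widw by (simp add: simplex_map_std collapse_simplex_def)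
  then show ?thesis using hgen_homologous[OF h3] homologous_rel_sym by blast
qed

text \<open>The correcting constant simplex sits at the antipole, hence is zero in the local
  homology at the pole; there the cycle and the collapsed simplex define the same class.\<close>

theorem collapsed_cycle_hgen:
  assumes "n > 0"
  shows "hgen n (nsphere n) {} (collapsed_cycle n (antipole n) (collapse_simplex n))"
proof -
  let ?S = "topspace (nsphere n)"
  let ?e = "if even n then - frag_of (const_simplex n (antipole n)) else 0"
  have P: "antipole n \<in> ?S" using nsphere_uminus[OF pole_in] .
  have "const_simplex n (antipole n) ` standard_simplex n \<subseteq> ?S - {pole n}"
    using P antipole_neq_pole[of n] by (auto simp: const_simplex_def)
  then have "singular_simplex n (subtopology (nsphere n) (?S - {pole n})) (const_simplex n (antipole n))"
    using singular_const_simplex[OF P] by (simp add: singular_simplex_subtopology)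
  then have "singular_chain n (subtopology (nsphere n) (?S - {pole n})) ?e"
    by (auto simp: singular_chain_minus singular_chain_of)
  from homologous_rel_sub_zero[OF this, of "frag_of (collapse_simplex n)"]
  have "homologous_rel n (nsphere n) (?S - {pole n}) (collapsed_cycle n (antipole n) (collapse_simplex n)) (frag_of (collapse_simplex n))"
    by (auto simp: collapsed_cycle_def split: if_splits)
  then have "hgen n (nsphere n) (?S - {pole n}) (collapsed_cycle n (antipole n) (collapse_simplex n))"
    using hgen_homologous[OF collapse_simplex_hgen_local] homologous_rel_sym by blast
  then show ?thesis
    using nsphere_hgen_local[OF assms pole_in collapsed_cycle_relcycle[OF collapsed_collapse_simplex assms]] by blast
qed

section \<open>Transfer of fundamental classes\<close>

text \<open>The part of the simplex that a lift sends to \<open>V\<close> is clopen, hence empty or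
  everything; in the second case the lift is the one given by the section.\<close>

lemma sheet_lift:
  assumes V: "openin N V" "openin N ({z \<in> topspace N. q z \<in> U} - V)" and U: "openin M U"
    and s: "homeomorphic_maps (subtopology N V) (subtopology M U) q s"
    and \<tau>: "singular_simplex k (subtopology M U) \<tau>" and \<sigma>: "\<sigma> \<in> simplex_lifts k N q \<tau>"
  shows "\<sigma> = simplex_map k s \<tau> \<or> \<sigma> ` standard_simplex k \<inter> V = {}"
proof -
  have \<sigma>': "singular_simplex k N \<sigma>" "simplex_map k q \<sigma> = \<tau>" using \<sigma> by (auto simp: simplex_lifts_def)
  note ss = sheet_simps[OF s V(1) U]
  have \<tau>U: "\<tau> t \<in> U" if "t \<in> standard_simplex k" for t using \<tau> that by (auto simp: singular_simplex_subtopology)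
  have q\<sigma>: "q (\<sigma> t) = \<tau> t" if "t \<in> standard_simplex k" for t using \<sigma>'(2) simplex_map_apply[OF that] by metis
  have c: "continuous_map (simplex_top k) N \<sigma>" using \<sigma>' by (simp add: singular_simplex_def)
  have o: "openin (simplex_top k) {t \<in> topspace (simplex_top k). \<sigma> t \<in> V}"
    "openin (simplex_top k) {t \<in> topspace (simplex_top k). \<sigma> t \<in> {z \<in> topspace N. q z \<in> U} - V}"
    using openin_continuous_map_preimage[OF c] V by blast+
  have "{t \<in> topspace (simplex_top k). \<sigma> t \<in> {z \<in> topspace N. q z \<in> U} - V} = topspace (simplex_top k) - {t \<in> topspace (simplex_top k). \<sigma> t \<in> V}"
    using \<tau>U q\<sigma> singular_simplex_value[OF \<sigma>'(1)] by auto
  then have "closedin (simplex_top k) {t \<in> topspace (simplex_top k). \<sigma> t \<in> V}"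
    using o unfolding closedin_def by auto
  then consider "{t \<in> topspace (simplex_top k). \<sigma> t \<in> V} = {}" | "{t \<in> topspace (simplex_top k). \<sigma> t \<in> V} = topspace (simplex_top k)"
    using connected_simplex_top[of k] o(1) unfolding connected_space_clopen_in by blast
  then show ?thesis
  proof cases
    case 1 then show ?thesis by auto
  next
    case 2
    then have V': "\<sigma> t \<in> V" if "t \<in> standard_simplex k" for t using that by auto
    have "\<sigma> t = simplex_map k s \<tau> t" for t
    proof (cases "t \<in> standard_simplex k")
      case True
      then show ?thesis using ss(2)[OF V'[OF True]] q\<sigma>[OF True] by (simp add: simplex_map_def)
    qed (use \<sigma>'(1) in \<open>auto simp: simplex_map_def singular_simplex_def extensional_def\<close>)
    then show ?thesis by blast
  qed
qed

text \<open>Localises the transfer: seen from a point of \<open>V\<close>, only the lift through the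
  section \<open>s\<close> contributes.\<close>

lemma (in finite_sheeted_covering) transfer_sheet:
  assumes V: "openin N V" "openin N ({z \<in> topspace N. q z \<in> U} - V)" and U: "openin M U"
    and s: "homeomorphic_maps (subtopology N V) (subtopology M U) q s"
    and z: "singular_chain k (subtopology M U) z"
  shows "singular_chain k (subtopology N (topspace N - V)) (transfer k N q z - chain_map k s z)"
  using z
proof (induction rule: singular_chain_induct)
  case (one \<tau>)
  note ss = sheet_simps[OF s V(1) U]
  have \<tau>: "singular_simplex k M \<tau>" using one by (simp add: singular_simplex_subtopology)
  have \<tau>U: "\<tau> t \<in> U" if "t \<in> standard_simplex k" for t using one that by (auto simp: singular_simplex_subtopology)
  have "singular_simplex k N (simplex_map k s \<tau>)" by (rule singular_simplex_simplex_map[OF one ss(5)])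
  moreover have "simplex_map k q (simplex_map k s \<tau>) = \<tau>"
  proof
    fix t show "simplex_map k q (simplex_map k s \<tau>) t = \<tau> t"
      using ss(4) \<tau>U \<tau> by (cases "t \<in> standard_simplex k") (auto simp: simplex_map_def singular_simplex_def extensional_def)
  qed
  ultimately have mem: "simplex_map k s \<tau> \<in> simplex_lifts k N q \<tau>" by (simp add: simplex_lifts_def)
  have "transfer k N q (frag_of \<tau>) - chain_map k s (frag_of \<tau>) = (\<Sum>\<sigma>\<in>simplex_lifts k N q \<tau> - {simplex_map k s \<tau>}. frag_of \<sigma>)"
    using mem finite_simplex_lifts(1)[OF \<tau>] by (simp add: sum_diff1)
  moreover have "singular_chain k (subtopology N (topspace N - V)) (frag_of \<sigma>)"
    if "\<sigma> \<in> simplex_lifts k N q \<tau> - {simplex_map k s \<tau>}" for \<sigma>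
  proof -
    have "\<sigma> ` standard_simplex k \<inter> V = {}" using sheet_lift[OF V U s one, of \<sigma>] that by blast
    moreover have "singular_simplex k N \<sigma>" using that by (simp add: simplex_lifts_def)
    moreover from this have "\<sigma> ` standard_simplex k \<subseteq> topspace N" using singular_simplex_value by blast
    ultimately show ?thesis by (auto simp: singular_chain_of singular_simplex_subtopology)
  qed
  ultimately show ?case by (auto intro: singular_chain_sum)
next
  case (diff a b)
  have eq: "transfer k N q (a - b) - chain_map k s (a - b) = (transfer k N q a - chain_map k s a) - (transfer k N q b - chain_map k s b)"
    by (simp only: chain_map_diff transfer_simps) simp
  show ?case unfolding eq by (rule singular_chain_diff[OF diff(3,4)])
qed simp

text \<open>The complement of a fibre is open because the fibre is finite and \<open>N\<close> is
  Hausdorff; its image under the open map \<open>q\<close> is the complement of the point.\<close>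

lemma finite_cover_closed_point:
  assumes fc: "finite_cover d N M q" and x: "x \<in> topspace M"
  shows "closedin M {x}"
proof -
  let ?F = "{y \<in> topspace N. q y = x}"
  have "finite ?F" using fc x by (auto simp: finite_cover_def sheeted_def)
  then have "closedin N ?F" using fc by (auto simp: finite_cover_def intro: closedin_Hausdorff_finite)
  then have "openin N (topspace N - ?F)" by blast
  then have "openin M (q ` (topspace N - ?F))" using fc by (auto simp: finite_cover_def open_map_def)
  moreover have "q ` (topspace N - ?F) = topspace M - {x}"
  proof -
    have im: "q ` topspace N = topspace M" using fc by (simp add: finite_cover_def)
    have "q ` (topspace N - ?F) = q ` topspace N - {x}" by auto
    then show ?thesis unfolding im .
  qed
  ultimately show ?thesis using x by (simp add: closedin_def)
qed

lemma covering_sheet_at: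
  assumes cov: "covering_map N M q" and y: "y \<in> topspace N"
  obtains U V s where "openin M U" "q y \<in> U" "openin N V" "y \<in> V" "openin N ({z \<in> topspace N. q z \<in> U} - V)"
    "homeomorphic_maps (subtopology N V) (subtopology M U) q s"
proof -
  have "q y \<in> topspace M" using cov y by (auto simp: covering_map_def)
  then obtain U where U: "q y \<in> U" "openin M U" and
    sh: "\<And>e. e \<in> topspace N \<Longrightarrow> q e \<in> U \<Longrightarrow>
       \<exists>V s. openin N V \<and> e \<in> V \<and> openin N ({z \<in> topspace N. q z \<in> U} - V) \<and>
             homeomorphic_maps (subtopology N V) (subtopology M U) q s"
    using covering_map_sheet[OF cov] by blast
  obtain V s where "openin N V" "y \<in> V" "openin N ({z \<in> topspace N. q z \<in> U} - V)"
             "homeomorphic_maps (subtopology N V) (subtopology M U) q s"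
    using sh[OF y U(1)] by blast
  then show thesis using that U by blast
qed

lemma sheet_homology_iso:
  assumes V: "openin N V" "y \<in> V" and U: "openin M U"
    and s: "homeomorphic_maps (subtopology N V) (subtopology M U) q s"
  shows "homology_iso n (subtopology M U) (U - {q y}) (subtopology N V) (V - {y}) s"
proof (rule homology_isoI)
  note ss = sheet_simps[OF s V(1) U]
  have hs: "homeomorphic_map (subtopology M U) (subtopology N V) s"
    using s homeomorphic_maps_map homeomorphic_maps_sym by blast
  have im: "s ` (U - {q y}) = V - {y}"
  proof
    show "s ` (U - {q y}) \<subseteq> V - {y}" using ss(3,4) by force
    show "V - {y} \<subseteq> s ` (U - {q y})"
    proof
      fix v assume v: "v \<in> V - {y}"
      then have "q v \<noteq> q y" using ss(2) V(2) by (metis DiffD1 DiffD2 singletonI)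
      then show "v \<in> s ` (U - {q y})" using ss(1,2) v by (intro image_eqI[of _ _ "q v"]) auto
    qed
  qed
  show "hom_induced (int n) (subtopology M U) (U - {q y}) (subtopology N V) (V - {y}) s \<in>
    Group.iso (relative_homology_group (int n) (subtopology M U) (U - {q y})) (relative_homology_group (int n) (subtopology N V) (V - {y}))"
    by (rule homeomorphic_map_relative_homology_iso[OF hs _ im]) (use ss(7) in auto)
  show "continuous_map (subtopology M U) (subtopology N V) s" using hs homeomorphic_imp_continuous_map by blast
  show "s \<in> U - {q y} \<rightarrow> V - {y}" using im by blast
qed

text \<open>One point \<open>y\<close> of the sphere suffices. Near \<open>q y\<close> the class of
  \<open>M\<close> is represented by a local cycle \<open>w\<close> in \<open>U\<close>; the lift of
  \<open>w\<close> to the sheet at \<open>y\<close> is a local generator, and its other lifts stay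
  away from \<open>y\<close>.\<close>

theorem transfer_fundamental_class:
  assumes fc: "finite_cover d (nsphere n) M q" and n: "n > 0" and c: "fundamental_class n M c" "z \<in> c"
  shows "hgen n (nsphere n) {} (transfer n (nsphere n) q z)"
proof -
  let ?N = "nsphere n"
  interpret finite_sheeted_covering ?N M q d by (rule finite_cover_locale[OF fc])
  have z: "singular_relcycle n M {} z" "\<And>x. x \<in> topspace M \<Longrightarrow> hgen n M (topspace M - {x}) z"
    using fundamental_class_iff[OF c(2)] c(1) by auto
  define y where "y = pole n"
  have y: "y \<in> topspace ?N" unfolding y_def by (rule pole_in)
  have qy: "q y \<in> topspace M" using cov y by (auto simp: covering_map_def)
  obtain U V s where U: "openin M U" "q y \<in> U" and V: "openin ?N V" "y \<in> V" "openin ?N ({z \<in> topspace ?N. q z \<in> U} - V)"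
    and s: "homeomorphic_maps (subtopology ?N V) (subtopology M U) q s"
    using covering_sheet_at[OF cov y] by blast
  interpret I1: homology_iso n "subtopology M U" "U - {q y}" M "topspace M - {q y}" id
    by (rule local_homology_iso[OF U finite_cover_closed_point[OF fc qy]])
  interpret I2: homology_iso n "subtopology M U" "U - {q y}" "subtopology ?N V" "V - {y}" s
    by (rule sheet_homology_iso[OF V(1,2) U(1) s])
  have zl: "singular_relcycle n M (topspace M - {q y}) z" using z(2)[OF qy] by (simp add: hgen_def)
  obtain w where w: "singular_relcycle n (subtopology M U) (U - {q y}) w" "homologous_rel n M (topspace M - {q y}) z (chain_map n id w)"
    by (rule I1.surj[OF zl])
  have wc: "singular_chain n (subtopology M U) w" using w(1) by (simp add: singular_relcycle)
  have widw: "chain_map n id w = w" using chain_map_id_singular[OF wc] .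
  have "hgen n (subtopology M U) (U - {q y}) w"
    using I1.hgen_iff[OF w(1)] hgen_homologous[OF z(2)[OF qy] w(2)] by blast
  then have "hgen n (subtopology ?N V) (V - {y}) (chain_map n s w)" using I2.hgen_iff[OF w(1)] by blast
  from homology_iso_id_hgen[OF local_homology_iso[OF V(1,2) closedin_nsphere_point[OF y]] this]
  have g: "hgen n ?N (topspace ?N - {y}) (chain_map n s w)" .
  have "homologous_rel n ?N (q -` (topspace M - {q y})) (transfer n ?N q z) (transfer n ?N q w)"
    using homologous_rel_transfer[OF w(2)] unfolding widw .
  then have "homologous_rel n ?N (topspace ?N \<inter> q -` (topspace M - {q y})) (transfer n ?N q z) (transfer n ?N q w)"
    by simp
  then have h1: "homologous_rel n ?N (topspace ?N - {y}) (transfer n ?N q z) (transfer n ?N q w)"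
    by (rule homologous_rel_id_sub) auto
  have "singular_chain n (subtopology ?N (topspace ?N - V)) (transfer n ?N q w - chain_map n s w)"
    by (rule transfer_sheet[OF V(1,3) U(1) s wc])
  then have "singular_chain n (subtopology ?N (topspace ?N - {y})) (transfer n ?N q w - chain_map n s w)"
    using V(2) by (auto simp: singular_chain_subtopology)
  from homologous_rel_sub_zero[OF this, of "chain_map n s w"]
  have h2: "homologous_rel n ?N (topspace ?N - {y}) (transfer n ?N q w) (chain_map n s w)" by simp
  have "homologous_rel n ?N (topspace ?N - {y}) (chain_map n s w) (transfer n ?N q z)"
    using h1 h2 homologous_rel_sym homologous_rel_trans by metis
  then have "hgen n ?N (topspace ?N - {y}) (transfer n ?N q z)" using hgen_homologous[OF g] by blast
  moreover have "singular_relcycle n ?N {} (transfer n ?N q z)" using singular_relcycle_transfer[OF z(1)] by simp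
  ultimately show ?thesis using nsphere_hgen_local[OF n y] by blast
qed

text \<open>Vanishing of the fundamental class of a covering manifold would propagate through the local homology
  at one point to the transfer of the fundamental class of \<open>M\<close>.\<close>

theorem covering_fundamental_class_nonzero:
  assumes fc: "finite_cover d (nsphere n) M q" and n: "n > 0" and c: "fundamental_class n M c"
    and N: "covering_map N M r" "topspace N \<noteq> {}" and cN: "fundamental_class n N cN" "zN \<in> cN"
  shows "\<not> singular_relboundary n N {} zN"
proof
  assume b: "singular_relboundary n N {} zN"
  interpret finite_sheeted_covering "nsphere n" M q d by (rule finite_cover_locale[OF fc])
  obtain z where zc: "z \<in> c" using fundamental_class_nonempty[OF c] .
  have z: "singular_relcycle n M {} z" "\<And>x. x \<in> topspace M \<Longrightarrow> hgen n M (topspace M - {x}) z"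
    using fundamental_class_iff[OF zc] c by auto
  obtain v where v: "v \<in> topspace N" using N(2) by blast
  have rv: "r v \<in> topspace M" using N(1) v by (auto simp: covering_map_def)
  obtain U V s where U: "openin M U" "r v \<in> U" and V: "openin N V" "v \<in> V" "openin N ({z \<in> topspace N. r z \<in> U} - V)"
    and s: "homeomorphic_maps (subtopology N V) (subtopology M U) r s"
    using covering_sheet_at[OF N(1) v] by blast
  \<comment> \<open>As \<open>N\<close> is merely a covering space of \<open>M\<close>, closedness
    of its points has to be derived: \<open>v\<close> is the only point of its fibre outside the
    open union of the other sheets.\<close>
  have cv: "closedin N {v}"
  proof -
    have A: "closedin N {y \<in> topspace N. r y \<in> {r v}}"
      by (rule closedin_continuous_map_preimage[OF covering_map_continuous[OF N(1)] finite_cover_closed_point[OF fc rv]])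
    have B: "closedin N (topspace N - ({z \<in> topspace N. r z \<in> U} - V))" using V(3) by blast
    have C: "{y \<in> topspace N. r y \<in> {r v}} \<inter> (topspace N - ({z \<in> topspace N. r z \<in> U} - V)) = {v}"
    proof (intro equalityI subsetI)
      fix y assume y: "y \<in> {y \<in> topspace N. r y \<in> {r v}} \<inter> (topspace N - ({z \<in> topspace N. r z \<in> U} - V))"
      then have yv: "y \<in> V" "r y = r v" using U(2) by auto
      have "y = s (r y)" using sheet_simps(2)[OF s V(1) U(1) yv(1)] by simp
      also have "\<dots> = v" unfolding yv(2) by (rule sheet_simps(2)[OF s V(1) U(1) V(2)])
      finally show "y \<in> {v}" by simp
    qed (use v V(2) in auto)
    show ?thesis using closedin_Int[OF A B] unfolding C .
  qed
  interpret I1: homology_iso n "subtopology M U" "U - {r v}" M "topspace M - {r v}" id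
    by (rule local_homology_iso[OF U finite_cover_closed_point[OF fc rv]])
  interpret I2: homology_iso n "subtopology M U" "U - {r v}" "subtopology N V" "V - {v}" s
    by (rule sheet_homology_iso[OF V(1,2) U(1) s])
  interpret I3: homology_iso n "subtopology N V" "V - {v}" N "topspace N - {v}" id
    by (rule local_homology_iso[OF V(1,2) cv])
  have zl: "singular_relcycle n M (topspace M - {r v}) z" using z(2)[OF rv] by (simp add: hgen_def)
  obtain w where w: "singular_relcycle n (subtopology M U) (U - {r v}) w" "homologous_rel n M (topspace M - {r v}) z (chain_map n id w)"
    by (rule I1.surj[OF zl])
  have sw: "singular_relcycle n (subtopology N V) (V - {v}) (chain_map n s w)"
    using singular_relcycle_chain_map[OF w(1) I2.cf I2.fST] .
  have "hgen n N (topspace N - {v}) zN" using fundamental_class_iff[OF cN(2)] cN(1) v by blast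
  moreover have "singular_relcycle n N (topspace N - {v}) (chain_map n id (chain_map n s w))"
    using singular_relcycle_chain_map[OF sw I3.cf I3.fST] .
  ultimately obtain m where m: "homologous_rel n N (topspace N - {v}) (chain_map n id (chain_map n s w)) (frag_cmul m zN)"
    by (auto simp: hgen_def)
  \<comment> \<open>The local class of \<open>M\<close> at \<open>r v\<close>, carried to
    \<open>N\<close>, is a multiple of \<open>zN\<close>. If \<open>zN\<close> bounds, that class
    vanishes locally in \<open>N\<close>, then in the sheet and over \<open>U\<close>, and finally
    in \<open>M\<close>.\<close>
  have "homologous_rel n N {} zN 0" using b by (simp add: homologous_rel_0)
  then have "homologous_rel n N (topspace N - {v}) zN 0" by (rule homologous_rel_id_sub) simp
  from homologous_rel_cmul[OF this, of m] have "homologous_rel n N (topspace N - {v}) (frag_cmul m zN) 0" by simp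
  then have "homologous_rel n N (topspace N - {v}) (chain_map n id (chain_map n s w)) (chain_map n id 0)"
    using m homologous_rel_trans by (metis chain_map_0)
  then have "homologous_rel n (subtopology N V) (V - {v}) (chain_map n s w) (chain_map n s 0)"
    by (intro I3.inj) (use sw in auto)
  then have "homologous_rel n (subtopology M U) (U - {r v}) w 0" by (intro I2.inj w(1)) auto
  from homologous_rel_chain_map[OF this I1.cf I1.fST] have "homologous_rel n M (topspace M - {r v}) (chain_map n id w) 0" by simp
  then have z0: "homologous_rel n M (topspace M - {r v}) z 0" using w(2) homologous_rel_trans by blast
  obtain y where y: "y \<in> topspace (nsphere n)" "q y = r v"
    using covering_map_surj[OF cov] rv by (metis imageE)
  have "homologous_rel n (nsphere n) (q -` (topspace M - {r v})) (transfer n (nsphere n) q z) (transfer n (nsphere n) q 0)"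
    by (rule homologous_rel_transfer[OF z0])
  then have "homologous_rel n (nsphere n) (topspace (nsphere n) \<inter> q -` (topspace M - {r v})) (transfer n (nsphere n) q z) 0"
    by simp
  then have h: "homologous_rel n (nsphere n) (topspace (nsphere n) - {y}) (transfer n (nsphere n) q z) 0"
    by (rule homologous_rel_id_sub) (use y in auto)
  interpret I4: homology_iso n "nsphere n" "{}" "nsphere n" "topspace (nsphere n) - {y}" id
    by (rule nsphere_homology_iso[OF n y(1)])
  have tz: "singular_relcycle n (nsphere n) {} (transfer n (nsphere n) q z)" using singular_relcycle_transfer[OF z(1)] by simp
  have "chain_map n id (transfer n (nsphere n) q z) = transfer n (nsphere n) q z"
    using tz chain_map_id_singular by (auto simp: singular_relcycle)
  then have "homologous_rel n (nsphere n) {} (transfer n (nsphere n) q z) 0"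
    by (intro I4.inj tz) (use h in auto)
  then have "singular_relboundary n (nsphere n) {} (frag_cmul 1 (transfer n (nsphere n) q z))"
    by (simp add: homologous_rel_0)
  then show False
    using integer_homology_hgen(2)[OF homology_nsphere_integer[OF n] transfer_fundamental_class[OF fc n c zc]] by fastforce
qed

section \<open>Doubling\<close>

lemma sum_atMost_split2:
  fixes f :: "nat \<Rightarrow> real"
  assumes "n \<ge> 1"
  shows "(\<Sum>i\<le>n. f i) = f 0 + f 1 + (\<Sum>i\<in>{2..n}. f i)"
proof -
  have "{..n} = {0, 1} \<union> {2..n}" using assms by auto
  then have "(\<Sum>i\<le>n. f i) = (\<Sum>i\<in>{0, 1} \<union> {2..n}. f i)" by (rule arg_cong)
  also have "\<dots> = (\<Sum>i\<in>{0, 1}. f i) + (\<Sum>i\<in>{2..n}. f i)" by (rule sum.union_disjoint) auto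
  finally show ?thesis by simp
qed

text \<open>The affine map that stretches the half \<open>t 1 \<le> t 0\<close> over the whole
  simplex: the midpoint of the first edge goes to vertex \<open>1\<close>, the remaining corners
  stay. \<open>fold_right\<close> treats the other half, with the midpoint going to vertex
  \<open>0\<close>.\<close>

definition fold_left :: "(nat \<Rightarrow> real) \<Rightarrow> nat \<Rightarrow> real" where
  "fold_left t = (\<lambda>i. if i = 0 then t 0 - t 1 else if i = 1 then 2 * t 1 else t i)"

definition fold_right :: "(nat \<Rightarrow> real) \<Rightarrow> nat \<Rightarrow> real" where
  "fold_right t = (\<lambda>i. if i = 0 then 2 * t 0 else if i = 1 then t 1 - t 0 else t i)"

definition double_simplex :: "nat \<Rightarrow> ((nat \<Rightarrow> real) \<Rightarrow> 'a) \<Rightarrow> (nat \<Rightarrow> real) \<Rightarrow> 'a" where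
  "double_simplex n \<sigma> = restrict (\<lambda>t. if t 1 \<le> t 0 then \<sigma> (fold_left t) else \<sigma> (fold_right t)) (standard_simplex n)"

text \<open>\<open>squash\<close> is the affine map of the \<open>(n+1)\<close>-simplex onto the \<open>n\<close>-simplex that sends vertex \<open>1\<close> to the
  midpoint of the first edge: two of its faces are the halves on which \<open>double_simplex\<close> is \<open>\<sigma>\<close>, a third one
  is the whole simplex, and the remaining ones lie in the boundary.\<close>

definition squash :: "(nat \<Rightarrow> real) \<Rightarrow> nat \<Rightarrow> real" where
  "squash s = (\<lambda>i. if i = 0 then s 0 + s 1 / 2 else if i = 1 then s 2 + s 1 / 2 else s (Suc i))"

lemma fold_in:
  assumes n: "n \<ge> 1" and t: "t \<in> standard_simplex n"
  shows "t 1 \<le> t 0 \<Longrightarrow> fold_left t \<in> standard_simplex n" "t 0 \<le> t 1 \<Longrightarrow> fold_right t \<in> standard_simplex n"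
proof -
  have s: "t 0 + t 1 + (\<Sum>i\<in>{2..n}. t i) = 1" using simplexD(4)[OF t] sum_atMost_split2[OF n, of t] by simp
  show "fold_left t \<in> standard_simplex n" if "t 1 \<le> t 0"
  proof (rule standard_simplexI)
    show "0 \<le> fold_left t i" for i using simplexD(1)[OF t] that by (auto simp: fold_left_def)
    show "fold_left t i = 0" if "i > n" for i using simplexD(3)[OF t that] n that by (auto simp: fold_left_def)
    show "(\<Sum>i\<le>n. fold_left t i) = 1"
      unfolding sum_atMost_split2[OF n] using s by (simp add: fold_left_def)
  qed
  show "fold_right t \<in> standard_simplex n" if "t 0 \<le> t 1"
  proof (rule standard_simplexI)
    show "0 \<le> fold_right t i" for i using simplexD(1)[OF t] that by (auto simp: fold_right_def)
    show "fold_right t i = 0" if "i > n" for i using simplexD(3)[OF t that] n that by (auto simp: fold_right_def)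
    show "(\<Sum>i\<le>n. fold_right t i) = 1"
      unfolding sum_atMost_split2[OF n] using s by (simp add: fold_right_def)
  qed
qed

lemma squash_in:
  assumes n: "n \<ge> 1" and s: "s \<in> standard_simplex (Suc n)"
  shows "squash s \<in> standard_simplex n"
proof (rule standard_simplexI)
  show "0 \<le> squash s i" for i using simplexD(1)[OF s] by (auto simp: squash_def intro!: add_nonneg_nonneg)
  show "squash s i = 0" if "i > n" for i using simplexD(3)[OF s, of "Suc i"] that n by (auto simp: squash_def)
  have "(\<Sum>i\<le>n. squash s i) = s 0 + s 1 + s 2 + (\<Sum>i\<in>{2..n}. s (Suc i))"
    unfolding sum_atMost_split2[OF n] by (simp add: squash_def)
  also have "\<dots> = s 0 + (\<Sum>i\<le>n. s (Suc i))"
    unfolding sum_atMost_split2[OF n] by (simp add: numeral_2_eq_2)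
  also have "\<dots> = (\<Sum>i\<le>Suc n. s i)" by (simp add: sum.atMost_Suc_shift del: sum.atMost_Suc)
  finally show "(\<Sum>i\<le>n. squash s i) = 1" using simplexD(4)[OF s] by simp
qed

lemma simplex_bdryI: "t \<in> standard_simplex n \<Longrightarrow> i \<le> n \<Longrightarrow> t i = 0 \<Longrightarrow> t \<in> simplex_bdry n"
  by (auto simp: simplex_bdry_def)

lemma double_simplex_left:
  assumes "t \<in> standard_simplex n" "t 1 \<le> t 0"
  shows "double_simplex n \<sigma> t = \<sigma> (fold_left t)"
  using assms by (simp add: double_simplex_def)

text \<open>On the wall between the halves both foldings end in the boundary, where
  \<open>\<sigma>\<close> is constant. This is why the two formulas fit together, and why the
  simplex has to be collapsed.\<close>

lemma double_simplex_right:
  assumes \<sigma>: "collapsed n X P \<sigma>" and n: "n \<ge> 1" and t: "t \<in> standard_simplex n" "t 0 \<le> t 1"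
  shows "double_simplex n \<sigma> t = \<sigma> (fold_right t)"
proof (cases "t 1 \<le> t 0")
  case True
  then have e: "t 1 = t 0" using t(2) by simp
  have "fold_left t \<in> simplex_bdry n"
    using e by (intro simplex_bdryI[OF fold_in(1)[OF n t(1) True], of 0]) (auto simp: fold_left_def)
  moreover have "fold_right t \<in> simplex_bdry n"
    using e n by (intro simplex_bdryI[OF fold_in(2)[OF n t], of 1]) (auto simp: fold_right_def)
  ultimately show ?thesis using \<sigma> double_simplex_left[OF t(1) True, of \<sigma>] by (simp add: collapsed_def)
qed (use t in \<open>simp add: double_simplex_def\<close>)

lemma collapsed_double:
  assumes \<sigma>: "collapsed n X P \<sigma>" and n: "n \<ge> 1"
  shows "collapsed n X P (double_simplex n \<sigma>)"
  unfolding collapsed_def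
proof (intro conjI ballI)
  show "P \<in> topspace X" using \<sigma> by (simp add: collapsed_def)
  have c\<sigma>: "continuous_map (simplex_top n) X \<sigma>" using \<sigma> by (simp add: collapsed_def singular_simplex_def)
  let ?L = "subtopology (simplex_top n) {t \<in> topspace (simplex_top n). t 1 \<le> t 0}"
  let ?R = "subtopology (simplex_top n) {t \<in> topspace (simplex_top n). t 0 \<le> t 1}"
  have co: "continuous_map (subtopology (simplex_top n) S) euclideanreal (\<lambda>t. t i)" for S i
    by (rule continuous_map_from_subtopology[OF continuous_map_Rtop_coord])
  have "continuous_map ?L (simplex_top n) fold_left"
    unfolding continuous_map_simplex_iff
  proof (intro conjI allI)
    show "continuous_map ?L euclideanreal (\<lambda>x. fold_left x i)" for i
      unfolding fold_left_def by (cases "i = 0"; cases "i = 1"; simp only: if_True if_False; intro continuous_intros co) auto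
  qed (use fold_in(1)[OF n] in auto)
  from continuous_map_compose[OF this c\<sigma>] have cL: "continuous_map ?L X (\<lambda>t. \<sigma> (fold_left t))" by (simp add: o_def)
  have "continuous_map ?R (simplex_top n) fold_right"
    unfolding continuous_map_simplex_iff
  proof (intro conjI allI)
    show "continuous_map ?R euclideanreal (\<lambda>x. fold_right x i)" for i
      unfolding fold_right_def by (cases "i = 0"; cases "i = 1"; simp only: if_True if_False; intro continuous_intros co) auto
  qed (use fold_in(2)[OF n] in auto)
  from continuous_map_compose[OF this c\<sigma>] have cR: "continuous_map ?R X (\<lambda>t. \<sigma> (fold_right t))" by (simp add: o_def)
  have "continuous_map (simplex_top n) X (\<lambda>t. if t 1 \<le> t 0 then \<sigma> (fold_left t) else \<sigma> (fold_right t))"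
  proof (rule continuous_map_cases_le[OF continuous_map_Rtop_coord continuous_map_Rtop_coord cL cR])
    fix t assume "t \<in> topspace (simplex_top n)" "t 1 = t 0"
    then show "\<sigma> (fold_left t) = \<sigma> (fold_right t)"
      using double_simplex_left[of t n \<sigma>] double_simplex_right[OF \<sigma> n, of t] by simp
  qed
  then show "singular_simplex n X (double_simplex n \<sigma>)"
    unfolding singular_simplex_def double_simplex_def
    by (auto intro: continuous_map_eq)
  fix t assume tb: "t \<in> simplex_bdry n"
  then obtain i where i: "i \<le> n" "t i = 0" and t: "t \<in> standard_simplex n" by (auto simp: simplex_bdry_def)
  show "double_simplex n \<sigma> t = P"
  proof (cases "t 1 \<le> t 0")
    case True
    have "\<exists>j\<le>n. fold_left t j = 0"
    proof (cases "i = 0")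
      case True
      then have "t 1 = 0" using i simplexD(1)[OF t, of 1] \<open>t 1 \<le> t 0\<close> by simp
      then show ?thesis using n by (intro exI[of _ 1]) (simp add: fold_left_def)
    next
      case False
      then show ?thesis using i by (intro exI[of _ i]) (auto simp: fold_left_def)
    qed
    then have "fold_left t \<in> simplex_bdry n" using fold_in(1)[OF n t True] by (auto simp: simplex_bdry_def)
    then show ?thesis using \<sigma> double_simplex_left[OF t True, of \<sigma>] by (simp add: collapsed_def)
  next
    case False
    then have le: "t 0 \<le> t 1" by simp
    have "i \<noteq> 1" using i simplexD(1)[OF t, of 0] False by auto
    then have "\<exists>j\<le>n. fold_right t j = 0"
      using i by (intro exI[of _ i]) (auto simp: fold_right_def)
    then have "fold_right t \<in> simplex_bdry n" using fold_in(2)[OF n t le] by (auto simp: simplex_bdry_def)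
    then show ?thesis using \<sigma> double_simplex_right[OF \<sigma> n t le] by (simp add: collapsed_def)
  qed
qed

text \<open>Faces 0, 1 and 2 of \<open>\<rho>\<close> are \<open>\<sigma>\<close>, its double and
  \<open>\<sigma>\<close>, with signs +, - and +. The faces from 3 on are constant, and what remains
  of them accounts for the constant corrections in the two cycles.\<close>

lemma double_homologous:
  assumes \<sigma>: "collapsed n X P \<sigma>" and n: "n \<ge> 1"
  shows "homologous_rel n X {} (frag_cmul 2 (collapsed_cycle n P \<sigma>)) (collapsed_cycle n P (double_simplex n \<sigma>))"
proof -
  let ?\<tau> = "double_simplex n \<sigma>" and ?c = "frag_of (const_simplex n P)"
  have \<tau>: "collapsed n X P ?\<tau>" by (rule collapsed_double[OF \<sigma> n])
  define \<rho> where "\<rho> = restrict (\<lambda>s. ?\<tau> (squash s)) (standard_simplex (Suc n))"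
  have csq: "continuous_map (simplex_top (Suc n)) (simplex_top n) squash"
    unfolding continuous_map_simplex_iff
  proof (intro conjI allI)
    show "continuous_map (simplex_top (Suc n)) euclideanreal (\<lambda>x. squash x i)" for i
      unfolding squash_def
      by (cases "i = 0"; cases "i = 1"; simp only: if_True if_False; intro continuous_intros continuous_map_Rtop_coord) auto
  qed (use squash_in[OF n] in auto)
  have "continuous_map (simplex_top (Suc n)) X (\<lambda>s. ?\<tau> (squash s))"
    using continuous_map_compose[OF csq, of X ?\<tau>] \<tau> by (simp add: o_def collapsed_def singular_simplex_def)
  then have \<rho>: "singular_simplex (Suc n) X \<rho>"
    unfolding singular_simplex_def \<rho>_def by (auto intro: continuous_map_eq)
  have face: "singular_face (Suc n) i \<rho> t = ?\<tau> (squash (simplical_face i t))" if "i \<le> Suc n" "t \<in> standard_simplex n" for i t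
    using that simplical_face_in_standard_simplex[of "Suc n" i t] by (simp add: singular_face_def \<rho>_def)
  have ext: "singular_face (Suc n) i \<rho> = \<phi>" if "\<And>t. t \<in> standard_simplex n \<Longrightarrow> ?\<tau> (squash (simplical_face i t)) = \<phi> t"
    "i \<le> Suc n" "\<phi> \<in> extensional (standard_simplex n)" for i \<phi>
  proof
    fix t show "singular_face (Suc n) i \<rho> t = \<phi> t"
      using that face by (cases "t \<in> standard_simplex n") (auto simp: singular_face_def extensional_def)
  qed
  have e: "\<sigma> \<in> extensional (standard_simplex n)" "?\<tau> \<in> extensional (standard_simplex n)"
    "const_simplex n P \<in> extensional (standard_simplex n)"
    using \<sigma> \<tau> by (auto simp: collapsed_def singular_simplex_def const_simplex_def)
  have sqf: "squash (simplical_face i t) \<in> standard_simplex n" if "i \<le> Suc n" "t \<in> standard_simplex n" for i t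
    using squash_in[OF n simplical_face_in_standard_simplex[of "Suc n" i t]] that by simp
  have f0: "singular_face (Suc n) 0 \<rho> = \<sigma>"
  proof (rule ext)
    fix t assume t: "t \<in> standard_simplex n"
    let ?s = "squash (simplical_face 0 t)"
    have "?s 0 \<le> ?s 1" using simplexD(1)[OF t, of 1] by (simp add: squash_def simplical_face_def)
    then have "?\<tau> ?s = \<sigma> (fold_right ?s)" using double_simplex_right[OF \<sigma> n sqf[OF _ t]] by simp
    moreover have "fold_right ?s = t"
      by (auto simp: fold_right_def squash_def simplical_face_def fun_eq_iff)
    ultimately show "?\<tau> ?s = \<sigma> t" by simp
  qed (use e in auto)
  have f1: "singular_face (Suc n) 1 \<rho> = ?\<tau>"
  proof (rule ext)
    fix t assume t: "t \<in> standard_simplex n"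
    have "squash (simplical_face 1 t) = t"
      by (auto simp: squash_def simplical_face_def fun_eq_iff)
    then show "?\<tau> (squash (simplical_face 1 t)) = ?\<tau> t" by simp
  qed (use e in auto)
  have f2: "singular_face (Suc n) 2 \<rho> = \<sigma>"
  proof (rule ext)
    fix t assume t: "t \<in> standard_simplex n"
    let ?s = "squash (simplical_face 2 t)"
    have "?s 1 \<le> ?s 0" using simplexD(1)[OF t, of 0] by (simp add: squash_def simplical_face_def)
    then have "?\<tau> ?s = \<sigma> (fold_left ?s)" using double_simplex_left[OF sqf[OF _ t], of 2] n by simp
    moreover have "fold_left ?s = t"
      by (auto simp: fold_left_def squash_def simplical_face_def fun_eq_iff)
    ultimately show "?\<tau> ?s = \<sigma> t" by simp
  qed (use e n in auto)
  have f3: "singular_face (Suc n) i \<rho> = const_simplex n P" if i: "3 \<le> i" "i \<le> Suc n" for i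
  proof (rule ext)
    fix t assume t: "t \<in> standard_simplex n"
    let ?s = "squash (simplical_face i t)"
    have "?s (i - 1) = simplical_face i t i" using i by (auto simp: squash_def)
    also have "\<dots> = 0" by (simp add: simplical_face_def)
    finally have "?s \<in> simplex_bdry n" using simplex_bdryI[OF sqf[OF i(2) t], of "i - 1"] i by simp
    then show "?\<tau> ?s = const_simplex n P t" using \<tau> t by (simp add: collapsed_def const_simplex_def)
  qed (use e i in auto)
  let ?g = "\<lambda>i. frag_cmul ((-1) ^ i) (frag_of (singular_face (Suc n) i \<rho>))"
  have split: "{..Suc n} = {0, 1, 2} \<union> {3..Suc n}" using n by auto
  have sp: "(\<Sum>i\<le>Suc n. h i) = h 0 + h 1 + h 2 + (\<Sum>i\<in>{3..Suc n}. h i)" for h :: "nat \<Rightarrow> 'a chain"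
  proof -
    have "(\<Sum>i\<le>Suc n. h i) = (\<Sum>i\<in>{0, 1, 2}. h i) + (\<Sum>i\<in>{3..Suc n}. h i)"
      unfolding split by (rule sum.union_disjoint) auto
    then show ?thesis by (simp add: add.assoc)
  qed
  have "(\<Sum>i\<in>{3..Suc n}. ?g i) = (\<Sum>i\<in>{3..Suc n}. frag_cmul ((-1) ^ i) ?c)"
    by (intro sum.cong refl) (simp add: f3)
  also have "\<dots> = (if even (Suc n) then ?c else 0) - ?c"
  proof -
    have "(\<Sum>i\<le>Suc n. frag_cmul ((-1) ^ i) ?c) = ?c + (\<Sum>i\<in>{3..Suc n}. frag_cmul ((-1) ^ i) ?c)"
      unfolding sp by simp
    then show ?thesis
      unfolding alternating_sum_cmul by (simp only: add_diff_cancel_left')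
  qed
  finally have tail: "(\<Sum>i\<in>{3..Suc n}. ?g i) = (if even (Suc n) then ?c else 0) - ?c" .
  have two: "frag_cmul 2 x = x + x" for x :: "'a chain"
    using frag_cmul_distrib[of 1 1 x] by simp
  have "chain_boundary (Suc n) (frag_of \<rho>) = (\<Sum>i\<le>Suc n. ?g i)" by (simp add: chain_boundary_of)
  also have "\<dots> = frag_of \<sigma> - frag_of ?\<tau> + frag_of \<sigma> + ((if even (Suc n) then ?c else 0) - ?c)"
    unfolding sp tail f0 f1 f2 by simp
  also have "\<dots> = frag_cmul 2 (collapsed_cycle n P \<sigma>) - collapsed_cycle n P ?\<tau>"
    by (auto simp: collapsed_cycle_def two)
  finally show ?thesis
    unfolding homologous_rel_def singular_boundary using \<rho> singular_chain_of by metis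
qed

lemma iterated_double:
  assumes \<sigma>: "collapsed n X P \<sigma>" and n: "n \<ge> 1"
  shows "\<exists>\<tau>. collapsed n X P \<tau> \<and> homologous_rel n X {} (frag_cmul (2 ^ m) (collapsed_cycle n P \<sigma>)) (collapsed_cycle n P \<tau>)"
proof (induction m)
  case 0 show ?case using \<sigma> by (intro exI[of _ \<sigma>]) simp
next
  case (Suc m)
  then obtain \<tau> where \<tau>: "collapsed n X P \<tau>"
    "homologous_rel n X {} (frag_cmul (2 ^ m) (collapsed_cycle n P \<sigma>)) (collapsed_cycle n P \<tau>)" by blast
  have "homologous_rel n X {} (frag_cmul (2 ^ Suc m) (collapsed_cycle n P \<sigma>)) (frag_cmul 2 (collapsed_cycle n P \<tau>))"
    using homologous_rel_cmul[OF \<tau>(2), of 2] by simp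
  then show ?case
    using collapsed_double[OF \<tau>(1) n] double_homologous[OF \<tau>(1) n] homologous_rel_trans by blast
qed

section \<open>Norms and coefficient sums of integral chains\<close>

definition cnorm :: "('b \<Rightarrow>\<^sub>0 int) \<Rightarrow> int" where
  "cnorm z = (\<Sum>x\<in>Poly_Mapping.keys z. \<bar>Poly_Mapping.lookup z x\<bar>)"

lemma cnorm_superset:
  assumes "finite A" "Poly_Mapping.keys z \<subseteq> A"
  shows "cnorm z = (\<Sum>x\<in>A. \<bar>Poly_Mapping.lookup z x\<bar>)"
  unfolding cnorm_def by (rule sum.mono_neutral_left) (use assms in \<open>auto simp: in_keys_iff\<close>)

lemma cnorm_diff: "cnorm (a - b) \<le> cnorm a + cnorm b"
proof -
  let ?A = "Poly_Mapping.keys a \<union> Poly_Mapping.keys b"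
  have "cnorm (a - b) = (\<Sum>x\<in>?A. \<bar>Poly_Mapping.lookup (a - b) x\<bar>)"
    by (rule cnorm_superset) (auto simp: in_keys_iff lookup_minus)
  also have "\<dots> \<le> (\<Sum>x\<in>?A. \<bar>Poly_Mapping.lookup a x\<bar> + \<bar>Poly_Mapping.lookup b x\<bar>)"
    by (rule sum_mono) (simp add: lookup_minus abs_triangle_ineq4)
  also have "\<dots> = cnorm a + cnorm b"
    using cnorm_superset[of ?A a] cnorm_superset[of ?A b] by (simp add: sum.distrib)
  finally show ?thesis .
qed

lemma cnorm_frag_of [simp]: "cnorm (frag_of x) = 1"
  by (simp add: cnorm_def)

lemma cnorm_0 [simp]: "cnorm 0 = 0"
  by (simp add: cnorm_def)

lemma cnorm_nonneg: "cnorm z \<ge> 0"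
  by (simp add: cnorm_def sum_nonneg)

lemma cnorm_eq_0: "cnorm z = 0 \<longleftrightarrow> z = 0"
proof
  assume "cnorm z = 0"
  then have "\<forall>x\<in>Poly_Mapping.keys z. \<bar>Poly_Mapping.lookup z x\<bar> = 0"
    unfolding cnorm_def by (simp add: sum_nonneg_eq_0_iff)
  then have "Poly_Mapping.lookup z x = 0" for x by (cases "x \<in> Poly_Mapping.keys z") (auto simp: in_keys_iff)
  then show "z = 0" by (intro poly_mapping_eqI) simp
qed simp

text \<open>Not undercut by any cycle that is not a boundary (\<open>cnorm_nonboundary\<close>), and
  reached by the cycles of collapsed simplices (\<open>cnorm_collapsed_cycle\<close>).\<close>

definition sphere_norm :: "nat \<Rightarrow> nat" where
  "sphere_norm n = (if odd n then 1 else 2)"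

lemma cnorm_collapsed_cycle: "cnorm (collapsed_cycle n P \<sigma>) \<le> int (sphere_norm n)"
  using cnorm_diff[of "frag_of \<sigma>" "frag_of (const_simplex n P)"]
  by (auto simp: collapsed_cycle_def sphere_norm_def)

definition coeff_sum :: "('b \<Rightarrow>\<^sub>0 int) \<Rightarrow> int" where
  "coeff_sum z = (\<Sum>x\<in>Poly_Mapping.keys z. Poly_Mapping.lookup z x)"

lemma coeff_sum_superset:
  assumes "finite A" "Poly_Mapping.keys z \<subseteq> A"
  shows "coeff_sum z = (\<Sum>x\<in>A. Poly_Mapping.lookup z x)"
  unfolding coeff_sum_def by (rule sum.mono_neutral_left) (use assms in \<open>auto simp: in_keys_iff\<close>)

lemma coeff_sum_diff: "coeff_sum (a - b) = coeff_sum a - coeff_sum b"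
proof -
  let ?A = "Poly_Mapping.keys a \<union> Poly_Mapping.keys b"
  have "coeff_sum (a - b) = (\<Sum>x\<in>?A. Poly_Mapping.lookup (a - b) x)"
    by (rule coeff_sum_superset) (auto simp: in_keys_iff lookup_minus)
  then show ?thesis
    using coeff_sum_superset[of ?A a] coeff_sum_superset[of ?A b] by (simp add: lookup_minus sum_subtractf)
qed

lemma coeff_sum_0 [simp]: "coeff_sum 0 = 0" by (simp add: coeff_sum_def)

lemma coeff_sum_frag_of [simp]: "coeff_sum (frag_of x) = 1" by (simp add: coeff_sum_def)

lemma coeff_sum_uminus: "coeff_sum (- a) = - coeff_sum a"
  using coeff_sum_diff[of 0 a] by simp

lemma coeff_sum_add: "coeff_sum (a + b) = coeff_sum a + coeff_sum b"
  using coeff_sum_diff[of a "- b"] by (simp add: coeff_sum_uminus)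

text \<open>A simplex of even dimension \<open>n\<close> has \<open>n + 1\<close> faces whose
  alternating signs add up to 1. Hence a cycle of positive even dimension has coefficient sum
  0.\<close>

lemma coeff_sum_chain_boundary:
  assumes "even n" "n > 0"
  shows "coeff_sum (chain_boundary n z) = coeff_sum z"
  using subset_UNIV[of "Poly_Mapping.keys z"]
proof (induction z rule: frag_induction)
  case (one f)
  have "coeff_sum (\<Sum>i\<le>m. frag_cmul ((-1) ^ i) (frag_of (singular_face n i f))) = (if even m then 1 else 0)" for m
    by (induction m) (auto simp: coeff_sum_add coeff_sum_uminus)
  then show ?case using assms by (simp add: chain_boundary_of)
qed (auto simp: chain_boundary_diff coeff_sum_diff)

text \<open>Replacing coefficients by their absolute values changes the sum by an even number, and
  for a cycle the sum is 0.\<close>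

lemma even_cnorm_cycle:
  assumes "even n" "n > 0" "singular_relcycle n X {} z"
  shows "even (cnorm z)"
proof -
  have "chain_boundary n z = 0" using assms(3) by (simp add: singular_cycle)
  then have "coeff_sum z = 0" using coeff_sum_chain_boundary[OF assms(1,2), of z] by simp
  moreover have "even (cnorm z - coeff_sum z)"
    unfolding cnorm_def coeff_sum_def sum_subtractf[symmetric] by (rule dvd_sum) (auto simp: abs_if)
  ultimately show ?thesis by simp
qed

lemma cnorm_nonboundary:
  assumes "n > 0" "singular_relcycle n X {} z" "\<not> singular_relboundary n X {} z"
  shows "int (sphere_norm n) \<le> cnorm z"
proof -
  have "z \<noteq> 0" using assms(3) by auto
  then have "cnorm z > 0" using cnorm_nonneg[of z] cnorm_eq_0[of z] by linarith
  moreover have "even n \<Longrightarrow> even (cnorm z)" using even_cnorm_cycle assms by blast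
  ultimately show ?thesis by (auto simp: sphere_norm_def elim!: evenE)
qed

section \<open>Simplicial volume and its integral variants\<close>

lemma real_Inf_eqI:
  fixes L :: real
  assumes "\<And>x. x \<in> A \<Longrightarrow> L \<le> x" "\<And>e. e > 0 \<Longrightarrow> \<exists>x\<in>A. x < L + e"
  shows "Inf A = L"
proof (rule cInf_eq_non_empty)
  show "A \<noteq> {}" using assms(2)[of 1] by auto
  fix y assume y: "\<And>x. x \<in> A \<Longrightarrow> y \<le> x"
  show "y \<le> L"
  proof (rule field_le_epsilon)
    fix e :: real assume "e > 0"
    then obtain x where "x \<in> A" "x < L + e" using assms(2) by blast
    then show "y \<le> L + e" using y[of x] by simp
  qed
qed (use assms(1) in auto)

abbreviation "sphere_cycle n \<equiv> collapsed_cycle n (antipole n) (collapse_simplex n)"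

text \<open>The class of \<open>M\<close> comes with an orientation that need not match the one
  given by the collapse; \<open>\<epsilon>\<close> records the sign.\<close>

lemma transfer_sphere_cycle:
  assumes fc: "finite_cover d (nsphere n) M q" and n: "n > 0" and c: "fundamental_class n M c" "z \<in> c"
  obtains \<epsilon> where "\<bar>\<epsilon>\<bar> = 1"
    "homologous_rel n (nsphere n) {} (transfer n (nsphere n) q z) (frag_cmul \<epsilon> (sphere_cycle n))"
proof -
  have "homologous_rel n (nsphere n) {} (transfer n (nsphere n) q z) (sphere_cycle n) \<or>
    homologous_rel n (nsphere n) {} (transfer n (nsphere n) q z) (- sphere_cycle n)"
    by (rule integer_homology_hgen(3)[OF homology_nsphere_integer[OF n] transfer_fundamental_class[OF assms] collapsed_cycle_hgen[OF n]])
  then show ?thesis using that[of 1] that[of "-1"] by auto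
qed

text \<open>Transfer followed by \<open>q\<close> is multiplication by \<open>d\<close>. So
  \<open>d\<close> times the class of \<open>M\<close> is represented, up to sign, by a cycle of
  norm at most \<open>sphere_norm n\<close> to which doubling applies.\<close>

lemma cover_multiple_class:
  assumes fc: "finite_cover d (nsphere n) M q" and n: "n > 0" and c: "fundamental_class n M c" "z \<in> c"
  obtains \<epsilon> where "\<bar>\<epsilon>\<bar> = 1"
    "homologous_rel n M {} (frag_cmul (int d) z)
       (frag_cmul \<epsilon> (collapsed_cycle n (q (antipole n)) (simplex_map n q (collapse_simplex n))))"
proof -
  interpret finite_sheeted_covering "nsphere n" M q d by (rule finite_cover_locale[OF fc])
  obtain \<epsilon> where \<epsilon>: "\<bar>\<epsilon>\<bar> = 1"
    "homologous_rel n (nsphere n) {} (transfer n (nsphere n) q z) (frag_cmul \<epsilon> (sphere_cycle n))"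
    by (rule transfer_sphere_cycle[OF assms])
  have z: "singular_chain n M z" using c fundamental_class_iff by (auto simp: singular_relcycle)
  have "homologous_rel n M {} (chain_map n q (transfer n (nsphere n) q z)) (chain_map n q (frag_cmul \<epsilon> (sphere_cycle n)))"
    by (rule homologous_rel_chain_map[OF \<epsilon>(2) covering_map_continuous[OF cov]]) simp
  then show ?thesis
    using that[OF \<epsilon>(1)] by (simp add: chain_map_transfer[OF z] chain_map_collapsed_cycle)
qed

section \<open>Vanishing of the simplicial volume\<close>

definition scale_real :: "real \<Rightarrow> ('b \<Rightarrow>\<^sub>0 int) \<Rightarrow> ('b \<Rightarrow>\<^sub>0 real)" where
  "scale_real r z = Poly_Mapping.map (\<lambda>k. r * real_of_int k) z"

lemma lookup_scale_real [simp]: "Poly_Mapping.lookup (scale_real r z) x = r * real_of_int (Poly_Mapping.lookup z x)"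
  by (simp add: scale_real_def Poly_Mapping.map.rep_eq when_def)

lemma keys_scale_real: "Poly_Mapping.keys (scale_real r z) \<subseteq> Poly_Mapping.keys z"
  by (auto simp: in_keys_iff)

lemma real_chain_boundary_scale:
  assumes "k > 0"
  shows "real_chain_boundary k (scale_real r b) = scale_real r (chain_boundary k b)"
proof (rule poly_mapping_eqI)
  fix x
  let ?h = "\<lambda>\<sigma> i. if singular_face k i \<sigma> = x then (-1) ^ i * Poly_Mapping.lookup b \<sigma> else 0"
  have "Poly_Mapping.lookup (real_chain_boundary k (scale_real r b)) x
    = (\<Sum>\<sigma>\<in>Poly_Mapping.keys (scale_real r b). \<Sum>i\<le>k. r * real_of_int (?h \<sigma> i))"
    unfolding real_chain_boundary_def using assms
    by (simp add: lookup_sum lookup_single when_def) (intro sum.cong refl, simp)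
  also have "\<dots> = (\<Sum>\<sigma>\<in>Poly_Mapping.keys b. \<Sum>i\<le>k. r * real_of_int (?h \<sigma> i))"
  proof (rule sum.mono_neutral_left[OF finite_keys keys_scale_real], intro ballI sum.neutral)
    fix \<sigma> i assume "\<sigma> \<in> Poly_Mapping.keys b - Poly_Mapping.keys (scale_real r b)"
    then show "r * real_of_int (?h \<sigma> i) = 0" by (auto simp: in_keys_iff)
  qed
  also have "\<dots> = r * real_of_int (\<Sum>\<sigma>\<in>Poly_Mapping.keys b. \<Sum>i\<le>k. ?h \<sigma> i)"
    by (simp add: sum_distrib_left)
  also have "(\<Sum>\<sigma>\<in>Poly_Mapping.keys b. \<Sum>i\<le>k. ?h \<sigma> i) = Poly_Mapping.lookup (chain_boundary k b) x"
    unfolding chain_boundary_def frag_extend_def using assms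
    by (simp add: lookup_sum lookup_single when_def sum_distrib_left) (intro sum.cong refl, simp)
  finally show "Poly_Mapping.lookup (real_chain_boundary k (scale_real r b)) x = Poly_Mapping.lookup (scale_real r (chain_boundary k b)) x"
    by simp
qed

lemma norm_scale_real: "(\<Sum>x\<in>Poly_Mapping.keys (scale_real r z). \<bar>Poly_Mapping.lookup (scale_real r z) x\<bar>) = \<bar>r\<bar> * real_of_int (cnorm z)"
proof -
  have "(\<Sum>x\<in>Poly_Mapping.keys (scale_real r z). \<bar>Poly_Mapping.lookup (scale_real r z) x\<bar>)
    = (\<Sum>x\<in>Poly_Mapping.keys z. \<bar>Poly_Mapping.lookup (scale_real r z) x\<bar>)"
    by (rule sum.mono_neutral_left[OF finite_keys keys_scale_real]) (auto simp: in_keys_iff)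
  then show ?thesis by (simp add: cnorm_def abs_mult sum_distrib_left)
qed

theorem simplicial_volume_zero:
  assumes fc: "finite_cover d (nsphere n) M q" and n: "n > 0" and c: "fundamental_class n M c"
  shows "simplicial_volume n M c = 0"
  unfolding simplicial_volume_def
proof (rule real_Inf_eqI)
  fix e :: real assume e: "e > 0"
  have d: "d > 0" using fc by (simp add: finite_cover_def)
  have cq: "continuous_map (nsphere n) M q" using fc by (simp add: finite_cover_def)
  obtain z where z: "z \<in> c" by (rule fundamental_class_nonempty[OF c])
  obtain \<epsilon> where \<epsilon>: "\<bar>\<epsilon>\<bar> = 1"
    "homologous_rel n M {} (frag_cmul (int d) z)
       (frag_cmul \<epsilon> (collapsed_cycle n (q (antipole n)) (simplex_map n q (collapse_simplex n))))"
    by (rule cover_multiple_class[OF fc n c z])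
  obtain m where m: "real (sphere_norm n) / e < real m" using reals_Archimedean2 by blast
  have "real m < 2 ^ m" by (rule of_nat_less_two_power)
  then have "real (sphere_norm n) / e < 2 ^ m" using m by linarith
  then have small: "real (sphere_norm n) / 2 ^ m < e" using e by (simp add: field_simps)
  have n1: "n \<ge> 1" using n by simp
  obtain \<tau> where \<tau>: "collapsed n M (q (antipole n)) \<tau>"
    "homologous_rel n M {} (frag_cmul (2 ^ m) (collapsed_cycle n (q (antipole n)) (simplex_map n q (collapse_simplex n))))
       (collapsed_cycle n (q (antipole n)) \<tau>)"
    using iterated_double[OF collapsed_simplex_map[OF collapsed_collapse_simplex cq] n1] by blast
  let ?T = "collapsed_cycle n (q (antipole n)) \<tau>"
  have "homologous_rel n M {} (frag_cmul (2 ^ m * int d) z)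
     (frag_cmul \<epsilon> (frag_cmul (2 ^ m) (collapsed_cycle n (q (antipole n)) (simplex_map n q (collapse_simplex n)))))"
    using homologous_rel_cmul[OF \<epsilon>(2), of "2 ^ m"] by (simp add: mult.commute)
  then have "homologous_rel n M {} (frag_cmul (2 ^ m * int d) z) (frag_cmul \<epsilon> ?T)"
    using homologous_rel_cmul[OF \<tau>(2), of \<epsilon>] homologous_rel_trans by metis
  then obtain b where b: "singular_chain (Suc n) M b"
    "chain_boundary (Suc n) b = frag_cmul (2 ^ m * int d) z - frag_cmul \<epsilon> ?T"
    unfolding homologous_rel_def singular_boundary by blast
  define D where "D = real (2 ^ m * d)"
  have D: "D > 0" using d by (simp add: D_def)
  let ?a = "scale_real (real_of_int \<epsilon> / D) ?T"
  have T: "singular_chain n M ?T" using collapsed_cycle_relcycle[OF \<tau>(1) n] by (simp add: singular_relcycle)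
  \<comment> \<open>The integral chain \<open>b\<close> bounds \<open>D\<close> times
    \<open>z\<close> minus the signed cycle \<open>?T\<close>. Division by \<open>-D\<close> turns
    this into a real homology between the small cycle \<open>?a\<close> and
    \<open>z\<close>.\<close>
  have "?a - Poly_Mapping.map real_of_int z = scale_real (- 1 / D) (frag_cmul (2 ^ m * int d) z - frag_cmul \<epsilon> ?T)"
  proof (rule poly_mapping_eqI)
    fix x
    have "Poly_Mapping.lookup (Poly_Mapping.map real_of_int z) x = real_of_int (Poly_Mapping.lookup z x)"
      by (simp add: Poly_Mapping.map.rep_eq when_def)
    then show "Poly_Mapping.lookup (?a - Poly_Mapping.map real_of_int z) x
       = Poly_Mapping.lookup (scale_real (- 1 / D) (frag_cmul (2 ^ m * int d) z - frag_cmul \<epsilon> ?T)) x"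
      using D by (simp add: lookup_minus field_simps) (simp add: D_def field_simps)
  qed
  also have "\<dots> = real_chain_boundary (Suc n) (scale_real (- 1 / D) b)"
    by (simp add: real_chain_boundary_scale b(2))
  finally have eq: "?a - Poly_Mapping.map real_of_int z = real_chain_boundary (Suc n) (scale_real (- 1 / D) b)" .
  have "real_singular_chain n M ?a"
    unfolding real_singular_chain_def using T unfolding singular_chain_def by (rule order_trans[OF keys_scale_real])
  moreover have "real_singular_chain (Suc n) M (scale_real (- 1 / D) b)"
    unfolding real_singular_chain_def using b(1) unfolding singular_chain_def by (rule order_trans[OF keys_scale_real])
  ultimately have "real_fundamental_cycle n M c ?a"
    unfolding real_fundamental_cycle_def using eq z by blast
  moreover have "(\<Sum>x\<in>Poly_Mapping.keys ?a. \<bar>Poly_Mapping.lookup ?a x\<bar>) < 0 + e"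
  proof -
    have "\<bar>real_of_int \<epsilon>\<bar> = 1" using \<epsilon>(1) by linarith
    then have "(\<Sum>x\<in>Poly_Mapping.keys ?a. \<bar>Poly_Mapping.lookup ?a x\<bar>) = real_of_int (cnorm ?T) / D"
      unfolding norm_scale_real using D by (simp add: abs_divide)
    also have "\<dots> \<le> real (sphere_norm n) / D"
      using D cnorm_collapsed_cycle[of n "q (antipole n)" \<tau>] by (intro divide_right_mono) linarith+
    also have "\<dots> \<le> real (sphere_norm n) / 2 ^ m"
      using d by (intro divide_left_mono) (auto simp: D_def)
    finally show ?thesis using small by simp
  qed
  ultimately show "\<exists>x\<in>{\<Sum>\<sigma>\<in>Poly_Mapping.keys a. \<bar>Poly_Mapping.lookup a \<sigma>\<bar> | a. real_fundamental_cycle n M c a}. x < 0 + e"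
    by blast
qed (auto intro: sum_nonneg)

section \<open>The stable integral simplicial volume\<close>

lemma integral_simplicial_volume_le: "z \<in> c \<Longrightarrow> int (integral_simplicial_volume c) \<le> cnorm z"
proof -
  assume "z \<in> c"
  then have "\<exists>z\<in>c. int (nat (cnorm z)) = cnorm z" using cnorm_nonneg by auto
  have "integral_simplicial_volume c \<le> nat (cnorm z)"
    unfolding integral_simplicial_volume_def cnorm_def[symmetric]
    by (rule Least_le) (use \<open>z \<in> c\<close> cnorm_nonneg[of z] in auto)
  then show ?thesis using cnorm_nonneg[of z] by linarith
qed

lemma integral_simplicial_volume_ge:
  assumes "c \<noteq> {}" "\<And>z. z \<in> c \<Longrightarrow> int m \<le> cnorm z"
  shows "m \<le> integral_simplicial_volume c"
proof -
  obtain z where "z \<in> c" using assms(1) by blast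
  then have "\<exists>k. \<exists>z\<in>c. int k = cnorm z" using cnorm_nonneg[of z] by (intro exI[of _ "nat (cnorm z)"]) auto
  from LeastI_ex[OF this] obtain z' where "z' \<in> c" "int (integral_simplicial_volume c) = cnorm z'"
    unfolding integral_simplicial_volume_def cnorm_def by blast
  then show ?thesis using assms(2)[of z'] by simp
qed

lemma integral_simplicial_volume_cover_ge:
  assumes fc: "finite_cover d (nsphere n) M q" and n: "n > 0" and c: "fundamental_class n M c"
    and N: "covering_map N M r" "topspace N \<noteq> {}" and cN: "fundamental_class n N cN"
  shows "sphere_norm n \<le> integral_simplicial_volume cN"
proof (rule integral_simplicial_volume_ge)
  show "cN \<noteq> {}" using fundamental_class_nonempty[OF cN] by blast
  show "int (sphere_norm n) \<le> cnorm z" if "z \<in> cN" for z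
    using covering_fundamental_class_nonzero[OF fc n c N cN that] fundamental_class_iff[OF that] cN
    by (intro cnorm_nonboundary[OF n]) auto
qed

text \<open>The sphere is copied onto a set of points of \<open>M\<close> paired with the index of a point in its fibre.\<close>

lemma finite_cover_copy:
  fixes M :: "'a topology"
  assumes fc: "finite_cover d (nsphere n) M q" and n: "n > 0"
  obtains N :: "('a \<times> nat) topology" and r cN where "connected_space N" "covering_map N M r" "sheeted d N M r"
    "fundamental_class n N cN" "integral_simplicial_volume cN \<le> sphere_norm n"
proof -
  let ?S = "topspace (nsphere n)"
  have fin: "finite {y \<in> ?S. q y = x}" if "x \<in> topspace M" for x
    using fc that by (simp add: finite_cover_def sheeted_def)
  have "\<forall>x\<in>topspace M. \<exists>f :: (nat \<Rightarrow> real) \<Rightarrow> nat. inj_on f {y \<in> ?S. q y = x}"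
    using finite_imp_inj_to_nat_seg[OF fin] by blast
  then obtain \<phi> where \<phi>: "\<forall>x\<in>topspace M. inj_on (\<phi> x :: (nat \<Rightarrow> real) \<Rightarrow> nat) {y \<in> ?S. q y = x}" by metis
  have cq: "continuous_map (nsphere n) M q" using fc by (simp add: finite_cover_def)
  define j where "j y = (q y, \<phi> (q y) y)" for y
  have j: "inj_on j ?S"
  proof (rule inj_onI)
    fix x y assume xy: "x \<in> ?S" "y \<in> ?S" "j x = j y"
    have "q x \<in> topspace M" using continuous_map_image_subset_topspace[OF cq] xy(1) by blast
    then show "x = y" using xy \<phi> by (auto simp: j_def inj_on_def)
  qed
  define g where "g = inv_into ?S j"
  have gj: "g (j y) = y" if "y \<in> ?S" for y using that j by (simp add: g_def)
  \<comment> \<open>The topology pulled back along the inverse \<open>g\<close> of the injection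
    \<open>j\<close> makes \<open>j\<close> a homeomorphism onto its image; the type of the points
    is now the one that coverings of \<open>M\<close> are required to have.\<close>
  define N where "N = pullback_topology (j ` ?S) g (nsphere n)"
  have tN: "topspace N = j ` ?S" unfolding N_def topspace_pullback_topology using gj by auto
  have cg: "continuous_map N (nsphere n) g"
    using continuous_map_pullback[OF continuous_map_id, of "j ` ?S" g "nsphere n"] by (simp add: N_def)
  have "continuous_map (nsphere n) (nsphere n) (g \<circ> j)"
    by (rule continuous_map_eq[OF continuous_map_id]) (simp add: gj)
  then have cj: "continuous_map (nsphere n) N j"
    unfolding N_def by (rule continuous_map_pullback') auto
  have hm: "homeomorphic_maps (nsphere n) N j g"
    unfolding homeomorphic_maps_def using cg cj gj tN by auto
  have hj: "homeomorphic_map (nsphere n) N j" using hm homeomorphic_maps_map by blast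
  have hg: "homeomorphic_map N (nsphere n) g" using hm homeomorphic_maps_map by blast
  have hs: "nsphere n homeomorphic_space N" using hm by (auto simp: homeomorphic_space_def)
  have "finite_cover 1 N (nsphere n) g"
    unfolding finite_cover_def
  proof (intro conjI ballI)
    show "Hausdorff_space N" using homeomorphic_Hausdorff_space[OF hs] Hausdorff_nsphere by blast
    show "open_map N (nsphere n) g" using hg by (rule homeomorphic_imp_open_map)
    show gs: "g ` topspace N = ?S" using hg homeomorphic_imp_surjective_map by blast
    have ig: "inj_on g (topspace N)" using hg homeomorphic_imp_injective_map by blast
    show "sheeted 1 N (nsphere n) g"
      unfolding sheeted_def
    proof
      fix x assume x: "x \<in> ?S"
      have "{y \<in> topspace N. g y = x} = {j x}" using x gj tN by auto
      then show "finite {y \<in> topspace N. g y = x} \<and> card {y \<in> topspace N. g y = x} = 1" by simp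
    qed
    show "\<exists>V. openin N V \<and> y \<in> V \<and> inj_on g V" if "y \<in> topspace N" for y
      using that ig openin_topspace by blast
  qed (use cg in auto)
  from finite_cover_compose[OF this fc] have fcN: "finite_cover d N M (q \<circ> g)" by simp
  have con: "connected_space N" using homeomorphic_connected_space[OF hs] connected_nsphere[OF n] by blast
  let ?\<kappa> = "sphere_cycle n" and ?z = "chain_map n j (sphere_cycle n)"
  have \<kappa>: "singular_relcycle n (nsphere n) {} ?\<kappa>" by (rule collapsed_cycle_relcycle[OF collapsed_collapse_simplex n])
  have z: "singular_relcycle n N {} ?z" by (rule singular_relcycle_chain_map[OF \<kappa> cj]) simp
  \<comment> \<open>Homeomorphisms preserve local generators, and on the sphere a global generator
    is a local one at every point.\<close>
  have loc: "hgen n N (topspace N - {y}) ?z" if "y \<in> topspace N" for y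
  proof -
    obtain x where x: "x \<in> ?S" "y = j x" using \<open>y \<in> topspace N\<close> unfolding tN by (rule imageE)
    have im: "j ` (?S - {x}) = topspace N - {y}"
      using inj_on_image_set_diff[OF j, of ?S "{x}"] x tN by simp
    have "homology_iso n (nsphere n) (?S - {x}) N (topspace N - {y}) j"
    proof (rule homology_isoI)
      show "hom_induced (int n) (nsphere n) (?S - {x}) N (topspace N - {y}) j
        \<in> Group.iso (relative_homology_group (int n) (nsphere n) (?S - {x})) (relative_homology_group (int n) N (topspace N - {y}))"
        by (rule homeomorphic_map_relative_homology_iso[OF hj _ im]) simp
      show "j \<in> ?S - {x} \<rightarrow> topspace N - {y}" using im by auto
    qed (rule cj)
    moreover have "hgen n (nsphere n) (?S - {x}) ?\<kappa>"
      using nsphere_hgen_local[OF n x(1) \<kappa>] collapsed_cycle_hgen[OF n] by blast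
    moreover have "singular_relcycle n (nsphere n) (?S - {x}) ?\<kappa>"
      by (rule singular_relcycle_sub[OF \<kappa>]) simp
    ultimately show ?thesis using homology_iso.hgen_iff by blast
  qed
  have zc: "?z \<in> homologous_rel_set n N {} ?z" by simp
  have "fundamental_class n N (homologous_rel_set n N {} ?z)"
    using fundamental_class_iff[OF zc] z loc by blast
  moreover have "integral_simplicial_volume (homologous_rel_set n N {} ?z) \<le> sphere_norm n"
    using integral_simplicial_volume_le[OF zc] cnorm_collapsed_cycle[of n "j (antipole n)" "simplex_map n j (collapse_simplex n)"]
    unfolding chain_map_collapsed_cycle by linarith
  moreover have "sheeted d N M (q \<circ> g)" using fcN by (simp add: finite_cover_def)
  ultimately show ?thesis using that con finite_cover_covering[OF fcN] by blast
qed

context pointed_universal_covering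
begin

text \<open>Feeds both infima. For \<open>n \<ge> 2\<close> the number of sheets is the order of the
  group; for the circle the sheets can be so many that the group must be infinite and the quotient
  falls below \<open>e\<close>.\<close>

lemma elliptic_inverse_order:
  assumes "elliptic_manifold n M" "n > 0"
  shows "e > 0 \<Longrightarrow> \<exists>d q. finite_cover d (nsphere n) M q \<and> real (sphere_norm n) / real d < inverse_order \<Gamma> * real (sphere_norm n) + e"
proof -
  assume e: "e > 0"
  \<comment> \<open>More than \<open>D\<close> sheets contradict finiteness of the group, by the
    first bound, and push \<open>real (sphere_norm n) / real d'\<close> below \<open>e\<close>, by
    the second one.\<close>
  obtain D where D: "D \<ge> card (carrier \<Gamma>)" "real (sphere_norm n) / e < real D"
  proof -
    obtain D' where "real (sphere_norm n) / e < real D'" using reals_Archimedean2 by blast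
    then show thesis using that[of "max D' (card (carrier \<Gamma>))"] by simp
  qed
  obtain d q where fc: "finite_cover d (nsphere n) M q"
    and n1: "n = 1 \<Longrightarrow> \<exists>d' q'. d' > D \<and> finite_cover d' (nsphere n) M q'"
    using elliptic_manifold_covers[OF assms(1), of D] by metis
  show ?thesis
  proof (cases "n = 1")
    case True
    then obtain d' q' where d': "d' > D" "finite_cover d' (nsphere n) M q'" using n1 by blast
    have "infinite (carrier \<Gamma>)" using finite_cover_le_card_pi1[OF d'(2) assms(2)] d'(1) D(1) by force
    then have "inverse_order \<Gamma> = 0" by (simp add: inverse_order_def)
    moreover have "real (sphere_norm n) / real d' < e"
    proof -
      have "real (sphere_norm n) < e * real D" using D(2) e by (simp add: field_simps)
      also have "\<dots> \<le> e * real d'" using d'(1) e by (intro mult_left_mono) auto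
      finally show ?thesis using d'(1) by (simp add: field_simps)
    qed
    ultimately show ?thesis using d'(2) by (intro exI[of _ d'] exI[of _ q']) simp
  next
    case False
    then have "n \<ge> 2" using assms(2) by simp
    from finite_cover_card_pi1[OF fc this] have "inverse_order \<Gamma> = 1 / real d" by (simp add: inverse_order_def)
    then show ?thesis using fc e by (intro exI[of _ d] exI[of _ q]) simp
  qed
qed

theorem stable_integral_simplicial_volume_elliptic:
  assumes M: "elliptic_manifold n M" "n > 0" and c: "fundamental_class n M c"
  shows "stable_integral_simplicial_volume n M = inverse_order \<Gamma> * real (sphere_norm n)"
  unfolding stable_integral_simplicial_volume_def
proof (rule real_Inf_eqI)
  obtain d0 q0 where fc0: "finite_cover d0 (nsphere n) M q0" using elliptic_manifold_covers[OF M(1)] by metis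
  let ?A = "{1 / real d * real (integral_simplicial_volume c) | d (N :: ('a \<times> nat) topology) p c.
            d > 0 \<and> connected_space N \<and> covering_map N M p \<and> sheeted d N M p \<and> fundamental_class n N c}"
  fix x assume "x \<in> ?A"
  then obtain d and N :: "('a \<times> nat) topology" and r cN where x: "x = 1 / real d * real (integral_simplicial_volume cN)"
    and d: "d > 0" and N: "connected_space N" "covering_map N M r" "sheeted d N M r" and cN: "fundamental_class n N cN"
    by blast
  show "inverse_order \<Gamma> * real (sphere_norm n) \<le> x"
  proof (cases "finite (carrier \<Gamma>)")
    case True
    have "d \<le> card (carrier \<Gamma>)" by (rule sheets_le_card_pi1[OF N(2,3,1) True])
    then have "inverse_order \<Gamma> \<le> 1 / real d" using d True by (simp add: inverse_order_def field_simps)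
    \<comment> \<open>Connectedness admits the empty space; the \<open>d > 0\<close> points over
      \<open>p e0\<close> exclude it.\<close>
    moreover have "topspace N \<noteq> {}"
    proof -
      have "p e0 \<in> topspace M" using continuous_map_image_subset_topspace[OF covering_map_continuous[OF cov]] e0 by blast
      then have "card {y \<in> topspace N. r y = p e0} = d" using N(3) by (simp add: sheeted_def)
      then show ?thesis using d by (auto intro: ccontr)
    qed
    then have "sphere_norm n \<le> integral_simplicial_volume cN"
      using integral_simplicial_volume_cover_ge[OF fc0 M(2) c N(2) _ cN] by blast
    ultimately show ?thesis unfolding x by (intro mult_mono) auto
  next
    case False
    then show ?thesis by (simp add: inverse_order_def x)
  qed
next
  let ?A = "{1 / real d * real (integral_simplicial_volume c) | d (N :: ('a \<times> nat) topology) p c.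
            d > 0 \<and> connected_space N \<and> covering_map N M p \<and> sheeted d N M p \<and> fundamental_class n N c}"
  fix e :: real assume "e > 0"
  from elliptic_inverse_order[OF M this] obtain d q where fc: "finite_cover d (nsphere n) M q"
    and lt: "real (sphere_norm n) / real d < inverse_order \<Gamma> * real (sphere_norm n) + e" by blast
  have d: "d > 0" using fc by (simp add: finite_cover_def)
  obtain N :: "('a \<times> nat) topology" and r cN where N: "connected_space N" "covering_map N M r" "sheeted d N M r"
    "fundamental_class n N cN" "integral_simplicial_volume cN \<le> sphere_norm n" by (rule finite_cover_copy[OF fc M(2)])
  have "1 / real d * real (integral_simplicial_volume cN) \<le> real (sphere_norm n) / real d"
    using N(5) by (simp add: divide_right_mono)
  then have "1 / real d * real (integral_simplicial_volume cN) < inverse_order \<Gamma> * real (sphere_norm n) + e" using lt by linarith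
  moreover have "1 / real d * real (integral_simplicial_volume cN) \<in> ?A" using d N by blast
  ultimately show "\<exists>x\<in>?A. x < inverse_order \<Gamma> * real (sphere_norm n) + e" by blast
qed

end

section \<open>Parametrised chains\<close>

lemma cnorm_uminus [simp]: "cnorm (- a) = cnorm a"
  by (simp add: cnorm_def)

lemma cnorm_sum: "finite I \<Longrightarrow> cnorm (\<Sum>i\<in>I. g i) \<le> (\<Sum>i\<in>I. cnorm (g i))"
proof (induction I rule: finite_induct)
  case (insert i I)
  then show ?case using cnorm_diff[of "g i" "- (\<Sum>i\<in>I. g i)"] by simp
qed simp

lemma cnorm_cmul_frag_of: "cnorm (frag_cmul m (frag_of x)) = \<bar>m\<bar>"
proof -
  have "Poly_Mapping.keys (frag_cmul m (frag_of x)) \<subseteq> {x}" by (auto simp: in_keys_iff lookup_single when_def split: if_splits)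
  from cnorm_superset[OF _ this] show ?thesis by simp
qed

lemma Linf_const: "(\<lambda>_. m) \<in> Linf X"
  by (auto simp: Linf_def)

lemma Linf_cmul:
  assumes "f \<in> Linf X"
  shows "(\<lambda>x. m * f x) \<in> Linf X"
proof -
  obtain B where f: "f \<in> measurable X (count_space UNIV)" and B: "AE x in X. \<bar>f x\<bar> \<le> B"
    using assms by (auto simp: Linf_def)
  have "(\<lambda>x. m * f x) \<in> measurable X (count_space UNIV)"
    by (rule measurable_compose[OF f, of "\<lambda>k. m * k"]) simp
  moreover have "AE x in X. \<bar>m * f x\<bar> \<le> \<bar>m\<bar> * B"
    using B by eventually_elim (simp add: abs_mult mult_left_mono)
  ultimately show ?thesis by (auto simp: Linf_def)
qed

lemma Linf_add:
  assumes "f \<in> Linf X" "g \<in> Linf X"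
  shows "(\<lambda>x. f x + g x) \<in> Linf X"
proof -
  obtain B C where f: "f \<in> measurable X (count_space UNIV)" and B: "AE x in X. \<bar>f x\<bar> \<le> B"
    and g: "g \<in> measurable X (count_space UNIV)" and C: "AE x in X. \<bar>g x\<bar> \<le> C"
    using assms by (auto simp: Linf_def)
  have "(\<lambda>x. f x + g x) \<in> measurable X (count_space UNIV)"
    by (rule measurable_compose_countable[OF _ f]) (rule measurable_compose[OF g], simp)
  moreover have "AE x in X. \<bar>f x + g x\<bar> \<le> B + C"
    using B C by eventually_elim linarith
  ultimately show ?thesis by (auto simp: Linf_def)
qed

section \<open>Computing modulo the relators of the tensor product\<close>

text \<open>The two assumptions keep the relators inside the free abelian group; the calculus below
  holds for any such actions on \<open>X\<close> and \<open>E\<close>.\<close>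

locale tensor_complex =
  fixes G :: "('g, 'm) monoid_scheme" and X :: "'x measure" and \<alpha> :: "'g \<Rightarrow> 'x \<Rightarrow> 'x"
    and E :: "'e topology" and \<rho> :: "'g \<Rightarrow> 'e \<Rightarrow> 'e"
  assumes act: "f \<in> Linf X \<Longrightarrow> \<gamma> \<in> carrier G \<Longrightarrow> (\<lambda>x. f (\<alpha> \<gamma> x)) \<in> Linf X"
    and cont: "\<gamma> \<in> carrier G \<Longrightarrow> continuous_map E E (\<rho> \<gamma>)"
begin

text \<open>The formal sums that are 0 in the tensor product. Equalities of tensors are handled as
  \<open>null k (a - b)\<close>, which chains by \<open>null_trans\<close>.\<close>

definition null :: "nat \<Rightarrow> ('x, 'e) formal_tensor \<Rightarrow> bool" where
  "null k u \<longleftrightarrow> u \<in> generate (formal_tensors X E k) (tensor_relators G X \<alpha> E \<rho> k)"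

lemma tensor_eq_null:
  "tensor_eq G X \<alpha> E \<rho> k v w \<longleftrightarrow>
     v \<in> carrier (formal_tensors X E k) \<and> w \<in> carrier (formal_tensors X E k) \<and> null k (v - w)"
  by (simp add: tensor_eq_def null_def)

lemma formal_tensors_carrier:
  "u \<in> carrier (formal_tensors X E k) \<longleftrightarrow> Poly_Mapping.keys u \<subseteq> Linf X \<times> singular_chain_set k E"
  by (simp add: formal_tensors_def)

lemma formal_tensors_closed:
  "0 \<in> carrier (formal_tensors X E k)"
  "u \<in> carrier (formal_tensors X E k) \<Longrightarrow> v \<in> carrier (formal_tensors X E k) \<Longrightarrow> u + v \<in> carrier (formal_tensors X E k)"
  "u \<in> carrier (formal_tensors X E k) \<Longrightarrow> v \<in> carrier (formal_tensors X E k) \<Longrightarrow> u - v \<in> carrier (formal_tensors X E k)"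
  "u \<in> carrier (formal_tensors X E k) \<Longrightarrow> - u \<in> carrier (formal_tensors X E k)"
  "f \<in> Linf X \<Longrightarrow> singular_chain k E c \<Longrightarrow> frag_of (f, c) \<in> carrier (formal_tensors X E k)"
  using keys_add[of u v] keys_diff[of u v] unfolding formal_tensors_carrier by auto

lemma formal_tensors_sum:
  "finite I \<Longrightarrow> (\<And>i. i \<in> I \<Longrightarrow> g i \<in> carrier (formal_tensors X E k)) \<Longrightarrow> (\<Sum>i\<in>I. g i) \<in> carrier (formal_tensors X E k)"
  by (induction I rule: finite_induct) (auto intro: formal_tensors_closed)

lemma relators_carrier:
  assumes "u \<in> tensor_relators G X \<alpha> E \<rho> k"
  shows "u \<in> carrier (formal_tensors X E k)"
proof -
  have ch: "singular_chain k E (c + d)" if "singular_chain k E c" "singular_chain k E d" for c d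
    using that by (rule singular_chain_add)
  have im: "singular_chain k E (chain_map k (\<rho> \<gamma>) c)" if "singular_chain k E c" "\<gamma> \<in> carrier G" for c \<gamma>
    using that by (auto intro: singular_chain_chain_map cont)
  show ?thesis
    using assms unfolding tensor_relators_def
    by (elim UnE CollectE exE conjE; hypsubst; intro formal_tensors_closed) (auto intro: Linf_add act ch im)
qed

lemma null_zero: "null k 0"
  using generate.one[of "formal_tensors X E k"] by (simp add: null_def formal_tensors_def)

lemma null_add: "null k u \<Longrightarrow> null k v \<Longrightarrow> null k (u + v)"
  using generate.eng[of u "formal_tensors X E k" _ v] by (simp add: null_def formal_tensors_def)

text \<open>The inverse of the free abelian group is the ordinary minus on its carrier only, so the
  relators have to be known to lie there.\<close>

lemma null_uminus: "null k u \<Longrightarrow> null k (- u)"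
  unfolding null_def
proof (induction u rule: generate.induct)
  case one show ?case using generate.one[of "formal_tensors X E k"] by (simp add: formal_tensors_def)
next
  case (incl h)
  have "inv\<^bsub>formal_tensors X E k\<^esub> h = - h" using relators_carrier[OF incl] by (simp add: formal_tensors_def)
  then show ?case using generate.inv[OF incl, of "formal_tensors X E k"] by simp
next
  case (inv h)
  have "inv\<^bsub>formal_tensors X E k\<^esub> h = - h" using relators_carrier[OF inv] by (simp add: formal_tensors_def)
  then show ?case using generate.incl[OF inv, of "formal_tensors X E k"] by simp
next
  case (eng h1 h2)
  then show ?case using generate.eng[OF eng.IH] by (simp add: formal_tensors_def add.commute)
qed

lemma null_diff: "null k u \<Longrightarrow> null k v \<Longrightarrow> null k (u - v)"
  using null_add[OF _ null_uminus, of k u v] by simp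

lemma null_sum: "finite I \<Longrightarrow> (\<And>i. i \<in> I \<Longrightarrow> null k (g i)) \<Longrightarrow> null k (\<Sum>i\<in>I. g i)"
  by (induction I rule: finite_induct) (auto intro: null_zero null_add)

lemma null_trans: "null k (a - b) \<Longrightarrow> null k (b - c) \<Longrightarrow> null k (a - c)"
  using null_add[of k "a - b" "b - c"] by simp

lemma null_sym: "null k (a - b) \<Longrightarrow> null k (b - a)"
  using null_uminus[of k "a - b"] by simp

lemma null_cmul: "null k u \<Longrightarrow> null k (frag_cmul m u)"
  by (rule frag_closure_minus_cmul[of "null k"]) (auto intro: null_zero null_diff)

lemma null_AE:
  assumes "f \<in> Linf X" "g \<in> Linf X" "AE x in X. f x = g x" "singular_chain k E c"
  shows "null k (frag_of (f, c) - frag_of (g, c))"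
  unfolding null_def by (rule generate.incl) (use assms in \<open>unfold tensor_relators_def, blast\<close>)

lemma null_add_left:
  assumes "f \<in> Linf X" "g \<in> Linf X" "singular_chain k E c"
  shows "null k (frag_of (\<lambda>x. f x + g x, c) - frag_of (f, c) - frag_of (g, c))"
  unfolding null_def by (rule generate.incl) (use assms in \<open>unfold tensor_relators_def, blast\<close>)

lemma null_add_right:
  assumes "f \<in> Linf X" "singular_chain k E c" "singular_chain k E d"
  shows "null k (frag_of (f, c + d) - frag_of (f, c) - frag_of (f, d))"
  unfolding null_def by (rule generate.incl) (use assms in \<open>unfold tensor_relators_def, blast\<close>)

lemma null_act:
  assumes "f \<in> Linf X" "\<gamma> \<in> carrier G" "singular_chain k E c"
  shows "null k (frag_of (\<lambda>x. f (\<alpha> \<gamma> x), c) - frag_of (f, chain_map k (\<rho> \<gamma>) c))"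
  unfolding null_def by (rule generate.incl) (use assms in \<open>unfold tensor_relators_def, blast\<close>)

lemma null_right_zero: "f \<in> Linf X \<Longrightarrow> null k (frag_of (f, 0))"
  using null_uminus[OF null_add_right[of f k 0 0]] by simp

lemma null_left_zero: "singular_chain k E c \<Longrightarrow> null k (frag_of (\<lambda>_. 0, c))"
  using null_uminus[OF null_add_left[OF Linf_const[of 0] Linf_const[of 0], of k c]] by simp

lemma null_diff_right:
  assumes "f \<in> Linf X" "singular_chain k E c" "singular_chain k E d"
  shows "null k (frag_of (f, c - d) - (frag_of (f, c) - frag_of (f, d)))"
  using null_uminus[OF null_add_right[OF assms(1) singular_chain_diff[OF assms(2,3)] assms(3)]] by (simp add: algebra_simps)

text \<open>A family over the integers with constant increment is linear. It lets scalars be pulled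
  out of either factor of the tensor product.\<close>

lemma null_int_linear:
  assumes "null k (h 0)" "\<And>m. null k (h (m + 1) - h m - u)"
  shows "null k (h m - frag_cmul m u)"
proof (induction m rule: int_induct[of _ 0])
  case (step1 i)
  have "h (i + 1) - frag_cmul (i + 1) u = (h (i + 1) - h i - u) + (h i - frag_cmul i u)"
    by (simp add: frag_cmul_distrib)
  show ?case unfolding \<open>h (i + 1) - _ = _\<close> by (rule null_add[OF assms(2) step1(2)])
next
  case (step2 i)
  have "h (i - 1) - frag_cmul (i - 1) u = (h i - frag_cmul i u) - (h (i - 1 + 1) - h (i - 1) - u)"
    by (simp add: frag_cmul_diff_distrib)
  show ?case unfolding \<open>h (i - 1) - _ = _\<close> by (rule null_diff[OF step2(2) assms(2)])
qed (use assms(1) in simp)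

lemma null_cmul_left:
  assumes "f \<in> Linf X" "singular_chain k E c"
  shows "null k (frag_of (\<lambda>x. m * f x, c) - frag_cmul m (frag_of (f, c)))"
proof (rule null_int_linear)
  show "null k (frag_of (\<lambda>x. 0 * f x, c))" using null_left_zero[OF assms(2)] by simp
  show "null k (frag_of (\<lambda>x. (m + 1) * f x, c) - frag_of (\<lambda>x. m * f x, c) - frag_of (f, c))" for m
    using null_add_left[OF Linf_cmul[OF assms(1), of m] assms] by (simp add: distrib_right)
qed

lemma null_cmul_right:
  assumes "f \<in> Linf X" "singular_chain k E c"
  shows "null k (frag_of (f, frag_cmul m c) - frag_cmul m (frag_of (f, c)))"
proof (rule null_int_linear)
  show "null k (frag_of (f, frag_cmul 0 c))" using null_right_zero[OF assms(1)] by simp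
  show "null k (frag_of (f, frag_cmul (m + 1) c) - frag_of (f, frag_cmul m c) - frag_of (f, c))" for m
    using null_add_right[OF assms(1) singular_chain_cmul[OF assms(2), of m] assms(2)] by (simp add: frag_cmul_distrib)
qed

lemma null_sum_right:
  assumes "f \<in> Linf X" "finite I" "\<And>i. i \<in> I \<Longrightarrow> singular_chain k E (g i)"
  shows "null k (frag_of (f, \<Sum>i\<in>I. g i) - (\<Sum>i\<in>I. frag_of (f, g i)))"
  using assms(2,3)
proof (induction I rule: finite_induct)
  case empty then show ?case using null_right_zero[OF assms(1)] by simp
next
  case (insert i I)
  have "singular_chain k E (\<Sum>i\<in>I. g i)" by (rule singular_chain_sum) (use insert in auto)
  from null_add[OF null_add_right[OF assms(1) _ this, of "g i"] insert.IH] show ?case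
    using insert by (simp add: algebra_simps)
qed

lemma null_sum_left:
  assumes "finite I" "\<And>i. i \<in> I \<Longrightarrow> g i \<in> Linf X" "singular_chain k E c"
  shows "(\<lambda>x. \<Sum>i\<in>I. g i x) \<in> Linf X \<and> null k (frag_of (\<lambda>x. \<Sum>i\<in>I. g i x, c) - (\<Sum>i\<in>I. frag_of (g i, c)))"
  using assms(1,2)
proof (induction I rule: finite_induct)
  case empty then show ?case using null_left_zero[OF assms(3)] Linf_const[of 0] by simp
next
  case (insert i I)
  then have g: "g i \<in> Linf X" "(\<lambda>x. \<Sum>i\<in>I. g i x) \<in> Linf X"
    and n: "null k (frag_of (\<lambda>x. \<Sum>i\<in>I. g i x, c) - (\<Sum>i\<in>I. frag_of (g i, c)))" by auto
  show ?case
    using insert(1,2) Linf_add[OF g] null_add[OF null_add_left[OF g assms(3)] n] by (simp add: algebra_simps)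
qed

end

lemma tensor_boundary_simps [simp]:
  "tensor_boundary k 0 = 0" "tensor_boundary k (u - v) = tensor_boundary k u - tensor_boundary k v"
  "tensor_boundary k (- u) = - tensor_boundary k u"
  "tensor_boundary k (frag_of (f, c)) = frag_of (f, chain_boundary k c)"
  by (auto simp: tensor_boundary_def frag_extend_diff frag_extend_minus)

lemma tensor_boundary_carrier:
  assumes "v \<in> carrier (formal_tensors X E (Suc k))"
  shows "tensor_boundary (Suc k) v \<in> carrier (formal_tensors X E k)"
proof -
  have "(f, chain_boundary (Suc k) c) \<in> Linf X \<times> singular_chain_set k E" if "(f, c) \<in> Poly_Mapping.keys v" for f c
  proof -
    have "f \<in> Linf X" "singular_chain (Suc k) E c" using assms that by (auto simp: formal_tensors_def)
    then show ?thesis using singular_chain_boundary[of "Suc k" E c] by simp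
  qed
  then show ?thesis
    unfolding formal_tensors_def tensor_boundary_def carrier_free_Abelian_group_iff
    by (intro order_trans[OF keys_frag_extend] UN_least) auto
qed

section \<open>Lifting chains to the universal covering\<close>

lemma covering_simplex_lift:
  assumes cov: "covering_map E M p" and \<tau>: "singular_simplex k M \<tau>"
  obtains \<sigma> where "singular_simplex k E \<sigma>" "simplex_map k p \<sigma> = \<tau>"
proof -
  have "\<tau> vertex0 \<in> p ` topspace E"
    unfolding covering_map_surj[OF cov] by (rule singular_simplex_value[OF \<tau>]) simp
  then obtain y where "y \<in> topspace E" "p y = \<tau> vertex0" by (metis imageE)
  then show thesis using simplex_lift_ex[OF cov \<tau> vertex0_in] that by metis
qed

text \<open>One lift is chosen for each simplex of \<open>m\<close>. Distinct members of
  \<open>S\<close> therefore have distinct projections, as reduced form demands.\<close>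

lemma chain_lift:
  assumes cov: "covering_map E M p" and m: "singular_chain k M m"
  obtains S where "finite S" "S \<subseteq> singular_simplex_set k E" "inj_on (simplex_map k p) S"
    "singular_chain k E (\<Sum>\<sigma>\<in>S. frag_cmul (Poly_Mapping.lookup m (simplex_map k p \<sigma>)) (frag_of \<sigma>))"
    "chain_map k p (\<Sum>\<sigma>\<in>S. frag_cmul (Poly_Mapping.lookup m (simplex_map k p \<sigma>)) (frag_of \<sigma>)) = m"
proof -
  have "\<exists>\<sigma>. singular_simplex k E \<sigma> \<and> simplex_map k p \<sigma> = \<tau>" if "\<tau> \<in> Poly_Mapping.keys m" for \<tau>
  proof -
    have "singular_simplex k M \<tau>" using m that by (auto simp: singular_chain_def)
    then show ?thesis using covering_simplex_lift[OF cov] by metis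
  qed
  then obtain l where l: "\<And>\<tau>. \<tau> \<in> Poly_Mapping.keys m \<Longrightarrow> singular_simplex k E (l \<tau>) \<and> simplex_map k p (l \<tau>) = \<tau>" by metis
  let ?S = "l ` Poly_Mapping.keys m"
  let ?z = "\<Sum>\<sigma>\<in>?S. frag_cmul (Poly_Mapping.lookup m (simplex_map k p \<sigma>)) (frag_of \<sigma>)"
  have inj: "inj_on l (Poly_Mapping.keys m)" by (rule inj_on_inverseI[of _ "simplex_map k p"]) (simp add: l)
  have "chain_map k p ?z = (\<Sum>\<sigma>\<in>?S. frag_cmul (Poly_Mapping.lookup m (simplex_map k p \<sigma>)) (frag_of (simplex_map k p \<sigma>)))"
    by (simp add: chain_map_sum o_def)
  also have "\<dots> = (\<Sum>\<tau>\<in>Poly_Mapping.keys m. frag_cmul (Poly_Mapping.lookup m \<tau>) (frag_of \<tau>))"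
    by (rule sum.reindex_cong[OF inj refl]) (simp add: l)
  also have "\<dots> = m" using frag_expansion[of m] by (simp add: frag_extend_def)
  finally have "chain_map k p ?z = m" .
  moreover have S: "?S \<subseteq> singular_simplex_set k E" using l by auto
  moreover have "singular_chain k E ?z"
  proof (rule singular_chain_sum)
    fix \<sigma> assume "\<sigma> \<in> ?S"
    then have "singular_simplex k E \<sigma>" using S by blast
    then show "singular_chain k E (frag_cmul (Poly_Mapping.lookup m (simplex_map k p \<sigma>)) (frag_of \<sigma>))"
      by (intro singular_chain_cmul) (simp add: singular_chain_of)
  qed
  moreover have "inj_on (simplex_map k p) ?S"
  proof (rule inj_onI)
    fix \<sigma> \<sigma>' assume "\<sigma> \<in> ?S" "\<sigma>' \<in> ?S" and e: "simplex_map k p \<sigma> = simplex_map k p \<sigma>'"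
    then obtain \<tau> \<tau>' where "\<tau> \<in> Poly_Mapping.keys m" "\<sigma> = l \<tau>" "\<tau>' \<in> Poly_Mapping.keys m" "\<sigma>' = l \<tau>'"
      by (elim imageE)
    then show "\<sigma> = \<sigma>'" using e l by metis
  qed
  ultimately show thesis by (intro that[of ?S]) simp_all
qed

section \<open>Tensors as equivariant chain-valued functions\<close>

context pointed_universal_covering
begin

text \<open>The action of the inverse of \<open>\<gamma>\<close>, taken as an inverse function on
  \<open>E\<close> instead of through an inverse in the group.\<close>

definition deck_inverse :: "(real \<Rightarrow> 'a) set \<Rightarrow> 'e \<Rightarrow> 'e" where
  "deck_inverse \<gamma> = inv_into (topspace E) (\<rho> \<gamma>)"

lemma deck_inverse:
  assumes \<gamma>: "\<gamma> \<in> carrier \<Gamma>"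
  shows "continuous_map E E (deck_inverse \<gamma>)"
    and "\<And>e. e \<in> topspace E \<Longrightarrow> deck_inverse \<gamma> e \<in> topspace E"
    and "\<And>e. e \<in> topspace E \<Longrightarrow> \<rho> \<gamma> (deck_inverse \<gamma> e) = e"
    and "\<And>e. e \<in> topspace E \<Longrightarrow> deck_inverse \<gamma> (\<rho> \<gamma> e) = e"
    and "\<And>e. e \<in> topspace E \<Longrightarrow> p (deck_inverse \<gamma> e) = p e"
proof -
  have h: "homeomorphic_map E E (\<rho> \<gamma>)" using deck_action_deck[OF \<gamma>] by (simp add: deck_transformation_def)
  then obtain g where g: "homeomorphic_maps E E (\<rho> \<gamma>) g" unfolding homeomorphic_map_maps by blast
  have inj: "inj_on (\<rho> \<gamma>) (topspace E)" by (rule homeomorphic_imp_injective_map[OF h])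
  have gc: "continuous_map E E g" and fg: "\<And>e. e \<in> topspace E \<Longrightarrow> \<rho> \<gamma> (g e) = e"
    using g by (auto simp: homeomorphic_maps_def)
  have ge: "g e \<in> topspace E" if "e \<in> topspace E" for e using gc that by (auto simp: continuous_map_def)
  have eq: "deck_inverse \<gamma> e = g e" if "e \<in> topspace E" for e
    unfolding deck_inverse_def by (rule inv_into_f_eq[OF inj ge[OF that] fg[OF that]])
  show "continuous_map E E (deck_inverse \<gamma>)" by (rule continuous_map_eq[OF gc]) (simp add: eq)
  show a: "deck_inverse \<gamma> e \<in> topspace E" if "e \<in> topspace E" for e using that eq ge by simp
  show b: "\<rho> \<gamma> (deck_inverse \<gamma> e) = e" if "e \<in> topspace E" for e using that eq fg by simp
  show "deck_inverse \<gamma> (\<rho> \<gamma> e) = e" if "e \<in> topspace E" for e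
    unfolding deck_inverse_def by (rule inv_into_f_f[OF inj that])
  show "p (deck_inverse \<gamma> e) = p e" if "e \<in> topspace E" for e
    using deck_actionD(3)[OF \<gamma> a[OF that]] b[OF that] by simp
qed

lemma deck_inverse_mult:
  assumes \<gamma>: "\<gamma> \<in> carrier \<Gamma>" and \<delta>: "\<delta> \<in> carrier \<Gamma>" and e: "e \<in> topspace E"
  shows "deck_inverse (\<gamma> \<otimes>\<^bsub>\<Gamma>\<^esub> \<delta>) e = deck_inverse \<delta> (deck_inverse \<gamma> e)"
proof -
  let ?u = "deck_inverse \<delta> (deck_inverse \<gamma> e)"
  have u: "?u \<in> topspace E" "deck_inverse \<gamma> e \<in> topspace E" using deck_inverse(2) \<gamma> \<delta> e by auto
  have "\<rho> (\<gamma> \<otimes>\<^bsub>\<Gamma>\<^esub> \<delta>) ?u = e"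
    using deck_action_mult(2)[OF \<gamma> \<delta> u(1)] deck_inverse(3)[OF \<delta> u(2)] deck_inverse(3)[OF \<gamma> e] by simp
  then show ?thesis using deck_inverse(4)[OF deck_action_mult(1)[OF \<gamma> \<delta>] u(1)] by simp
qed

lemma deck_action_transitive:
  assumes "x \<in> topspace E" "y \<in> topspace E" "p y = p x"
  obtains \<gamma> where "\<gamma> \<in> carrier \<Gamma>" "\<rho> \<gamma> x = y"
proof -
  obtain g where g: "deck_transformation E p g" "g x = y" by (rule deck_ex[OF assms])
  have "g e0 \<in> topspace E" "p (g e0) = p e0" using deckD(2,3)[OF g(1) e0] .
  then obtain \<gamma> where \<gamma>: "\<gamma> \<in> carrier \<Gamma>" "\<rho> \<gamma> e0 = g e0" by (rule deck_action_surj)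
  have "\<rho> \<gamma> = g" by (rule deck_unique[OF deck_action_deck[OF \<gamma>(1)] g(1) e0 \<gamma>(2)])
  then show thesis using that[OF \<gamma>(1)] g(2) by simp
qed

text \<open>The group acts simply transitively on each fibre, hence so do the inverses. It supplies
  the bijection for \<open>transfer_chain_map\<close> and the number of sheets of
  \<open>E\<close>.\<close>

lemma deck_inverse_bij:
  assumes a: "a \<in> topspace E"
  shows "bij_betw (\<lambda>\<gamma>. deck_inverse \<gamma> a) (carrier \<Gamma>) {y \<in> topspace E. p y = p a}"
  unfolding bij_betw_def
proof
  show "inj_on (\<lambda>\<gamma>. deck_inverse \<gamma> a) (carrier \<Gamma>)"
  proof (rule inj_onI)
    fix \<gamma> \<delta> assume g: "\<gamma> \<in> carrier \<Gamma>" "\<delta> \<in> carrier \<Gamma>" and e: "deck_inverse \<gamma> a = deck_inverse \<delta> a"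
    let ?u = "deck_inverse \<gamma> a"
    have "?u \<in> topspace E" "\<rho> \<gamma> ?u = \<rho> \<delta> ?u"
      using deck_inverse(2,3)[OF g(1) a] deck_inverse(3)[OF g(2) a] e by auto
    then have "\<rho> \<gamma> = \<rho> \<delta>" by (rule deck_unique[OF deck_action_deck[OF g(1)] deck_action_deck[OF g(2)]])
    then show "\<gamma> = \<delta>" using deck_action_inj[OF g] by simp
  qed
  show "(\<lambda>\<gamma>. deck_inverse \<gamma> a) ` carrier \<Gamma> = {y \<in> topspace E. p y = p a}"
  proof
    show "{y \<in> topspace E. p y = p a} \<subseteq> (\<lambda>\<gamma>. deck_inverse \<gamma> a) ` carrier \<Gamma>"
    proof
      fix y assume "y \<in> {y \<in> topspace E. p y = p a}"
      then have y: "y \<in> topspace E" "p a = p y" by auto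
      obtain \<gamma> where \<gamma>: "\<gamma> \<in> carrier \<Gamma>" "\<rho> \<gamma> y = a" by (rule deck_action_transitive[OF y(1) a y(2)])
      then have "y = deck_inverse \<gamma> a" using deck_inverse(4)[OF \<gamma>(1) y(1)] by simp
      then show "y \<in> (\<lambda>\<gamma>. deck_inverse \<gamma> a) ` carrier \<Gamma>" using \<gamma>(1) by (rule image_eqI)
    qed
  qed (use deck_inverse(2,5) a in auto)
qed

text \<open>The value at \<open>x\<close> of a chain \<open>f \<otimes> c\<close>, once \<open>L\<^sup>\<infinity>(X, \<int>) \<otimes>\<^bsub>\<int>\<Gamma>\<^esub> C\<^sub>*(E)\<close> is read as the equivariant maps
  \<open>X \<rightarrow> C\<^sub>*(E)\<close>; it needs \<open>\<Gamma>\<close> to be finite.\<close>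

definition tensor_value :: "nat \<Rightarrow> ((real \<Rightarrow> 'a) set \<Rightarrow> 'x \<Rightarrow> 'x) \<Rightarrow> 'x \<Rightarrow> ('x, 'e) formal_tensor \<Rightarrow> 'e chain" where
  "tensor_value k \<alpha> x = frag_extend (\<lambda>(f, c). \<Sum>\<gamma>\<in>carrier \<Gamma>. frag_cmul (f (\<alpha> \<gamma> x)) (chain_map k (deck_inverse \<gamma>) c))"

lemma tensor_value_simps [simp]:
  "tensor_value k \<alpha> x 0 = 0" "tensor_value k \<alpha> x (u + v) = tensor_value k \<alpha> x u + tensor_value k \<alpha> x v"
  "tensor_value k \<alpha> x (u - v) = tensor_value k \<alpha> x u - tensor_value k \<alpha> x v"
  "tensor_value k \<alpha> x (- u) = - tensor_value k \<alpha> x u"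
  "tensor_value k \<alpha> x (frag_of (f, c)) = (\<Sum>\<gamma>\<in>carrier \<Gamma>. frag_cmul (f (\<alpha> \<gamma> x)) (chain_map k (deck_inverse \<gamma>) c))"
  by (auto simp: tensor_value_def frag_extend_add frag_extend_diff frag_extend_minus)

lemma singular_chain_deck_inverse:
  assumes "\<gamma> \<in> carrier \<Gamma>" "singular_chain k E c"
  shows "singular_chain k E (chain_map k (deck_inverse \<gamma>) c)"
  using singular_chain_chain_map[OF assms(2) deck_inverse(1)[OF assms(1)]] .

lemma tensor_value_boundary:
  assumes fin: "finite (carrier \<Gamma>)" and v: "v \<in> carrier (formal_tensors X E (Suc k))"
  shows "singular_chain (Suc k) E (tensor_value (Suc k) \<alpha> x v)"
    and "tensor_value k \<alpha> x (tensor_boundary (Suc k) v) = chain_boundary (Suc k) (tensor_value (Suc k) \<alpha> x v)"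
proof -
  have "Poly_Mapping.keys v \<subseteq> Linf X \<times> singular_chain_set (Suc k) E" using v by (simp add: formal_tensors_def)
  then have "singular_chain (Suc k) E (tensor_value (Suc k) \<alpha> x v) \<and>
    tensor_value k \<alpha> x (tensor_boundary (Suc k) v) = chain_boundary (Suc k) (tensor_value (Suc k) \<alpha> x v)"
  proof (induction v rule: frag_induction)
    case (one fc)
    obtain f c where fc: "fc = (f, c)" by (cases fc)
    have c: "singular_chain (Suc k) E c" using one fc by auto
    have 1: "singular_chain (Suc k) E (tensor_value (Suc k) \<alpha> x (frag_of fc))"
      unfolding fc tensor_value_simps using c
      by (intro singular_chain_sum singular_chain_cmul singular_chain_deck_inverse) auto
    have "chain_boundary (Suc k) (tensor_value (Suc k) \<alpha> x (frag_of fc))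
      = (\<Sum>\<gamma>\<in>carrier \<Gamma>. frag_cmul (f (\<alpha> \<gamma> x)) (chain_boundary (Suc k) (chain_map (Suc k) (deck_inverse \<gamma>) c)))"
      unfolding fc tensor_value_simps using fin by (simp add: chain_boundary_sum chain_boundary_cmul o_def)
    also have "\<dots> = tensor_value k \<alpha> x (tensor_boundary (Suc k) (frag_of fc))"
      unfolding fc by (simp add: chain_boundary_chain_map[OF c])
    finally show ?case using 1 by simp
  qed (auto simp: chain_boundary_diff intro: singular_chain_diff)
  then show "singular_chain (Suc k) E (tensor_value (Suc k) \<alpha> x v)"
    "tensor_value k \<alpha> x (tensor_boundary (Suc k) v) = chain_boundary (Suc k) (tensor_value (Suc k) \<alpha> x v)" by auto
qed

lemma finite_sheeted_universal:
  assumes fin: "finite (carrier \<Gamma>)"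
  shows "finite_sheeted_covering E M p (card (carrier \<Gamma>))"
proof
  show "sheeted (card (carrier \<Gamma>)) E M p"
    unfolding sheeted_def
  proof
    fix x assume "x \<in> topspace M"
    then obtain a where a: "a \<in> topspace E" "p a = x" unfolding covering_map_surj[OF cov, symmetric] by (elim imageE) auto
    show "finite {y \<in> topspace E. p y = x} \<and> card {y \<in> topspace E. p y = x} = card (carrier \<Gamma>)"
      using bij_betw_finite[OF deck_inverse_bij[OF a(1)]] bij_betw_same_card[OF deck_inverse_bij[OF a(1)]] fin a(2) by simp
  qed
qed (rule cov)

end

section \<open>The lower bound for a given standard space\<close>

locale standard_action = pointed_universal_covering E M p e0
  for E :: "'e topology" and M :: "'a topology" and p e0 +
  fixes X :: "'x measure" and \<alpha>
  assumes std: "standard_space (fundamental_group M (p e0)) X \<alpha>"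
begin

lemma prob: "prob_space X" using std by (simp add: standard_space_def)

lemma action_measurable: "\<gamma> \<in> carrier \<Gamma> \<Longrightarrow> \<alpha> \<gamma> \<in> measurable X X"
  using std by (simp add: standard_space_def)

lemma action_mult:
  "\<gamma> \<in> carrier \<Gamma> \<Longrightarrow> \<delta> \<in> carrier \<Gamma> \<Longrightarrow> x \<in> space X \<Longrightarrow> \<alpha> (\<gamma> \<otimes>\<^bsub>\<Gamma>\<^esub> \<delta>) x = \<alpha> \<gamma> (\<alpha> \<delta> x)"
  using std by (simp add: standard_space_def)

lemma distr_action:
  assumes "\<gamma> \<in> carrier \<Gamma>"
  shows "distr X X (\<alpha> \<gamma>) = X"
proof (rule measure_eqI)
  show "emeasure (distr X X (\<alpha> \<gamma>)) A = emeasure X A" if "A \<in> sets (distr X X (\<alpha> \<gamma>))" for A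
    using that std assms by (simp add: emeasure_distr action_measurable standard_space_def)
qed simp

lemma AE_action:
  assumes "\<gamma> \<in> carrier \<Gamma>" "AE x in X. P x"
  shows "AE x in X. P (\<alpha> \<gamma> x)"
  by (rule AE_distrD[OF action_measurable[OF assms(1)], of P]) (unfold distr_action[OF assms(1)], rule assms(2))

lemma Linf_action:
  assumes "f \<in> Linf X" "\<gamma> \<in> carrier \<Gamma>"
  shows "(\<lambda>x. f (\<alpha> \<gamma> x)) \<in> Linf X"
proof -
  obtain B where f: "f \<in> measurable X (count_space UNIV)" and B: "AE x in X. \<bar>f x\<bar> \<le> B"
    using assms by (auto simp: Linf_def)
  have "(\<lambda>x. f (\<alpha> \<gamma> x)) \<in> measurable X (count_space UNIV)"
    by (rule measurable_compose[OF action_measurable[OF assms(2)] f])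
  then show ?thesis using AE_action[OF assms(2) B] by (auto simp: Linf_def)
qed

sublocale tensor_complex "fundamental_group M (p e0)" X \<alpha> E "deck_action E p e0"
  by unfold_locales (auto intro: Linf_action deck_actionD(1))

lemma Linf_measurable:
  assumes "f \<in> Linf X"
  shows "(\<lambda>x. \<bar>real_of_int (f x)\<bar>) \<in> borel_measurable X"
proof -
  have "f \<in> measurable X (count_space UNIV)" using assms by (simp add: Linf_def)
  then show ?thesis by (rule measurable_compose[where g = "\<lambda>k. \<bar>real_of_int k\<bar>"]) simp
qed

lemma Linf_integrable:
  assumes "f \<in> Linf X"
  shows "integrable X (\<lambda>x. \<bar>real_of_int (f x)\<bar>)"
proof -
  interpret prob_space X by (rule prob)
  obtain B where B: "AE x in X. \<bar>f x\<bar> \<le> B" using assms by (auto simp: Linf_def)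
  have "AE x in X. norm \<bar>real_of_int (f x)\<bar> \<le> real_of_int B"
    using B by eventually_elim (simp add: abs_le_iff)
  then show ?thesis by (rule integrable_const_bound[OF _ Linf_measurable[OF assms]])
qed

lemma integral_action:
  assumes "f \<in> Linf X" "\<gamma> \<in> carrier \<Gamma>"
  shows "(\<integral>x. \<bar>real_of_int (f (\<alpha> \<gamma> x))\<bar> \<partial>X) = (\<integral>x. \<bar>real_of_int (f x)\<bar> \<partial>X)"
  using integral_distr[OF action_measurable[OF assms(2)] Linf_measurable[OF assms(1)]]
  by (simp add: distr_action[OF assms(2)])

text \<open>Evaluation at a point is well defined almost everywhere. The first kind of relator costs
  one null set for each element of the finite group; biadditivity is immediate; for the last kind,
  left multiplication by \<open>\<delta>\<close> permutes the summands and cancels against the deck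
  transformation \<open>\<rho> \<delta>\<close>.\<close>

lemma tensor_value_null:
  assumes fin: "finite (carrier \<Gamma>)" and u: "null k u"
  shows "AE x in X. tensor_value k \<alpha> x u = 0"
proof -
  have rel: "AE x in X. tensor_value k \<alpha> x h = 0" if h: "h \<in> tensor_relators \<Gamma> X \<alpha> E \<rho> k" for h
  proof -
    from h show ?thesis
      unfolding tensor_relators_def
    proof (elim UnE CollectE exE conjE, goal_cases)
      case (1 f g c)
      have "AE x in X. \<forall>\<gamma>\<in>carrier \<Gamma>. f (\<alpha> \<gamma> x) = g (\<alpha> \<gamma> x)"
        by (intro AE_finite_allI[OF fin] AE_action 1)
      then show ?case unfolding 1(1) by eventually_elim simp
    next
      case (2 f g c)
      then show ?case by (simp add: frag_cmul_distrib sum.distrib)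
    next
      case (3 f c d)
      then show ?case by (simp add: chain_map_add frag_cmul_distrib2 sum.distrib)
    next
      case act: (4 f \<delta> c)
      have inj: "inj_on (\<lambda>\<gamma>. \<delta> \<otimes>\<^bsub>\<Gamma>\<^esub> \<gamma>) (carrier \<Gamma>)"
        by (rule inj_onI) (rule deck_action_mult_inj[OF act(3)])
      have bij: "(\<lambda>\<gamma>. \<delta> \<otimes>\<^bsub>\<Gamma>\<^esub> \<gamma>) ` carrier \<Gamma> = carrier \<Gamma>"
        by (rule endo_inj_surj[OF fin _ inj]) (use deck_action_mult(1)[OF act(3)] in auto)
      have cm: "chain_map k (deck_inverse (\<delta> \<otimes>\<^bsub>\<Gamma>\<^esub> \<gamma>)) (chain_map k (\<rho> \<delta>) c) = chain_map k (deck_inverse \<gamma>) c"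
        if "\<gamma> \<in> carrier \<Gamma>" for \<gamma>
      proof -
        have "chain_map k (deck_inverse (\<delta> \<otimes>\<^bsub>\<Gamma>\<^esub> \<gamma>)) (chain_map k (\<rho> \<delta>) c)
          = chain_map k (deck_inverse (\<delta> \<otimes>\<^bsub>\<Gamma>\<^esub> \<gamma>) \<circ> \<rho> \<delta>) c" by (simp add: chain_map_compose)
        also have "\<dots> = chain_map k (deck_inverse \<gamma>) c"
          by (rule chain_map_eq[OF act(4)])
            (simp add: deck_inverse_mult[OF act(3) that] deck_inverse(4)[OF act(3)] deck_actionD(2)[OF act(3)])
        finally show ?thesis .
      qed
      show ?case
      proof (rule AE_I2)
        fix x assume x: "x \<in> space X"
        have "tensor_value k \<alpha> x (frag_of (f, chain_map k (\<rho> \<delta>) c))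
          = (\<Sum>\<gamma>\<in>(\<lambda>\<gamma>. \<delta> \<otimes>\<^bsub>\<Gamma>\<^esub> \<gamma>) ` carrier \<Gamma>. frag_cmul (f (\<alpha> \<gamma> x)) (chain_map k (deck_inverse \<gamma>) (chain_map k (\<rho> \<delta>) c)))"
          unfolding bij by simp
        also have "\<dots> = (\<Sum>\<gamma>\<in>carrier \<Gamma>. frag_cmul (f (\<alpha> \<delta> (\<alpha> \<gamma> x))) (chain_map k (deck_inverse \<gamma>) c))"
          by (subst sum.reindex[OF inj]) (intro sum.cong refl, simp add: cm action_mult[OF act(3) _ x])
        also have "\<dots> = tensor_value k \<alpha> x (frag_of (\<lambda>x. f (\<alpha> \<delta> x), c))" by simp
        finally show "tensor_value k \<alpha> x h = 0" unfolding act(1) by (simp only: tensor_value_simps(3) diff_self)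
      qed
    qed
  qed
  have "u \<in> generate (formal_tensors X E k) (tensor_relators \<Gamma> X \<alpha> E \<rho> k)" using u by (simp add: null_def)
  then show ?thesis
  proof (induction u rule: generate.induct)
    case one then show ?case by (simp add: formal_tensors_def)
  next
    case (incl h) then show ?case by (rule rel)
  next
    case (inv h)
    have "inv\<^bsub>formal_tensors X E k\<^esub> h = - h" using relators_carrier[OF inv] by (simp add: formal_tensors_def)
    then show ?case using rel[OF inv] by simp
  next
    case (eng h1 h2)
    from eng.IH have "AE x in X. tensor_value k \<alpha> x (h1 + h2) = 0" by eventually_elim simp
    then show ?case by (simp add: formal_tensors_def)
  qed
qed

lemma tensor_value_sum:
  "finite S \<Longrightarrow> tensor_value k \<alpha> x (\<Sum>\<sigma>\<in>S. g \<sigma>) = (\<Sum>\<sigma>\<in>S. tensor_value k \<alpha> x (g \<sigma>))"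
  by (induction S rule: finite_induct) auto

lemma parametrised_norm_ge:
  assumes fin: "finite (carrier \<Gamma>)" and fc: "finite_cover d (nsphere n) M q" and n: "n > 0"
    and c: "fundamental_class n M c" and S: "finite S" "\<And>\<sigma>. \<sigma> \<in> S \<Longrightarrow> f \<sigma> \<in> Linf X"
    and w: "parametrised_fundamental_cycle n M c E p e0 X \<alpha> (\<Sum>\<sigma>\<in>S. frag_of (f \<sigma>, frag_of \<sigma>))"
  shows "real (sphere_norm n) / real (card (carrier \<Gamma>)) \<le> (\<Sum>\<sigma>\<in>S. \<integral>x. \<bar>real_of_int (f \<sigma> x)\<bar> \<partial>X)"
proof -
  interpret U: finite_sheeted_covering E M p "card (carrier \<Gamma>)" by (rule finite_sheeted_universal[OF fin])
  interpret Q: finite_sheeted_covering "nsphere n" M q d by (rule finite_cover_locale[OF fc])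
  interpret prob_space X by (rule prob)
  let ?w = "\<Sum>\<sigma>\<in>S. frag_of (f \<sigma>, frag_of \<sigma>)"
  have card: "card (carrier \<Gamma>) > 0" using fin deck_action_one(1) by (auto simp: card_gt_0_iff)
  obtain z v where z: "singular_chain n E z" "chain_map n p z \<in> c" and v: "v \<in> carrier (formal_tensors X E (Suc n))"
    and eq: "null n (?w - (frag_of (\<lambda>_. 1, z) + tensor_boundary (Suc n) v))"
    using w by (auto simp: parametrised_fundamental_cycle_def tensor_eq_null)
  let ?zM = "chain_map n p z" and ?t = "transfer n E p (chain_map n p z)"
  have zM: "singular_relcycle n M {} ?zM" using fundamental_class_iff[OF z(2)] c by blast
  then have zMc: "singular_chain n M ?zM" by (simp add: singular_relcycle)
  have t: "singular_relcycle n E {} ?t" using U.singular_relcycle_transfer[OF zM] by simp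
  \<comment> \<open>Pushed down to \<open>M\<close>, the transfer becomes a positive multiple of the
    fundamental cycle; a second transfer, along \<open>q\<close>, shows on the sphere that this
    multiple is not a boundary.\<close>
  have nb: "\<not> singular_relboundary n E {} ?t"
  proof
    assume "singular_relboundary n E {} ?t"
    then have "homologous_rel n E {} ?t 0" by (simp add: homologous_rel_0)
    from homologous_rel_chain_map[OF this covering_map_continuous[OF cov]]
    have "homologous_rel n M {} (frag_cmul (int (card (carrier \<Gamma>))) ?zM) 0" by (simp add: U.chain_map_transfer[OF zMc])
    from Q.homologous_rel_transfer[OF this]
    have "singular_relboundary n (nsphere n) {} (frag_cmul (int (card (carrier \<Gamma>))) (transfer n (nsphere n) q ?zM))"
      by (simp add: homologous_rel_0)
    from integer_homology_hgen(2)[OF homology_nsphere_integer[OF n] transfer_fundamental_class[OF fc n c z(2)] this] card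
    show False by simp
  qed
  \<comment> \<open>At every point the value of \<open>1 \<otimes> z\<close> is the sum of all
    translates of \<open>z\<close>, and the translates of a simplex are the lifts of its
    image.\<close>
  have one: "tensor_value n \<alpha> x (frag_of (\<lambda>_. 1, z)) = ?t" for x
    using U.transfer_chain_map[OF covering_map_continuous[OF cov] deck_inverse(1) deck_inverse(5) deck_inverse_bij z(1)] by simp
  have lower: "int (sphere_norm n) \<le> cnorm (tensor_value n \<alpha> x ?w)"
    if "tensor_value n \<alpha> x (?w - (frag_of (\<lambda>_. 1, z) + tensor_boundary (Suc n) v)) = 0" for x
  proof -
    have e: "tensor_value n \<alpha> x ?w = ?t + chain_boundary (Suc n) (tensor_value (Suc n) \<alpha> x v)"
      using that tensor_value_boundary(2)[OF fin v, of \<alpha> x] one[of x] by (simp add: algebra_simps)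
    have b: "singular_relboundary n E {} (chain_boundary (Suc n) (tensor_value (Suc n) \<alpha> x v))"
      unfolding singular_boundary using tensor_value_boundary(1)[OF fin v] by blast
    have "singular_relcycle n E {} (tensor_value n \<alpha> x ?w)"
      unfolding e by (rule singular_relcycle_add[OF t singular_relboundary_imp_relcycle[OF b]])
    moreover have "\<not> singular_relboundary n E {} (tensor_value n \<alpha> x ?w)"
    proof
      assume "singular_relboundary n E {} (tensor_value n \<alpha> x ?w)"
      from singular_relboundary_diff[OF this b] nb show False unfolding e by simp
    qed
    ultimately show ?thesis by (rule cnorm_nonboundary[OF n])
  qed
  have upper: "cnorm (tensor_value n \<alpha> x ?w) \<le> (\<Sum>\<sigma>\<in>S. \<Sum>\<gamma>\<in>carrier \<Gamma>. \<bar>f \<sigma> (\<alpha> \<gamma> x)\<bar>)" for x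
  proof -
    have "cnorm (tensor_value n \<alpha> x ?w) \<le> (\<Sum>\<sigma>\<in>S. cnorm (tensor_value n \<alpha> x (frag_of (f \<sigma>, frag_of \<sigma>))))"
      unfolding tensor_value_sum[OF S(1)] by (rule cnorm_sum[OF S(1)])
    also have "\<dots> \<le> (\<Sum>\<sigma>\<in>S. \<Sum>\<gamma>\<in>carrier \<Gamma>. cnorm (frag_cmul (f \<sigma> (\<alpha> \<gamma> x)) (frag_of (simplex_map n (deck_inverse \<gamma>) \<sigma>))))"
      unfolding tensor_value_simps chain_map_of by (intro sum_mono cnorm_sum fin)
    finally show ?thesis by (simp only: cnorm_cmul_frag_of)
  qed
  have int: "integrable X (\<lambda>x. \<bar>real_of_int (f \<sigma> (\<alpha> \<gamma> x))\<bar>)" if "\<sigma> \<in> S" "\<gamma> \<in> carrier \<Gamma>" for \<sigma> \<gamma>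
    by (rule Linf_integrable[OF Linf_action[OF S(2)[OF that(1)] that(2)]])
  have ae: "AE x in X. real (sphere_norm n) \<le> (\<Sum>\<sigma>\<in>S. \<Sum>\<gamma>\<in>carrier \<Gamma>. \<bar>real_of_int (f \<sigma> (\<alpha> \<gamma> x))\<bar>)"
    using tensor_value_null[OF fin eq]
  proof eventually_elim
    case (elim x)
    have "int (sphere_norm n) \<le> (\<Sum>\<sigma>\<in>S. \<Sum>\<gamma>\<in>carrier \<Gamma>. \<bar>f \<sigma> (\<alpha> \<gamma> x)\<bar>)"
      using lower[OF elim] upper[of x] by linarith
    then have "real_of_int (int (sphere_norm n)) \<le> real_of_int (\<Sum>\<sigma>\<in>S. \<Sum>\<gamma>\<in>carrier \<Gamma>. \<bar>f \<sigma> (\<alpha> \<gamma> x)\<bar>)"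
      by (rule of_int_le_iff[THEN iffD2])
    then show ?case by simp
  qed
  have "real (sphere_norm n) = (\<integral>x. real (sphere_norm n) \<partial>X)" by (simp add: prob_space)
  also have "\<dots> \<le> (\<integral>x. (\<Sum>\<sigma>\<in>S. \<Sum>\<gamma>\<in>carrier \<Gamma>. \<bar>real_of_int (f \<sigma> (\<alpha> \<gamma> x))\<bar>) \<partial>X)"
    by (intro integral_mono_AE ae Bochner_Integration.integrable_sum int) auto
  also have "\<dots> = (\<Sum>\<sigma>\<in>S. \<Sum>\<gamma>\<in>carrier \<Gamma>. \<integral>x. \<bar>real_of_int (f \<sigma> (\<alpha> \<gamma> x))\<bar> \<partial>X)"
    by (subst Bochner_Integration.integral_sum) (auto intro!: Bochner_Integration.integrable_sum int sum.cong Bochner_Integration.integral_sum)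
  \<comment> \<open>Invariance of the measure makes the integrals for all \<open>\<gamma>\<close>
    equal, which produces the factor \<open>card (carrier \<Gamma>)\<close>.\<close>
  also have "\<dots> = (\<Sum>\<sigma>\<in>S. \<Sum>\<gamma>\<in>carrier \<Gamma>. \<integral>x. \<bar>real_of_int (f \<sigma> x)\<bar> \<partial>X)"
    by (intro sum.cong refl integral_action S(2))
  also have "\<dots> = real (card (carrier \<Gamma>)) * (\<Sum>\<sigma>\<in>S. \<integral>x. \<bar>real_of_int (f \<sigma> x)\<bar> \<partial>X)"
    by (simp add: sum_distrib_left)
  finally show ?thesis using card by (simp add: field_simps)
qed

text \<open>The infimum in \<open>ifsv_param\<close> has to be taken over a nonempty set before a
  lower bound can pass to it. The tensor \<open>1 \<otimes> z\<close> is brought into reduced form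
  with constant coefficient functions.\<close>

lemma parametrised_cycle_ex:
  assumes c: "fundamental_class n M c"
  obtains S f where "finite S" "S \<subseteq> singular_simplex_set n E" "inj_on (simplex_map n p) S" "\<forall>\<sigma>\<in>S. f \<sigma> \<in> Linf X"
    "parametrised_fundamental_cycle n M c E p e0 X \<alpha> (\<Sum>\<sigma>\<in>S. frag_of (f \<sigma>, frag_of \<sigma>))"
proof -
  obtain m where m: "m \<in> c" by (rule fundamental_class_nonempty[OF c])
  have "singular_chain n M m" using fundamental_class_iff[OF m] c by (auto simp: singular_relcycle)
  from chain_lift[OF cov this] obtain S where S: "finite S" "S \<subseteq> singular_simplex_set n E" "inj_on (simplex_map n p) S"
    and zc: "singular_chain n E (\<Sum>\<sigma>\<in>S. frag_cmul (Poly_Mapping.lookup m (simplex_map n p \<sigma>)) (frag_of \<sigma>))"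
    and zm: "chain_map n p (\<Sum>\<sigma>\<in>S. frag_cmul (Poly_Mapping.lookup m (simplex_map n p \<sigma>)) (frag_of \<sigma>)) = m" by blast
  define a where "a \<sigma> = Poly_Mapping.lookup m (simplex_map n p \<sigma>)" for \<sigma>
  let ?z = "\<Sum>\<sigma>\<in>S. frag_cmul (a \<sigma>) (frag_of \<sigma>)" and ?w = "\<Sum>\<sigma>\<in>S. frag_of (\<lambda>_. a \<sigma>, frag_of \<sigma>)"
  have sc: "singular_chain n E (frag_of \<sigma>)" if "\<sigma> \<in> S" for \<sigma> using S(2) that by (auto simp: singular_chain_of)
  have z: "singular_chain n E ?z" using zc by (simp add: a_def)
  have summand: "null n (frag_of (\<lambda>_. a \<sigma>, frag_of \<sigma>) - frag_of (\<lambda>_. 1, frag_cmul (a \<sigma>) (frag_of \<sigma>)))" if "\<sigma> \<in> S" for \<sigma>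
    using null_trans[OF _ null_sym[OF null_cmul_right[OF Linf_const sc[OF that]]]]
      null_cmul_left[OF Linf_const[of 1] sc[OF that], of "a \<sigma>"] by simp
  have "null n (\<Sum>\<sigma>\<in>S. frag_of (\<lambda>_. a \<sigma>, frag_of \<sigma>) - frag_of (\<lambda>_. 1, frag_cmul (a \<sigma>) (frag_of \<sigma>)))"
    by (rule null_sum[OF S(1) summand])
  then have "null n (?w - (\<Sum>\<sigma>\<in>S. frag_of (\<lambda>_. 1, frag_cmul (a \<sigma>) (frag_of \<sigma>))))" by (simp add: sum_subtractf)
  moreover have "null n ((\<Sum>\<sigma>\<in>S. frag_of (\<lambda>_. 1, frag_cmul (a \<sigma>) (frag_of \<sigma>))) - frag_of (\<lambda>_. 1, ?z))"
    by (rule null_sym[OF null_sum_right[OF Linf_const S(1) singular_chain_cmul[OF sc]]])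
  ultimately have "null n (?w - frag_of (\<lambda>_. 1, ?z))" by (rule null_trans)
  moreover have "?w \<in> carrier (formal_tensors X E n)"
    by (rule formal_tensors_sum[OF S(1) formal_tensors_closed(5)[OF Linf_const sc]])
  ultimately have "tensor_eq \<Gamma> X \<alpha> E \<rho> n ?w (frag_of (\<lambda>_. 1, ?z) + tensor_boundary (Suc n) 0)"
    using formal_tensors_closed(5)[OF Linf_const z] by (simp add: tensor_eq_null)
  then have "parametrised_fundamental_cycle n M c E p e0 X \<alpha> ?w"
    unfolding parametrised_fundamental_cycle_def
    using z zm m formal_tensors_closed(1)[of "Suc n"] unfolding a_def[symmetric] by blast
  then show thesis using that[of S "\<lambda>\<sigma> _. a \<sigma>"] S Linf_const by blast
qed

end

section \<open>An efficient parametrised fundamental cycle\<close>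

lemma simplex_map_face:
  assumes "i \<le> Suc k"
  shows "simplex_map k f (singular_face (Suc k) i \<sigma>) = singular_face (Suc k) i (simplex_map (Suc k) f \<sigma>)"
proof
  fix t
  show "simplex_map k f (singular_face (Suc k) i \<sigma>) t = singular_face (Suc k) i (simplex_map (Suc k) f \<sigma>) t"
    using assms simplical_face_in_standard_simplex[of "Suc k" i t]
    by (simp add: simplex_map_def singular_face_def restrict_def)
qed

text \<open>For even \<open>n\<close> the efficient cycle has two simplices, and reduced form
  requires different images in \<open>M\<close>. Were they equal, the image of the sphere cycle
  would be 0, and with it \<open>d\<close> times the fundamental class.\<close>

lemma cover_collapse_nonconst:
  assumes fc: "finite_cover d (nsphere n) M q" and n: "n > 0" "even n" and c: "fundamental_class n M c"
  shows "simplex_map n q (collapse_simplex n) \<noteq> simplex_map n q (const_simplex n (antipole n))"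
proof
  assume eq: "simplex_map n q (collapse_simplex n) = simplex_map n q (const_simplex n (antipole n))"
  interpret Q: finite_sheeted_covering "nsphere n" M q d by (rule finite_cover_locale[OF fc])
  obtain z where z: "z \<in> c" by (rule fundamental_class_nonempty[OF c])
  obtain \<epsilon> where "homologous_rel n M {} (frag_cmul (int d) z)
       (frag_cmul \<epsilon> (collapsed_cycle n (q (antipole n)) (simplex_map n q (collapse_simplex n))))"
    by (rule cover_multiple_class[OF fc n(1) c z])
  then have "homologous_rel n M {} (frag_cmul (int d) z) 0"
    using n(2) eq by (simp add: collapsed_cycle_def simplex_map_const)
  from Q.homologous_rel_transfer[OF this]
  have "singular_relboundary n (nsphere n) {} (frag_cmul (int d) (transfer n (nsphere n) q z))"
    by (simp add: homologous_rel_0)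
  from integer_homology_hgen(2)[OF homology_nsphere_integer[OF n(1)] transfer_fundamental_class[OF fc n(1) c z] this]
  show False using fc by (simp add: finite_cover_def)
qed

text \<open>\<open>K\<close> enumerates the lifts \<open>L x\<close> of \<open>p\<close> through the sphere, on which \<open>\<Gamma>\<close> acts by precomposition with the
  inverse deck transformations.\<close>

locale fibre_action = pointed_universal_covering E M p e0
  for E :: "'e topology" and M :: "'a topology" and p e0 +
  fixes n d :: nat and q :: "(nat \<Rightarrow> real) \<Rightarrow> 'a" and K :: "real set" and L :: "real \<Rightarrow> 'e \<Rightarrow> nat \<Rightarrow> real"
  assumes fc: "finite_cover d (nsphere n) M q" and finK: "finite K"
    and contL: "x \<in> K \<Longrightarrow> continuous_map E (nsphere n) (L x)"
    and qL: "x \<in> K \<Longrightarrow> e \<in> topspace E \<Longrightarrow> q (L x e) = p e"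
    and bij_e0: "bij_betw (\<lambda>x. L x e0) K {y \<in> topspace (nsphere n). q y = p e0}"
begin

lemma covq: "covering_map (nsphere n) M q" by (rule finite_cover_covering[OF fc])

sublocale Q: finite_sheeted_covering "nsphere n" M q d by (rule finite_cover_locale[OF fc])

lemma L_in: "x \<in> K \<Longrightarrow> e \<in> topspace E \<Longrightarrow> L x e \<in> topspace (nsphere n)"
  using contL by (meson continuous_map_image_subset_topspace image_subset_iff)

lemma L_inj:
  assumes "x \<in> K" "x' \<in> K" "e \<in> topspace E" "L x e = L x' e"
  shows "x = x'"
proof -
  have "L x e0 = L x' e0"
    by (rule lift_unique[OF covq contL[OF assms(1)] contL[OF assms(2)] qL[OF assms(1)] qL[OF assms(2)] assms(3,4) e0])
  then show ?thesis using bij_betw_imp_inj_on[OF bij_e0] assms(1,2) by (auto dest: inj_onD)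
qed

lemma fibre_card:
  assumes "a \<in> topspace E"
  shows "finite {y \<in> topspace (nsphere n). q y = p a}" "card {y \<in> topspace (nsphere n). q y = p a} = d"
proof -
  have "p a \<in> topspace M" using covering_map_surj[OF cov] assms by blast
  then show "finite {y \<in> topspace (nsphere n). q y = p a}" "card {y \<in> topspace (nsphere n). q y = p a} = d"
    using Q.sheets by (auto simp: sheeted_def)
qed

lemma card_K: "card K = d"
  using bij_betw_same_card[OF bij_e0] fibre_card(2)[OF e0] by simp

lemma d_pos: "d > 0"
  using fc by (simp add: finite_cover_def)

text \<open>Different lifts differ at every point, and there are as many lifts as points in a fibre;
  so the bijection at \<open>e0\<close> extends to all of \<open>E\<close>.\<close>

lemma L_bij:
  assumes a: "a \<in> topspace E"
  shows "bij_betw (\<lambda>x. L x a) K {y \<in> topspace (nsphere n). q y = p a}"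
proof -
  have inj: "inj_on (\<lambda>x. L x a) K" by (rule inj_onI) (rule L_inj[OF _ _ a])
  have "(\<lambda>x. L x a) ` K = {y \<in> topspace (nsphere n). q y = p a}"
    by (rule card_subset_eq[OF fibre_card(1)[OF a]]) (use L_in qL a card_image[OF inj] card_K fibre_card(2)[OF a] in auto)
  then show ?thesis using inj by (simp add: bij_betw_def)
qed

text \<open>The composite of \<open>L x\<close> with an inverse deck transformation is again a lift
  of \<open>p\<close>; its index in \<open>K\<close> is looked up by the value at \<open>e0\<close>,
  which determines a lift.\<close>

definition lift_action :: "(real \<Rightarrow> 'a) set \<Rightarrow> real \<Rightarrow> real" where
  "lift_action \<gamma> x = inv_into K (\<lambda>x. L x e0) (L x (deck_inverse \<gamma> e0))"

lemma lift_action: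
  assumes \<gamma>: "\<gamma> \<in> carrier \<Gamma>" and x: "x \<in> K"
  shows "lift_action \<gamma> x \<in> K" and "\<And>e. e \<in> topspace E \<Longrightarrow> L (lift_action \<gamma> x) e = L x (deck_inverse \<gamma> e)"
proof -
  let ?y = "L x (deck_inverse \<gamma> e0)"
  have i: "deck_inverse \<gamma> e0 \<in> topspace E" by (rule deck_inverse(2)[OF \<gamma> e0])
  have "q ?y = p e0" using qL[OF x i] deck_inverse(5)[OF \<gamma> e0] by simp
  then have "?y \<in> {y \<in> topspace (nsphere n). q y = p e0}" using L_in[OF x i] by simp
  then have im: "?y \<in> (\<lambda>x. L x e0) ` K" using bij_betw_imp_surj_on[OF bij_e0] by simp
  show k: "lift_action \<gamma> x \<in> K" unfolding lift_action_def by (rule inv_into_into[OF im])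
  have e: "L (lift_action \<gamma> x) e0 = ?y" unfolding lift_action_def by (rule f_inv_into_f[OF im])
  show "L (lift_action \<gamma> x) e = L x (deck_inverse \<gamma> e)" if "e \<in> topspace E" for e
  proof (rule lift_unique[where r = q and N = "nsphere n" and l = "L (lift_action \<gamma> x)" and l' = "\<lambda>e. L x (deck_inverse \<gamma> e)" and x = e0,
        OF covq contL[OF k] _ qL[OF k] _ e0 e that])
    show "continuous_map E (nsphere n) (\<lambda>e. L x (deck_inverse \<gamma> e))"
      using continuous_map_compose[OF deck_inverse(1)[OF \<gamma>] contL[OF x]] by (simp add: o_def)
    show "q (L x (deck_inverse \<gamma> e)) = p e" if "e \<in> topspace E" for e
      using qL[OF x deck_inverse(2)[OF \<gamma> that]] deck_inverse(5)[OF \<gamma> that] by simp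
  qed
qed

lemma lift_action_bij:
  assumes \<gamma>: "\<gamma> \<in> carrier \<Gamma>"
  shows "inj_on (lift_action \<gamma>) K" "lift_action \<gamma> ` K = K"
proof -
  show inj: "inj_on (lift_action \<gamma>) K"
  proof (rule inj_onI)
    fix x x' assume x: "x \<in> K" "x' \<in> K" and e: "lift_action \<gamma> x = lift_action \<gamma> x'"
    have "L x (deck_inverse \<gamma> e0) = L x' (deck_inverse \<gamma> e0)"
      using lift_action(2)[OF \<gamma> x(1) e0] lift_action(2)[OF \<gamma> x(2) e0] e by simp
    then show "x = x'" by (rule L_inj[OF x deck_inverse(2)[OF \<gamma> e0]])
  qed
  show "lift_action \<gamma> ` K = K"
    by (rule endo_inj_surj[OF finK _ inj]) (use lift_action(1)[OF \<gamma>] in auto)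
qed

text \<open>Each of the \<open>d\<close> lifts has weight \<open>1 / real d\<close>; this weight is
  the source of the factor in the upper bound.\<close>

abbreviation "X \<equiv> uniform_count_measure K"

lemma standard_borel_K: "standard_borel X"
  unfolding standard_borel_def
proof (intro exI conjI)
  show "completely_metrizable_space (discrete_topology K)" by (rule completely_metrizable_space_discrete_topology)
  show "second_countable (discrete_topology K)"
    unfolding second_countable_discrete_topology by (rule countable_finite[OF finK])
  show "topspace (discrete_topology K) = space X" by (simp add: space_uniform_count_measure)
  have "sigma_sets K (Pow K) = Pow K" by (rule sigma_algebra.sigma_sets_eq[OF sigma_algebra_Pow])
  moreover have "{U. openin (discrete_topology K) U} = Pow K" by auto
  ultimately show "sets X = sigma_sets (topspace (discrete_topology K)) {U. openin (discrete_topology K) U}"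
    by (simp add: sets_uniform_count_measure)
qed

lemma standard_space_K: "standard_space \<Gamma> X lift_action"
  unfolding standard_space_def space_uniform_count_measure sets_uniform_count_measure
proof (intro conjI ballI)
  show "standard_borel X" by (rule standard_borel_K)
  show "prob_space X"
    by (rule prob_space_uniform_count_measure[OF finK]) (use card_K d_pos in auto)
next
  fix \<gamma> assume \<gamma>: "\<gamma> \<in> carrier \<Gamma>"
  show "lift_action \<gamma> \<in> measurable X X"
    by (rule measurableI) (auto simp: space_uniform_count_measure sets_uniform_count_measure lift_action(1)[OF \<gamma>])
  fix A assume "A \<in> Pow K"
  then have A: "A \<subseteq> K" by simp
  have "lift_action \<gamma> ` (lift_action \<gamma> -` A \<inter> K) = A"
  proof
    show "A \<subseteq> lift_action \<gamma> ` (lift_action \<gamma> -` A \<inter> K)"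
    proof
      fix a assume a: "a \<in> A"
      then have "a \<in> lift_action \<gamma> ` K" unfolding lift_action_bij(2)[OF \<gamma>] using A by blast
      then obtain x where "a = lift_action \<gamma> x" "x \<in> K" by (rule imageE)
      then show "a \<in> lift_action \<gamma> ` (lift_action \<gamma> -` A \<inter> K)" using a by simp
    qed
  qed (rule image_subsetI, simp)
  then have "card (lift_action \<gamma> -` A \<inter> K) = card A"
    using card_image[OF inj_on_subset[OF lift_action_bij(1)[OF \<gamma>]], of "lift_action \<gamma> -` A \<inter> K"] by simp
  then show "emeasure X (lift_action \<gamma> -` A \<inter> K) = emeasure X A"
    using A by (simp add: emeasure_uniform_count_measure[OF finK])
next
  fix x assume x: "x \<in> K"
  have "deck_inverse \<one>\<^bsub>\<Gamma>\<^esub> e0 = e0"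
    using deck_inverse(4)[OF deck_action_one(1) e0] deck_action_one(2)[OF e0] by simp
  then show "lift_action \<one>\<^bsub>\<Gamma>\<^esub> x = x"
    using lift_action(2)[OF deck_action_one(1) x e0] L_inj[OF lift_action(1)[OF deck_action_one(1) x] x e0] by simp
next
  fix \<gamma> \<delta> x assume g: "\<gamma> \<in> carrier \<Gamma>" "\<delta> \<in> carrier \<Gamma>" and x: "x \<in> K"
  have m: "\<gamma> \<otimes>\<^bsub>\<Gamma>\<^esub> \<delta> \<in> carrier \<Gamma>" by (rule deck_action_mult(1)[OF g])
  have \<delta>x: "lift_action \<delta> x \<in> K" by (rule lift_action(1)[OF g(2) x])
  have "L (lift_action (\<gamma> \<otimes>\<^bsub>\<Gamma>\<^esub> \<delta>) x) e0 = L x (deck_inverse \<delta> (deck_inverse \<gamma> e0))"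
    using lift_action(2)[OF m x e0] deck_inverse_mult[OF g e0] by simp
  also have "\<dots> = L (lift_action \<gamma> (lift_action \<delta> x)) e0"
    using lift_action(2)[OF g(1) \<delta>x e0] lift_action(2)[OF g(2) x deck_inverse(2)[OF g(1) e0]] by simp
  finally show "lift_action (\<gamma> \<otimes>\<^bsub>\<Gamma>\<^esub> \<delta>) x = lift_action \<gamma> (lift_action \<delta> x)"
    by (rule L_inj[OF lift_action(1)[OF m x] lift_action(1)[OF g(1) \<delta>x] e0])
qed

sublocale standard_action E M p e0 X lift_action
  by unfold_locales (rule standard_space_K)

lemma Linf_all: "f \<in> Linf X"
proof -
  have "AE x in X. \<bar>f x\<bar> \<le> (\<Sum>x\<in>K. \<bar>f x\<bar>)"
    by (rule AE_I2) (auto simp: space_uniform_count_measure finK intro!: member_le_sum)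
  moreover have "f \<in> measurable X (count_space UNIV)"
    by (rule measurableI) (auto simp: space_uniform_count_measure sets_uniform_count_measure)
  ultimately show ?thesis by (auto simp: Linf_def)
qed

lemma null_eqI:
  assumes "\<And>x. x \<in> K \<Longrightarrow> f x = g x" "singular_chain k E c"
  shows "null k (frag_of (f, c) - frag_of (g, c))"
  by (rule null_AE[OF Linf_all Linf_all _ assms(2)]) (rule AE_I2, simp add: space_uniform_count_measure assms(1))

section \<open>From chains of the sphere to tensors\<close>

text \<open>Marks those lifts \<open>L x\<close> that carry the simplex \<open>\<sigma>\<close> of
  \<open>E\<close> to the simplex \<open>\<tau>\<close> of the sphere. Tensored with
  \<open>\<sigma>\<close>, it represents \<open>\<tau>\<close> spread over \<open>K\<close>.\<close>

definition lift_indicator :: "nat \<Rightarrow> ((nat \<Rightarrow> real) \<Rightarrow> 'e) \<Rightarrow> ((nat \<Rightarrow> real) \<Rightarrow> nat \<Rightarrow> real) \<Rightarrow> real \<Rightarrow> int" where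
  "lift_indicator k \<sigma> \<tau> x = (if simplex_map k (L x) \<sigma> = \<tau> then 1 else 0)"

definition chosen_lift :: "nat \<Rightarrow> ((nat \<Rightarrow> real) \<Rightarrow> nat \<Rightarrow> real) \<Rightarrow> (nat \<Rightarrow> real) \<Rightarrow> 'e" where
  "chosen_lift k \<tau> = (SOME \<sigma>. singular_simplex k E \<sigma> \<and> simplex_map k p \<sigma> = simplex_map k q \<tau>)"

text \<open>A chain map only modulo the relators, because the chosen lift of a face need not be a
  face of the chosen lift.\<close>

definition tensor_lift :: "nat \<Rightarrow> (nat \<Rightarrow> real) chain \<Rightarrow> (real, 'e) formal_tensor" where
  "tensor_lift k = frag_extend (\<lambda>\<tau>. frag_of (lift_indicator k (chosen_lift k \<tau>) \<tau>, frag_of (chosen_lift k \<tau>)))"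

lemma tensor_lift_simps [simp]:
  "tensor_lift k 0 = 0" "tensor_lift k (a - b) = tensor_lift k a - tensor_lift k b"
  "tensor_lift k (frag_cmul m a) = frag_cmul m (tensor_lift k a)"
  "tensor_lift k (frag_of \<tau>) = frag_of (lift_indicator k (chosen_lift k \<tau>) \<tau>, frag_of (chosen_lift k \<tau>))"
  by (auto simp: tensor_lift_def frag_extend_diff frag_extend_cmul)

lemma chosen_lift:
  assumes "singular_simplex k (nsphere n) \<tau>"
  shows "singular_simplex k E (chosen_lift k \<tau>)" "simplex_map k p (chosen_lift k \<tau>) = simplex_map k q \<tau>"
proof -
  have "singular_simplex k M (simplex_map k q \<tau>)"
    by (rule singular_simplex_simplex_map[OF assms covering_map_continuous[OF covq]])
  then obtain \<sigma> where "singular_simplex k E \<sigma>" "simplex_map k p \<sigma> = simplex_map k q \<tau>"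
    by (rule covering_simplex_lift[OF cov])
  then have "singular_simplex k E \<sigma> \<and> simplex_map k p \<sigma> = simplex_map k q \<tau>" by (rule conjI)
  from someI[where P = "\<lambda>\<sigma>. singular_simplex k E \<sigma> \<and> simplex_map k p \<sigma> = simplex_map k q \<tau>", OF this]
  show "singular_simplex k E (chosen_lift k \<tau>)" "simplex_map k p (chosen_lift k \<tau>) = simplex_map k q \<tau>"
    unfolding chosen_lift_def by (rule conjunct1, rule conjunct2)
qed

text \<open>Two lifts of the same simplex of \<open>M\<close> differ by some
  \<open>\<rho> \<gamma>\<close>. Moving \<open>\<gamma>\<close> across the tensor product turns the
  indicator of one into that of the other, since \<open>lift_action\<close> composes with the
  inverse deck transformation.\<close>

lemma tensor_lift_independent:
  assumes \<tau>: "singular_simplex k (nsphere n) \<tau>" and \<sigma>: "singular_simplex k E \<sigma>"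
    and eq: "simplex_map k p \<sigma> = simplex_map k q \<tau>"
  shows "null k (frag_of (lift_indicator k \<sigma> \<tau>, frag_of \<sigma>) - tensor_lift k (frag_of \<tau>))"
proof -
  let ?\<sigma> = "chosen_lift k \<tau>"
  note c = chosen_lift[OF \<tau>]
  have v: "?\<sigma> vertex0 \<in> topspace E" "\<sigma> vertex0 \<in> topspace E" by (auto intro: singular_simplex_value c \<sigma>)
  have "p (\<sigma> vertex0) = p (?\<sigma> vertex0)"
    using simplex_map_apply[OF vertex0_in, of k p \<sigma>] simplex_map_apply[OF vertex0_in, of k p ?\<sigma>] eq c(2) by simp
  then obtain \<gamma> where \<gamma>: "\<gamma> \<in> carrier \<Gamma>" "\<rho> \<gamma> (?\<sigma> vertex0) = \<sigma> vertex0" by (rule deck_action_transitive[OF v])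
  have s: "simplex_map k (\<rho> \<gamma>) ?\<sigma> = \<sigma>"
  proof (rule simplex_lift_unique[OF cov _ \<sigma> _ vertex0_in])
    show "singular_simplex k E (simplex_map k (\<rho> \<gamma>) ?\<sigma>)"
      by (rule singular_simplex_simplex_map[OF c(1) deck_actionD(1)[OF \<gamma>(1)]])
    have "simplex_map k p (simplex_map k (\<rho> \<gamma>) ?\<sigma>) = simplex_map k (p \<circ> \<rho> \<gamma>) ?\<sigma>" by (simp add: simplex_map_compose)
    also have "\<dots> = simplex_map k p ?\<sigma>"
      by (rule simplex_map_eq[OF c(1)]) (simp add: deck_actionD(3)[OF \<gamma>(1)])
    finally show "simplex_map k p (simplex_map k (\<rho> \<gamma>) ?\<sigma>) = simplex_map k p \<sigma>" using c(2) eq by simp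
    show "simplex_map k (\<rho> \<gamma>) ?\<sigma> vertex0 = \<sigma> vertex0"
      using \<gamma>(2) by (simp add: simplex_map_apply)
  qed
  have ind: "lift_indicator k \<sigma> \<tau> (lift_action \<gamma> x) = lift_indicator k ?\<sigma> \<tau> x" if x: "x \<in> K" for x
  proof -
    have "simplex_map k (L (lift_action \<gamma> x)) \<sigma> = simplex_map k (L (lift_action \<gamma> x) \<circ> \<rho> \<gamma>) ?\<sigma>"
      unfolding simplex_map_compose o_apply s ..
    also have "\<dots> = simplex_map k (L x) ?\<sigma>"
      by (rule simplex_map_eq[OF c(1)])
        (simp add: lift_action(2)[OF \<gamma>(1) x] deck_inverse(4)[OF \<gamma>(1)] deck_actionD(2)[OF \<gamma>(1)])
    finally show ?thesis by (simp add: lift_indicator_def)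
  qed
  have sc: "singular_chain k E (frag_of ?\<sigma>)" using c(1) by (simp add: singular_chain_of)
  have "null k (frag_of (lift_indicator k ?\<sigma> \<tau>, frag_of ?\<sigma>) - frag_of (\<lambda>x. lift_indicator k \<sigma> \<tau> (lift_action \<gamma> x), frag_of ?\<sigma>))"
    by (rule null_eqI[OF _ sc]) (simp add: ind)
  moreover have "null k (frag_of (\<lambda>x. lift_indicator k \<sigma> \<tau> (lift_action \<gamma> x), frag_of ?\<sigma>) - frag_of (lift_indicator k \<sigma> \<tau>, frag_of \<sigma>))"
    using null_act[OF Linf_all \<gamma>(1) sc, of "lift_indicator k \<sigma> \<tau>"] by (simp add: s)
  ultimately have "null k (frag_of (lift_indicator k ?\<sigma> \<tau>, frag_of ?\<sigma>) - frag_of (lift_indicator k \<sigma> \<tau>, frag_of \<sigma>))"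
    by (rule null_trans)
  then show ?thesis using null_sym by simp
qed

text \<open>Two simplices of the sphere over the same simplex of \<open>M\<close> coincide as soon
  as one face does, by unique lifting. So passing to a face leaves the coefficient function
  unchanged.\<close>

lemma lift_indicator_face:
  assumes \<tau>: "singular_simplex (Suc k) (nsphere n) \<tau>" and \<sigma>: "singular_simplex (Suc k) E \<sigma>"
    and eq: "simplex_map (Suc k) p \<sigma> = simplex_map (Suc k) q \<tau>" and i: "i \<le> Suc k" and x: "x \<in> K"
  shows "lift_indicator k (singular_face (Suc k) i \<sigma>) (singular_face (Suc k) i \<tau>) x = lift_indicator (Suc k) \<sigma> \<tau> x"
proof -
  let ?s = "simplex_map (Suc k) (L x) \<sigma>"
  have f: "simplex_map k (L x) (singular_face (Suc k) i \<sigma>) = singular_face (Suc k) i ?s"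
    by (rule simplex_map_face[OF i])
  have "?s = \<tau>" if e: "singular_face (Suc k) i ?s = singular_face (Suc k) i \<tau>"
  proof (rule simplex_lift_unique[OF covq _ \<tau>])
    show "singular_simplex (Suc k) (nsphere n) ?s" by (rule singular_simplex_simplex_map[OF \<sigma> contL[OF x]])
    have "simplex_map (Suc k) q ?s = simplex_map (Suc k) (q \<circ> L x) \<sigma>" by (simp add: simplex_map_compose)
    also have "\<dots> = simplex_map (Suc k) p \<sigma>" by (rule simplex_map_eq[OF \<sigma>]) (simp add: qL[OF x])
    finally show "simplex_map (Suc k) q ?s = simplex_map (Suc k) q \<tau>" using eq by simp
    show "simplical_face i vertex0 \<in> standard_simplex (Suc k)"
      by (rule simplical_face_in_standard_simplex) (use i in auto)
    have "singular_face (Suc k) i ?s vertex0 = singular_face (Suc k) i \<tau> vertex0" using e by simp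
    then show "?s (simplical_face i vertex0) = \<tau> (simplical_face i vertex0)"
      by (simp add: singular_face_def)
  qed
  then show ?thesis unfolding lift_indicator_def f by auto
qed

lemma tensor_lift_carrier: "singular_chain k (nsphere n) b \<Longrightarrow> tensor_lift k b \<in> carrier (formal_tensors X E k)"
proof (induction rule: singular_chain_induct)
  case (one \<tau>)
  then show ?case using chosen_lift(1)[OF one]
    unfolding tensor_lift_simps by (intro formal_tensors_closed(5) Linf_all) (simp add: singular_chain_of)
qed (auto intro: formal_tensors_closed)

text \<open>Faces inherit the coefficient function of the simplex by
  \<open>lift_indicator_face\<close>, and \<open>tensor_lift_independent\<close> replaces the faces
  of the chosen lift by chosen lifts of the faces.\<close>

lemma tensor_lift_boundary:
  "singular_chain (Suc k) (nsphere n) b \<Longrightarrow>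
     null k (tensor_boundary (Suc k) (tensor_lift (Suc k) b) - tensor_lift k (chain_boundary (Suc k) b))"
proof (induction rule: singular_chain_induct)
  case zero then show ?case by (simp add: null_zero)
next
  case (one \<tau>)
  let ?\<sigma> = "chosen_lift (Suc k) \<tau>"
  note c = chosen_lift[OF one]
  let ?f = "lift_indicator (Suc k) ?\<sigma> \<tau>" and ?s = "\<lambda>i. singular_face (Suc k) i ?\<sigma>" and ?t = "\<lambda>i. singular_face (Suc k) i \<tau>"
  have si: "singular_simplex k E (?s i)" if "i \<le> Suc k" for i
    using singular_simplex_singular_face[OF c(1), of i] that by simp
  have ti: "singular_simplex k (nsphere n) (?t i)" if "i \<le> Suc k" for i
    using singular_simplex_singular_face[OF one, of i] that by simp
  have sc: "singular_chain k E (frag_of (?s i))" if "i \<le> Suc k" for i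
    using si[OF that] by (simp add: singular_chain_of)
  have summand: "null k (frag_of (?f, frag_cmul ((-1) ^ i) (frag_of (?s i))) - frag_cmul ((-1) ^ i) (tensor_lift k (frag_of (?t i))))"
    if i: "i \<le> Suc k" for i
  proof (rule null_trans[OF null_cmul_right[OF Linf_all sc[OF i]]])
    have "simplex_map k p (?s i) = simplex_map k q (?t i)"
      by (simp add: simplex_map_face[OF i] c(2))
    from tensor_lift_independent[OF ti[OF i] si[OF i] this]
    have "null k (frag_of (?f, frag_of (?s i)) - tensor_lift k (frag_of (?t i)))"
      by (rule null_trans[OF null_eqI[OF _ sc[OF i]], rotated]) (simp add: lift_indicator_face[OF one c i])
    from null_cmul[OF this, of "(-1) ^ i"]
    show "null k (frag_cmul ((-1) ^ i) (frag_of (?f, frag_of (?s i))) - frag_cmul ((-1) ^ i) (tensor_lift k (frag_of (?t i))))"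
      by (simp only: frag_cmul_diff_distrib2)
  qed
  have e1: "tensor_boundary (Suc k) (tensor_lift (Suc k) (frag_of \<tau>)) = frag_of (?f, \<Sum>i\<le>Suc k. frag_cmul ((-1) ^ i) (frag_of (?s i)))"
    by (simp add: chain_boundary_of del: sum.atMost_Suc)
  have n1: "null k (frag_of (?f, \<Sum>i\<le>Suc k. frag_cmul ((-1) ^ i) (frag_of (?s i))) - (\<Sum>i\<le>Suc k. frag_of (?f, frag_cmul ((-1) ^ i) (frag_of (?s i)))))"
    by (rule null_sum_right[OF Linf_all]) (auto intro: singular_chain_cmul sc)
  have n2: "null k ((\<Sum>i\<le>Suc k. frag_of (?f, frag_cmul ((-1) ^ i) (frag_of (?s i)))) - (\<Sum>i\<le>Suc k. frag_cmul ((-1) ^ i) (tensor_lift k (frag_of (?t i)))))"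
    unfolding sum_subtractf[symmetric] by (rule null_sum[OF finite_atMost]) (rule summand, simp only: atMost_iff)
  have e2: "(\<Sum>i\<le>Suc k. frag_cmul ((-1) ^ i) (tensor_lift k (frag_of (?t i)))) = tensor_lift k (chain_boundary (Suc k) (frag_of \<tau>))"
    unfolding chain_boundary_of tensor_lift_def by (simp add: frag_extend_sum o_def frag_extend_cmul del: sum.atMost_Suc)
  show ?case unfolding e1 e2[symmetric] by (rule null_trans[OF n1 n2])
next
  case (diff a b)
  from null_diff[OF diff(3,4)] show ?case by (simp add: chain_boundary_diff algebra_simps)
qed

text \<open>For a simplex \<open>\<sigma>\<close> of \<open>E\<close> the images under the different
  \<open>L x\<close> are pairwise distinct, so on \<open>K\<close> their indicators add up to 1.
  With \<open>z\<close> a lifted fundamental cycle this identifies the image of the transfer with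
  \<open>1 \<otimes> z\<close>.\<close>

lemma tensor_lift_total:
  "singular_chain k E z \<Longrightarrow> null k ((\<Sum>x\<in>K. tensor_lift k (chain_map k (L x) z)) - frag_of (\<lambda>_. 1, z))"
proof (induction rule: singular_chain_induct)
  case zero
  then show ?case using null_uminus[OF null_right_zero[OF Linf_all]] by simp
next
  case (one \<sigma>)
  let ?\<tau> = "\<lambda>x. simplex_map k (L x) \<sigma>"
  have sc: "singular_chain k E (frag_of \<sigma>)" using one by (simp add: singular_chain_of)
  have summand: "null k (tensor_lift k (chain_map k (L x) (frag_of \<sigma>)) - frag_of (lift_indicator k \<sigma> (?\<tau> x), frag_of \<sigma>))" if x: "x \<in> K" for x
  proof -
    have "simplex_map k q (?\<tau> x) = simplex_map k (q \<circ> L x) \<sigma>" by (simp add: simplex_map_compose)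
    also have "\<dots> = simplex_map k p \<sigma>" by (rule simplex_map_eq[OF one]) (simp add: qL[OF x])
    finally have "simplex_map k p \<sigma> = simplex_map k q (?\<tau> x)" by simp
    from null_sym[OF tensor_lift_independent[OF singular_simplex_simplex_map[OF one contL[OF x]] one this]]
    show ?thesis by simp
  qed
  have "(\<Sum>x\<in>K. lift_indicator k \<sigma> (?\<tau> x) y) = 1" if y: "y \<in> K" for y
  proof -
    have "?\<tau> y = ?\<tau> x \<longleftrightarrow> x = y" if x: "x \<in> K" for x
    proof
      assume "?\<tau> y = ?\<tau> x"
      then have "L y (\<sigma> vertex0) = L x (\<sigma> vertex0)" by (metis simplex_map_apply vertex0_in)
      then show "x = y" using L_inj[OF y x singular_simplex_value[OF one vertex0_in]] by simp
    qed simp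
    then have "(\<Sum>x\<in>K. lift_indicator k \<sigma> (?\<tau> x) y) = (\<Sum>x\<in>K. if x = y then 1 else 0)"
      unfolding lift_indicator_def by (intro sum.cong refl) simp
    then show ?thesis using y finK by simp
  qed
  then have "null k (frag_of (\<lambda>y. \<Sum>x\<in>K. lift_indicator k \<sigma> (?\<tau> x) y, frag_of \<sigma>) - frag_of (\<lambda>_. 1, frag_of \<sigma>))"
    by (rule null_eqI[OF _ sc])
  moreover have "null k ((\<Sum>x\<in>K. frag_of (lift_indicator k \<sigma> (?\<tau> x), frag_of \<sigma>)) - frag_of (\<lambda>y. \<Sum>x\<in>K. lift_indicator k \<sigma> (?\<tau> x) y, frag_of \<sigma>))"
    by (rule null_sym) (rule conjunct2[OF null_sum_left[OF finK Linf_all sc]])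
  moreover have "null k ((\<Sum>x\<in>K. tensor_lift k (chain_map k (L x) (frag_of \<sigma>))) - (\<Sum>x\<in>K. frag_of (lift_indicator k \<sigma> (?\<tau> x), frag_of \<sigma>)))"
    unfolding sum_subtractf[symmetric] by (rule null_sum[OF finK summand])
  ultimately show ?case using null_trans by metis
next
  case (diff a b)
  have "null k ((\<Sum>x\<in>K. tensor_lift k (chain_map k (L x) (a - b))) - (frag_of (\<lambda>_. 1, a) - frag_of (\<lambda>_. 1, b)))"
    using null_diff[OF diff(3,4)] by (simp add: chain_map_diff sum_subtractf algebra_simps)
  from null_trans[OF this null_sym[OF null_diff_right[OF Linf_all diff(1,2)]]] show ?case .
qed

text \<open>At most one lift carries \<open>\<sigma>\<close> to \<open>\<tau>\<close>, since lifts
  that agree at a point are equal.\<close>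

lemma lift_indicator_integral:
  assumes \<sigma>: "singular_simplex k E \<sigma>" and \<epsilon>: "\<bar>\<epsilon>\<bar> = 1"
  shows "(\<integral>x. \<bar>real_of_int (\<epsilon> * lift_indicator k \<sigma> \<tau> x)\<bar> \<partial>X) \<le> 1 / real d"
proof -
  let ?A = "{x \<in> K. simplex_map k (L x) \<sigma> = \<tau>}"
  have "\<bar>real_of_int (\<epsilon> * lift_indicator k \<sigma> \<tau> x)\<bar> = (if simplex_map k (L x) \<sigma> = \<tau> then 1 else 0)" for x
  proof -
    have "\<bar>real_of_int \<epsilon>\<bar> = 1" using \<epsilon> by linarith
    then show ?thesis by (simp add: lift_indicator_def)
  qed
  then have "(\<integral>x. \<bar>real_of_int (\<epsilon> * lift_indicator k \<sigma> \<tau> x)\<bar> \<partial>X) = (\<Sum>x\<in>K. if simplex_map k (L x) \<sigma> = \<tau> then 1 else 0) / real d"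
    by (simp add: integral_uniform_count_measure[OF finK] card_K)
  also have "\<dots> = real (card ?A) / real d"
    using finK by (simp add: sum.If_cases Int_def)
  also have "\<dots> \<le> 1 / real d"
  proof -
    have "x = y" if "x \<in> ?A" "y \<in> ?A" for x y
    proof (rule L_inj[OF _ _ singular_simplex_value[OF \<sigma> vertex0_in]])
      show "L x (\<sigma> vertex0) = L y (\<sigma> vertex0)" using that by (metis (mono_tags, lifting) mem_Collect_eq simplex_map_apply vertex0_in)
    qed (use that in auto)
    then have "card ?A \<le> 1" using card_le_Suc0_iff_eq[of ?A] finK by simp
    then show ?thesis by (intro divide_right_mono) auto
  qed
  finally show ?thesis .
qed

lemma parametrised_sphere_cycle:
  assumes c: "fundamental_class n M c" and n: "n > 0"
  obtains S f where "finite S" "S \<subseteq> singular_simplex_set n E" "inj_on (simplex_map n p) S" "\<forall>\<sigma>\<in>S. f \<sigma> \<in> Linf X"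
    "parametrised_fundamental_cycle n M c E p e0 X lift_action (\<Sum>\<sigma>\<in>S. frag_of (f \<sigma>, frag_of \<sigma>))"
    "(\<Sum>\<sigma>\<in>S. \<integral>x. \<bar>real_of_int (f \<sigma> x)\<bar> \<partial>X) \<le> real (sphere_norm n) / real d"
proof -
  obtain m where m: "m \<in> c" by (rule fundamental_class_nonempty[OF c])
  have mc: "singular_chain n M m" using fundamental_class_iff[OF m] c by (auto simp: singular_relcycle)
  obtain z where z: "singular_chain n E z" "chain_map n p z = m" by (rule chain_lift[OF cov mc])
  obtain \<epsilon> where \<epsilon>: "\<bar>\<epsilon>\<bar> = 1"
    "homologous_rel n (nsphere n) {} (transfer n (nsphere n) q m) (frag_cmul \<epsilon> (sphere_cycle n))"
    by (rule transfer_sphere_cycle[OF fc n c m])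
  then obtain b where b: "singular_chain (Suc n) (nsphere n) b"
    "chain_boundary (Suc n) b = transfer n (nsphere n) q m - frag_cmul \<epsilon> (sphere_cycle n)"
    unfolding homologous_rel_def singular_boundary by blast
  have "transfer n (nsphere n) q m = (\<Sum>x\<in>K. chain_map n (L x) z)"
    using Q.transfer_chain_map[OF covering_map_continuous[OF cov] contL qL L_bij z(1)] z(2) by simp
  then have "tensor_lift n (transfer n (nsphere n) q m) = (\<Sum>x\<in>K. tensor_lift n (chain_map n (L x) z))"
    unfolding tensor_lift_def by (simp add: frag_extend_sum[OF finK] o_def)
  then have t: "null n (tensor_lift n (transfer n (nsphere n) q m) - frag_of (\<lambda>_. 1, z))"
    using tensor_lift_total[OF z(1)] by simp
  let ?\<kappa> = "collapse_simplex n" and ?\<pi> = "const_simplex n (antipole n)"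
  have cs: "collapsed n (nsphere n) (antipole n) ?\<kappa>" by (rule collapsed_collapse_simplex)
  have \<kappa>: "singular_simplex n (nsphere n) ?\<kappa>" "singular_simplex n (nsphere n) ?\<pi>"
    using cs by (auto simp: collapsed_def intro: singular_const_simplex)
  let ?s = "chosen_lift n ?\<kappa>" and ?r = "chosen_lift n ?\<pi>"
  note s = chosen_lift[OF \<kappa>(1)] and r = chosen_lift[OF \<kappa>(2)]
  have ne: "simplex_map n p ?s \<noteq> simplex_map n p ?r" if "even n"
    using cover_collapse_nonconst[OF fc n that c] s(2) r(2) by simp
  \<comment> \<open>One simplex of \<open>E\<close> for odd \<open>n\<close>, two for even
    \<open>n\<close>; in the latter case \<open>ne\<close> keeps their projections apart.\<close>
  define S where "S = (if even n then {?s, ?r} else {?s})"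
  define f where "f \<sigma> = (if \<sigma> = ?s then (\<lambda>x. \<epsilon> * lift_indicator n ?s ?\<kappa> x) else (\<lambda>x. - \<epsilon> * lift_indicator n ?r ?\<pi> x))" for \<sigma>
  have fs: "f ?s = (\<lambda>x. \<epsilon> * lift_indicator n ?s ?\<kappa> x)" by (simp add: f_def)
  have fr: "f ?r = (\<lambda>x. - \<epsilon> * lift_indicator n ?r ?\<pi> x)" if "even n" using ne[OF that] by (auto simp: f_def)
  have S: "finite S" "S \<subseteq> singular_simplex_set n E" using s r by (auto simp: S_def)
  have inj: "inj_on (simplex_map n p) S" using ne by (auto simp: S_def)
  let ?w = "\<Sum>\<sigma>\<in>S. frag_of (f \<sigma>, frag_of \<sigma>)"
  have ns: "null n (frag_of (f ?s, frag_of ?s) - frag_cmul \<epsilon> (tensor_lift n (frag_of ?\<kappa>)))"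
    unfolding fs tensor_lift_simps by (rule null_cmul_left[OF Linf_all]) (simp add: singular_chain_of s)
  have nr: "null n (frag_of (f ?r, frag_of ?r) - frag_cmul (- \<epsilon>) (tensor_lift n (frag_of ?\<pi>)))" if "even n"
    unfolding fr[OF that] tensor_lift_simps by (rule null_cmul_left[OF Linf_all]) (simp add: singular_chain_of r)
  have w: "null n (?w - frag_cmul \<epsilon> (tensor_lift n (sphere_cycle n)))"
  proof (cases "even n")
    case True
    then have "?s \<noteq> ?r" using ne by auto
    then have "?w - frag_cmul \<epsilon> (tensor_lift n (sphere_cycle n))
      = (frag_of (f ?s, frag_of ?s) - frag_cmul \<epsilon> (tensor_lift n (frag_of ?\<kappa>)))
        + (frag_of (f ?r, frag_of ?r) - frag_cmul (- \<epsilon>) (tensor_lift n (frag_of ?\<pi>)))"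
      using True by (simp add: S_def collapsed_cycle_def frag_cmul_diff_distrib2)
    then show ?thesis using null_add[OF ns nr[OF True]] by simp
  next
    case False
    then show ?thesis using ns by (simp add: S_def collapsed_cycle_def)
  qed
  \<comment> \<open>The chain \<open>b\<close> bounds the transfer minus the signed sphere cycle, so
    its image bounds the difference of the tensors. The minus sign comes from the side on which the
    boundary stands in \<open>parametrised_fundamental_cycle\<close>.\<close>
  let ?v = "- tensor_lift (Suc n) b"
  have "null n (?w - (frag_of (\<lambda>_. 1, z) + tensor_boundary (Suc n) ?v))"
  proof -
    have e: "tensor_lift n (chain_boundary (Suc n) b)
      = tensor_lift n (transfer n (nsphere n) q m) - frag_cmul \<epsilon> (tensor_lift n (sphere_cycle n))"
      unfolding b(2) by (simp only: tensor_lift_simps)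
    have "?w - (frag_of (\<lambda>_. 1, z) + tensor_boundary (Suc n) ?v)
      = (?w - frag_cmul \<epsilon> (tensor_lift n (sphere_cycle n)))
        + (tensor_lift n (transfer n (nsphere n) q m) - frag_of (\<lambda>_. 1, z))
        + (tensor_boundary (Suc n) (tensor_lift (Suc n) b) - tensor_lift n (chain_boundary (Suc n) b))"
      unfolding e by (simp only: tensor_boundary_simps) (simp add: algebra_simps)
    show ?thesis
      unfolding \<open>?w - (frag_of (\<lambda>_. 1, z) + tensor_boundary (Suc n) ?v) = _\<close>
      by (rule null_add[OF null_add[OF w t] tensor_lift_boundary[OF b(1)]])
  qed
  moreover have v: "?v \<in> carrier (formal_tensors X E (Suc n))"
    by (rule formal_tensors_closed(4)[OF tensor_lift_carrier[OF b(1)]])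
  moreover have "?w \<in> carrier (formal_tensors X E n)"
    by (rule formal_tensors_sum[OF S(1) formal_tensors_closed(5)[OF Linf_all]]) (use S(2) in \<open>auto simp: singular_chain_of\<close>)
  moreover have "frag_of (\<lambda>_. 1, z) + tensor_boundary (Suc n) ?v \<in> carrier (formal_tensors X E n)"
    by (rule formal_tensors_closed(2)[OF formal_tensors_closed(5)[OF Linf_all z(1)] tensor_boundary_carrier[OF v]])
  ultimately have "parametrised_fundamental_cycle n M c E p e0 X lift_action ?w"
    unfolding parametrised_fundamental_cycle_def tensor_eq_null using z m by blast
  moreover have "(\<Sum>\<sigma>\<in>S. \<integral>x. \<bar>real_of_int (f \<sigma> x)\<bar> \<partial>X) \<le> real (sphere_norm n) / real d"
  proof -
    have "(\<integral>x. \<bar>real_of_int (f \<sigma> x)\<bar> \<partial>X) \<le> 1 / real d" if "\<sigma> \<in> S" for \<sigma>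
      using that lift_indicator_integral[OF s(1) \<epsilon>(1)] lift_indicator_integral[OF r(1), of "- \<epsilon>"] \<epsilon>(1)
      by (auto simp: f_def S_def split: if_splits)
    then have "(\<Sum>\<sigma>\<in>S. \<integral>x. \<bar>real_of_int (f \<sigma> x)\<bar> \<partial>X) \<le> real (card S) * (1 / real d)"
      by (rule sum_bounded_above)
    also have "card S \<le> sphere_norm n" by (simp add: S_def sphere_norm_def card_insert_if)
    then have "real (card S) * (1 / real d) \<le> real (sphere_norm n) / real d" by (simp add: divide_right_mono)
    finally show ?thesis .
  qed
  ultimately show thesis using that[of S f] S inj Linf_all by blast
qed

end

section \<open>The integral foliated simplicial volume\<close>

context pointed_universal_covering
begin

lemma fibre_action_ex:
  assumes fc: "finite_cover d (nsphere n) M q"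
  obtains K L where "fibre_action E M p e0 n d q K L"
proof -
  let ?F = "{y \<in> topspace (nsphere n). q y = p e0}"
  have covq: "covering_map (nsphere n) M q" by (rule finite_cover_covering[OF fc])
  have "p e0 \<in> topspace M" using covering_map_surj[OF cov] e0 by blast
  then have "finite ?F" using fc by (simp add: finite_cover_def sheeted_def)
  then obtain h where h: "bij_betw h {0..<card ?F} ?F" using ex_bij_betw_nat_finite by blast
  \<comment> \<open>Points of the parameter space have to be reals, so the fibre over
    \<open>p e0\<close> is numbered by the first few of them.\<close>
  let ?K = "real ` {0..<card ?F}"
  let ?Y = "h \<circ> inv_into {0..<card ?F} real"
  have "bij_betw real {0..<card ?F} ?K" by (rule inj_on_imp_bij_betw) (auto intro: inj_onI)
  from bij_betw_trans[OF bij_betw_inv_into[OF this] h] have Y: "bij_betw ?Y ?K ?F" .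
  have "\<exists>l. continuous_map E (nsphere n) l \<and> l e0 = y \<and> (\<forall>e\<in>topspace E. q (l e) = p e)" if "y \<in> ?F" for y
  proof -
    have y: "y \<in> topspace (nsphere n)" "q y = p e0" using that by auto
    obtain l where "continuous_map E (nsphere n) l" "l e0 = y" "\<And>e. e \<in> topspace E \<Longrightarrow> q (l e) = p e"
      by (rule lift_ex[where r = q and N = "nsphere n" and x = e0 and y = y, OF covq e0 y]) blast
    then show ?thesis by blast
  qed
  then obtain l where l: "\<And>y. y \<in> ?F \<Longrightarrow> continuous_map E (nsphere n) (l y) \<and> l y e0 = y \<and> (\<forall>e\<in>topspace E. q (l y e) = p e)"
    by metis
  have YF: "?Y x \<in> ?F" if "x \<in> ?K" for x using Y that by (rule bij_betwE[rule_format])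
  have "bij_betw (\<lambda>x. l (?Y x) e0) ?K ?F"
    using Y l YF bij_betw_cong[of ?K ?Y "\<lambda>x. l (?Y x) e0" ?F] by simp
  then have "fibre_action E M p e0 n d q ?K (\<lambda>x. l (?Y x))"
    using fc l YF by unfold_locales auto
  then show thesis by (rule that)
qed

theorem ifsv_elliptic:
  assumes M: "elliptic_manifold n M" "n > 0" and c: "fundamental_class n M c"
  shows "ifsv n M c E p e0 = inverse_order \<Gamma> * real (sphere_norm n)"
  unfolding ifsv_def
proof (rule real_Inf_eqI)
  obtain d0 q0 where fc0: "finite_cover d0 (nsphere n) M q0" using elliptic_manifold_covers[OF M(1)] by metis
  fix y assume "y \<in> {ifsv_param n M c E p e0 X \<alpha> | (X :: real measure) \<alpha>. standard_space \<Gamma> X \<alpha>}"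
  then obtain X :: "real measure" and \<alpha> where y: "y = ifsv_param n M c E p e0 X \<alpha>" and std: "standard_space \<Gamma> X \<alpha>" by blast
  interpret standard_action E M p e0 X \<alpha> by unfold_locales (rule std)
  show "inverse_order \<Gamma> * real (sphere_norm n) \<le> y"
    unfolding y ifsv_param_def
  proof (rule cInf_greatest)
    show "{\<Sum>\<sigma>\<in>S. \<integral>x. \<bar>real_of_int (f \<sigma> x)\<bar> \<partial>X | S f.
            finite S \<and> S \<subseteq> singular_simplex_set n E \<and> inj_on (simplex_map n p) S \<and> (\<forall>\<sigma>\<in>S. f \<sigma> \<in> Linf X) \<and>
            parametrised_fundamental_cycle n M c E p e0 X \<alpha> (\<Sum>\<sigma>\<in>S. frag_of (f \<sigma>, frag_of \<sigma>))} \<noteq> {}"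
      by (rule parametrised_cycle_ex[OF c]) blast
    fix t assume "t \<in> {\<Sum>\<sigma>\<in>S. \<integral>x. \<bar>real_of_int (f \<sigma> x)\<bar> \<partial>X | S f.
            finite S \<and> S \<subseteq> singular_simplex_set n E \<and> inj_on (simplex_map n p) S \<and> (\<forall>\<sigma>\<in>S. f \<sigma> \<in> Linf X) \<and>
            parametrised_fundamental_cycle n M c E p e0 X \<alpha> (\<Sum>\<sigma>\<in>S. frag_of (f \<sigma>, frag_of \<sigma>))}"
    then obtain S f where t: "t = (\<Sum>\<sigma>\<in>S. \<integral>x. \<bar>real_of_int (f \<sigma> x)\<bar> \<partial>X)" and S: "finite S" "\<forall>\<sigma>\<in>S. f \<sigma> \<in> Linf X"
      and w: "parametrised_fundamental_cycle n M c E p e0 X \<alpha> (\<Sum>\<sigma>\<in>S. frag_of (f \<sigma>, frag_of \<sigma>))" by blast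
    show "inverse_order \<Gamma> * real (sphere_norm n) \<le> t"
    proof (cases "finite (carrier \<Gamma>)")
      case True
      then show ?thesis using parametrised_norm_ge[OF True fc0 M(2) c S(1) _ w] S(2) by (simp add: t inverse_order_def)
    next
      case False
      \<comment> \<open>For an infinite group \<open>inverse_order\<close> is 0 by convention, and
        norms are nonnegative.\<close>
      then show ?thesis by (auto simp: t inverse_order_def intro: sum_nonneg)
    qed
  qed
next
  fix e :: real assume "e > 0"
  from elliptic_inverse_order[OF M this] obtain d q where fc: "finite_cover d (nsphere n) M q"
    and lt: "real (sphere_norm n) / real d < inverse_order \<Gamma> * real (sphere_norm n) + e" by blast
  obtain K L where "fibre_action E M p e0 n d q K L" by (rule fibre_action_ex[OF fc])
  then interpret fibre_action E M p e0 n d q K L .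
  obtain S f where S: "finite S" "S \<subseteq> singular_simplex_set n E" "inj_on (simplex_map n p) S" "\<forall>\<sigma>\<in>S. f \<sigma> \<in> Linf X"
    "parametrised_fundamental_cycle n M c E p e0 X lift_action (\<Sum>\<sigma>\<in>S. frag_of (f \<sigma>, frag_of \<sigma>))"
    and norm: "(\<Sum>\<sigma>\<in>S. \<integral>x. \<bar>real_of_int (f \<sigma> x)\<bar> \<partial>X) \<le> real (sphere_norm n) / real d"
    by (rule parametrised_sphere_cycle[OF c M(2)])
  have "ifsv_param n M c E p e0 X lift_action \<le> (\<Sum>\<sigma>\<in>S. \<integral>x. \<bar>real_of_int (f \<sigma> x)\<bar> \<partial>X)"
    unfolding ifsv_param_def
  proof (rule cInf_lower)
    show "bdd_below {\<Sum>\<sigma>\<in>S. \<integral>x. \<bar>real_of_int (f \<sigma> x)\<bar> \<partial>X | S f.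
            finite S \<and> S \<subseteq> singular_simplex_set n E \<and> inj_on (simplex_map n p) S \<and> (\<forall>\<sigma>\<in>S. f \<sigma> \<in> Linf X) \<and>
            parametrised_fundamental_cycle n M c E p e0 X lift_action (\<Sum>\<sigma>\<in>S. frag_of (f \<sigma>, frag_of \<sigma>))}"
      by (rule bdd_belowI[of _ 0]) (auto intro: sum_nonneg)
  qed (use S in blast)
  then show "\<exists>y\<in>{ifsv_param n M c E p e0 X \<alpha> | (X :: real measure) \<alpha>. standard_space \<Gamma> X \<alpha>}.
      y < inverse_order \<Gamma> * real (sphere_norm n) + e"
    using norm lt standard_space_K by (intro bexI[of _ "ifsv_param n M c E p e0 X lift_action"]) auto
qed

end

theorem proposition8p3:
  fixes n :: nat and M :: "'a topology" and c :: "'a chain set"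
    and E :: "'e topology" and p :: "'e \<Rightarrow> 'a" and e0 :: 'e
  assumes "n > 0"
    and "elliptic_manifold n M" and "fundamental_class n M c"
    and "universal_covering E M p" and "e0 \<in> topspace E"
  shows "ifsv n M c E p e0 = stable_integral_simplicial_volume n M
       \<and> stable_integral_simplicial_volume n M
           = inverse_order (fundamental_group M (p e0)) * (if odd n then 1 else 2)
       \<and> simplicial_volume n M c = 0"
proof -
  obtain d q where fc: "finite_cover d (nsphere n) M q" and lpc: "locally_path_connected_space M"
    using elliptic_manifold_covers[OF assms(2)] by metis
  interpret pointed_universal_covering E M p e0 by unfold_locales (fact assms lpc)+
  have "real (sphere_norm n) = (if odd n then 1 else 2)" by (simp add: sphere_norm_def)
  then show ?thesis
    using ifsv_elliptic[OF assms(2,1,3)] stable_integral_simplicial_volume_elliptic[OF assms(2,1,3)]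
      simplicial_volume_zero[OF fc assms(1,3)] by simp
qed

end
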